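(* Let $A$ be a left noetherian Artin-Schelter regular algebra of dimension $d$ over a field $k$. Let $f\in A_+$ be a homogeneous normal regular element, let $\sigma$ be its normalizing automorphism, and let $B=A/(f)$. If $$\mathbf{Q}:\ \cdots\to Q_2\to Q_1\to Q_0$$ is a minimal graded free left $B$-module resolution of a finitely generated graded left $B$-module $M$, then: (1) The truncated complex $\cdots\to Q_{d+2}\to Q_{d+1}$ is chain isomorphic to $\mathbf{\Omega}(\varphi,\tau)$ for some reduced twisted left matrix factorization $(\varphi,\tau)$ of $f$ over $A$. Assuming further that $|\sigma|<\infty$, where $|\sigma|$ is the order of $\sigma$, we have: (2) $\mathbf{Q}$ becomes periodic of period at most $2|\sigma|$ after $d+1$ steps. (3) $\mathbf{Q}$ is periodic (of period at most $2|\sigma|$) if and only if $\operatorname{pd}_A(M)=1$ and $M$ has no graded free $B$-module summand. (4) Every periodic minimal graded free left module resolution over $B$ has the form $\mathbf{\Omega}(\varphi,\tau)$ for some reduced twisted left matrix factorization $(\varphi,\tau)$ of $f$ over $A$.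
   Context: Conventions. $A=\bigoplus_{n\ge 0}A_n$ is connected ($A_0=k$), $\mathbb{N}$-graded, locally finite-dimensional ($\dim_k A_i<\infty$); $A_+=\bigoplus_{n>0}A_n$. $A$ is Artin-Schelter regular of dimension $d$ if $\operatorname{gl.dim}(A)=d<\infty$, $\operatorname{GKdim}(A)=d$, and $\operatorname{Ext}_A^i(k,A)=0$ for $i\ne d$ while $\operatorname{Ext}^d_A(k,A)\cong k$ (up to degree shift). Modules are graded left modules and homomorphisms have degree $0$; $M(n)_i=M_{i+n}$. Regular means non-zero-divisor (on both sides); normal means $fA=Af$. The normalizing automorphism $\sigma$ of $f$ is the graded algebra automorphism of $A$ with $af=f\sigma(a)$ for all $a$. $M^\sigma$ is $M$ as a graded abelian group with action $a\cdot m=\sigma(a)m$. Put $M^{tw}=M^{\sigma}(-\deg f)$ and $\varphi^{tw}=\varphi$ on underlying groups. Left multiplication by $f$ is a degree $0$ homomorphism $\lambda_f^M:M^{tw}\to M$. $\operatorname{pd}_A$ denotes projective dimension over $A$, $B$-modules being viewed as $A$-modules via $A\to B$. A twisted left matrix factorization of $f$ over $A$ is a pair $(\varphi:F\to G,\ \tau:G^{tw}\to F)$ of degree $0$ maps of finitely generated graded free left $A$-modules (possibly zero) with $\varphi\tau=\lambda_f^G$ and $\tau\varphi^{tw}=\lambda_f^F$. A morphism $(\varphi,\tau)\to(\varphi',\tau')$ is a pair of degree $0$ homomorphisms $\Psi_G:G\to G'$, $\Psi_F:F\to F'$ with $\Psi_G\varphi=\varphi'\Psi_F$; it is an isomorphism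 if both components are. Direct sums are componentwise. A factorization is trivial if $\varphi=\lambda_f^{A(n)}$ or $\tau=\lambda_f^{A(n)}$ for some $n\in\mathbb{Z}$; $(\varphi,\tau)$ is reduced if it is not isomorphic to a factorization having a trivial direct summand. Since $\sigma(f)=f$, $\sigma$ induces $\bar\sigma\in\operatorname{Aut}(B)$; for a graded left $B$-module $N$ put $N^{\overline{tw}}=N^{\bar\sigma}(-\deg f)$. With $\overline{(\ )}=B\otimes_A(-)$, $\mathbf{\Omega}(\varphi,\tau)$ is the complex of free left $B$-modules $$\cdots\to \overline{G}^{\overline{tw}^2}\xrightarrow{\overline\tau^{\overline{tw}}}\overline F^{\overline{tw}}\xrightarrow{\overline\varphi^{\overline{tw}}}\overline G^{\overline{tw}}\xrightarrow{\overline\tau}\overline F\xrightarrow{\overline\varphi}\overline G .$$ A graded free $B$-resolution $(Q_\bullet,\partial_\bullet)$ is minimal if $\operatorname{im}\partial_i\subset B_+Q_{i-1}$ for all $i$. A complex $\cdots\to P_2\to P_1\to P_0$ is periodic of period $p$ if $p$ is the smallest positive integer for which there exist an integer $n$ and a morphism of complexes $t:\mathbf P(n)\to\mathbf P$ of homological degree $-p$ with $t:P_{i+p}(n)\to P_i$ an isomorphism for all $i\ge 0$ (the shift $(n)$ is in the internal grading); it is periodic if such $p$ exists; it is periodic after $m$ steps if $\cdots\to P_{m+1}\to P_m$ is periodic.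
   Formalization: In (3) the equivalence is stated for M ≠ 0 (for M = 0 the zero resolution is periodic although pd is not 1), and in (4) the periodic resolutions are those of finitely generated modules (an infinite direct sum of periodic ones would be a counterexample). *)

theory Defs
  imports "HOL-Library.Extended_Real" "HOL-Algebra.Embedded_Algebras" "HOL-Algebra.QuotRing"
    "HOL-Algebra.Free_Abelian_Groups" "HOL-Algebra.Module"
begin

section \<open>Graded rings and graded left modules\<close>

text \<open>
  The library locale \<open>module\<close> is restricted to commutative rings of scalars, so left modules over an
  arbitrary ring are introduced here on top of the library record \<open>module\<close> (whose fields
  \<open>mult\<close> and \<open>one\<close> play no role). All gradings are indexed by the integers; an
  \<open>\<nat>\<close>-graded ring is one whose components of negative degree vanish.
  Maps are total functions of which only the values on the carrier matter.
\<close>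

record 'a gring = "'a ring" +
  rpart :: "int \<Rightarrow> 'a set"

record ('a, 'b) gmodule = "('a, 'b) Module.module" +
  mpart :: "int \<Rightarrow> 'b set"

definition internal_direct_sum :: "('b, 'c) ring_scheme \<Rightarrow> (int \<Rightarrow> 'b set) \<Rightarrow> bool" where
  "internal_direct_sum G D \<longleftrightarrow>
     (\<forall>n. additive_subgroup (D n) G) \<and>
     (\<forall>x\<in>carrier G. \<exists>!c. (\<forall>n. c n \<in> D n) \<and> finite {n. c n \<noteq> \<zero>\<^bsub>G\<^esub>} \<and>
        x = finsum G c {n. c n \<noteq> \<zero>\<^bsub>G\<^esub>})"

locale graded_ring = ring A for A :: "'a gring" (structure) +
  assumes rpart_direct_sum: "internal_direct_sum A (rpart A)"
    and rpart_mult: "\<lbrakk>a \<in> rpart A i; b \<in> rpart A j\<rbrakk> \<Longrightarrow> a \<otimes> b \<in> rpart A (i + j)"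
    and rpart_one: "\<one> \<in> rpart A 0"

locale left_module = R?: ring R + M?: abelian_group M
  for R :: "('a, 'r) ring_scheme" (structure)
    and M :: "('a, 'b, 'm) Module.module_scheme" (structure) +
  assumes lsmult_closed: "\<lbrakk>a \<in> carrier R; x \<in> carrier M\<rbrakk> \<Longrightarrow> a \<odot>\<^bsub>M\<^esub> x \<in> carrier M"
    and lsmult_l_distr: "\<lbrakk>a \<in> carrier R; b \<in> carrier R; x \<in> carrier M\<rbrakk> \<Longrightarrow>
      (a \<oplus>\<^bsub>R\<^esub> b) \<odot>\<^bsub>M\<^esub> x = a \<odot>\<^bsub>M\<^esub> x \<oplus>\<^bsub>M\<^esub> b \<odot>\<^bsub>M\<^esub> x"
    and lsmult_r_distr: "\<lbrakk>a \<in> carrier R; x \<in> carrier M; y \<in> carrier M\<rbrakk> \<Longrightarrow>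
      a \<odot>\<^bsub>M\<^esub> (x \<oplus>\<^bsub>M\<^esub> y) = a \<odot>\<^bsub>M\<^esub> x \<oplus>\<^bsub>M\<^esub> a \<odot>\<^bsub>M\<^esub> y"
    and lsmult_assoc: "\<lbrakk>a \<in> carrier R; b \<in> carrier R; x \<in> carrier M\<rbrakk> \<Longrightarrow>
      (a \<otimes>\<^bsub>R\<^esub> b) \<odot>\<^bsub>M\<^esub> x = a \<odot>\<^bsub>M\<^esub> (b \<odot>\<^bsub>M\<^esub> x)"
    and lsmult_one: "x \<in> carrier M \<Longrightarrow> \<one>\<^bsub>R\<^esub> \<odot>\<^bsub>M\<^esub> x = x"

locale graded_left_module = graded_ring R + left_module R M
  for R :: "'a gring" (structure) and M :: "('a, 'b) gmodule" (structure) +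
  assumes mpart_direct_sum: "internal_direct_sum M (mpart M)"
    and mpart_smult: "\<lbrakk>a \<in> rpart R i; x \<in> mpart M j\<rbrakk> \<Longrightarrow> a \<odot>\<^bsub>M\<^esub> x \<in> mpart M (i + j)"

text \<open>Homomorphisms have degree 0.\<close>

definition gmod_hom ::
  "'a gring \<Rightarrow> ('a, 'b) gmodule \<Rightarrow> ('a, 'c) gmodule \<Rightarrow> ('b \<Rightarrow> 'c) set" where
  "gmod_hom R M N = {h. h \<in> carrier M \<rightarrow> carrier N \<and>
     (\<forall>x\<in>carrier M. \<forall>y\<in>carrier M. h (x \<oplus>\<^bsub>M\<^esub> y) = h x \<oplus>\<^bsub>N\<^esub> h y) \<and>
     (\<forall>a\<in>carrier R. \<forall>x\<in>carrier M. h (a \<odot>\<^bsub>M\<^esub> x) = a \<odot>\<^bsub>N\<^esub> h x) \<and>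
     (\<forall>n. h ` mpart M n \<subseteq> mpart N n)}"

definition gmod_iso ::
  "'a gring \<Rightarrow> ('a, 'b) gmodule \<Rightarrow> ('a, 'c) gmodule \<Rightarrow> ('b \<Rightarrow> 'c) set" where
  "gmod_iso R M N = {h \<in> gmod_hom R M N. bij_betw h (carrier M) (carrier N)}"

definition reg_module :: "'a gring \<Rightarrow> ('a, 'a) gmodule" where
  "reg_module R = \<lparr>carrier = carrier R, monoid.mult = monoid.mult R, one = one R,
     ring.zero = ring.zero R, ring.add = ring.add R, smult = monoid.mult R, mpart = rpart R\<rparr>"

definition gshift :: "int \<Rightarrow> ('a, 'b) gmodule \<Rightarrow> ('a, 'b) gmodule" where
  "gshift n M = M\<lparr>mpart := \<lambda>i. mpart M (i + n)\<rparr>"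

definition gtwist :: "('a \<Rightarrow> 'a) \<Rightarrow> ('a, 'b) gmodule \<Rightarrow> ('a, 'b) gmodule" where
  "gtwist s M = M\<lparr>smult := \<lambda>a x. s a \<odot>\<^bsub>M\<^esub> x\<rparr>"

definition gsum :: "('a, 'b) gmodule \<Rightarrow> ('a, 'c) gmodule \<Rightarrow> ('a, 'b \<times> 'c) gmodule" where
  "gsum M N = \<lparr>carrier = carrier M \<times> carrier N, monoid.mult = undefined, one = undefined,
     ring.zero = (\<zero>\<^bsub>M\<^esub>, \<zero>\<^bsub>N\<^esub>),
     ring.add = (\<lambda>(x, y) (x', y'). (x \<oplus>\<^bsub>M\<^esub> x', y \<oplus>\<^bsub>N\<^esub> y')),
     smult = (\<lambda>a (x, y). (a \<odot>\<^bsub>M\<^esub> x, a \<odot>\<^bsub>N\<^esub> y)),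
     mpart = (\<lambda>n. mpart M n \<times> mpart N n)\<rparr>"

definition gquot :: "('a, 'b) gmodule \<Rightarrow> 'b set \<Rightarrow> ('a, 'b set) gmodule" where
  "gquot M H = \<lparr>carrier = a_rcosets\<^bsub>M\<^esub> H, monoid.mult = undefined, one = undefined,
     ring.zero = H, ring.add = set_add M, smult = (\<lambda>a X. H <+>\<^bsub>M\<^esub> (smult M a ` X)),
     mpart = (\<lambda>n. (\<lambda>x. H +>\<^bsub>M\<^esub> x) ` mpart M n)\<rparr>"

definition restrict_scalars ::
  "('a \<Rightarrow> 'b) \<Rightarrow> ('b, 'm) gmodule \<Rightarrow> ('a, 'm) gmodule" where
  "restrict_scalars p M = \<lparr>carrier = carrier M, monoid.mult = monoid.mult M, one = one M,
     ring.zero = ring.zero M, ring.add = ring.add M, smult = (\<lambda>a. smult M (p a)), mpart = mpart M\<rparr>"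

definition fin_gen :: "'a gring \<Rightarrow> ('a, 'b) gmodule \<Rightarrow> bool" where
  "fin_gen R M \<longleftrightarrow> (\<exists>S. finite S \<and> S \<subseteq> carrier M \<and> carrier M = (\<lambda>H. submodule H R M) hull S)"

definition left_noetherian :: "'a gring \<Rightarrow> bool" where
  "left_noetherian R \<longleftrightarrow> (\<forall>I. submodule I R (reg_module R) \<longrightarrow>
     (\<exists>S. finite S \<and> S \<subseteq> I \<and> I = (\<lambda>H. submodule H R (reg_module R)) hull S))"

definition graded_basis :: "'a gring \<Rightarrow> ('a, 'b) gmodule \<Rightarrow> 'b set \<Rightarrow> bool" where
  "graded_basis R M X \<longleftrightarrow> X \<subseteq> (\<Union>n. mpart M n) \<and>
     (\<forall>m\<in>carrier M. \<exists>!c. (\<forall>x. c x \<in> carrier R) \<and> (\<forall>x. x \<notin> X \<longrightarrow> c x = \<zero>\<^bsub>R\<^esub>) \<and>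
        finite {x. c x \<noteq> \<zero>\<^bsub>R\<^esub>} \<and>
        m = finsum M (\<lambda>x. c x \<odot>\<^bsub>M\<^esub> x) {x. c x \<noteq> \<zero>\<^bsub>R\<^esub>})"

definition graded_free :: "'a gring \<Rightarrow> ('a, 'b) gmodule \<Rightarrow> bool" where
  "graded_free R M \<longleftrightarrow> graded_left_module R M \<and> (\<exists>X. graded_basis R M X)"

text \<open>
  Projective means direct summand of a graded free module. The type \<open>'b \<Rightarrow> 'a\<close> has room
  for the free module on the homogeneous elements of \<open>P\<close> (finitely supported functions), so
  fixing it for the ambient free module loses nothing.
\<close>

definition graded_projective :: "'a gring \<Rightarrow> ('a, 'b) gmodule \<Rightarrow> bool" where
  "graded_projective R P \<longleftrightarrow> graded_left_module R P \<and>
     (\<exists>(L :: ('a, 'b \<Rightarrow> 'a) gmodule) i r. graded_free R L \<and> i \<in> gmod_hom R P L \<and>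
        r \<in> gmod_hom R L P \<and> (\<forall>x\<in>carrier P. r (i x) = x))"

definition has_free_summand :: "'a gring \<Rightarrow> ('a, 'b) gmodule \<Rightarrow> bool" where
  "has_free_summand R M \<longleftrightarrow>
     (\<exists>(N :: ('a, 'b) gmodule) (L :: ('a, 'b) gmodule). graded_left_module R N \<and>
        graded_free R L \<and> carrier L \<noteq> {\<zero>\<^bsub>L\<^esub>} \<and> gmod_iso R M (gsum N L) \<noteq> {})"

definition irrelevant_ideal :: "'a gring \<Rightarrow> 'a set" where
  "irrelevant_ideal R = generate (add_monoid R) (\<Union>n\<in>{0<..}. rpart R n)"

section \<open>Complexes and resolutions\<close>

text \<open>\<open>cdiff C i\<close> is the differential from \<open>cobj C (Suc i)\<close> to \<open>cobj C i\<close>.\<close>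

record ('a, 'q) gcomplex =
  cobj :: "nat \<Rightarrow> ('a, 'q) gmodule"
  cdiff :: "nat \<Rightarrow> 'q \<Rightarrow> 'q"

definition is_complex :: "'a gring \<Rightarrow> ('a, 'q) gcomplex \<Rightarrow> bool" where
  "is_complex R C \<longleftrightarrow> (\<forall>i. graded_left_module R (cobj C i)) \<and>
     (\<forall>i. cdiff C i \<in> gmod_hom R (cobj C (Suc i)) (cobj C i)) \<and>
     (\<forall>i. \<forall>x\<in>carrier (cobj C (Suc (Suc i))). cdiff C i (cdiff C (Suc i) x) = \<zero>\<^bsub>cobj C i\<^esub>)"

definition is_resolution ::
  "'a gring \<Rightarrow> ('a, 'm) gmodule \<Rightarrow> ('a, 'q) gcomplex \<Rightarrow> ('q \<Rightarrow> 'm) \<Rightarrow> bool" where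
  "is_resolution R M C \<epsilon> \<longleftrightarrow> is_complex R C \<and>
     (\<forall>i. {x \<in> carrier (cobj C (Suc i)). cdiff C i x = \<zero>\<^bsub>cobj C i\<^esub>} =
          cdiff C (Suc i) ` carrier (cobj C (Suc (Suc i)))) \<and>
     \<epsilon> \<in> gmod_hom R (cobj C 0) M \<and> \<epsilon> ` carrier (cobj C 0) = carrier M \<and>
     {x \<in> carrier (cobj C 0). \<epsilon> x = \<zero>\<^bsub>M\<^esub>} = cdiff C 0 ` carrier (cobj C (Suc 0))"

definition free_resolution ::
  "'a gring \<Rightarrow> ('a, 'm) gmodule \<Rightarrow> ('a, 'q) gcomplex \<Rightarrow> bool" where
  "free_resolution R M C \<longleftrightarrow> (\<forall>i. graded_free R (cobj C i)) \<and> (\<exists>\<epsilon>. is_resolution R M C \<epsilon>)"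

definition projective_resolution ::
  "'a gring \<Rightarrow> ('a, 'm) gmodule \<Rightarrow> ('a, 'q) gcomplex \<Rightarrow> bool" where
  "projective_resolution R M C \<longleftrightarrow>
     (\<forall>i. graded_projective R (cobj C i)) \<and> (\<exists>\<epsilon>. is_resolution R M C \<epsilon>)"

definition minimal_free_resolution ::
  "'a gring \<Rightarrow> ('a, 'm) gmodule \<Rightarrow> ('a, 'q) gcomplex \<Rightarrow> bool" where
  "minimal_free_resolution R M C \<longleftrightarrow> free_resolution R M C \<and>
     (\<forall>i. cdiff C i ` carrier (cobj C (Suc i)) \<subseteq>
        generate (add_monoid (cobj C i))
          {a \<odot>\<^bsub>cobj C i\<^esub> x | a x. a \<in> irrelevant_ideal R \<and> x \<in> carrier (cobj C i)})"

definition ctrunc :: "nat \<Rightarrow> ('a, 'q) gcomplex \<Rightarrow> ('a, 'q) gcomplex" where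
  "ctrunc m C = \<lparr>cobj = \<lambda>i. cobj C (i + m), cdiff = \<lambda>i. cdiff C (i + m)\<rparr>"

definition chain_isomorphic ::
  "'a gring \<Rightarrow> ('a, 'p) gcomplex \<Rightarrow> ('a, 'q) gcomplex \<Rightarrow> bool" where
  "chain_isomorphic R C D \<longleftrightarrow> (\<exists>h. (\<forall>i. h i \<in> gmod_iso R (cobj C i) (cobj D i)) \<and>
     (\<forall>i. \<forall>x\<in>carrier (cobj C (Suc i)). cdiff D i (h (Suc i) x) = h i (cdiff C i x)))"

text \<open>
  A morphism \<open>t\<close> of homological degree \<open>-p\<close> has components
  \<open>t i : C\<^sub>i\<^sub>+\<^sub>p(n) \<rightarrow> C\<^sub>i\<close>; the components out of \<open>C\<^sub>j\<close> with \<open>j < p\<close> have target 0.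
\<close>

definition shift_periodic :: "'a gring \<Rightarrow> ('a, 'q) gcomplex \<Rightarrow> nat \<Rightarrow> bool" where
  "shift_periodic R C p \<longleftrightarrow>
     (\<exists>n t. (\<forall>i. t i \<in> gmod_iso R (gshift n (cobj C (i + p))) (cobj C i)) \<and>
        (\<forall>i. \<forall>x\<in>carrier (cobj C (Suc i + p)).
           cdiff C i (t (Suc i) x) = t i (cdiff C (i + p) x)))"

definition periodic_of_period :: "'a gring \<Rightarrow> ('a, 'q) gcomplex \<Rightarrow> nat \<Rightarrow> bool" where
  "periodic_of_period R C p \<longleftrightarrow> 0 < p \<and> shift_periodic R C p \<and>
     (\<forall>q. 0 < q \<and> q < p \<longrightarrow> \<not> shift_periodic R C q)"

definition periodic :: "'a gring \<Rightarrow> ('a, 'q) gcomplex \<Rightarrow> bool" where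
  "periodic R C \<longleftrightarrow> (\<exists>p. periodic_of_period R C p)"

section \<open>Homological dimensions and Ext\<close>

text \<open>
  The type \<open>('a + 'm) list\<close> has at least the cardinality \<open>max \<aleph>\<^sub>0 |'a| |'m|\<close>, so it has room for
  isomorphic copies of the terms of the standard free resolution of a module with carrier in \<open>'m\<close>
  and of all its syzygies. Hence restricting the terms of projective resolutions to this type
  changes neither their existence nor their minimal length. The zero module gets projective
  dimension 0 here.
\<close>

definition pd_le :: "'a gring \<Rightarrow> ('a, 'm) gmodule \<Rightarrow> nat \<Rightarrow> bool" where
  "pd_le R M n \<longleftrightarrow> (\<exists>P :: ('a, ('a + 'm) list) gcomplex. projective_resolution R M P \<and>
     (\<forall>i>n. carrier (cobj P i) = {\<zero>\<^bsub>cobj P i\<^esub>}))"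

definition proj_dim :: "'a gring \<Rightarrow> ('a, 'm) gmodule \<Rightarrow> enat" where
  "proj_dim R M = (INF n\<in>{n. pd_le R M n}. enat n)"

text \<open>
  A supremum over all modules has to be taken inside some type. Cosets of finitely supported
  functions \<open>nat \<Rightarrow> 'a\<close> represent every countably generated module, in particular all cyclic ones,
  which already determine the global dimension by Auslander's theorem.
\<close>

definition gl_dim :: "'a gring \<Rightarrow> enat" where
  "gl_dim R = (SUP M\<in>{M :: ('a, (nat \<Rightarrow> 'a) set) gmodule. graded_left_module R M}. proj_dim R M)"

text \<open>The space \<open>\<Sum>\<^sub>i\<^sub>\<le>\<^sub>n V\<^sup>i\<close>, where \<open>V\<^sup>0 = K\<close>.\<close>

definition word_span :: "'a set \<Rightarrow> 'a gring \<Rightarrow> 'a set \<Rightarrow> nat \<Rightarrow> 'a set" where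
  "word_span K A V n = generate (add_monoid A)
     {c \<otimes>\<^bsub>A\<^esub> foldr (monoid.mult A) xs \<one>\<^bsub>A\<^esub> | c xs. c \<in> K \<and> set xs \<subseteq> V \<and> length xs \<le> n}"

definition GK_dim :: "'a set \<Rightarrow> 'a gring \<Rightarrow> ereal" where
  "GK_dim K A = (SUP V\<in>{V. ring.finite_dimension A K V}.
     limsup (\<lambda>n. ereal (log (real n) (real (ring.dim A K (word_span K A V n))))))"

definition hom_space ::
  "'a gring \<Rightarrow> ('a, 'b) gmodule \<Rightarrow> ('a, 'c) gmodule \<Rightarrow> ('a, 'b \<Rightarrow> 'c) Module.module" where
  "hom_space R M N = \<lparr>carrier = gmod_hom R M N \<inter> extensional (carrier M),
     monoid.mult = undefined, one = undefined,
     ring.zero = (\<lambda>x\<in>carrier M. \<zero>\<^bsub>N\<^esub>), ring.add = (\<lambda>g h. \<lambda>x\<in>carrier M. g x \<oplus>\<^bsub>N\<^esub> h x),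
     smult = (\<lambda>c h. \<lambda>x\<in>carrier M. c \<odot>\<^bsub>N\<^esub> h x)\<rparr>"

definition cocycles ::
  "'a gring \<Rightarrow> ('a, 'q) gcomplex \<Rightarrow> ('a, 'c) gmodule \<Rightarrow> nat \<Rightarrow> ('q \<Rightarrow> 'c) set" where
  "cocycles R P N i = {h \<in> carrier (hom_space R (cobj P i) N).
     \<forall>x\<in>carrier (cobj P (Suc i)). h (cdiff P i x) = \<zero>\<^bsub>N\<^esub>}"

fun coboundaries ::
  "'a gring \<Rightarrow> ('a, 'q) gcomplex \<Rightarrow> ('a, 'c) gmodule \<Rightarrow> nat \<Rightarrow> ('q \<Rightarrow> 'c) set" where
  "coboundaries R P N 0 = {\<zero>\<^bsub>hom_space R (cobj P 0) N\<^esub>}"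
| "coboundaries R P N (Suc i) = (\<lambda>g. \<lambda>x\<in>carrier (cobj P (Suc i)). g (cdiff P i x)) `
     carrier (hom_space R (cobj P i) N)"

text \<open>
  \<open>ext_part R M N i n\<close> is the component of degree \<open>n\<close> of \<open>Ext\<^sup>i\<^sub>R(M, N)\<close>, that is, the \<open>i\<close>-th
  cohomology of \<open>Hom\<^sub>R(P, N(n))\<close> (homomorphisms of degree 0), where \<open>P\<close> is a graded projective
  resolution of \<open>M\<close>. Its \<open>smult\<close> is meaningful for central scalars of degree 0.
\<close>

definition ext_part :: "'a gring \<Rightarrow> ('a, 'm) gmodule \<Rightarrow> ('a, 'c) gmodule \<Rightarrow> nat \<Rightarrow> int \<Rightarrow>
    ('a, (('a + 'm) list \<Rightarrow> 'c) set) Module.module" where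
  "ext_part R M N i n =
     (let P = (SOME P :: ('a, ('a + 'm) list) gcomplex. projective_resolution R M P);
          H = hom_space R (cobj P i) (gshift n N);
          D = coboundaries R P (gshift n N) i
      in \<lparr>carrier = (\<lambda>h. D +>\<^bsub>H\<^esub> h) ` cocycles R P (gshift n N) i,
          monoid.mult = undefined, one = undefined,
          ring.zero = D, ring.add = set_add H, smult = (\<lambda>c X. D <+>\<^bsub>H\<^esub> (smult H c ` X))\<rparr>)"

definition lin_isomorphic :: "'a set \<Rightarrow> ('a, 'b, 'm) Module.module_scheme \<Rightarrow>
    ('a, 'c, 'n) Module.module_scheme \<Rightarrow> bool" where
  "lin_isomorphic K X Y \<longleftrightarrow> (\<exists>h. bij_betw h (carrier X) (carrier Y) \<and>
     (\<forall>x\<in>carrier X. \<forall>y\<in>carrier X. h (x \<oplus>\<^bsub>X\<^esub> y) = h x \<oplus>\<^bsub>Y\<^esub> h y) \<and>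
     (\<forall>c\<in>K. \<forall>x\<in>carrier X. h (c \<odot>\<^bsub>X\<^esub> x) = c \<odot>\<^bsub>Y\<^esub> h x))"

section \<open>Artin-Schelter regular algebras\<close>

text \<open>The ground field is literally the degree 0 part of the algebra.\<close>

locale connected_graded_algebra = graded_ring A + subfield K A
  for K :: "'a set" and A :: "'a gring" (structure) +
  assumes ground_field_central: "\<lbrakk>c \<in> K; a \<in> carrier A\<rbrakk> \<Longrightarrow> c \<otimes> a = a \<otimes> c"
    and rpart_neg: "n < 0 \<Longrightarrow> rpart A n = {\<zero>}"
    and connected: "rpart A 0 = K"
    and locally_finite: "finite_dimension K (rpart A n)"

definition trivial_module :: "'a gring \<Rightarrow> ('a, 'a set) gmodule" where
  "trivial_module A = gquot (reg_module A) (irrelevant_ideal A)"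

text \<open>
  In the last clause \<open>Ext\<^sup>d(k, A)\<close> is isomorphic to a shift \<open>k(l)\<close> as a graded vector space.
  Since it is concentrated in one degree, \<open>A\<^sub>+\<close> annihilates it, so this is the same as being
  isomorphic to \<open>k(l)\<close> as a graded right \<open>A\<close>-module.
\<close>

definition AS_regular :: "'a set \<Rightarrow> 'a gring \<Rightarrow> nat \<Rightarrow> bool" where
  "AS_regular K A d \<longleftrightarrow> connected_graded_algebra K A \<and> gl_dim A = enat d \<and>
     GK_dim K A = ereal (real d) \<and>
     (\<forall>i n. i \<noteq> d \<longrightarrow> carrier (ext_part A (trivial_module A) (reg_module A) i n) =
        {\<zero>\<^bsub>ext_part A (trivial_module A) (reg_module A) i n\<^esub>}) \<and>
     (\<exists>l. \<forall>n. lin_isomorphic K (ext_part A (trivial_module A) (reg_module A) d n)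
        ((trivial_module A)\<lparr>carrier := mpart (gshift l (trivial_module A)) n\<rparr>))"

section \<open>Normal elements and twists\<close>

definition regular_element :: "'a gring \<Rightarrow> 'a \<Rightarrow> bool" where
  "regular_element A f \<longleftrightarrow> f \<in> carrier A \<and>
     (\<forall>a\<in>carrier A. a \<otimes>\<^bsub>A\<^esub> f = \<zero>\<^bsub>A\<^esub> \<longrightarrow> a = \<zero>\<^bsub>A\<^esub>) \<and>
     (\<forall>a\<in>carrier A. f \<otimes>\<^bsub>A\<^esub> a = \<zero>\<^bsub>A\<^esub> \<longrightarrow> a = \<zero>\<^bsub>A\<^esub>)"

definition normal_element :: "'a gring \<Rightarrow> 'a \<Rightarrow> bool" where
  "normal_element A f \<longleftrightarrow> f \<in> carrier A \<and> f <#\<^bsub>A\<^esub> carrier A = carrier A #>\<^bsub>A\<^esub> f"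

definition graded_algebra_automorphism :: "'a set \<Rightarrow> 'a gring \<Rightarrow> ('a \<Rightarrow> 'a) \<Rightarrow> bool" where
  "graded_algebra_automorphism K A \<sigma> \<longleftrightarrow> \<sigma> \<in> ring_iso A A \<and> (\<forall>c\<in>K. \<sigma> c = c) \<and>
     (\<forall>n. \<sigma> ` rpart A n = rpart A n)"

definition normalizing_automorphism :: "'a set \<Rightarrow> 'a gring \<Rightarrow> 'a \<Rightarrow> ('a \<Rightarrow> 'a) \<Rightarrow> bool" where
  "normalizing_automorphism K A f \<sigma> \<longleftrightarrow> graded_algebra_automorphism K A \<sigma> \<and>
     (\<forall>a\<in>carrier A. a \<otimes>\<^bsub>A\<^esub> f = f \<otimes>\<^bsub>A\<^esub> \<sigma> a)"

definition finite_aut_order :: "'a gring \<Rightarrow> ('a \<Rightarrow> 'a) \<Rightarrow> bool" where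
  "finite_aut_order A \<sigma> \<longleftrightarrow> (\<exists>n>0. \<forall>a\<in>carrier A. (\<sigma> ^^ n) a = a)"

definition aut_order :: "'a gring \<Rightarrow> ('a \<Rightarrow> 'a) \<Rightarrow> nat" where
  "aut_order A \<sigma> = (LEAST n. 0 < n \<and> (\<forall>a\<in>carrier A. (\<sigma> ^^ n) a = a))"

definition quot_ring :: "'a gring \<Rightarrow> 'a \<Rightarrow> 'a set gring" where
  "quot_ring A f = ring.extend (A Quot (Idl\<^bsub>A\<^esub> {f}))
     \<lparr>rpart = \<lambda>n. (\<lambda>a. (Idl\<^bsub>A\<^esub> {f}) +>\<^bsub>A\<^esub> a) ` rpart A n\<rparr>"

definition quot_map :: "'a gring \<Rightarrow> 'a \<Rightarrow> 'a \<Rightarrow> 'a set" where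
  "quot_map A f a = (Idl\<^bsub>A\<^esub> {f}) +>\<^bsub>A\<^esub> a"

text \<open>
  \<open>tw \<sigma> e M\<close> is \<open>M\<^sup>t\<^sup>w = M\<^sup>\<sigma>(-e)\<close> with \<open>e = deg f\<close>. On maps \<open>tw\<close> is the identity. The automorphism
  induced by \<open>\<sigma>\<close> on a quotient ring, whose elements are cosets, is \<open>image \<sigma>\<close>.
\<close>

definition tw :: "('a \<Rightarrow> 'a) \<Rightarrow> int \<Rightarrow> ('a, 'b) gmodule \<Rightarrow> ('a, 'b) gmodule" where
  "tw \<sigma> e M = gshift (- e) (gtwist \<sigma> M)"

section \<open>Extension of scalars\<close>

text \<open>
  The graded left \<open>B\<close>-module \<open>B \<otimes>\<^sub>A F\<close> for a ring homomorphism \<open>p : A \<rightarrow> B\<close>, constructed as the free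
  abelian group on \<open>B \<times> F\<close> modulo the subgroup of the usual relations.
\<close>

abbreviation tensor_free :: "'b gring \<Rightarrow> ('a, 'c) gmodule \<Rightarrow> ('b \<times> 'c \<Rightarrow>\<^sub>0 int) monoid" where
  "tensor_free B F \<equiv> free_Abelian_group (carrier B \<times> carrier F)"

definition tensor_rel ::
  "'a gring \<Rightarrow> ('a \<Rightarrow> 'b) \<Rightarrow> 'b gring \<Rightarrow> ('a, 'c) gmodule \<Rightarrow> ('b \<times> 'c \<Rightarrow>\<^sub>0 int) set" where
  "tensor_rel A p B F = generate (tensor_free B F)
     ({frag_of (b \<oplus>\<^bsub>B\<^esub> b', x) - frag_of (b, x) - frag_of (b', x) | b b' x.
         b \<in> carrier B \<and> b' \<in> carrier B \<and> x \<in> carrier F} \<union>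
      {frag_of (b, x \<oplus>\<^bsub>F\<^esub> x') - frag_of (b, x) - frag_of (b, x') | b x x'.
         b \<in> carrier B \<and> x \<in> carrier F \<and> x' \<in> carrier F} \<union>
      {frag_of (b \<otimes>\<^bsub>B\<^esub> p a, x) - frag_of (b, a \<odot>\<^bsub>F\<^esub> x) | a b x.
         a \<in> carrier A \<and> b \<in> carrier B \<and> x \<in> carrier F})"

definition base_change :: "'a gring \<Rightarrow> ('a \<Rightarrow> 'b) \<Rightarrow> 'b gring \<Rightarrow> ('a, 'c) gmodule \<Rightarrow>
    ('b, ('b \<times> 'c \<Rightarrow>\<^sub>0 int) set) gmodule" where
  "base_change A p B F =
     \<lparr>carrier = rcosets\<^bsub>tensor_free B F\<^esub> (tensor_rel A p B F),
      monoid.mult = undefined, one = undefined,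
      ring.zero = tensor_rel A p B F,
      ring.add = set_mult (tensor_free B F),
      smult = (\<lambda>b X. tensor_rel A p B F <#>\<^bsub>tensor_free B F\<^esub>
        (frag_extend (\<lambda>(b', x). frag_of (b \<otimes>\<^bsub>B\<^esub> b', x)) ` X)),
      mpart = (\<lambda>n. (\<lambda>u. tensor_rel A p B F #>\<^bsub>tensor_free B F\<^esub> u) `
        generate (tensor_free B F) {frag_of (b, x) | b x i. b \<in> rpart B i \<and> x \<in> mpart F (n - i)})\<rparr>"

text \<open>
  The map \<open>B \<otimes>\<^sub>A F \<rightarrow> B \<otimes>\<^sub>A G\<close> sending \<open>b \<otimes> x\<close> to \<open>s b \<otimes> h x\<close>. For \<open>s = id\<close> this is \<open>B \<otimes>\<^sub>A h\<close>. A general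
  \<open>s\<close> accounts for twists: \<open>s b \<otimes> x \<mapsto> b \<otimes> x\<close> is the canonical isomorphism from the twist of
  \<open>B \<otimes>\<^sub>A G\<close> by the automorphism \<open>s\<close> of \<open>B\<close> induced by \<open>\<sigma>\<close> to \<open>B \<otimes>\<^sub>A G\<^sup>\<sigma>\<close>.
\<close>

definition base_change_map :: "'a gring \<Rightarrow> ('a \<Rightarrow> 'b) \<Rightarrow> 'b gring \<Rightarrow> ('a, 'd) gmodule \<Rightarrow>
    ('b \<Rightarrow> 'b) \<Rightarrow> ('c \<Rightarrow> 'd) \<Rightarrow> ('b \<times> 'c \<Rightarrow>\<^sub>0 int) set \<Rightarrow> ('b \<times> 'd \<Rightarrow>\<^sub>0 int) set" where
  "base_change_map A p B G s h X = tensor_rel A p B G <#>\<^bsub>tensor_free B G\<^esub>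
     (frag_extend (\<lambda>(b, x). frag_of (s b, h x)) ` X)"

section \<open>Twisted matrix factorizations\<close>

text \<open>In all definitions below \<open>e\<close> stands for the degree of \<open>f\<close>.\<close>

record ('a, 'b) factorization =
  srcF :: "('a, 'b) gmodule"
  tgtG :: "('a, 'b) gmodule"
  phi :: "'b \<Rightarrow> 'b"
  tau :: "'b \<Rightarrow> 'b"

definition left_mult :: "('a, 'b) gmodule \<Rightarrow> 'a \<Rightarrow> 'b \<Rightarrow> 'b" where
  "left_mult M f x = f \<odot>\<^bsub>M\<^esub> x"

definition twisted_mf ::
  "'a gring \<Rightarrow> ('a \<Rightarrow> 'a) \<Rightarrow> int \<Rightarrow> 'a \<Rightarrow> ('a, 'b) factorization \<Rightarrow> bool" where
  "twisted_mf A \<sigma> e f X \<longleftrightarrow>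
     graded_free A (srcF X) \<and> fin_gen A (srcF X) \<and> graded_free A (tgtG X) \<and> fin_gen A (tgtG X) \<and>
     phi X \<in> gmod_hom A (srcF X) (tgtG X) \<and> tau X \<in> gmod_hom A (tw \<sigma> e (tgtG X)) (srcF X) \<and>
     (\<forall>x\<in>carrier (tgtG X). phi X (tau X x) = left_mult (tgtG X) f x) \<and>
     (\<forall>x\<in>carrier (srcF X). tau X (phi X x) = left_mult (srcF X) f x)"

definition mf_isomorphic ::
  "'a gring \<Rightarrow> ('a, 'b) factorization \<Rightarrow> ('a, 'c) factorization \<Rightarrow> bool" where
  "mf_isomorphic A X Y \<longleftrightarrow>
     (\<exists>\<Psi>G \<Psi>F. \<Psi>G \<in> gmod_iso A (tgtG X) (tgtG Y) \<and> \<Psi>F \<in> gmod_iso A (srcF X) (srcF Y) \<and>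
        (\<forall>x\<in>carrier (srcF X). \<Psi>G (phi X x) = phi Y (\<Psi>F x)))"

definition mf_sum ::
  "('a, 'b) factorization \<Rightarrow> ('a, 'c) factorization \<Rightarrow> ('a, 'b \<times> 'c) factorization" where
  "mf_sum X Y = \<lparr>srcF = gsum (srcF X) (srcF Y), tgtG = gsum (tgtG X) (tgtG Y),
     phi = map_prod (phi X) (phi Y), tau = map_prod (tau X) (tau Y)\<rparr>"

definition trivial_mf ::
  "'a gring \<Rightarrow> ('a \<Rightarrow> 'a) \<Rightarrow> int \<Rightarrow> 'a \<Rightarrow> ('a, 'a) factorization \<Rightarrow> bool" where
  "trivial_mf A \<sigma> e f X \<longleftrightarrow> twisted_mf A \<sigma> e f X \<and>
     (\<exists>n. let L = gshift n (reg_module A) in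
        (srcF X = tw \<sigma> e L \<and> tgtG X = L \<and> (\<forall>x\<in>carrier L. phi X x = left_mult L f x)) \<or>
        (srcF X = L \<and> tgtG X = L \<and> (\<forall>x\<in>carrier L. tau X x = left_mult L f x)))"

text \<open>
  Up to isomorphism a direct summand of a factorization with modules carried by \<open>'b\<close> is again
  carried by \<open>'b\<close>, so the type of the complementary summand \<open>Y\<close> is no restriction.
\<close>

definition reduced_mf ::
  "'a gring \<Rightarrow> ('a \<Rightarrow> 'a) \<Rightarrow> int \<Rightarrow> 'a \<Rightarrow> ('a, 'b) factorization \<Rightarrow> bool" where
  "reduced_mf A \<sigma> e f X \<longleftrightarrow> twisted_mf A \<sigma> e f X \<and>
     \<not> (\<exists>(Y :: ('a, 'b) factorization) T. twisted_mf A \<sigma> e f Y \<and> trivial_mf A \<sigma> e f T \<and>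
          mf_isomorphic A X (mf_sum Y T))"

definition Omega :: "'a gring \<Rightarrow> ('a \<Rightarrow> 'a) \<Rightarrow> int \<Rightarrow> 'a \<Rightarrow> ('a, 'b) factorization \<Rightarrow>
    ('a set, ('a set \<times> 'b \<Rightarrow>\<^sub>0 int) set) gcomplex" where
  "Omega A \<sigma> e f X =
     (let B = quot_ring A f; p = quot_map A f
      in \<lparr>cobj = (\<lambda>i. (tw (image \<sigma>) e ^^ (i div 2))
             (base_change A p B (if even i then tgtG X else srcF X))),
          cdiff = (\<lambda>i. if even i
             then base_change_map A p B (tgtG X) id (phi X)
             else base_change_map A p B (srcF X) (inv_into (carrier B) (image \<sigma>)) (tau X))\<rparr>)"

end

theory Submission
  imports Defs
begin

text \<open>
  Everything is done over \<open>A\<close>, with \<open>B\<close>-modules viewed as \<open>A\<close>-modules. Let \<open>G\<^sub>i\<close> be the free \<open>A\<close>-module with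
  \<open>Q\<^sub>i = G\<^sub>i / f G\<^sub>i\<close>, and \<open>K\<^sub>i \<subseteq> G\<^sub>i\<close> the preimage of the image of \<open>Q\<^sub>i\<^sub>+\<^sub>1\<close>. The \<open>K\<^sub>i\<close> are the syzygies of
  \<open>M\<close> over \<open>A\<close> with respect to the resolution with terms \<open>G\<^sub>i\<^sub>+\<^sub>1 \<oplus> G\<^sub>i\<^sup>t\<^sup>w\<close>, so finite global dimension makes
  them free for \<open>i \<ge> d\<close>; if \<open>K\<^sub>i\<close> and \<open>K\<^sub>i\<^sub>+\<^sub>1\<close> are free, then moreover \<open>f G\<^sub>i\<^sub>+\<^sub>1 \<subseteq> A\<^sub>+K\<^sub>i\<^sub>+\<^sub>1\<close>. Then the inclusion
  \<open>K\<^sub>m \<rightarrow> G\<^sub>m\<close> and multiplication by \<open>f\<close> form a reduced factorization for \<open>m > d\<close>, and its complex is a minimal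
  resolution of the same module as the truncation of \<open>Q\<close>, so both agree. The identity map shows that
  this complex has period \<open>2|\<sigma>|\<close>.

  If \<open>Q\<close> is periodic, then \<open>M\<close> is a shift of \<open>G\<^sub>m / K\<^sub>m\<close> for some \<open>m > d\<close>, so the above applies to \<open>Q\<close> itself
  and \<open>K\<^sub>m \<rightarrow> G\<^sub>m\<close> is a free resolution of \<open>M\<close>. Conversely, if \<open>M\<close> has projective dimension 1, then \<open>K\<^sub>0\<close> is
  free, and if \<open>f G\<^sub>0\<close> were not contained in \<open>A\<^sub>+K\<^sub>0\<close>, a coordinate of multiplication by \<open>f\<close> would induce a
  surjection of \<open>M\<close> onto a shift of \<open>B\<close> and split off a free summand.
\<close>

section \<open>Graded components\<close>

text \<open>The passage from finite global dimension to freeness compares two resolutions with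
  nothing in common: the one built from the \<open>G i\<close>, and an arbitrary projective one that
  stops, whose terms satisfy no finiteness condition. Only stable information survives: the identity
  of one syzygy factors through the other up to a map through a free module. Where the finite
  resolution stops, this becomes a splitting of the cover of \<open>K i\<close>, and a finitely
  generated module with split covers is free by Nakayama's lemma.

  The same splitting puts \<open>f G\<close> into \<open>A_+ K\<close> one step later: a coordinate
  of multiplication by f, pulled back to \<open>K i\<close> along the splitting, takes values in
  \<open>f A_+\<close> on \<open>f K i\<close>, and f can be cancelled. So two consecutive syzygies
  are involved, which is the source of d + 1.

  Multiplication by f is only semilinear. Over A it is a map out of a twist, and its coordinates
  become linear after applying \<sigma>. All free modules are realized on
  \<open>nat \<Rightarrow> 'a\<close> by vectors padded with zeros, so that a syzygy, being a subset
  of such a module, can be a term of a factorization without any change of type.\<close>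

definition gcomp :: "('b, 'c) ring_scheme \<Rightarrow> (int \<Rightarrow> 'b set) \<Rightarrow> 'b \<Rightarrow> int \<Rightarrow> 'b" where
  "gcomp G D x = (THE c. (\<forall>n. c n \<in> D n) \<and> finite {n. c n \<noteq> \<zero>\<^bsub>G\<^esub>} \<and>
     x = finsum G c {n. c n \<noteq> \<zero>\<^bsub>G\<^esub>})"

lemma (in abelian_group) finsum_support:
  assumes "finite S" "{n. c n \<noteq> \<zero>} \<subseteq> S" "\<And>n. c n \<in> carrier G"
  shows "finsum G c {n. c n \<noteq> \<zero>} = finsum G c S"
  by (rule add.finprod_mono_neutral_cong_left) (use assms in auto)

lemma additive_zero:
  assumes G: "abelian_group G" and H: "abelian_group H"
    and h: "h \<in> carrier G \<rightarrow> carrier H"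
    and add: "\<And>x y. x \<in> carrier G \<Longrightarrow> y \<in> carrier G \<Longrightarrow> h (x \<oplus>\<^bsub>G\<^esub> y) = h x \<oplus>\<^bsub>H\<^esub> h y"
  shows "h \<zero>\<^bsub>G\<^esub> = \<zero>\<^bsub>H\<^esub>"
proof -
  interpret G: abelian_group G by (rule G)
  interpret H: abelian_group H by (rule H)
  show ?thesis
    using add[of "\<zero>\<^bsub>G\<^esub>" "\<zero>\<^bsub>G\<^esub>"] h
    by (metis G.l_zero G.zero_closed H.add.r_cancel_one' PiE)
qed

text \<open>Kept to bare additive maps so that it serves for homomorphisms, for graded components,
  for basis coordinates and for the identity between two records that share their addition.\<close>

lemma additive_finsum:
  assumes G: "abelian_group G" and H: "abelian_group H"
    and h: "h \<in> carrier G \<rightarrow> carrier H"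
    and add: "\<And>x y. x \<in> carrier G \<Longrightarrow> y \<in> carrier G \<Longrightarrow> h (x \<oplus>\<^bsub>G\<^esub> y) = h x \<oplus>\<^bsub>H\<^esub> h y"
    and S: "finite S" "c \<in> S \<rightarrow> carrier G"
  shows "h (finsum G c S) = finsum H (\<lambda>s. h (c s)) S"
proof -
  interpret G: abelian_group G by (rule G)
  interpret H: abelian_group H by (rule H)
  have z: "h \<zero>\<^bsub>G\<^esub> = \<zero>\<^bsub>H\<^esub>"
    by (rule additive_zero[OF G H h add])
  show ?thesis
    using S
  proof (induction S rule: finite_induct)
    case (insert s S)
    have "h (finsum G c (insert s S)) = h (c s \<oplus>\<^bsub>G\<^esub> finsum G c S)"
      using insert by (simp add: Pi_def)
    also have "\<dots> = h (c s) \<oplus>\<^bsub>H\<^esub> h (finsum G c S)"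
      using insert by (intro add) (auto intro!: G.finsum_closed)
    also have "\<dots> = finsum H (\<lambda>s. h (c s)) (insert s S)"
      using insert h by (subst H.finsum_insert) (auto simp: Pi_def)
    finally show ?case .
  qed (simp add: z)
qed

lemma additive_subgroupI':
  assumes "H \<subseteq> carrier G" "\<zero>\<^bsub>G\<^esub> \<in> H"
    and "\<And>a b. \<lbrakk>a \<in> H; b \<in> H\<rbrakk> \<Longrightarrow> a \<oplus>\<^bsub>G\<^esub> b \<in> H" "\<And>a. a \<in> H \<Longrightarrow> \<ominus>\<^bsub>G\<^esub> a \<in> H"
  shows "additive_subgroup H G"
  using assms by (auto simp: additive_subgroup_def a_inv_def intro!: subgroup.intro)

locale graded_group = abelian_group G for G :: "('b, 'c) ring_scheme" (structure) +
  fixes D :: "int \<Rightarrow> 'b set"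
  assumes ids: "internal_direct_sum G D"
begin

abbreviation cp where "cp \<equiv> gcomp G D"

lemma D_subgroup: "additive_subgroup (D n) G"
  using ids by (simp add: internal_direct_sum_def)

lemma D_carrier: "x \<in> D n \<Longrightarrow> x \<in> carrier G"
  using additive_subgroup.a_Hcarr[OF D_subgroup] .

lemma D_zero [simp]: "\<zero> \<in> D n"
  using additive_subgroup.zero_closed[OF D_subgroup] .

lemma D_add: "x \<in> D n \<Longrightarrow> y \<in> D n \<Longrightarrow> x \<oplus> y \<in> D n"
  using additive_subgroup.a_closed[OF D_subgroup] .

lemma D_neg: "x \<in> D n \<Longrightarrow> \<ominus> x \<in> D n"
  using additive_subgroup.a_inv_closed[OF D_subgroup] .

lemma cp_props:
  assumes "x \<in> carrier G"
  shows "(\<forall>n. cp x n \<in> D n) \<and> finite {n. cp x n \<noteq> \<zero>} \<and> x = finsum G (cp x) {n. cp x n \<noteq> \<zero>}"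
proof -
  have "\<exists>!c. (\<forall>n. c n \<in> D n) \<and> finite {n. c n \<noteq> \<zero>} \<and> x = finsum G c {n. c n \<noteq> \<zero>}"
    using ids assms by (simp add: internal_direct_sum_def)
  from theI'[OF this] show ?thesis
    unfolding gcomp_def .
qed

lemma cp_D: "x \<in> carrier G \<Longrightarrow> cp x n \<in> D n"
  and cp_finite: "x \<in> carrier G \<Longrightarrow> finite {n. cp x n \<noteq> \<zero>}"
  and cp_sum: "x \<in> carrier G \<Longrightarrow> finsum G (cp x) {n. cp x n \<noteq> \<zero>} = x"
  using cp_props by auto

lemma cp_closed [simp]: "x \<in> carrier G \<Longrightarrow> cp x n \<in> carrier G"
  using cp_D D_carrier by blast

lemma cp_sum_superset:
  assumes "x \<in> carrier G" "finite S" "{n. cp x n \<noteq> \<zero>} \<subseteq> S"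
  shows "finsum G (cp x) S = x"
  using finsum_support[of S "cp x"] assms cp_sum by simp

lemma cp_unique:
  assumes "\<And>n. c n \<in> D n" "finite S" "{n. c n \<noteq> \<zero>} \<subseteq> S"
  shows "cp (finsum G c S) = c"
proof -
  let ?x = "finsum G c S"
  have c: "\<And>n. c n \<in> carrier G" using assms(1) D_carrier by blast
  have x: "?x \<in> carrier G" using c by (auto intro!: finsum_closed)
  have "\<exists>!c. (\<forall>n. c n \<in> D n) \<and> finite {n. c n \<noteq> \<zero>} \<and> ?x = finsum G c {n. c n \<noteq> \<zero>}"
    using ids x by (simp add: internal_direct_sum_def)
  moreover have "(\<forall>n. c n \<in> D n) \<and> finite {n. c n \<noteq> \<zero>} \<and> ?x = finsum G c {n. c n \<noteq> \<zero>}"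
    using assms finsum_support[OF assms(2,3) c] finite_subset by auto
  ultimately show ?thesis
    using cp_props[OF x] by blast
qed

lemma cp_add:
  assumes x: "x \<in> carrier G" and y: "y \<in> carrier G"
  shows "cp (x \<oplus> y) n = cp x n \<oplus> cp y n"
proof -
  let ?S = "{n. cp x n \<noteq> \<zero>} \<union> {n. cp y n \<noteq> \<zero>}"
  have S: "finite ?S" using cp_finite x y by auto
  have "cp (finsum G (\<lambda>n. cp x n \<oplus> cp y n) ?S) = (\<lambda>n. cp x n \<oplus> cp y n)"
    using x y by (intro cp_unique S) (auto simp: cp_D D_add)
  moreover have "finsum G (\<lambda>n. cp x n \<oplus> cp y n) ?S = x \<oplus> y"
    using x y S by (subst finsum_addf) (auto simp: cp_sum_superset)
  ultimately show ?thesis by metis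
qed

lemma cp_homog:
  assumes "x \<in> D n"
  shows "cp x m = (if m = n then x else \<zero>)"
proof -
  have "cp (finsum G (\<lambda>m. if m = n then x else \<zero>) {n}) = (\<lambda>m. if m = n then x else \<zero>)"
    using assms by (intro cp_unique) auto
  moreover have "finsum G (\<lambda>m. if m = n then x else \<zero>) {n} = x"
    using D_carrier[OF assms] by simp
  ultimately show ?thesis by metis
qed

lemma cp_zero [simp]: "cp \<zero> n = \<zero>"
  using cp_homog[of \<zero> n n] by simp

lemma homog_induct [consumes 1, case_names zero homog add]:
  assumes x: "x \<in> carrier G"
    and z: "Q \<zero>" and hom: "\<And>n x. x \<in> D n \<Longrightarrow> Q x"
    and add: "\<And>x y. x \<in> carrier G \<Longrightarrow> y \<in> carrier G \<Longrightarrow> Q x \<Longrightarrow> Q y \<Longrightarrow> Q (x \<oplus> y)"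
  shows "Q x"
proof -
  have "Q (finsum G (cp x) S)" if "finite S" for S
    using that
  proof (induction S rule: finite_induct)
    case empty then show ?case by (simp add: z)
  next
    case (insert n S)
    then show ?case using x
      by (subst finsum_insert) (auto intro!: add hom[OF cp_D] finsum_closed)
  qed
  from this[OF cp_finite[OF x]] show ?thesis
    by (simp add: cp_sum[OF x])
qed

end

text \<open>Uniqueness comes from additivity: applying \<open>p _ m\<close> to any decomposition of
  x leaves only its term of degree m. Gradings below are obtained by exhibiting such projections,
  usually built from those of a module that is already graded.\<close>

lemma internal_direct_sumI:
  assumes "abelian_group G"
    and D: "\<And>n. additive_subgroup (D n) G"
    and p: "\<And>x n. x \<in> carrier G \<Longrightarrow> p x n \<in> D n"
    and fin: "\<And>x. x \<in> carrier G \<Longrightarrow> finite {n. p x n \<noteq> \<zero>\<^bsub>G\<^esub>}"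
    and sum: "\<And>x. x \<in> carrier G \<Longrightarrow> finsum G (p x) {n. p x n \<noteq> \<zero>\<^bsub>G\<^esub>} = x"
    and add: "\<And>x y n. x \<in> carrier G \<Longrightarrow> y \<in> carrier G \<Longrightarrow> p (x \<oplus>\<^bsub>G\<^esub> y) n = p x n \<oplus>\<^bsub>G\<^esub> p y n"
    and homog: "\<And>x n m. x \<in> D n \<Longrightarrow> p x m = (if m = n then x else \<zero>\<^bsub>G\<^esub>)"
  shows "internal_direct_sum G D"
proof -
  interpret abelian_group G by fact
  have Dc: "x \<in> carrier G" if "x \<in> D n" for x n
    using additive_subgroup.a_Hcarr[OF D that] .
  have uniq: "c = p x"
    if x: "x \<in> carrier G" and c: "\<forall>n. c n \<in> D n" "finite {n. c n \<noteq> \<zero>\<^bsub>G\<^esub>}"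
      "x = finsum G c {n. c n \<noteq> \<zero>\<^bsub>G\<^esub>}" for x c
  proof
    fix m
    let ?S = "{n. c n \<noteq> \<zero>\<^bsub>G\<^esub>}"
    have cc: "\<And>n. c n \<in> carrier G" using c Dc by blast
    have "p x m = finsum G (\<lambda>n. p (c n) m) ?S"
      using c(3) additive_finsum[of G G "\<lambda>x. p x m", OF assms(1) assms(1) _ _ c(2)]
        add cc p Dc by (metis (no_types, lifting) Pi_I)
    also have "\<dots> = finsum G (\<lambda>n. if m = n then c n else \<zero>\<^bsub>G\<^esub>) ?S"
      using homog c(1) cc by (intro add.finprod_cong') auto
    also have "\<dots> = c m"
      using c(2) cc by (cases "m \<in> ?S") (auto simp: finsum_singleton intro!: add.finprod_one_eqI)
    finally show "c m = p x m" by simp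
  qed
  show ?thesis
    unfolding internal_direct_sum_def
    using D p fin sum uniq by (intro conjI allI ballI ex1I[of _ "p _"]) auto
qed

section \<open>Graded modules\<close>

lemma (in left_module) left_module_facts:
  shows lsmult_l_null [simp]: "x \<in> carrier M \<Longrightarrow> \<zero>\<^bsub>R\<^esub> \<odot>\<^bsub>M\<^esub> x = \<zero>\<^bsub>M\<^esub>"
    and lsmult_r_null [simp]: "a \<in> carrier R \<Longrightarrow> a \<odot>\<^bsub>M\<^esub> \<zero>\<^bsub>M\<^esub> = \<zero>\<^bsub>M\<^esub>"
    and lsmult_l_minus: "a \<in> carrier R \<Longrightarrow> x \<in> carrier M \<Longrightarrow> (\<ominus>\<^bsub>R\<^esub> a) \<odot>\<^bsub>M\<^esub> x = \<ominus>\<^bsub>M\<^esub> (a \<odot>\<^bsub>M\<^esub> x)"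
    and lsmult_r_minus: "a \<in> carrier R \<Longrightarrow> x \<in> carrier M \<Longrightarrow> a \<odot>\<^bsub>M\<^esub> (\<ominus>\<^bsub>M\<^esub> x) = \<ominus>\<^bsub>M\<^esub> (a \<odot>\<^bsub>M\<^esub> x)"
proof -
  show 1: "\<zero>\<^bsub>R\<^esub> \<odot>\<^bsub>M\<^esub> x = \<zero>\<^bsub>M\<^esub>" if "x \<in> carrier M" for x
    using lsmult_l_distr[of "\<zero>\<^bsub>R\<^esub>" "\<zero>\<^bsub>R\<^esub>" x] that lsmult_closed[of "\<zero>\<^bsub>R\<^esub>" x]
    by (metis M.add.r_cancel_one' R.l_zero R.zero_closed)
  show 2: "a \<odot>\<^bsub>M\<^esub> \<zero>\<^bsub>M\<^esub> = \<zero>\<^bsub>M\<^esub>" if "a \<in> carrier R" for a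
    using lsmult_r_distr[of a "\<zero>\<^bsub>M\<^esub>" "\<zero>\<^bsub>M\<^esub>"] that lsmult_closed[of a "\<zero>\<^bsub>M\<^esub>"]
    by (metis M.add.r_cancel_one' M.l_zero M.zero_closed)
  show "(\<ominus>\<^bsub>R\<^esub> a) \<odot>\<^bsub>M\<^esub> x = \<ominus>\<^bsub>M\<^esub> (a \<odot>\<^bsub>M\<^esub> x)" if "a \<in> carrier R" "x \<in> carrier M" for a x
    using lsmult_l_distr[of "\<ominus>\<^bsub>R\<^esub> a" a x] that lsmult_closed 1
    by (metis M.minus_equality R.a_inv_closed R.l_neg)
  show "a \<odot>\<^bsub>M\<^esub> (\<ominus>\<^bsub>M\<^esub> x) = \<ominus>\<^bsub>M\<^esub> (a \<odot>\<^bsub>M\<^esub> x)" if "a \<in> carrier R" "x \<in> carrier M" for a x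
    using lsmult_r_distr[of a "\<ominus>\<^bsub>M\<^esub> x" x] that lsmult_closed 2
    by (metis M.minus_equality M.a_inv_closed M.l_neg)
qed

lemma (in left_module) finsum_lsmult:
  assumes "finite S" "a \<in> carrier R" "c \<in> S \<rightarrow> carrier M"
  shows "a \<odot>\<^bsub>M\<^esub> finsum M c S = finsum M (\<lambda>s. a \<odot>\<^bsub>M\<^esub> c s) S"
  by (rule additive_finsum[of M M "\<lambda>x. a \<odot>\<^bsub>M\<^esub> x"])
    (use assms in \<open>auto simp: lsmult_closed lsmult_r_distr M.abelian_group_axioms\<close>)

sublocale graded_ring \<subseteq> rgr: graded_group A "rpart A"
  by unfold_locales (rule rpart_direct_sum)

sublocale graded_left_module \<subseteq> mgr: graded_group M "mpart M"
  by unfold_locales (rule mpart_direct_sum)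

lemma (in left_module) submoduleI':
  assumes "H \<subseteq> carrier M" "\<zero>\<^bsub>M\<^esub> \<in> H"
    and "\<And>a b. \<lbrakk>a \<in> H; b \<in> H\<rbrakk> \<Longrightarrow> a \<oplus>\<^bsub>M\<^esub> b \<in> H"
    and "\<And>a x. \<lbrakk>a \<in> carrier R; x \<in> H\<rbrakk> \<Longrightarrow> a \<odot>\<^bsub>M\<^esub> x \<in> H"
  shows "submodule H R M"
proof -
  have "\<ominus>\<^bsub>M\<^esub> x \<in> H" if "x \<in> H" for x
    using assms(4)[of "\<ominus>\<^bsub>R\<^esub> \<one>\<^bsub>R\<^esub>" x] that assms(1) lsmult_l_minus[of "\<one>\<^bsub>R\<^esub>" x] lsmult_one[of x]
    by (metis R.a_inv_closed R.one_closed subsetD)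
  then show ?thesis
    using assms by (intro submodule.intro subgroup.intro) (auto simp: submodule_axioms_def a_inv_def)
qed

lemma submoduleD:
  assumes "submodule H R M"
  shows "H \<subseteq> carrier M" "\<zero>\<^bsub>M\<^esub> \<in> H" "\<And>a b. \<lbrakk>a \<in> H; b \<in> H\<rbrakk> \<Longrightarrow> a \<oplus>\<^bsub>M\<^esub> b \<in> H"
    "\<And>a x. \<lbrakk>a \<in> carrier R; x \<in> H\<rbrakk> \<Longrightarrow> a \<odot>\<^bsub>M\<^esub> x \<in> H" "\<And>a. a \<in> H \<Longrightarrow> \<ominus>\<^bsub>M\<^esub> a \<in> H"
proof -
  interpret submodule H R M by fact
  show "H \<subseteq> carrier M" "\<zero>\<^bsub>M\<^esub> \<in> H" "\<And>a b. \<lbrakk>a \<in> H; b \<in> H\<rbrakk> \<Longrightarrow> a \<oplus>\<^bsub>M\<^esub> b \<in> H"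
    "\<And>a x. \<lbrakk>a \<in> carrier R; x \<in> H\<rbrakk> \<Longrightarrow> a \<odot>\<^bsub>M\<^esub> x \<in> H" "\<And>a. a \<in> H \<Longrightarrow> \<ominus>\<^bsub>M\<^esub> a \<in> H"
    using subset one_closed m_closed smult_closed m_inv_closed by (auto simp: a_inv_def)
qed

definition graded_submodule :: "'a gring \<Rightarrow> ('a, 'b) gmodule \<Rightarrow> 'b set \<Rightarrow> bool" where
  "graded_submodule R M H \<longleftrightarrow> submodule H R M \<and> (\<forall>x\<in>H. \<forall>n. gcomp M (mpart M) x n \<in> H)"

text \<open>The submodule stays on the type of the ambient module. This later lets a syzygy inside
  \<open>Fr\<close> be a term of a factorization carried by
  \<open>nat \<Rightarrow> 'a\<close>.\<close>

definition gsub :: "('a, 'b) gmodule \<Rightarrow> 'b set \<Rightarrow> ('a, 'b) gmodule" where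
  "gsub M H = M\<lparr>carrier := H, mpart := \<lambda>n. H \<inter> mpart M n\<rparr>"

definition hker :: "('a, 'b) gmodule \<Rightarrow> ('a, 'c) gmodule \<Rightarrow> ('b \<Rightarrow> 'c) \<Rightarrow> 'b set" where
  "hker M N h = {x \<in> carrier M. h x = \<zero>\<^bsub>N\<^esub>}"

lemma glmI:
  assumes "graded_ring R" "abelian_group M"
    and "\<And>a x. \<lbrakk>a \<in> carrier R; x \<in> carrier M\<rbrakk> \<Longrightarrow> a \<odot>\<^bsub>M\<^esub> x \<in> carrier M"
    and "\<And>a b x. \<lbrakk>a \<in> carrier R; b \<in> carrier R; x \<in> carrier M\<rbrakk> \<Longrightarrow>
      (a \<oplus>\<^bsub>R\<^esub> b) \<odot>\<^bsub>M\<^esub> x = a \<odot>\<^bsub>M\<^esub> x \<oplus>\<^bsub>M\<^esub> b \<odot>\<^bsub>M\<^esub> x"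
    and "\<And>a x y. \<lbrakk>a \<in> carrier R; x \<in> carrier M; y \<in> carrier M\<rbrakk> \<Longrightarrow>
      a \<odot>\<^bsub>M\<^esub> (x \<oplus>\<^bsub>M\<^esub> y) = a \<odot>\<^bsub>M\<^esub> x \<oplus>\<^bsub>M\<^esub> a \<odot>\<^bsub>M\<^esub> y"
    and "\<And>a b x. \<lbrakk>a \<in> carrier R; b \<in> carrier R; x \<in> carrier M\<rbrakk> \<Longrightarrow>
      (a \<otimes>\<^bsub>R\<^esub> b) \<odot>\<^bsub>M\<^esub> x = a \<odot>\<^bsub>M\<^esub> (b \<odot>\<^bsub>M\<^esub> x)"
    and "\<And>x. x \<in> carrier M \<Longrightarrow> \<one>\<^bsub>R\<^esub> \<odot>\<^bsub>M\<^esub> x = x"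
    and "internal_direct_sum M (mpart M)"
    and "\<And>a x i j. \<lbrakk>a \<in> rpart R i; x \<in> mpart M j\<rbrakk> \<Longrightarrow> a \<odot>\<^bsub>M\<^esub> x \<in> mpart M (i + j)"
  shows "graded_left_module R M"
  using assms
  by (auto simp: graded_left_module_def graded_left_module_axioms_def left_module_def left_module_axioms_def
      graded_ring_def)

lemma gmod_homD:
  assumes "h \<in> gmod_hom R M N"
  shows "x \<in> carrier M \<Longrightarrow> h x \<in> carrier N"
    "x \<in> carrier M \<Longrightarrow> y \<in> carrier M \<Longrightarrow> h (x \<oplus>\<^bsub>M\<^esub> y) = h x \<oplus>\<^bsub>N\<^esub> h y"
    "a \<in> carrier R \<Longrightarrow> x \<in> carrier M \<Longrightarrow> h (a \<odot>\<^bsub>M\<^esub> x) = a \<odot>\<^bsub>N\<^esub> h x"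
    "x \<in> mpart M n \<Longrightarrow> h x \<in> mpart N n"
  using assms unfolding gmod_hom_def by blast+

lemma gmod_homI:
  assumes "\<And>x. x \<in> carrier M \<Longrightarrow> h x \<in> carrier N"
    "\<And>x y. x \<in> carrier M \<Longrightarrow> y \<in> carrier M \<Longrightarrow> h (x \<oplus>\<^bsub>M\<^esub> y) = h x \<oplus>\<^bsub>N\<^esub> h y"
    "\<And>a x. a \<in> carrier R \<Longrightarrow> x \<in> carrier M \<Longrightarrow> h (a \<odot>\<^bsub>M\<^esub> x) = a \<odot>\<^bsub>N\<^esub> h x"
    "\<And>x n. x \<in> mpart M n \<Longrightarrow> h x \<in> mpart N n"
  shows "h \<in> gmod_hom R M N"
  using assms by (auto simp: gmod_hom_def)

lemma gmod_hom_comp: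
  assumes "h \<in> gmod_hom R M N" "k \<in> gmod_hom R N P"
  shows "(\<lambda>x. k (h x)) \<in> gmod_hom R M P"
  by (rule gmod_homI) (simp_all add: gmod_homD[OF assms(1)] gmod_homD[OF assms(2)])

lemma gmod_hom_id: "(\<lambda>x. x) \<in> gmod_hom R M M"
  by (rule gmod_homI) auto

lemma glm_abelian: "graded_left_module R M \<Longrightarrow> abelian_group M"
  by (simp add: graded_left_module_def left_module_def)

lemma glm_ring: "graded_left_module R M \<Longrightarrow> graded_ring R"
  by (simp add: graded_left_module_def)

lemma glm_mpart_carrier: "graded_left_module R M \<Longrightarrow> x \<in> mpart M n \<Longrightarrow> x \<in> carrier M"
  using graded_group.D_carrier[of M "mpart M"]
  by (simp add: graded_group_def graded_group_axioms_def glm_abelian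
      graded_left_module.mpart_direct_sum)

lemma gmod_hom_zero:
  assumes "graded_left_module R M" "graded_left_module R N" "h \<in> gmod_hom R M N"
  shows "h \<zero>\<^bsub>M\<^esub> = \<zero>\<^bsub>N\<^esub>"
  by (rule additive_zero[OF glm_abelian glm_abelian, OF assms(1,2)]) (auto simp: gmod_homD[OF assms(3)])

lemma gmod_hom_minus:
  assumes "graded_left_module R M" "graded_left_module R N" "h \<in> gmod_hom R M N" "x \<in> carrier M"
  shows "h (\<ominus>\<^bsub>M\<^esub> x) = \<ominus>\<^bsub>N\<^esub> h x"
proof -
  interpret M: graded_left_module R M by fact
  interpret N: graded_left_module R N by fact
  have "h (\<ominus>\<^bsub>M\<^esub> x) \<oplus>\<^bsub>N\<^esub> h x = \<zero>\<^bsub>N\<^esub>"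
    using gmod_homD(2)[OF assms(3), of "\<ominus>\<^bsub>M\<^esub> x" x] assms(4) gmod_hom_zero[OF assms(1-3)]
    by (simp add: M.M.l_neg)
  then show ?thesis
    using gmod_homD(1)[OF assms(3)] assms(4) by (metis M.M.a_inv_closed N.M.minus_equality)
qed

lemma gmod_hom_finsum:
  assumes "graded_left_module R M" "graded_left_module R N" "h \<in> gmod_hom R M N"
    "finite S" "c \<in> S \<rightarrow> carrier M"
  shows "h (finsum M c S) = finsum N (\<lambda>s. h (c s)) S"
  by (rule additive_finsum[OF glm_abelian glm_abelian, OF assms(1,2)])
    (use assms(4,5) in \<open>auto simp: gmod_homD[OF assms(3)]\<close>)

lemma gmod_hom_gcomp:
  assumes "graded_left_module R M" "graded_left_module R N" "h \<in> gmod_hom R M N" "x \<in> carrier M"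
  shows "gcomp N (mpart N) (h x) n = h (gcomp M (mpart M) x n)"
proof -
  interpret M: graded_left_module R M by fact
  interpret N: graded_left_module R N by fact
  let ?c = "gcomp M (mpart M) x" and ?S = "{n. gcomp M (mpart M) x n \<noteq> \<zero>\<^bsub>M\<^esub>}"
  have "h x = finsum N (\<lambda>n. h (?c n)) ?S"
    using M.mgr.cp_sum[OF assms(4)] gmod_hom_finsum[OF assms(1-3) M.mgr.cp_finite[OF assms(4)], of ?c]
      assms(4) by simp
  moreover have "N.mgr.cp (finsum N (\<lambda>n. h (?c n)) ?S) = (\<lambda>n. h (?c n))"
    using M.mgr.cp_D[OF assms(4)] gmod_homD(4)[OF assms(3)] gmod_hom_zero[OF assms(1-3)]
      M.mgr.cp_finite[OF assms(4)]
    by (intro N.mgr.cp_unique) auto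
  ultimately show ?thesis by metis
qed

lemma gsub_simps [simp]:
  "carrier (gsub M H) = H" "ring.add (gsub M H) = ring.add M" "\<zero>\<^bsub>gsub M H\<^esub> = \<zero>\<^bsub>M\<^esub>"
  "smult (gsub M H) = smult M" "mpart (gsub M H) n = H \<inter> mpart M n"
  by (simp_all add: gsub_def)

lemma gsub_abelian:
  assumes M: "abelian_group M" and H: "H \<subseteq> carrier M" "\<zero>\<^bsub>M\<^esub> \<in> H"
    "\<And>a b. \<lbrakk>a \<in> H; b \<in> H\<rbrakk> \<Longrightarrow> a \<oplus>\<^bsub>M\<^esub> b \<in> H" "\<And>a. a \<in> H \<Longrightarrow> \<ominus>\<^bsub>M\<^esub> a \<in> H"
  shows "abelian_group (gsub M H)"
proof -
  interpret abelian_group M by fact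
  show ?thesis
  proof (rule abelian_groupI)
    show "\<exists>y\<in>carrier (gsub M H). y \<oplus>\<^bsub>gsub M H\<^esub> x = \<zero>\<^bsub>gsub M H\<^esub>" if "x \<in> carrier (gsub M H)" for x
      using that H l_neg by (intro bexI[of _ "\<ominus>\<^bsub>M\<^esub> x"]) auto
  qed (use H in \<open>auto simp: subset_iff a_ac\<close>)
qed

lemma gsub_finsum:
  assumes "abelian_group M" "abelian_group (gsub M H)" "H \<subseteq> carrier M" "finite S" "c \<in> S \<rightarrow> H"
  shows "finsum (gsub M H) c S = finsum M c S"
  using additive_finsum[of "gsub M H" M "\<lambda>x. x" S c] assms by auto

lemma glm_gsub:
  assumes "graded_left_module R M" "graded_submodule R M H"
  shows "graded_left_module R (gsub M H)"
proof -
  interpret M: graded_left_module R M by fact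
  have sm: "submodule H R M" using assms(2) by (simp add: graded_submodule_def)
  note H = submoduleD[OF sm]
  have cH: "M.mgr.cp x n \<in> H" if "x \<in> H" for x n using assms(2) that by (simp add: graded_submodule_def)
  have ab: "abelian_group (gsub M H)"
    by (rule gsub_abelian) (use H M.M.abelian_group_axioms in auto)
  interpret S: abelian_group "gsub M H" by fact
  have inv: "\<ominus>\<^bsub>gsub M H\<^esub> x = \<ominus>\<^bsub>M\<^esub> x" if "x \<in> H" for x
    using that H S.minus_equality[of "\<ominus>\<^bsub>M\<^esub> x" x] M.M.l_neg[of x] by auto
  have Hc: "x \<in> carrier M" if "x \<in> H" for x using that H by blast
  have ids: "internal_direct_sum (gsub M H) (mpart (gsub M H))"
  proof (rule internal_direct_sumI[where p = "M.mgr.cp", OF ab])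
    show "additive_subgroup (mpart (gsub M H) n) (gsub M H)" for n
      by (rule additive_subgroupI') (use H M.mgr.D_add M.mgr.D_zero M.mgr.D_neg inv in auto)
    show "finsum (gsub M H) (M.mgr.cp x) {n. M.mgr.cp x n \<noteq> \<zero>\<^bsub>gsub M H\<^esub>} = x"
      if "x \<in> carrier (gsub M H)" for x
      using that gsub_finsum[OF M.M.abelian_group_axioms ab H(1), of _ "M.mgr.cp x"]
        M.mgr.cp_finite[OF Hc[of x]] cH M.mgr.cp_sum[OF Hc[of x]] by auto
  qed (use H cH Hc in \<open>auto simp: M.mgr.cp_D M.mgr.cp_finite M.mgr.cp_add M.mgr.cp_homog\<close>)
  show ?thesis
    by (rule glmI[OF _ ab _ _ _ _ _ ids])
      (use H Hc in \<open>auto simp: M.lsmult_l_distr M.lsmult_r_distr M.lsmult_assoc M.lsmult_one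
        M.mpart_smult M.rgr.D_carrier M.graded_ring_axioms\<close>)
qed

lemma submodule_hker:
  assumes "graded_left_module R M" "graded_left_module R N" "h \<in> gmod_hom R M N"
  shows "graded_submodule R M (hker M N h)"
proof -
  interpret M: graded_left_module R M by fact
  interpret N: graded_left_module R N by fact
  have "submodule (hker M N h) R M"
    by (rule M.submoduleI')
      (auto simp: hker_def gmod_hom_zero[OF assms] gmod_homD[OF assms(3)] M.lsmult_closed)
  then show ?thesis
    unfolding graded_submodule_def
    using gmod_hom_gcomp[OF assms, symmetric] by (auto simp: hker_def)
qed

lemma submodule_himage:
  assumes "graded_left_module R M" "graded_left_module R N" "h \<in> gmod_hom R M N"
  shows "graded_submodule R N (h ` carrier M)"
proof -
  interpret M: graded_left_module R M by fact
  interpret N: graded_left_module R N by fact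
  note hD = gmod_homD[OF assms(3)]
  have "submodule (h ` carrier M) R N"
  proof (rule N.submoduleI')
    show "\<zero>\<^bsub>N\<^esub> \<in> h ` carrier M" using gmod_hom_zero[OF assms] M.M.zero_closed by force
    show "a \<oplus>\<^bsub>N\<^esub> b \<in> h ` carrier M" if "a \<in> h ` carrier M" "b \<in> h ` carrier M" for a b
      using that hD(2)[symmetric] by (auto intro!: imageI)
    show "a \<odot>\<^bsub>N\<^esub> b \<in> h ` carrier M" if "a \<in> carrier R" "b \<in> h ` carrier M" for a b
      using that hD(3)[symmetric] by (auto intro!: imageI M.lsmult_closed)
  qed (use hD in auto)
  then show ?thesis
    unfolding graded_submodule_def
    using gmod_hom_gcomp[OF assms] by auto
qed

text \<open>This covers quotients, tensor products and transport along bijections at once.\<close>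

lemma glm_pushforward:
  assumes "graded_left_module R M"
    and car: "carrier N = h ` carrier M" and zero: "h \<zero>\<^bsub>M\<^esub> = \<zero>\<^bsub>N\<^esub>"
    and add: "\<And>x y. x \<in> carrier M \<Longrightarrow> y \<in> carrier M \<Longrightarrow> h (x \<oplus>\<^bsub>M\<^esub> y) = h x \<oplus>\<^bsub>N\<^esub> h y"
    and sm: "\<And>a x. a \<in> carrier R \<Longrightarrow> x \<in> carrier M \<Longrightarrow> h (a \<odot>\<^bsub>M\<^esub> x) = a \<odot>\<^bsub>N\<^esub> h x"
    and part: "\<And>n. mpart N n = h ` mpart M n"
    and ker: "\<And>x y n. x \<in> carrier M \<Longrightarrow> y \<in> carrier M \<Longrightarrow> h x = h y \<Longrightarrow>
       h (gcomp M (mpart M) x n) = h (gcomp M (mpart M) y n)"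
  shows "graded_left_module R N" "h \<in> gmod_hom R M N"
proof -
  interpret M: graded_left_module R M by fact
  have ab: "abelian_group N"
  proof (rule abelian_groupI)
    show "\<exists>y\<in>carrier N. y \<oplus>\<^bsub>N\<^esub> x = \<zero>\<^bsub>N\<^esub>" if "x \<in> carrier N" for x
      using that unfolding car by (auto simp: zero M.M.l_neg simp flip: add intro!: bexI[of _ "\<ominus>\<^bsub>M\<^esub> _"])
    show "\<zero>\<^bsub>N\<^esub> \<in> carrier N" unfolding car zero[symmetric] by simp
    show "x \<oplus>\<^bsub>N\<^esub> y \<in> carrier N" if "x \<in> carrier N" "y \<in> carrier N" for x y
      using that unfolding car by (auto simp flip: add)
    show "\<zero>\<^bsub>N\<^esub> \<oplus>\<^bsub>N\<^esub> x = x" if "x \<in> carrier N" for x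
      using that unfolding car zero[symmetric] by (auto simp flip: add)
  qed (auto simp: car M.M.a_ac simp flip: add)
  interpret N: abelian_group N by fact
  have neg: "\<ominus>\<^bsub>N\<^esub> h x = h (\<ominus>\<^bsub>M\<^esub> x)" if "x \<in> carrier M" for x
    using that by (intro N.minus_equality) (auto simp: car zero M.M.l_neg simp flip: add)
  \<comment> \<open>The component of an element of N is read off from an arbitrary preimage in M;
    \<open>ker\<close> makes the choice harmless.\<close>
  define p where "p y n = h (M.mgr.cp (SOME x. x \<in> carrier M \<and> h x = y) n)" for y n
  have p: "p (h x) n = h (M.mgr.cp x n)" if "x \<in> carrier M" for x n
  proof -
    have "(SOME z. z \<in> carrier M \<and> h z = h x) \<in> carrier M \<and> h (SOME z. z \<in> carrier M \<and> h z = h x) = h x"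
      by (rule someI[of _ x]) (use that in auto)
    then show ?thesis unfolding p_def using that by (intro ker) auto
  qed
  have "internal_direct_sum N (mpart N)"
  proof (rule internal_direct_sumI[where p = p, OF ab])
    show "additive_subgroup (mpart N n) N" for n
    proof (rule additive_subgroupI')
      show "\<zero>\<^bsub>N\<^esub> \<in> mpart N n" unfolding part zero[symmetric] by (rule imageI) simp
      show "a \<oplus>\<^bsub>N\<^esub> b \<in> mpart N n" if "a \<in> mpart N n" "b \<in> mpart N n" for a b
        using that unfolding part by (auto simp: M.mgr.D_carrier M.mgr.D_add simp flip: add)
      show "\<ominus>\<^bsub>N\<^esub> a \<in> mpart N n" if "a \<in> mpart N n" for a
        using that unfolding part by (auto simp: M.mgr.D_carrier M.mgr.D_neg neg)
    qed (auto simp: part car M.mgr.D_carrier)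
    show "p x n \<in> mpart N n" if "x \<in> carrier N" for x n
      using that unfolding car by (auto simp: p part M.mgr.cp_D)
    have fin: "{n. p (h x) n \<noteq> \<zero>\<^bsub>N\<^esub>} \<subseteq> {n. M.mgr.cp x n \<noteq> \<zero>\<^bsub>M\<^esub>}" if "x \<in> carrier M" for x
      using that zero by (auto simp: p)
    show "finite {n. p x n \<noteq> \<zero>\<^bsub>N\<^esub>}" if "x \<in> carrier N" for x
      using that unfolding car using fin M.mgr.cp_finite by (auto intro: finite_subset)
    show "finsum N (p x) {n. p x n \<noteq> \<zero>\<^bsub>N\<^esub>} = x" if x: "x \<in> carrier N" for x
    proof -
      obtain y where y: "y \<in> carrier M" "x = h y" using x car by blast
      have "finsum N (p x) {n. p x n \<noteq> \<zero>\<^bsub>N\<^esub>} = finsum N (p x) {n. M.mgr.cp y n \<noteq> \<zero>\<^bsub>M\<^esub>}"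
        using y fin M.mgr.cp_finite by (intro N.finsum_support) (auto simp: p car)
      also have "\<dots> = finsum N (\<lambda>n. h (M.mgr.cp y n)) {n. M.mgr.cp y n \<noteq> \<zero>\<^bsub>M\<^esub>}"
        by (rule arg_cong[where f = "\<lambda>c. finsum N c _"]) (simp add: y p fun_eq_iff)
      also have "\<dots> = h (finsum M (M.mgr.cp y) {n. M.mgr.cp y n \<noteq> \<zero>\<^bsub>M\<^esub>})"
        by (rule additive_finsum[OF M.M.abelian_group_axioms ab _ _ M.mgr.cp_finite, symmetric])
          (use y in \<open>auto simp: car add\<close>)
      finally show ?thesis using y M.mgr.cp_sum by simp
    qed
    show "p (x \<oplus>\<^bsub>N\<^esub> y) n = p x n \<oplus>\<^bsub>N\<^esub> p y n" if "x \<in> carrier N" "y \<in> carrier N" for x y n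
      using that unfolding car by (auto simp: p M.mgr.cp_add simp flip: add)
    show "p x m = (if m = n then x else \<zero>\<^bsub>N\<^esub>)" if "x \<in> mpart N n" for x n m
      using that unfolding part by (auto simp: p M.mgr.D_carrier M.mgr.cp_homog zero)
  qed
  then show "graded_left_module R N"
    by (rule glmI[OF M.graded_ring_axioms ab, rotated 5])
      (auto simp: car part M.lsmult_l_distr M.lsmult_r_distr M.lsmult_assoc M.lsmult_one M.lsmult_closed
        M.mpart_smult M.mgr.D_carrier M.rgr.D_carrier simp flip: add sm)
  show "h \<in> gmod_hom R M N"
    by (rule gmod_homI) (auto simp: car add sm part)
qed

subsection \<open>Shifts, twists and direct sums\<close>

lemma abelian_group_cong:
  fixes M N :: "('b, 'c) ring_scheme"
  assumes "abelian_group M" "carrier N = carrier M" "ring.add N = ring.add M" "\<zero>\<^bsub>N\<^esub> = \<zero>\<^bsub>M\<^esub>"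
  shows "abelian_group N"
  using assms by (simp add: abelian_group_def abelian_monoid_def abelian_group_axioms_def)

lemma finsum_ring_cong:
  fixes M N :: "('b, 'c) ring_scheme"
  assumes "carrier N = carrier M" "ring.add N = ring.add M" "\<zero>\<^bsub>N\<^esub> = \<zero>\<^bsub>M\<^esub>"
  shows "finsum N = finsum M"
  using assms by (intro ext) (simp add: finsum_def)

lemma a_inv_cong:
  fixes M N :: "('b, 'c) ring_scheme"
  assumes "carrier N = carrier M" "ring.add N = ring.add M" "\<zero>\<^bsub>N\<^esub> = \<zero>\<^bsub>M\<^esub>"
  shows "\<ominus>\<^bsub>N\<^esub> x = \<ominus>\<^bsub>M\<^esub> x"
  using assms by (simp add: a_inv_def)

lemma gshift_simps [simp]:
  "carrier (gshift n M) = carrier M" "ring.add (gshift n M) = ring.add M"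
  "\<zero>\<^bsub>gshift n M\<^esub> = \<zero>\<^bsub>M\<^esub>" "smult (gshift n M) = smult M" "mpart (gshift n M) i = mpart M (i + n)"
  by (simp_all add: gshift_def)

lemma gtwist_simps [simp]:
  "carrier (gtwist s M) = carrier M" "ring.add (gtwist s M) = ring.add M"
  "\<zero>\<^bsub>gtwist s M\<^esub> = \<zero>\<^bsub>M\<^esub>" "smult (gtwist s M) = (\<lambda>a. smult M (s a))" "mpart (gtwist s M) = mpart M"
  by (simp_all add: gtwist_def)

lemma tw_simps [simp]:
  "carrier (tw s e M) = carrier M" "ring.add (tw s e M) = ring.add M"
  "\<zero>\<^bsub>tw s e M\<^esub> = \<zero>\<^bsub>M\<^esub>" "smult (tw s e M) = (\<lambda>a. smult M (s a))"
  "mpart (tw s e M) i = mpart M (i - e)"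
  by (simp_all add: tw_def)

lemma gsum_simps [simp]:
  "carrier (gsum M N) = carrier M \<times> carrier N" "\<zero>\<^bsub>gsum M N\<^esub> = (\<zero>\<^bsub>M\<^esub>, \<zero>\<^bsub>N\<^esub>)"
  "(x, y) \<oplus>\<^bsub>gsum M N\<^esub> (x', y') = (x \<oplus>\<^bsub>M\<^esub> x', y \<oplus>\<^bsub>N\<^esub> y')"
  "a \<odot>\<^bsub>gsum M N\<^esub> (x, y) = (a \<odot>\<^bsub>M\<^esub> x, a \<odot>\<^bsub>N\<^esub> y)"
  "mpart (gsum M N) n = mpart M n \<times> mpart N n"
  by (simp_all add: gsum_def)

lemma glm_gshift:
  assumes "graded_left_module R M"
  shows "graded_left_module R (gshift n M)"
proof -
  interpret M: graded_left_module R M by fact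
  let ?N = "gshift n M"
  have ab: "abelian_group ?N"
    by (rule abelian_group_cong[OF M.M.abelian_group_axioms]) auto
  have fs: "finsum ?N = finsum M" by (rule finsum_ring_cong) auto
  have supp: "{i. M.mgr.cp x (i + n) \<noteq> \<zero>\<^bsub>M\<^esub>} = (\<lambda>i. i - n) ` {i. M.mgr.cp x i \<noteq> \<zero>\<^bsub>M\<^esub>}" for x
    by (auto simp: image_iff intro!: exI[of _ "_ + n"])
  have ids: "internal_direct_sum ?N (mpart ?N)"
  proof (rule internal_direct_sumI[where p = "\<lambda>x i. M.mgr.cp x (i + n)", OF ab])
    show "additive_subgroup (mpart ?N i) ?N" for i
      by (rule additive_subgroupI')
        (auto simp: M.mgr.D_carrier M.mgr.D_add M.mgr.D_neg a_inv_cong[of ?N M])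
    show "finite {i. M.mgr.cp x (i + n) \<noteq> \<zero>\<^bsub>?N\<^esub>}" if "x \<in> carrier ?N" for x
      using that by (simp add: supp M.mgr.cp_finite)
    show "finsum ?N (\<lambda>i. M.mgr.cp x (i + n)) {i. M.mgr.cp x (i + n) \<noteq> \<zero>\<^bsub>?N\<^esub>} = x"
      if "x \<in> carrier ?N" for x
    proof -
      have "finsum M (\<lambda>i. M.mgr.cp x (i + n)) ((\<lambda>i. i - n) ` {i. M.mgr.cp x i \<noteq> \<zero>\<^bsub>M\<^esub>}) =
        finsum M (\<lambda>i. M.mgr.cp x (i - n + n)) {i. M.mgr.cp x i \<noteq> \<zero>\<^bsub>M\<^esub>}"
        by (rule M.finsum_reindex) (use that in \<open>auto simp: inj_on_def\<close>)
      then show ?thesis using that by (simp add: fs supp M.mgr.cp_sum)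
    qed
  qed (auto simp: M.mgr.cp_D M.mgr.cp_add M.mgr.cp_homog)
  show ?thesis
    by (rule glmI[OF M.graded_ring_axioms ab _ _ _ _ _ ids])
      (auto simp: M.lsmult_l_distr M.lsmult_r_distr M.lsmult_assoc M.lsmult_one M.lsmult_closed
        add.assoc M.mpart_smult)
qed

lemma glm_gtwist:
  assumes "graded_left_module R M" and s: "s \<in> ring_hom R R"
    and part: "\<And>a n. a \<in> rpart R n \<Longrightarrow> s a \<in> rpart R n"
  shows "graded_left_module R (gtwist s M)"
proof -
  interpret M: graded_left_module R M by fact
  let ?N = "gtwist s M"
  have ab: "abelian_group ?N"
    by (rule abelian_group_cong[OF M.M.abelian_group_axioms]) auto
  have ids: "internal_direct_sum ?N (mpart ?N)"
    using M.mpart_direct_sum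
    by (simp add: internal_direct_sum_def additive_subgroup_def finsum_ring_cong[of ?N M])
  show ?thesis
    by (rule glmI[OF M.graded_ring_axioms ab _ _ _ _ _ ids])
      (auto simp: M.lsmult_l_distr M.lsmult_r_distr M.lsmult_assoc M.lsmult_one M.lsmult_closed
        M.mpart_smult part ring_hom_closed[OF s] ring_hom_add[OF s] ring_hom_mult[OF s] ring_hom_one[OF s])
qed

lemma glm_tw:
  assumes "graded_left_module R M" and s: "s \<in> ring_hom R R"
    and part: "\<And>a n. a \<in> rpart R n \<Longrightarrow> s a \<in> rpart R n"
  shows "graded_left_module R (tw s e M)"
  unfolding tw_def by (intro glm_gshift glm_gtwist assms)

lemma glm_gsum:
  assumes "graded_left_module R M" "graded_left_module R N"
  shows "graded_left_module R (gsum M N)"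
proof -
  interpret M: graded_left_module R M by fact
  interpret N: graded_left_module R N by fact
  let ?P = "gsum M N"
  have ab: "abelian_group ?P"
  proof (rule abelian_groupI)
    show "\<exists>y\<in>carrier ?P. y \<oplus>\<^bsub>?P\<^esub> x = \<zero>\<^bsub>?P\<^esub>" if "x \<in> carrier ?P" for x
      using that by (intro bexI[of _ "(\<ominus>\<^bsub>M\<^esub> fst x, \<ominus>\<^bsub>N\<^esub> snd x)"]) (auto simp: M.M.l_neg N.M.l_neg)
  qed (auto simp: M.M.a_ac N.M.a_ac)
  interpret P: abelian_group ?P by fact
  have neg: "\<ominus>\<^bsub>?P\<^esub> (x, y) = (\<ominus>\<^bsub>M\<^esub> x, \<ominus>\<^bsub>N\<^esub> y)" if "x \<in> carrier M" "y \<in> carrier N" for x y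
    using that by (intro P.minus_equality) (auto simp: M.M.l_neg N.M.l_neg)
  have fst: "fst (finsum ?P c S) = finsum M (\<lambda>s. fst (c s)) S"
    and snd: "snd (finsum ?P c S) = finsum N (\<lambda>s. snd (c s)) S"
    if "finite S" "c \<in> S \<rightarrow> carrier ?P" for c :: "int \<Rightarrow> _" and S
    by (rule additive_finsum[OF ab M.M.abelian_group_axioms _ _ that]; auto)
      (rule additive_finsum[OF ab N.M.abelian_group_axioms _ _ that]; auto)
  have ids: "internal_direct_sum ?P (mpart ?P)"
  proof (rule internal_direct_sumI[where p = "\<lambda>x n. (M.mgr.cp (fst x) n, N.mgr.cp (snd x) n)", OF ab])
    show "additive_subgroup (mpart ?P i) ?P" for i
      by (rule additive_subgroupI')
        (auto simp: M.mgr.D_carrier M.mgr.D_add M.mgr.D_neg N.mgr.D_carrier N.mgr.D_add N.mgr.D_neg neg)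
    let ?s = "\<lambda>x. {n. M.mgr.cp (fst x) n \<noteq> \<zero>\<^bsub>M\<^esub>} \<union> {n. N.mgr.cp (snd x) n \<noteq> \<zero>\<^bsub>N\<^esub>}"
    have supp: "{n. (M.mgr.cp (fst x) n, N.mgr.cp (snd x) n) \<noteq> \<zero>\<^bsub>?P\<^esub>} = ?s x" for x
      by auto
    have fin: "finite (?s x)" if "x \<in> carrier ?P" for x
      using that by (auto simp: M.mgr.cp_finite N.mgr.cp_finite)
    then show "finite {n. (M.mgr.cp (fst x) n, N.mgr.cp (snd x) n) \<noteq> \<zero>\<^bsub>?P\<^esub>}"
      if "x \<in> carrier ?P" for x
      using that unfolding supp by blast
    show "finsum ?P (\<lambda>n. (M.mgr.cp (fst x) n, N.mgr.cp (snd x) n))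
        {n. (M.mgr.cp (fst x) n, N.mgr.cp (snd x) n) \<noteq> \<zero>\<^bsub>?P\<^esub>} = x"
      if x: "x \<in> carrier ?P" for x
      unfolding supp
      by (rule prod_eqI; subst fst snd; use x fin[OF x] in \<open>force intro!: M.mgr.cp_sum_superset N.mgr.cp_sum_superset\<close>)
  qed (auto simp: M.mgr.cp_D M.mgr.cp_add M.mgr.cp_homog N.mgr.cp_D N.mgr.cp_add N.mgr.cp_homog)
  show ?thesis
    by (rule glmI[OF M.graded_ring_axioms ab _ _ _ _ _ ids])
      (auto simp: M.lsmult_l_distr M.lsmult_r_distr M.lsmult_assoc M.lsmult_one M.lsmult_closed
        M.mpart_smult N.lsmult_l_distr N.lsmult_r_distr N.lsmult_assoc N.lsmult_one N.lsmult_closed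
        N.mpart_smult)
qed

subsection \<open>Isomorphisms\<close>

lemma gmod_isoD:
  assumes "h \<in> gmod_iso R M N"
  shows "h \<in> gmod_hom R M N" "bij_betw h (carrier M) (carrier N)" "inj_on h (carrier M)"
    "h ` carrier M = carrier N"
  using assms by (auto simp: gmod_iso_def bij_betw_def)

lemma gmod_iso_comp:
  assumes "h \<in> gmod_iso R M N" "k \<in> gmod_iso R N P"
  shows "(\<lambda>x. k (h x)) \<in> gmod_iso R M P"
  using gmod_hom_comp[OF gmod_isoD(1)[OF assms(1)] gmod_isoD(1)[OF assms(2)]]
    bij_betw_trans[OF gmod_isoD(2)[OF assms(1)] gmod_isoD(2)[OF assms(2)]]
  by (simp add: gmod_iso_def comp_def)

lemma gmod_iso_inverse:
  assumes M: "graded_left_module R M" and N: "graded_left_module R N" and h: "h \<in> gmod_iso R M N"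
  defines "k \<equiv> inv_into (carrier M) h"
  shows "k \<in> gmod_iso R N M" "\<And>x. x \<in> carrier M \<Longrightarrow> k (h x) = x" "\<And>y. y \<in> carrier N \<Longrightarrow> h (k y) = y"
proof -
  interpret M: graded_left_module R M by fact
  interpret N: graded_left_module R N by fact
  note hh = gmod_isoD[OF h]
  note hD = gmod_homD[OF hh(1)]
  show kh: "k (h x) = x" if "x \<in> carrier M" for x
    unfolding k_def using that hh(3) by simp
  show hk: "h (k y) = y" if "y \<in> carrier N" for y
    unfolding k_def using that hh(4) by (simp add: f_inv_into_f)
  have kc: "k y \<in> carrier M" if "y \<in> carrier N" for y
    unfolding k_def using that hh(4) by (metis inv_into_into)
  have eqI: "x = z" if "h x = h z" "x \<in> carrier M" "z \<in> carrier M" for x z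
    using that hh(3) by (auto dest: inj_onD)
  have "k \<in> gmod_hom R N M"
  proof (rule gmod_homI)
    show "k (x \<oplus>\<^bsub>N\<^esub> y) = k x \<oplus>\<^bsub>M\<^esub> k y" if "x \<in> carrier N" "y \<in> carrier N" for x y
      by (rule eqI) (use that in \<open>auto simp: kc hk hD\<close>)
    show "k (a \<odot>\<^bsub>N\<^esub> x) = a \<odot>\<^bsub>M\<^esub> k x" if "a \<in> carrier R" "x \<in> carrier N" for a x
      by (rule eqI) (use that in \<open>auto simp: kc hk hD M.lsmult_closed N.lsmult_closed\<close>)
    show "k y \<in> mpart M n" if "y \<in> mpart N n" for y n
    proof -
      have y: "y \<in> carrier N" using that N.mgr.D_carrier by blast
      \<comment> \<open>h commutes with taking components and y is homogeneous, so by injectivity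
        \<open>k y\<close> equals its own component of degree n.\<close>
      have "h (M.mgr.cp (k y) n) = h (k y)"
        using gmod_hom_gcomp[OF M N hh(1) kc[OF y], of n] N.mgr.cp_homog[OF that, of n] hk[OF y] by simp
      then have "M.mgr.cp (k y) n = k y" using kc[OF y] by (auto intro: eqI)
      then show ?thesis using M.mgr.cp_D[OF kc[OF y], of n] by simp
    qed
  qed (rule kc)
  moreover have "bij_betw k (carrier N) (carrier M)"
    unfolding k_def by (rule bij_betw_inv_into[OF hh(2)])
  ultimately show "k \<in> gmod_iso R N M" by (simp add: gmod_iso_def)
qed

lemma gmod_hom_gsub_dom:
  "h \<in> gmod_hom R M N \<Longrightarrow> H \<subseteq> carrier M \<Longrightarrow> h \<in> gmod_hom R (gsub M H) N"
  by (rule gmod_homI) (auto simp: gmod_homD subset_iff)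

lemma gmod_hom_gsub_cod:
  "h \<in> gmod_hom R M N \<Longrightarrow> (\<And>x. x \<in> carrier M \<Longrightarrow> h x \<in> H) \<Longrightarrow> (\<And>x n. x \<in> mpart M n \<Longrightarrow> x \<in> carrier M)
    \<Longrightarrow> h \<in> gmod_hom R M (gsub N H)"
  by (rule gmod_homI) (auto simp: gmod_homD)

lemma gmod_hom_add:
  assumes "graded_left_module R N" "h \<in> gmod_hom R M N" "k \<in> gmod_hom R M N"
  shows "(\<lambda>x. h x \<oplus>\<^bsub>N\<^esub> k x) \<in> gmod_hom R M N"
proof -
  interpret N: graded_left_module R N by fact
  show ?thesis
    by (rule gmod_homI)
      (simp_all add: gmod_homD[OF assms(2)] gmod_homD[OF assms(3)] N.lsmult_r_distr N.M.a_ac N.mgr.D_add)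
qed

lemma gmod_hom_uminus:
  assumes "graded_left_module R N" "h \<in> gmod_hom R M N"
  shows "(\<lambda>x. \<ominus>\<^bsub>N\<^esub> h x) \<in> gmod_hom R M N"
proof -
  interpret N: graded_left_module R N by fact
  show ?thesis
    by (rule gmod_homI)
      (simp_all add: gmod_homD[OF assms(2)] N.lsmult_r_minus N.M.minus_add N.mgr.D_neg)
qed

lemma gmod_hom_diff:
  assumes "graded_left_module R N" "h \<in> gmod_hom R M N" "k \<in> gmod_hom R M N"
  shows "(\<lambda>x. h x \<ominus>\<^bsub>N\<^esub> k x) \<in> gmod_hom R M N"
  using gmod_hom_add[OF assms(1,2) gmod_hom_uminus[OF assms(1,3)]] by (simp add: a_minus_def)

section \<open>Graded free modules\<close>

definition coef :: "'a gring \<Rightarrow> ('a, 'b) gmodule \<Rightarrow> 'b set \<Rightarrow> 'b \<Rightarrow> 'b \<Rightarrow> 'a" where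
  "coef R M X m = (THE c. (\<forall>x. c x \<in> carrier R) \<and> (\<forall>x. x \<notin> X \<longrightarrow> c x = \<zero>\<^bsub>R\<^esub>) \<and>
     finite {x. c x \<noteq> \<zero>\<^bsub>R\<^esub>} \<and> m = finsum M (\<lambda>x. c x \<odot>\<^bsub>M\<^esub> x) {x. c x \<noteq> \<zero>\<^bsub>R\<^esub>})"

text \<open>For a homogeneous element the choice is arbitrary only if the element is zero.\<close>

definition bdeg :: "('a, 'b) gmodule \<Rightarrow> 'b \<Rightarrow> int" where
  "bdeg M x = (SOME n. x \<in> mpart M n)"

definition lin_ext :: "'a gring \<Rightarrow> ('a, 'b) gmodule \<Rightarrow> 'b set \<Rightarrow> ('a, 'c) gmodule \<Rightarrow> ('b \<Rightarrow> 'c) \<Rightarrow> 'b \<Rightarrow> 'c" where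
  "lin_ext R M X U u m = finsum U (\<lambda>x. coef R M X m x \<odot>\<^bsub>U\<^esub> u x) {x. coef R M X m x \<noteq> \<zero>\<^bsub>R\<^esub>}"

locale free_basis = graded_left_module R M for R :: "'a gring" (structure) and M :: "('a, 'b) gmodule" (structure) +
  fixes X :: "'b set"
  assumes basis: "graded_basis R M X"
begin

abbreviation "cf \<equiv> coef R M X"

lemma basis_mpart: "x \<in> X \<Longrightarrow> x \<in> mpart M (bdeg M x)"
  unfolding bdeg_def using basis by (auto simp: graded_basis_def intro: someI)

lemma basis_carrier: "x \<in> X \<Longrightarrow> x \<in> carrier M"
  using basis_mpart mgr.D_carrier by blast

lemma cf_props:
  assumes "m \<in> carrier M"
  shows "(\<forall>x. cf m x \<in> carrier R) \<and> (\<forall>x. x \<notin> X \<longrightarrow> cf m x = \<zero>\<^bsub>R\<^esub>) \<and>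
     finite {x. cf m x \<noteq> \<zero>\<^bsub>R\<^esub>} \<and> m = finsum M (\<lambda>x. cf m x \<odot>\<^bsub>M\<^esub> x) {x. cf m x \<noteq> \<zero>\<^bsub>R\<^esub>}"
proof -
  have "\<exists>!c. (\<forall>x. c x \<in> carrier R) \<and> (\<forall>x. x \<notin> X \<longrightarrow> c x = \<zero>\<^bsub>R\<^esub>) \<and>
        finite {x. c x \<noteq> \<zero>\<^bsub>R\<^esub>} \<and> m = finsum M (\<lambda>x. c x \<odot>\<^bsub>M\<^esub> x) {x. c x \<noteq> \<zero>\<^bsub>R\<^esub>}"
    using basis assms by (simp add: graded_basis_def)
  from theI'[OF this] show ?thesis unfolding coef_def .
qed

lemma cf_closed [simp]: "m \<in> carrier M \<Longrightarrow> cf m x \<in> carrier R"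
  and cf_outside: "m \<in> carrier M \<Longrightarrow> x \<notin> X \<Longrightarrow> cf m x = \<zero>\<^bsub>R\<^esub>"
  and cf_finite: "m \<in> carrier M \<Longrightarrow> finite {x. cf m x \<noteq> \<zero>\<^bsub>R\<^esub>}"
  and cf_sum: "m \<in> carrier M \<Longrightarrow> finsum M (\<lambda>x. cf m x \<odot>\<^bsub>M\<^esub> x) {x. cf m x \<noteq> \<zero>\<^bsub>R\<^esub>} = m"
  using cf_props by auto

lemma lincomb_superset:
  assumes U: "graded_left_module R U" and c: "\<And>x. c x \<in> carrier R" "\<And>x. x \<notin> X \<Longrightarrow> c x = \<zero>\<^bsub>R\<^esub>"
    and S: "finite S" "{x. c x \<noteq> \<zero>\<^bsub>R\<^esub>} \<subseteq> S" "S \<subseteq> X" and u: "\<And>x. x \<in> X \<Longrightarrow> u x \<in> carrier U"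
  shows "finsum U (\<lambda>x. c x \<odot>\<^bsub>U\<^esub> u x) {x. c x \<noteq> \<zero>\<^bsub>R\<^esub>} = finsum U (\<lambda>x. c x \<odot>\<^bsub>U\<^esub> u x) S"
proof -
  interpret U: graded_left_module R U by fact
  show ?thesis
    by (rule U.add.finprod_mono_neutral_cong_left)
      (use c S u in \<open>auto simp: U.lsmult_closed subset_iff\<close>)
qed

lemma cf_unique:
  assumes c: "\<And>x. c x \<in> carrier R" "\<And>x. x \<notin> X \<Longrightarrow> c x = \<zero>\<^bsub>R\<^esub>"
    and S: "finite S" "{x. c x \<noteq> \<zero>\<^bsub>R\<^esub>} \<subseteq> S" "S \<subseteq> X"
  shows "cf (finsum M (\<lambda>x. c x \<odot>\<^bsub>M\<^esub> x) S) = c"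
proof -
  let ?m = "finsum M (\<lambda>x. c x \<odot>\<^bsub>M\<^esub> x) S"
  have m: "?m \<in> carrier M"
    using c S basis_carrier by (intro M.finsum_closed) (auto simp: lsmult_closed subset_iff)
  have "\<exists>!c. (\<forall>x. c x \<in> carrier R) \<and> (\<forall>x. x \<notin> X \<longrightarrow> c x = \<zero>\<^bsub>R\<^esub>) \<and>
        finite {x. c x \<noteq> \<zero>\<^bsub>R\<^esub>} \<and> ?m = finsum M (\<lambda>x. c x \<odot>\<^bsub>M\<^esub> x) {x. c x \<noteq> \<zero>\<^bsub>R\<^esub>}"
    using basis m by (simp add: graded_basis_def)
  moreover have "(\<forall>x. c x \<in> carrier R) \<and> (\<forall>x. x \<notin> X \<longrightarrow> c x = \<zero>\<^bsub>R\<^esub>) \<and>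
        finite {x. c x \<noteq> \<zero>\<^bsub>R\<^esub>} \<and> ?m = finsum M (\<lambda>x. c x \<odot>\<^bsub>M\<^esub> x) {x. c x \<noteq> \<zero>\<^bsub>R\<^esub>}"
    using c S lincomb_superset[OF graded_left_module_axioms c S, of "\<lambda>x. x"] basis_carrier
    by (auto intro: finite_subset)
  ultimately show ?thesis using cf_props[OF m] by blast
qed

lemma cf_sum_superset:
  assumes "m \<in> carrier M" "finite S" "{x. cf m x \<noteq> \<zero>\<^bsub>R\<^esub>} \<subseteq> S" "S \<subseteq> X"
  shows "finsum M (\<lambda>x. cf m x \<odot>\<^bsub>M\<^esub> x) S = m"
  using lincomb_superset[OF graded_left_module_axioms, of "cf m" S "\<lambda>x. x"] assms cf_sum basis_carrier
    cf_outside by simp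

lemma supp_subset: "m \<in> carrier M \<Longrightarrow> {x. cf m x \<noteq> \<zero>\<^bsub>R\<^esub>} \<subseteq> X"
  using cf_outside by auto

lemma cf_add:
  assumes m: "m \<in> carrier M" and m': "m' \<in> carrier M"
  shows "cf (m \<oplus>\<^bsub>M\<^esub> m') x = cf m x \<oplus>\<^bsub>R\<^esub> cf m' x"
proof -
  let ?S = "{x. cf m x \<noteq> \<zero>\<^bsub>R\<^esub>} \<union> {x. cf m' x \<noteq> \<zero>\<^bsub>R\<^esub>}"
  have S: "finite ?S" "?S \<subseteq> X" using cf_finite supp_subset m m' by auto
  have c: "x \<in> carrier M" if "x \<in> ?S" for x using that S basis_carrier by blast
  have "cf (finsum M (\<lambda>x. (cf m x \<oplus>\<^bsub>R\<^esub> cf m' x) \<odot>\<^bsub>M\<^esub> x) ?S) = (\<lambda>x. cf m x \<oplus>\<^bsub>R\<^esub> cf m' x)"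
    using m m' S by (intro cf_unique) (auto simp: cf_outside)
  moreover have "finsum M (\<lambda>x. (cf m x \<oplus>\<^bsub>R\<^esub> cf m' x) \<odot>\<^bsub>M\<^esub> x) ?S =
      finsum M (\<lambda>x. cf m x \<odot>\<^bsub>M\<^esub> x \<oplus>\<^bsub>M\<^esub> cf m' x \<odot>\<^bsub>M\<^esub> x) ?S"
    using m m' c by (intro M.add.finprod_cong') (auto simp: lsmult_l_distr lsmult_closed)
  moreover have "\<dots> = m \<oplus>\<^bsub>M\<^esub> m'"
    using m m' S c by (subst M.finsum_addf) (auto simp: lsmult_closed cf_sum_superset)
  ultimately show ?thesis by metis
qed

lemma cf_smult:
  assumes m: "m \<in> carrier M" and a: "a \<in> carrier R"
  shows "cf (a \<odot>\<^bsub>M\<^esub> m) x = a \<otimes>\<^bsub>R\<^esub> cf m x"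
proof -
  let ?S = "{x. cf m x \<noteq> \<zero>\<^bsub>R\<^esub>}"
  have S: "finite ?S" "?S \<subseteq> X" using cf_finite supp_subset m by auto
  have c: "x \<in> carrier M" if "x \<in> ?S" for x using that S basis_carrier by blast
  have "cf (finsum M (\<lambda>x. (a \<otimes>\<^bsub>R\<^esub> cf m x) \<odot>\<^bsub>M\<^esub> x) ?S) = (\<lambda>x. a \<otimes>\<^bsub>R\<^esub> cf m x)"
    using m a S by (intro cf_unique) (auto simp: cf_outside)
  moreover have "finsum M (\<lambda>x. (a \<otimes>\<^bsub>R\<^esub> cf m x) \<odot>\<^bsub>M\<^esub> x) ?S =
      finsum M (\<lambda>x. a \<odot>\<^bsub>M\<^esub> (cf m x \<odot>\<^bsub>M\<^esub> x)) ?S"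
    using m a c by (intro M.add.finprod_cong') (auto simp: lsmult_assoc lsmult_closed)
  moreover have "\<dots> = a \<odot>\<^bsub>M\<^esub> m"
    using m a S c finsum_lsmult[of ?S a "\<lambda>x. cf m x \<odot>\<^bsub>M\<^esub> x"] by (auto simp: lsmult_closed cf_sum)
  ultimately show ?thesis by metis
qed

lemma cf_basis:
  assumes "x \<in> X"
  shows "cf x y = (if y = x then \<one>\<^bsub>R\<^esub> else \<zero>\<^bsub>R\<^esub>)"
proof -
  have "cf (finsum M (\<lambda>y. (if y = x then \<one>\<^bsub>R\<^esub> else \<zero>\<^bsub>R\<^esub>) \<odot>\<^bsub>M\<^esub> y) {x}) = (\<lambda>y. if y = x then \<one>\<^bsub>R\<^esub> else \<zero>\<^bsub>R\<^esub>)"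
    using assms by (intro cf_unique) auto
  moreover have "finsum M (\<lambda>y. (if y = x then \<one>\<^bsub>R\<^esub> else \<zero>\<^bsub>R\<^esub>) \<odot>\<^bsub>M\<^esub> y) {x} = x"
    using basis_carrier[OF assms] by (simp add: lsmult_one)
  ultimately show ?thesis by metis
qed

lemma cf_zero [simp]: "cf \<zero>\<^bsub>M\<^esub> x = \<zero>\<^bsub>R\<^esub>"
  using cf_smult[of "\<zero>\<^bsub>M\<^esub>" "\<zero>\<^bsub>R\<^esub>" x] by simp

lemma cf_eqI: "m \<in> carrier M \<Longrightarrow> m' \<in> carrier M \<Longrightarrow> (\<And>x. cf m x = cf m' x) \<Longrightarrow> m = m'"
  using cf_sum[of m] cf_sum[of m'] by presburger

text \<open>Taking the degree n component of the expansion of m replaces each coordinate by its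
  component of degree \<open>n - bdeg M x\<close>. Since m is homogeneous, the result is again an
  expansion of m, and uniqueness of coordinates makes the two coincide.\<close>

lemma cf_graded:
  assumes m: "m \<in> mpart M n" and x: "x \<in> X"
  shows "cf m x \<in> rpart R (n - bdeg M x)"
proof -
  have mc: "m \<in> carrier M" using m mgr.D_carrier by blast
  let ?S = "{x. cf m x \<noteq> \<zero>\<^bsub>R\<^esub>}"
  let ?c = "\<lambda>x. if x \<in> X then rgr.cp (cf m x) (n - bdeg M x) else \<zero>\<^bsub>R\<^esub>"
  have S: "finite ?S" "?S \<subseteq> X" using cf_finite supp_subset mc by auto
  have c: "x \<in> carrier M" if "x \<in> ?S" for x using that S basis_carrier by blast
  have eq: "mgr.cp (cf m x \<odot>\<^bsub>M\<^esub> x) n = ?c x \<odot>\<^bsub>M\<^esub> x" if "x \<in> ?S" for x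
  proof -
    have xX: "x \<in> X" using that S by blast
    have *: "mgr.cp (a \<odot>\<^bsub>M\<^esub> x) n = rgr.cp a (n - bdeg M x) \<odot>\<^bsub>M\<^esub> x" if "a \<in> carrier R" for a
      using that
    proof (induction a rule: rgr.homog_induct)
      case zero then show ?case using c[OF \<open>x \<in> ?S\<close>] by simp
    next
      case (homog k a)
      have "a \<odot>\<^bsub>M\<^esub> x \<in> mpart M (k + bdeg M x)"
        by (rule mpart_smult[OF homog basis_mpart[OF xX]])
      then show ?case
        using c[OF \<open>x \<in> ?S\<close>] by (auto simp: mgr.cp_homog rgr.cp_homog[OF homog])
    next
      case (add a b)
      then show ?case
        using c[OF \<open>x \<in> ?S\<close>] by (simp add: lsmult_l_distr mgr.cp_add rgr.cp_add lsmult_closed)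
    qed
    show ?thesis using *[of "cf m x"] mc xX by simp
  qed
  have "m = mgr.cp (finsum M (\<lambda>x. cf m x \<odot>\<^bsub>M\<^esub> x) ?S) n"
    using cf_sum[OF mc] mgr.cp_homog[OF m, of n] by simp
  also have "\<dots> = finsum M (\<lambda>x. mgr.cp (cf m x \<odot>\<^bsub>M\<^esub> x) n) ?S"
    by (rule additive_finsum[OF M.abelian_group_axioms M.abelian_group_axioms _ _ S(1)])
      (use mc c in \<open>auto simp: mgr.cp_add lsmult_closed\<close>)
  also have "\<dots> = finsum M (\<lambda>x. ?c x \<odot>\<^bsub>M\<^esub> x) ?S"
    using mc c eq S by (intro M.add.finprod_cong') (auto simp: lsmult_closed)
  finally have "cf m = cf (finsum M (\<lambda>x. ?c x \<odot>\<^bsub>M\<^esub> x) ?S)" by simp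
  also have "\<dots> = ?c"
    using mc S by (intro cf_unique) auto
  finally have "cf m x = ?c x" by (rule fun_cong)
  then have "cf m x = rgr.cp (cf m x) (n - bdeg M x)" using x by simp
  then show ?thesis using rgr.cp_D[OF cf_closed[OF mc]] by metis
qed

context
  fixes U :: "('a, 'c) gmodule" and u :: "'b \<Rightarrow> 'c"
  assumes U: "graded_left_module R U" and u: "\<And>x. x \<in> X \<Longrightarrow> u x \<in> mpart U (bdeg M x)"
begin

interpretation U: graded_left_module R U by (rule U)

lemma lin_ext_superset:
  assumes "m \<in> carrier M" "finite S" "{x. cf m x \<noteq> \<zero>\<^bsub>R\<^esub>} \<subseteq> S" "S \<subseteq> X"
  shows "lin_ext R M X U u m = finsum U (\<lambda>x. cf m x \<odot>\<^bsub>U\<^esub> u x) S"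
  unfolding lin_ext_def
  by (rule lincomb_superset[OF U]) (use assms cf_outside U.mgr.D_carrier[OF u] in auto)

lemma lin_ext_basis: "x \<in> X \<Longrightarrow> lin_ext R M X U u x = u x"
  by (subst lin_ext_superset[of x "{x}"])
    (use U.mgr.D_carrier[OF u] in \<open>auto simp: basis_carrier cf_basis U.lsmult_one\<close>)

lemma lin_ext_hom: "lin_ext R M X U u \<in> gmod_hom R M U"
proof (rule gmod_homI)
  have uc: "u x \<in> carrier U" if "x \<in> X" for x using u[OF that] U.mgr.D_carrier by blast
  show "lin_ext R M X U u m \<in> carrier U" if "m \<in> carrier M" for m
    unfolding lin_ext_def using that uc supp_subset[OF that]
    by (intro U.finsum_closed) (auto simp: U.lsmult_closed subset_iff)
  show "lin_ext R M X U u (m \<oplus>\<^bsub>M\<^esub> m') = lin_ext R M X U u m \<oplus>\<^bsub>U\<^esub> lin_ext R M X U u m'"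
    if m: "m \<in> carrier M" and m': "m' \<in> carrier M" for m m'
  proof -
    let ?S = "{x. cf m x \<noteq> \<zero>\<^bsub>R\<^esub>} \<union> {x. cf m' x \<noteq> \<zero>\<^bsub>R\<^esub>}"
    have S: "finite ?S" "?S \<subseteq> X" using cf_finite supp_subset m m' by auto
    have c: "u x \<in> carrier U" if "x \<in> ?S" for x using that S uc by blast
    have "lin_ext R M X U u (m \<oplus>\<^bsub>M\<^esub> m') = finsum U (\<lambda>x. cf (m \<oplus>\<^bsub>M\<^esub> m') x \<odot>\<^bsub>U\<^esub> u x) ?S"
      by (rule lin_ext_superset[OF _ S(1) _ S(2)]) (use m m' cf_add in auto)
    also have "\<dots> = finsum U (\<lambda>x. cf m x \<odot>\<^bsub>U\<^esub> u x \<oplus>\<^bsub>U\<^esub> cf m' x \<odot>\<^bsub>U\<^esub> u x) ?S"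
      using m m' c by (intro U.M.add.finprod_cong') (auto simp: cf_add U.lsmult_l_distr U.lsmult_closed)
    also have "\<dots> = finsum U (\<lambda>x. cf m x \<odot>\<^bsub>U\<^esub> u x) ?S \<oplus>\<^bsub>U\<^esub> finsum U (\<lambda>x. cf m' x \<odot>\<^bsub>U\<^esub> u x) ?S"
      using m m' c by (intro U.M.finsum_addf) (auto simp: U.lsmult_closed)
    finally show ?thesis
      using lin_ext_superset[OF m S(1) _ S(2)] lin_ext_superset[OF m' S(1) _ S(2)] by simp
  qed
  show "lin_ext R M X U u (a \<odot>\<^bsub>M\<^esub> m) = a \<odot>\<^bsub>U\<^esub> lin_ext R M X U u m"
    if a: "a \<in> carrier R" and m: "m \<in> carrier M" for a m
  proof -
    let ?S = "{x. cf m x \<noteq> \<zero>\<^bsub>R\<^esub>}"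
    have S: "finite ?S" "?S \<subseteq> X" using cf_finite supp_subset m by auto
    have c: "u x \<in> carrier U" if "x \<in> ?S" for x using that S uc by blast
    have "lin_ext R M X U u (a \<odot>\<^bsub>M\<^esub> m) = finsum U (\<lambda>x. cf (a \<odot>\<^bsub>M\<^esub> m) x \<odot>\<^bsub>U\<^esub> u x) ?S"
      by (rule lin_ext_superset[OF _ S(1) _ S(2)]) (use m a cf_smult lsmult_closed in auto)
    also have "\<dots> = finsum U (\<lambda>x. a \<odot>\<^bsub>U\<^esub> (cf m x \<odot>\<^bsub>U\<^esub> u x)) ?S"
      using m a c by (intro U.M.add.finprod_cong') (auto simp: cf_smult U.lsmult_assoc U.lsmult_closed)
    also have "\<dots> = a \<odot>\<^bsub>U\<^esub> finsum U (\<lambda>x. cf m x \<odot>\<^bsub>U\<^esub> u x) ?S"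
      using m a c S by (intro U.finsum_lsmult[symmetric]) (auto simp: U.lsmult_closed)
    finally show ?thesis unfolding lin_ext_def .
  qed
  show "lin_ext R M X U u m \<in> mpart U n" if m: "m \<in> mpart M n" for m n
  proof -
    have mc: "m \<in> carrier M" using m mgr.D_carrier by blast
    have el: "cf m x \<odot>\<^bsub>U\<^esub> u x \<in> mpart U n" if "x \<in> X" for x
      using U.mpart_smult[OF cf_graded[OF m that] u[OF that]] by simp
    have "finsum U (\<lambda>x. cf m x \<odot>\<^bsub>U\<^esub> u x) S \<in> mpart U n" if "finite S" "S \<subseteq> X" for S
      using that
    proof (induction S rule: finite_induct)
      case (insert x S)
      have "cf m y \<odot>\<^bsub>U\<^esub> u y \<in> carrier U" if "y \<in> insert x S" for y
        using that insert el U.mgr.D_carrier by blast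
      then have "finsum U (\<lambda>x. cf m x \<odot>\<^bsub>U\<^esub> u x) (insert x S) =
          cf m x \<odot>\<^bsub>U\<^esub> u x \<oplus>\<^bsub>U\<^esub> finsum U (\<lambda>x. cf m x \<odot>\<^bsub>U\<^esub> u x) S"
        using insert by (intro U.M.finsum_insert) auto
      also have "\<dots> \<in> mpart U n"
        using insert el by (intro U.mgr.D_add) auto
      finally show ?case .
    qed simp
    from this[OF cf_finite[OF mc] supp_subset[OF mc]] show ?thesis unfolding lin_ext_def .
  qed
qed

end

lemma hom_eq_on_basis:
  assumes U: "graded_left_module R U" and h: "h \<in> gmod_hom R M U" "k \<in> gmod_hom R M U"
    and eq: "\<And>x. x \<in> X \<Longrightarrow> h x = k x" and m: "m \<in> carrier M"
  shows "h m = k m"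
proof -
  interpret U: graded_left_module R U by fact
  let ?S = "{x. cf m x \<noteq> \<zero>\<^bsub>R\<^esub>}"
  have S: "finite ?S" "?S \<subseteq> X" using cf_finite supp_subset m by auto
  have c: "x \<in> carrier M" if "x \<in> ?S" for x using that S basis_carrier by blast
  have *: "h m = finsum U (\<lambda>x. cf m x \<odot>\<^bsub>U\<^esub> h x) ?S" if h: "h \<in> gmod_hom R M U" for h
  proof -
    have "h m = finsum U (\<lambda>x. h (cf m x \<odot>\<^bsub>M\<^esub> x)) ?S"
      using gmod_hom_finsum[OF graded_left_module_axioms U h S(1), of "\<lambda>x. cf m x \<odot>\<^bsub>M\<^esub> x"]
        m c cf_sum[OF m] by (auto simp: lsmult_closed)
    also have "\<dots> = finsum U (\<lambda>x. cf m x \<odot>\<^bsub>U\<^esub> h x) ?S"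
      using m c gmod_homD[OF h] by (intro U.M.add.finprod_cong') (auto simp: U.lsmult_closed)
    finally show ?thesis .
  qed
  have "finsum U (\<lambda>x. cf m x \<odot>\<^bsub>U\<^esub> h x) ?S = finsum U (\<lambda>x. cf m x \<odot>\<^bsub>U\<^esub> k x) ?S"
    using m c gmod_homD(1)[OF h(1)] gmod_homD(1)[OF h(2)] eq S
    by (intro U.M.add.finprod_cong') (auto simp: U.lsmult_closed)
  then show ?thesis using *[OF h(1)] *[OF h(2)] by simp
qed

text \<open>A preimage of the image of a basis element need not be homogeneous, but its component in
  the degree of the basis element is still a preimage, because g preserves degrees. These components
  define the lift on the basis.\<close>

lemma lifting:
  assumes U: "graded_left_module R U" and V: "graded_left_module R V"
    and g: "g \<in> gmod_hom R U V" "g ` carrier U = carrier V" and h: "h \<in> gmod_hom R M V"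
  shows "\<exists>k\<in>gmod_hom R M U. \<forall>m\<in>carrier M. g (k m) = h m"
proof -
  interpret U: graded_left_module R U by fact
  interpret V: graded_left_module R V by fact
  have "\<exists>y\<in>mpart U (bdeg M x). g y = h x" if x: "x \<in> X" for x
  proof -
    have hx: "h x \<in> mpart V (bdeg M x)" using gmod_homD(4)[OF h basis_mpart[OF x]] .
    then obtain y where y: "y \<in> carrier U" "g y = h x" using g(2) V.mgr.D_carrier by (metis imageE)
    have "g (U.mgr.cp y (bdeg M x)) = h x"
      using gmod_hom_gcomp[OF U V g(1) y(1), of "bdeg M x"] V.mgr.cp_homog[OF hx, of "bdeg M x"] y(2) by simp
    then show ?thesis using U.mgr.cp_D[OF y(1)] by blast
  qed
  then obtain u where u: "\<And>x. x \<in> X \<Longrightarrow> u x \<in> mpart U (bdeg M x)" "\<And>x. x \<in> X \<Longrightarrow> g (u x) = h x"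
    by metis
  have hom: "lin_ext R M X U u \<in> gmod_hom R M U" by (rule lin_ext_hom[OF U u(1)])
  have "g (lin_ext R M X U u m) = h m" if "m \<in> carrier M" for m
    using hom_eq_on_basis[OF V gmod_hom_comp[OF hom g(1)] h _ that] lin_ext_basis[OF U u(1)] u(2) by simp
  then show ?thesis using hom by blast
qed

end

lemma graded_free_lifting:
  assumes "graded_free R L" "graded_left_module R U" "graded_left_module R V"
    and "g \<in> gmod_hom R U V" "g ` carrier U = carrier V" "h \<in> gmod_hom R L V"
  shows "\<exists>k\<in>gmod_hom R L U. \<forall>m\<in>carrier L. g (k m) = h m"
proof -
  obtain X where "graded_left_module R L" "graded_basis R L X" using assms(1) by (auto simp: graded_free_def)
  then interpret free_basis R L X by (simp add: free_basis_def free_basis_axioms_def)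
  show ?thesis by (rule lifting) fact+
qed

lemma graded_projective_lifting:
  assumes "graded_projective R P" "graded_left_module R U" "graded_left_module R V"
    and "g \<in> gmod_hom R U V" "g ` carrier U = carrier V" "h \<in> gmod_hom R P V"
  shows "\<exists>k\<in>gmod_hom R P U. \<forall>m\<in>carrier P. g (k m) = h m"
proof -
  obtain L :: "('a, 'b \<Rightarrow> 'a) gmodule" and i r where L: "graded_free R L"
    and i: "i \<in> gmod_hom R P L" and r: "r \<in> gmod_hom R L P" and ri: "\<forall>x\<in>carrier P. r (i x) = x"
    using assms(1) unfolding graded_projective_def by blast
  obtain k where "k \<in> gmod_hom R L U" "\<forall>m\<in>carrier L. g (k m) = h (r m)"
    using graded_free_lifting[OF L assms(2-5) gmod_hom_comp[OF r assms(6)]] by blast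
  then show ?thesis
    using gmod_hom_comp[OF i, of k U] gmod_homD(1)[OF i] ri by (intro bexI[of _ "\<lambda>x. k (i x)"]) auto
qed

text \<open>Linear functions dual to Y force the coefficients of an expansion, just as additive
  projections force the components in \<open>internal_direct_sumI\<close>.\<close>

lemma graded_basisI:
  assumes N: "graded_left_module R N" and Y: "Y \<subseteq> (\<Union>n. mpart N n)"
    and p: "\<And>m y. m \<in> carrier N \<Longrightarrow> p m y \<in> carrier R" "\<And>m y. m \<in> carrier N \<Longrightarrow> y \<notin> Y \<Longrightarrow> p m y = \<zero>\<^bsub>R\<^esub>"
      "\<And>m. m \<in> carrier N \<Longrightarrow> finite {y. p m y \<noteq> \<zero>\<^bsub>R\<^esub>}"
      "\<And>m. m \<in> carrier N \<Longrightarrow> finsum N (\<lambda>y. p m y \<odot>\<^bsub>N\<^esub> y) {y. p m y \<noteq> \<zero>\<^bsub>R\<^esub>} = m"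
    and padd: "\<And>m m' y. m \<in> carrier N \<Longrightarrow> m' \<in> carrier N \<Longrightarrow> y \<in> Y \<Longrightarrow> p (m \<oplus>\<^bsub>N\<^esub> m') y = p m y \<oplus>\<^bsub>R\<^esub> p m' y"
    and psm: "\<And>a m y. a \<in> carrier R \<Longrightarrow> m \<in> carrier N \<Longrightarrow> y \<in> Y \<Longrightarrow> p (a \<odot>\<^bsub>N\<^esub> m) y = a \<otimes>\<^bsub>R\<^esub> p m y"
    and pb: "\<And>y y'. y \<in> Y \<Longrightarrow> y' \<in> Y \<Longrightarrow> p y y' = (if y' = y then \<one>\<^bsub>R\<^esub> else \<zero>\<^bsub>R\<^esub>)"
  shows "graded_basis R N Y"
proof -
  interpret RR: graded_ring R by (rule glm_ring[OF N])
  interpret N: graded_left_module R N by fact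
  have Yc: "y \<in> carrier N" if "y \<in> Y" for y using that Y N.mgr.D_carrier by blast
  have uniq: "c = p m" if m: "m \<in> carrier N" and c: "\<forall>y. c y \<in> carrier R" "\<forall>y. y \<notin> Y \<longrightarrow> c y = \<zero>\<^bsub>R\<^esub>"
    "finite {y. c y \<noteq> \<zero>\<^bsub>R\<^esub>}" "m = finsum N (\<lambda>y. c y \<odot>\<^bsub>N\<^esub> y) {y. c y \<noteq> \<zero>\<^bsub>R\<^esub>}" for c m
  proof
    fix y
    show "c y = p m y"
    proof (cases "y \<in> Y")
      case True
      let ?S = "{y. c y \<noteq> \<zero>\<^bsub>R\<^esub>}"
      have S: "?S \<subseteq> Y" using c(2) by auto
      have "p m y = finsum R (\<lambda>z. p (c z \<odot>\<^bsub>N\<^esub> z) y) ?S"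
        unfolding c(4)
        by (rule additive_finsum[OF N.M.abelian_group_axioms RR.abelian_group_axioms, of "\<lambda>m. p m y"])
          (use p(1) padd True c S Yc in \<open>auto simp: N.lsmult_closed subset_iff\<close>)
      also have "\<dots> = finsum R (\<lambda>z. if y = z then c z else \<zero>\<^bsub>R\<^esub>) ?S"
        using S c Yc True by (intro RR.add.finprod_cong') (auto simp: psm pb subset_iff)
      also have "\<dots> = c y"
        using c by (cases "y \<in> ?S") (auto simp: RR.finsum_singleton intro!: RR.add.finprod_one_eqI)
      finally show ?thesis by simp
    qed (use c p(2)[OF m] in auto)
  qed
  show ?thesis
    unfolding graded_basis_def
    using Y p uniq by (intro conjI ballI ex1I[of _ "p _"]) auto
qed

lemma free_basisI: "graded_left_module R M \<Longrightarrow> graded_basis R M X \<Longrightarrow> free_basis R M X"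
  by (simp add: free_basis_def free_basis_axioms_def)

lemma graded_free_glm: "graded_free R M \<Longrightarrow> graded_left_module R M"
  by (auto simp: graded_free_def)

lemma graded_free_iso:
  assumes M: "graded_free R M" and N: "graded_left_module R N" and h: "h \<in> gmod_iso R M N"
  shows "graded_free R N"
proof -
  obtain X where X: "graded_left_module R M" "graded_basis R M X" using M by (auto simp: graded_free_def)
  interpret free_basis R M X using X by (rule free_basisI)
  interpret N: graded_left_module R N by fact
  define k where "k = inv_into (carrier M) h"
  have k: "k \<in> gmod_iso R N M" and kh: "\<And>x. x \<in> carrier M \<Longrightarrow> k (h x) = x"
    and hk: "\<And>y. y \<in> carrier N \<Longrightarrow> h (k y) = y"
    using gmod_iso_inverse[OF X(1) N h] unfolding k_def by auto
  note hD = gmod_homD[OF gmod_isoD(1)[OF h]] and kD = gmod_homD[OF gmod_isoD(1)[OF k]]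
  let ?p = "\<lambda>m y. if y \<in> h ` X then cf (k m) (k y) else \<zero>\<^bsub>R\<^esub>"
  have supp: "{y. ?p m y \<noteq> \<zero>\<^bsub>R\<^esub>} = h ` {x. cf (k m) x \<noteq> \<zero>\<^bsub>R\<^esub>}" if "m \<in> carrier N" for m
  proof -
    have "{y. ?p m y \<noteq> \<zero>\<^bsub>R\<^esub>} = {y \<in> h ` X. cf (k m) (k y) \<noteq> \<zero>\<^bsub>R\<^esub>}" by auto
    also have "\<dots> = h ` {x \<in> X. cf (k m) x \<noteq> \<zero>\<^bsub>R\<^esub>}" using kh basis_carrier by force
    also have "{x \<in> X. cf (k m) x \<noteq> \<zero>\<^bsub>R\<^esub>} = {x. cf (k m) x \<noteq> \<zero>\<^bsub>R\<^esub>}"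
      using supp_subset[OF kD(1)[OF that]] by blast
    finally show ?thesis .
  qed
  have "graded_basis R N (h ` X)"
  proof (rule graded_basisI[OF N, where p = ?p])
    show "h ` X \<subseteq> (\<Union>n. mpart N n)" using hD(4)[OF basis_mpart] by blast
    show "finite {y. ?p m y \<noteq> \<zero>\<^bsub>R\<^esub>}" if "m \<in> carrier N" for m
      unfolding supp[OF that] using cf_finite[OF kD(1)[OF that]] by simp
    show "finsum N (\<lambda>y. ?p m y \<odot>\<^bsub>N\<^esub> y) {y. ?p m y \<noteq> \<zero>\<^bsub>R\<^esub>} = m" if m: "m \<in> carrier N" for m
    proof -
      let ?S = "{x. cf (k m) x \<noteq> \<zero>\<^bsub>R\<^esub>}"
      note km = kD(1)[OF m]
      have c: "x \<in> carrier M" if "x \<in> ?S" for x using that supp_subset[OF km] basis_carrier by blast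
      have "finsum N (\<lambda>y. ?p m y \<odot>\<^bsub>N\<^esub> y) (h ` ?S) = finsum N (\<lambda>x. ?p m (h x) \<odot>\<^bsub>N\<^esub> h x) ?S"
      proof (rule N.finsum_reindex)
        show "inj_on h ?S" using gmod_isoD(3)[OF h] c by (auto simp: inj_on_def)
      qed (use km c in \<open>auto simp: hD N.lsmult_closed kh\<close>)
      also have "\<dots> = finsum N (\<lambda>x. h (cf (k m) x \<odot>\<^bsub>M\<^esub> x)) ?S"
        using km c supp_subset[OF km]
        by (intro N.M.add.finprod_cong') (auto simp: hD kh lsmult_closed N.lsmult_closed)
      also have "\<dots> = h (finsum M (\<lambda>x. cf (k m) x \<odot>\<^bsub>M\<^esub> x) ?S)"
        using km c cf_finite[OF km]
        by (intro gmod_hom_finsum[OF X(1) N gmod_isoD(1)[OF h], symmetric]) (auto simp: lsmult_closed)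
      finally show ?thesis unfolding supp[OF m] using hk[OF m] cf_sum[OF km] by simp
    qed
    show "?p y y' = (if y' = y then \<one>\<^bsub>R\<^esub> else \<zero>\<^bsub>R\<^esub>)" if "y \<in> h ` X" "y' \<in> h ` X" for y y'
      using that by (auto simp: kh basis_carrier cf_basis)
  qed (use kD hD in \<open>auto simp: cf_add cf_smult\<close>)
  then show ?thesis using N by (auto simp: graded_free_def)
qed

lemma graded_free_gshift:
  assumes "graded_free R M"
  shows "graded_free R (gshift n M)"
proof -
  obtain X where X: "graded_left_module R M" "graded_basis R M X" using assms by (auto simp: graded_free_def)
  have "X \<subseteq> (\<Union>i. mpart M (i + n))"
  proof
    fix x assume "x \<in> X"
    then obtain i where "x \<in> mpart M i" using X(2) by (auto simp: graded_basis_def)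
    then have "x \<in> mpart M (i - n + n)" by simp
    then show "x \<in> (\<Union>i. mpart M (i + n))" by blast
  qed
  then have "graded_basis R (gshift n M) X"
    using X(2) by (simp add: graded_basis_def finsum_ring_cong[of "gshift n M" M])
  then show ?thesis using glm_gshift[OF X(1)] by (auto simp: graded_free_def)
qed

text \<open>The same basis works. As a now acts through \<open>s a\<close>, the coordinates are the
  old ones moved by the inverse of s, and the degrees of the basis elements rise by e.\<close>

lemma graded_free_tw:
  assumes "graded_free R M" and s: "s \<in> ring_iso R R"
    and part: "\<And>n. s ` rpart R n = rpart R n"
  shows "graded_free R (tw s e M)"
proof -
  obtain X where X: "graded_left_module R M" "graded_basis R M X" using assms by (auto simp: graded_free_def)
  interpret RR: graded_ring R by (rule glm_ring[OF X(1)])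
  interpret free_basis R M X using X by (rule free_basisI)
  have sh: "s \<in> ring_hom R R" and bij: "bij_betw s (carrier R) (carrier R)"
    using s by (auto simp: ring_iso_def)
  define t where "t = inv_into (carrier R) s"
  have st: "s (t a) = a" and tc: "t a \<in> carrier R" if "a \<in> carrier R" for a
    using that bij by (simp_all add: t_def bij_betw_inv_into_right bij_betw_def inv_into_into)
  have ts: "t (s a) = a" if "a \<in> carrier R" for a
    using that bij by (simp add: t_def bij_betw_inv_into_left)
  have eqI: "a = b" if "s a = s b" "a \<in> carrier R" "b \<in> carrier R" for a b
    using that ts by metis
  have s0: "s \<zero>\<^bsub>R\<^esub> = \<zero>\<^bsub>R\<^esub>" and s1: "s \<one>\<^bsub>R\<^esub> = \<one>\<^bsub>R\<^esub>"
    using ring_hom_zero[OF sh RR.ring_axioms RR.ring_axioms] ring_hom_one[OF sh] by auto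
  have t0: "t a = \<zero>\<^bsub>R\<^esub> \<longleftrightarrow> a = \<zero>\<^bsub>R\<^esub>" if "a \<in> carrier R" for a
    using that s0 st ts RR.zero_closed by metis
  let ?N = "tw s e M"
  have N: "graded_left_module R ?N" by (rule glm_tw[OF X(1) sh]) (use part in blast)
  have fs: "finsum ?N = finsum M" by (rule finsum_ring_cong) auto
  have "graded_basis R ?N X"
  proof (rule graded_basisI[OF N, where p = "\<lambda>m x. t (cf m x)"])
    have "\<exists>n. x \<in> mpart M (n - e)" if "x \<in> X" for x
      using basis_mpart[OF that] by (intro exI[of _ "bdeg M x + e"]) simp
    then show "X \<subseteq> (\<Union>n. mpart ?N n)" by auto
    show "finsum ?N (\<lambda>x. t (cf m x) \<odot>\<^bsub>?N\<^esub> x) {x. t (cf m x) \<noteq> \<zero>\<^bsub>R\<^esub>} = m" if "m \<in> carrier ?N" for m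
      using that cf_sum[of m] by (simp add: fs st t0)
    show "t (cf (a \<odot>\<^bsub>?N\<^esub> m) x) = a \<otimes>\<^bsub>R\<^esub> t (cf m x)"
      if "a \<in> carrier R" "m \<in> carrier ?N" "x \<in> X" for a m x
      by (rule eqI)
        (use that in \<open>auto simp: st tc ring_hom_mult[OF sh] ring_hom_closed[OF sh] cf_smult lsmult_closed\<close>)
    show "t (cf (m \<oplus>\<^bsub>?N\<^esub> m') x) = t (cf m x) \<oplus>\<^bsub>R\<^esub> t (cf m' x)"
      if "m \<in> carrier ?N" "m' \<in> carrier ?N" "x \<in> X" for m m' x
      by (rule eqI) (use that in \<open>auto simp: st tc ring_hom_add[OF sh] cf_add\<close>)
    show "t (cf x y) = (if y = x then \<one>\<^bsub>R\<^esub> else \<zero>\<^bsub>R\<^esub>)" if "x \<in> X" "y \<in> X" for x y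
      by (rule eqI) (use that in \<open>auto simp: st tc s0 s1 cf_basis\<close>)
  qed (auto simp: tc t0 cf_finite cf_outside)
  then show ?thesis using N by (auto simp: graded_free_def)
qed

section \<open>Finitely generated free modules\<close>

text \<open>The j-th generator has degree \<open>\<delta> j\<close>. Padding with zeros, instead of
  restricting the index type, puts all ranks on one carrier type, as is needed for sequences of free
  modules and for the factorizations in the theorem.\<close>

definition Fr :: "'a gring \<Rightarrow> nat \<Rightarrow> (nat \<Rightarrow> int) \<Rightarrow> ('a, nat \<Rightarrow> 'a) gmodule" where
  "Fr R r \<delta> = \<lparr>carrier = {v. (\<forall>j<r. v j \<in> carrier R) \<and> (\<forall>j\<ge>r. v j = \<zero>\<^bsub>R\<^esub>)},
     monoid.mult = undefined, one = undefined, ring.zero = (\<lambda>_. \<zero>\<^bsub>R\<^esub>),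
     ring.add = (\<lambda>v w j. v j \<oplus>\<^bsub>R\<^esub> w j), smult = (\<lambda>a v j. a \<otimes>\<^bsub>R\<^esub> v j),
     mpart = (\<lambda>n. {v. (\<forall>j<r. v j \<in> rpart R (n - \<delta> j)) \<and> (\<forall>j\<ge>r. v j = \<zero>\<^bsub>R\<^esub>)})\<rparr>"

lemma Fr_simps [simp]:
  "carrier (Fr R r \<delta>) = {v. (\<forall>j<r. v j \<in> carrier R) \<and> (\<forall>j\<ge>r. v j = \<zero>\<^bsub>R\<^esub>)}"
  "\<zero>\<^bsub>Fr R r \<delta>\<^esub> = (\<lambda>_. \<zero>\<^bsub>R\<^esub>)" "v \<oplus>\<^bsub>Fr R r \<delta>\<^esub> w = (\<lambda>j. v j \<oplus>\<^bsub>R\<^esub> w j)"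
  "a \<odot>\<^bsub>Fr R r \<delta>\<^esub> v = (\<lambda>j. a \<otimes>\<^bsub>R\<^esub> v j)"
  "mpart (Fr R r \<delta>) n = {v. (\<forall>j<r. v j \<in> rpart R (n - \<delta> j)) \<and> (\<forall>j\<ge>r. v j = \<zero>\<^bsub>R\<^esub>)}"
  by (simp_all add: Fr_def)

lemma gshift_Fr: "gshift n (Fr R r \<delta>) = Fr R r (\<lambda>j. \<delta> j - n)"
  by (simp add: gshift_def Fr_def fun_eq_iff algebra_simps)

context graded_ring
begin

lemma Fr_carrier: "v \<in> carrier (Fr A r \<delta>) \<Longrightarrow> v j \<in> carrier A"
  by (cases "j < r") auto

lemma abelian_Fr: "abelian_group (Fr A r \<delta>)"
proof (rule abelian_groupI)
  show "\<exists>y\<in>carrier (Fr A r \<delta>). y \<oplus>\<^bsub>Fr A r \<delta>\<^esub> x = \<zero>\<^bsub>Fr A r \<delta>\<^esub>" if "x \<in> carrier (Fr A r \<delta>)" for x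
    using that Fr_carrier[OF that]
    by (intro bexI[of _ "\<lambda>j. \<ominus> x j"]) (auto simp: l_neg fun_eq_iff)
  show "x \<oplus>\<^bsub>Fr A r \<delta>\<^esub> y \<oplus>\<^bsub>Fr A r \<delta>\<^esub> z = x \<oplus>\<^bsub>Fr A r \<delta>\<^esub> (y \<oplus>\<^bsub>Fr A r \<delta>\<^esub> z)"
    if "x \<in> carrier (Fr A r \<delta>)" "y \<in> carrier (Fr A r \<delta>)" "z \<in> carrier (Fr A r \<delta>)" for x y z
    using that[THEN Fr_carrier] by (simp add: a_assoc)
  show "x \<oplus>\<^bsub>Fr A r \<delta>\<^esub> y = y \<oplus>\<^bsub>Fr A r \<delta>\<^esub> x"
    if "x \<in> carrier (Fr A r \<delta>)" "y \<in> carrier (Fr A r \<delta>)" for x y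
    using that[THEN Fr_carrier] by (simp add: a_comm)
  show "\<zero>\<^bsub>Fr A r \<delta>\<^esub> \<oplus>\<^bsub>Fr A r \<delta>\<^esub> x = x" if "x \<in> carrier (Fr A r \<delta>)" for x
    using Fr_carrier[OF that] by simp
qed auto

lemma Fr_finsum:
  assumes "finite S" "c \<in> S \<rightarrow> carrier (Fr A r \<delta>)"
  shows "finsum (Fr A r \<delta>) c S j = finsum A (\<lambda>s. c s j) S"
proof (rule additive_finsum[OF abelian_Fr abelian_group_axioms _ _ assms, of "\<lambda>v. v j"])
  show "(\<lambda>v. v j) \<in> carrier (Fr A r \<delta>) \<rightarrow> carrier A" using Fr_carrier by blast
qed simp

lemma Fr_uminus:
  assumes "v \<in> carrier (Fr A r \<delta>)"
  shows "\<ominus>\<^bsub>Fr A r \<delta>\<^esub> v = (\<lambda>j. \<ominus> v j)"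
proof -
  interpret F: abelian_group "Fr A r \<delta>" by (rule abelian_Fr)
  show ?thesis
  proof (rule F.minus_equality)
    show "(\<lambda>j. \<ominus> v j) \<oplus>\<^bsub>Fr A r \<delta>\<^esub> v = \<zero>\<^bsub>Fr A r \<delta>\<^esub>"
      using Fr_carrier[OF assms] by (simp add: l_neg)
    show "(\<lambda>j. \<ominus> v j) \<in> carrier (Fr A r \<delta>)" using assms by simp
  qed (rule assms)
qed

lemma glm_Fr: "graded_left_module A (Fr A r \<delta>)"
proof -
  let ?F = "Fr A r \<delta>"
  interpret F: abelian_group ?F by (rule abelian_Fr)
  let ?p = "\<lambda>v n j. if j < r then rgr.cp (v j) (n - \<delta> j) else \<zero>"
  have supp: "{n. ?p v n \<noteq> \<zero>\<^bsub>?F\<^esub>} = (\<Union>j<r. (\<lambda>m. m + \<delta> j) ` {m. rgr.cp (v j) m \<noteq> \<zero>})" for v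
  proof (rule Set.set_eqI)
    fix n
    have im: "n \<in> (\<lambda>m. m + d) ` T \<longleftrightarrow> n - d \<in> T" for d :: int and T
      by (auto simp: image_iff intro: bexI[of _ "n - d"])
    have "n \<in> {n. ?p v n \<noteq> \<zero>\<^bsub>?F\<^esub>} \<longleftrightarrow> (\<exists>j<r. rgr.cp (v j) (n - \<delta> j) \<noteq> \<zero>)"
      by (simp add: fun_eq_iff) blast
    then show "n \<in> {n. ?p v n \<noteq> \<zero>\<^bsub>?F\<^esub>} \<longleftrightarrow> n \<in> (\<Union>j<r. (\<lambda>m. m + \<delta> j) ` {m. rgr.cp (v j) m \<noteq> \<zero>})"
      by (simp add: im Bex_def)
  qed
  have fin: "finite {n. ?p v n \<noteq> \<zero>\<^bsub>?F\<^esub>}" if "v \<in> carrier ?F" for v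
    unfolding supp using Fr_carrier[OF that] by (auto intro!: finite_imageI rgr.cp_finite)
  have ids: "internal_direct_sum ?F (mpart ?F)"
  proof (rule internal_direct_sumI[where p = ?p, OF abelian_Fr])
    show "additive_subgroup (mpart ?F n) ?F" for n
    proof (rule additive_subgroupI')
      show sub: "mpart ?F n \<subseteq> carrier ?F" by (auto simp: rgr.D_carrier)
      show "\<ominus>\<^bsub>?F\<^esub> v \<in> mpart ?F n" if "v \<in> mpart ?F n" for v
        using that Fr_uminus[of v r \<delta>] sub by (auto simp: rgr.D_neg)
    qed (auto simp: rgr.D_add)
    show "finite {n. ?p v n \<noteq> \<zero>\<^bsub>?F\<^esub>}" if "v \<in> carrier ?F" for v using fin[OF that] .
    show "finsum ?F (?p v) {n. ?p v n \<noteq> \<zero>\<^bsub>?F\<^esub>} = v" if v: "v \<in> carrier ?F" for v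
    proof
      fix j
      let ?S = "{n. ?p v n \<noteq> \<zero>\<^bsub>?F\<^esub>}"
      have vc: "v j \<in> carrier A" for j using Fr_carrier[OF v] .
      have "finsum ?F (?p v) ?S j = finsum A (\<lambda>n. ?p v n j) ?S"
        using fin[OF v] vc by (intro Fr_finsum) auto
      also have "\<dots> = v j"
      proof (cases "j < r")
        case True
        have "finsum A (rgr.cp (v j)) ((\<lambda>n. n - \<delta> j) ` ?S) = finsum A (\<lambda>n. rgr.cp (v j) (n - \<delta> j)) ?S"
          by (rule finsum_reindex) (use vc in \<open>auto simp: inj_on_def\<close>)
        moreover have "finsum A (rgr.cp (v j)) ((\<lambda>n. n - \<delta> j) ` ?S) = v j"
        proof (rule rgr.cp_sum_superset[OF vc])
          show "finite ((\<lambda>n. n - \<delta> j) ` ?S)" using fin[OF v] by simp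
          show "{n. rgr.cp (v j) n \<noteq> \<zero>} \<subseteq> (\<lambda>n. n - \<delta> j) ` ?S"
            unfolding supp using True by (force simp: image_iff)
        qed
        ultimately show ?thesis using True by simp
      next
        case False
        then show ?thesis using v by (simp add: finsum_zero)
      qed
      finally show "finsum ?F (?p v) ?S j = v j" .
    qed
  qed (auto simp: fun_eq_iff rgr.cp_D rgr.cp_add rgr.cp_homog)
  show ?thesis
  proof (rule glmI[OF graded_ring_axioms abelian_Fr _ _ _ _ _ ids])
    show "a \<odot>\<^bsub>?F\<^esub> x \<in> mpart ?F (i + j)" if "a \<in> rpart A i" "x \<in> mpart ?F j" for a x i j
      using that rpart_mult[OF that(1)] by (auto simp: rgr.D_carrier add_diff_eq[symmetric])
    fix x assume x: "x \<in> carrier ?F"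
    note xc = Fr_carrier[OF x]
    show "a \<odot>\<^bsub>?F\<^esub> x \<in> carrier ?F" if "a \<in> carrier A" for a using x that by simp
    show "(a \<oplus> b) \<odot>\<^bsub>?F\<^esub> x = a \<odot>\<^bsub>?F\<^esub> x \<oplus>\<^bsub>?F\<^esub> b \<odot>\<^bsub>?F\<^esub> x"
      "(a \<otimes> b) \<odot>\<^bsub>?F\<^esub> x = a \<odot>\<^bsub>?F\<^esub> (b \<odot>\<^bsub>?F\<^esub> x)" if "a \<in> carrier A" "b \<in> carrier A" for a b
      using xc that by (simp_all add: l_distr m_assoc)
    show "\<one> \<odot>\<^bsub>?F\<^esub> x = x" using xc by simp
    show "a \<odot>\<^bsub>?F\<^esub> (x \<oplus>\<^bsub>?F\<^esub> y) = a \<odot>\<^bsub>?F\<^esub> x \<oplus>\<^bsub>?F\<^esub> a \<odot>\<^bsub>?F\<^esub> y"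
      if "a \<in> carrier A" "y \<in> carrier ?F" for a y
      using xc that(1) Fr_carrier[OF that(2)] by (simp add: r_distr)
  qed
qed

lemma gcomp_Fr:
  assumes v: "v \<in> carrier (Fr A r \<delta>)" and j: "j < r"
  shows "gcomp (Fr A r \<delta>) (mpart (Fr A r \<delta>)) v n j = rgr.cp (v j) (n - \<delta> j)"
proof -
  interpret F: graded_left_module A "Fr A r \<delta>" by (rule glm_Fr)
  have *: "F.mgr.cp v n j = rgr.cp (v j) (n - \<delta> j)" if "v \<in> mpart (Fr A r \<delta>) m" for m v
    using F.mgr.cp_homog[OF that, of n] that j by (auto simp: rgr.cp_homog)
  show ?thesis
    using v
  proof (induction v rule: F.mgr.homog_induct)
    case zero then show ?case by (subst F.mgr.cp_zero) simp
  next
    case (homog m v) then show ?case using * by blast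
  next
    case (add x y)
    then show ?case using Fr_carrier[OF add(1)] Fr_carrier[OF add(2)]
      by (subst F.mgr.cp_add) (simp_all add: rgr.cp_add del: Fr_simps(1,5))
  qed
qed

lemma Fr_lin_hom:
  assumes N: "graded_left_module A N" and x: "\<And>j. j < r \<Longrightarrow> x j \<in> mpart N (\<delta> j)"
  shows "(\<lambda>v. finsum N (\<lambda>j. v j \<odot>\<^bsub>N\<^esub> x j) {..<r}) \<in> gmod_hom A (Fr A r \<delta>) N"
proof -
  interpret N: graded_left_module A N by fact
  have xc: "x j \<in> carrier N" if "j < r" for j using x[OF that] N.mgr.D_carrier by blast
  show ?thesis
  proof (rule gmod_homI)
    fix v assume v: "v \<in> carrier (Fr A r \<delta>)"
    note vc = Fr_carrier[OF v]
    show "finsum N (\<lambda>j. v j \<odot>\<^bsub>N\<^esub> x j) {..<r} \<in> carrier N"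
      using vc xc by (intro N.M.finsum_closed) (auto simp: N.lsmult_closed)
    show "finsum N (\<lambda>j. (a \<odot>\<^bsub>Fr A r \<delta>\<^esub> v) j \<odot>\<^bsub>N\<^esub> x j) {..<r} = a \<odot>\<^bsub>N\<^esub> finsum N (\<lambda>j. v j \<odot>\<^bsub>N\<^esub> x j) {..<r}"
      if "a \<in> carrier A" for a
      using vc xc that
      by (subst N.finsum_lsmult) (auto simp: N.lsmult_closed N.lsmult_assoc intro!: N.M.add.finprod_cong')
    fix w assume w: "w \<in> carrier (Fr A r \<delta>)"
    note wc = Fr_carrier[OF w]
    show "finsum N (\<lambda>j. (v \<oplus>\<^bsub>Fr A r \<delta>\<^esub> w) j \<odot>\<^bsub>N\<^esub> x j) {..<r} =
        finsum N (\<lambda>j. v j \<odot>\<^bsub>N\<^esub> x j) {..<r} \<oplus>\<^bsub>N\<^esub> finsum N (\<lambda>j. w j \<odot>\<^bsub>N\<^esub> x j) {..<r}"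
    proof -
      have "finsum N (\<lambda>j. (v \<oplus>\<^bsub>Fr A r \<delta>\<^esub> w) j \<odot>\<^bsub>N\<^esub> x j) {..<r} =
          finsum N (\<lambda>j. v j \<odot>\<^bsub>N\<^esub> x j \<oplus>\<^bsub>N\<^esub> w j \<odot>\<^bsub>N\<^esub> x j) {..<r}"
        using vc wc xc by (intro N.M.add.finprod_cong') (auto simp: N.lsmult_closed N.lsmult_l_distr)
      also have "\<dots> = finsum N (\<lambda>j. v j \<odot>\<^bsub>N\<^esub> x j) {..<r} \<oplus>\<^bsub>N\<^esub> finsum N (\<lambda>j. w j \<odot>\<^bsub>N\<^esub> x j) {..<r}"
        using vc wc xc by (intro N.M.finsum_addf) (auto simp: N.lsmult_closed)
      finally show ?thesis .
    qed
  next
    fix v n assume v: "v \<in> mpart (Fr A r \<delta>) n"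
    have el: "v j \<odot>\<^bsub>N\<^esub> x j \<in> mpart N n" if "j < r" for j
      using N.mpart_smult[of "v j" "n - \<delta> j" "x j" "\<delta> j"] v x[OF that] that by simp
    have "finsum N (\<lambda>j. v j \<odot>\<^bsub>N\<^esub> x j) S \<in> mpart N n" if "finite S" "S \<subseteq> {..<r}" for S
      using that
    proof (induction S rule: finite_induct)
      case (insert i S)
      have "v j \<odot>\<^bsub>N\<^esub> x j \<in> carrier N" if "j \<in> insert i S" for j
        using that insert el N.mgr.D_carrier by blast
      then have "finsum N (\<lambda>j. v j \<odot>\<^bsub>N\<^esub> x j) (insert i S) =
          v i \<odot>\<^bsub>N\<^esub> x i \<oplus>\<^bsub>N\<^esub> finsum N (\<lambda>j. v j \<odot>\<^bsub>N\<^esub> x j) S"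
        using insert by (intro N.M.finsum_insert) auto
      also have "\<dots> \<in> mpart N n"
        using insert el by (intro N.mgr.D_add) auto
      finally show ?case .
    qed simp
    then show "finsum N (\<lambda>j. v j \<odot>\<^bsub>N\<^esub> x j) {..<r} \<in> mpart N n" by blast
  qed
qed

definition unit_vec :: "nat \<Rightarrow> nat \<Rightarrow> 'a" where
  "unit_vec j = (\<lambda>i. if i = j then \<one> else \<zero>)"

lemma unit_vec_mpart: "j < r \<Longrightarrow> unit_vec j \<in> mpart (Fr A r \<delta>) (\<delta> j)"
  by (auto simp: unit_vec_def rpart_one)

lemma unit_vec_carrier: "j < r \<Longrightarrow> unit_vec j \<in> carrier (Fr A r \<delta>)"
  by (auto simp: unit_vec_def)

lemma Fr_expand:
  assumes v: "v \<in> carrier (Fr A r \<delta>)"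
  shows "finsum (Fr A r \<delta>) (\<lambda>j. v j \<odot>\<^bsub>Fr A r \<delta>\<^esub> unit_vec j) {..<r} = v"
proof
  fix i
  note vc = Fr_carrier[OF v]
  have "finsum (Fr A r \<delta>) (\<lambda>j. v j \<odot>\<^bsub>Fr A r \<delta>\<^esub> unit_vec j) {..<r} i =
      finsum A (\<lambda>j. (v j \<odot>\<^bsub>Fr A r \<delta>\<^esub> unit_vec j) i) {..<r}"
    using vc by (intro Fr_finsum) (auto simp: unit_vec_def)
  also have "\<dots> = finsum A (\<lambda>j. if i = j then v j else \<zero>) {..<r}"
    using vc by (intro add.finprod_cong') (auto simp: unit_vec_def)
  also have "\<dots> = v i"
    using vc v by (cases "i < r") (auto simp: finsum_singleton intro!: add.finprod_one_eqI)
  finally show "finsum (Fr A r \<delta>) (\<lambda>j. v j \<odot>\<^bsub>Fr A r \<delta>\<^esub> unit_vec j) {..<r} i = v i" .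
qed

lemma graded_free_Fr:
  assumes nontriv: "\<one> \<noteq> \<zero>"
  shows "graded_free A (Fr A r \<delta>)"
proof -
  let ?F = "Fr A r \<delta>"
  interpret F: graded_left_module A ?F by (rule glm_Fr)
  \<comment> \<open>Distinctness of the unit vectors rests on
    \<open>\<one> \<noteq> \<zero>\<close>; it allows a coordinate to be indexed by the basis vector
    itself.\<close>
  have inj: "inj_on unit_vec {..<r}"
    using nontriv by (auto simp: inj_on_def unit_vec_def fun_eq_iff split: if_splits)
  let ?ix = "inv_into {..<r} unit_vec"
  have ix: "?ix (unit_vec j) = j" if "j < r" for j using inj that by simp
  let ?p = "\<lambda>v y. if y \<in> unit_vec ` {..<r} then v (?ix y) else \<zero>"
  have supp: "{y. ?p v y \<noteq> \<zero>} = unit_vec ` {j\<in>{..<r}. v j \<noteq> \<zero>}" for v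
  proof -
    have "{y. ?p v y \<noteq> \<zero>} = {y \<in> unit_vec ` {..<r}. v (?ix y) \<noteq> \<zero>}" by auto
    also have "\<dots> = unit_vec ` {j\<in>{..<r}. v j \<noteq> \<zero>}" using ix by force
    finally show ?thesis .
  qed
  have "graded_basis A ?F (unit_vec ` {..<r})"
  proof (rule graded_basisI[OF glm_Fr, where p = ?p])
    show "unit_vec ` {..<r} \<subseteq> (\<Union>n. mpart ?F n)" using unit_vec_mpart by blast
    show "finsum ?F (\<lambda>y. ?p v y \<odot>\<^bsub>?F\<^esub> y) {y. ?p v y \<noteq> \<zero>} = v" if v: "v \<in> carrier ?F" for v
    proof -
      note vc = Fr_carrier[OF v]
      let ?T = "{j\<in>{..<r}. v j \<noteq> \<zero>}"
      have "finsum ?F (\<lambda>y. ?p v y \<odot>\<^bsub>?F\<^esub> y) (unit_vec ` ?T) =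
          finsum ?F (\<lambda>j. ?p v (unit_vec j) \<odot>\<^bsub>?F\<^esub> unit_vec j) ?T"
      proof (rule F.finsum_reindex)
        show "inj_on unit_vec ?T" using inj by (auto simp: inj_on_def)
      qed (use vc unit_vec_carrier in \<open>auto simp: F.lsmult_closed simp del: Fr_simps intro!: F.lsmult_closed\<close>)
      also have "\<dots> = finsum ?F (\<lambda>j. v j \<odot>\<^bsub>?F\<^esub> unit_vec j) {..<r}"
        using vc unit_vec_carrier
        by (intro F.M.add.finprod_mono_neutral_cong_left)
          (auto simp: ix simp del: Fr_simps intro!: F.lsmult_closed F.lsmult_l_null)
      finally show ?thesis unfolding supp using Fr_expand[OF v] by simp
    qed
    show "?p y y' = (if y' = y then \<one> else \<zero>)" if "y \<in> unit_vec ` {..<r}" "y' \<in> unit_vec ` {..<r}" for y y'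
    proof -
      from that obtain i j where ij: "i < r" "j < r" "y = unit_vec i" "y' = unit_vec j" by auto
      then have "y' = y \<longleftrightarrow> j = i" using inj by (auto simp: inj_on_def)
      moreover have "?p y y' = unit_vec i j" using ij ix by simp
      ultimately show ?thesis by (simp add: unit_vec_def)
    qed
    show "?p v y \<in> carrier A" if "v \<in> carrier ?F" for v y using Fr_carrier[OF that] by auto
  qed (auto simp: ix supp simp del: Fr_simps(1))
  then show ?thesis using glm_Fr by (auto simp: graded_free_def)
qed

end

section \<open>The irrelevant ideal and Nakayama's lemma\<close>

locale pos_graded_ring = graded_ring R for R :: "'a gring" (structure) +
  assumes rpart_negative: "n < 0 \<Longrightarrow> rpart R n = {\<zero>}" and nontrivial: "\<one> \<noteq> \<zero>"
begin

lemma rpart_prod_neg: "a \<in> rpart R i \<Longrightarrow> i < 0 \<Longrightarrow> a = \<zero>"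
  using rpart_negative by auto

text \<open>Without negative degrees, only the product of the two degree 0 parts lands in degree 0.
  So taking the degree 0 part is a ring map, and its kernel is the irrelevant ideal
  (\<open>irrelevant_ideal_iff\<close>).\<close>

lemma cp_mult_0:
  assumes a: "a \<in> carrier R" and b: "b \<in> carrier R"
  shows "rgr.cp (a \<otimes> b) 0 = rgr.cp a 0 \<otimes> rgr.cp b 0"
  using a
proof (induction a rule: rgr.homog_induct)
  case zero then show ?case using b by simp
next
  case (add x y) then show ?case using b by (simp add: l_distr rgr.cp_add)
next
  case (homog i x)
  have xc: "x \<in> carrier R" using homog by (rule rgr.D_carrier)
  show ?case using b
  proof (induction b rule: rgr.homog_induct)
    case zero then show ?case using xc by simp
  next
    case (add y z) then show ?case using xc by (simp add: r_distr rgr.cp_add)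
  next
    case (homog j y)
    have yc: "y \<in> carrier R" using homog by (rule rgr.D_carrier)
    have xy: "x \<otimes> y \<in> rpart R (i + j)" using \<open>x \<in> rpart R i\<close> homog by (rule rpart_mult)
    show ?case
      using xc yc rpart_prod_neg[OF \<open>x \<in> rpart R i\<close>] rpart_prod_neg[OF homog]
      by (cases "i < 0 \<or> j < 0") (auto simp: rgr.cp_homog[OF xy] rgr.cp_homog[OF \<open>x \<in> rpart R i\<close>] rgr.cp_homog[OF homog])
  qed
qed

lemma irrelevant_ideal_iff:
  "a \<in> irrelevant_ideal R \<longleftrightarrow> a \<in> carrier R \<and> rgr.cp a 0 = \<zero>"
proof
  let ?U = "\<Union>n\<in>{0<..}. rpart R n"
  have Uc: "?U \<subseteq> carrier (add_monoid R)" by (auto simp: rgr.D_carrier)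
  have sub: "subgroup {a. a \<in> carrier R \<and> rgr.cp a 0 = \<zero>} (add_monoid R)"
  proof (rule group.subgroupI[OF a_group])
    fix x assume "x \<in> {a. a \<in> carrier R \<and> rgr.cp a 0 = \<zero>}"
    then have x: "x \<in> carrier R" "rgr.cp x 0 = \<zero>" by auto
    have "rgr.cp (\<ominus> x \<oplus> x) 0 = rgr.cp (\<ominus> x) 0 \<oplus> rgr.cp x 0" using x by (intro rgr.cp_add) auto
    then have "rgr.cp (\<ominus> x) 0 = \<zero>" using x by (simp add: l_neg)
    then show "inv\<^bsub>add_monoid R\<^esub> x \<in> {a. a \<in> carrier R \<and> rgr.cp a 0 = \<zero>}"
      using x by (simp flip: a_inv_def)
  qed (auto simp: rgr.cp_add intro: exI[of _ \<zero>])
  show "a \<in> carrier R \<and> rgr.cp a 0 = \<zero>" if "a \<in> irrelevant_ideal R"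
  proof -
    have "generate (add_monoid R) ?U \<subseteq> {a. a \<in> carrier R \<and> rgr.cp a 0 = \<zero>}"
      by (rule group.generate_subgroup_incl[OF a_group _ sub]) (auto simp: rgr.D_carrier rgr.cp_homog)
    then show ?thesis using that by (auto simp: irrelevant_ideal_def)
  qed
  show "a \<in> irrelevant_ideal R" if "a \<in> carrier R \<and> rgr.cp a 0 = \<zero>"
  proof -
    have sg: "subgroup (irrelevant_ideal R) (add_monoid R)"
      unfolding irrelevant_ideal_def by (rule group.generate_is_subgroup[OF a_group Uc])
    have cpi: "rgr.cp a n \<in> irrelevant_ideal R" for n
    proof -
      have "rgr.cp a n \<in> rpart R n" using that rgr.cp_D by blast
      moreover have "\<zero> \<in> irrelevant_ideal R" using subgroup.one_closed[OF sg] by simp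
      ultimately show ?thesis
        using that rpart_prod_neg[of "rgr.cp a n" n]
        by (cases n "0 :: int" rule: linorder_cases)
          (auto simp: irrelevant_ideal_def intro!: generate.incl)
    qed
    have "finsum R (rgr.cp a) S \<in> irrelevant_ideal R" if "finite S" for S
      using that
    proof (induction S rule: finite_induct)
      case empty then show ?case using subgroup.one_closed[OF sg] by simp
    next
      case (insert n S)
      then show ?case
        using cpi \<open>a \<in> carrier R \<and> _\<close> subgroup.m_closed[OF sg] by (subst finsum_insert) auto
    qed
    from this[OF rgr.cp_finite] that show ?thesis by (metis rgr.cp_sum)
  qed
qed

lemma irr_closed: "a \<in> irrelevant_ideal R \<Longrightarrow> a \<in> carrier R"
  by (simp add: irrelevant_ideal_iff)

lemma irr_zero [simp]: "\<zero> \<in> irrelevant_ideal R"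
  by (simp add: irrelevant_ideal_iff)

lemma irr_add: "a \<in> irrelevant_ideal R \<Longrightarrow> b \<in> irrelevant_ideal R \<Longrightarrow> a \<oplus> b \<in> irrelevant_ideal R"
  by (simp add: irrelevant_ideal_iff rgr.cp_add)

lemma irr_mult_l: "a \<in> irrelevant_ideal R \<Longrightarrow> b \<in> carrier R \<Longrightarrow> b \<otimes> a \<in> irrelevant_ideal R"
  by (simp add: irrelevant_ideal_iff cp_mult_0)

lemma irr_mult_r: "a \<in> irrelevant_ideal R \<Longrightarrow> b \<in> carrier R \<Longrightarrow> a \<otimes> b \<in> irrelevant_ideal R"
  by (simp add: irrelevant_ideal_iff cp_mult_0)

lemma irr_uminus: "a \<in> irrelevant_ideal R \<Longrightarrow> \<ominus> a \<in> irrelevant_ideal R"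
  using irr_mult_l[of a "\<ominus> \<one>"] irr_closed[of a] by (simp add: l_minus)

lemma irr_one: "\<one> \<notin> irrelevant_ideal R"
  using nontrivial by (simp add: irrelevant_ideal_iff rgr.cp_homog[OF rpart_one])

lemma irr_homog: "a \<in> rpart R n \<Longrightarrow> n > 0 \<Longrightarrow> a \<in> irrelevant_ideal R"
  by (simp add: irrelevant_ideal_iff rgr.D_carrier rgr.cp_homog)

lemma irr_induct [consumes 1, case_names zero homog add]:
  assumes a: "a \<in> irrelevant_ideal R" and z: "Q \<zero>"
    and hom: "\<And>n a. n > 0 \<Longrightarrow> a \<in> rpart R n \<Longrightarrow> Q a"
    and add: "\<And>a b. a \<in> carrier R \<Longrightarrow> b \<in> carrier R \<Longrightarrow> Q a \<Longrightarrow> Q b \<Longrightarrow> Q (a \<oplus> b)"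
  shows "Q a"
proof -
  have ac: "a \<in> carrier R" "rgr.cp a 0 = \<zero>" using a by (auto simp: irrelevant_ideal_iff)
  have Qc: "Q (rgr.cp a n)" for n
  proof -
    have "rgr.cp a n \<in> rpart R n" using ac rgr.cp_D by blast
    then consider "n > 0" "rgr.cp a n \<in> rpart R n" | "rgr.cp a n = \<zero>"
      using ac(2) rpart_prod_neg linorder_cases by metis
    then show ?thesis by cases (use hom z in auto)
  qed
  have "Q (finsum R (rgr.cp a) S)" if "finite S" for S
    using that
  proof (induction S rule: finite_induct)
    case empty then show ?case by (simp add: z)
  next
    case (insert n S)
    then show ?case using ac Qc by (subst finsum_insert) (auto intro!: add finsum_closed)
  qed
  from this[OF rgr.cp_finite[OF ac(1)]] show ?thesis unfolding rgr.cp_sum[OF ac(1)] .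
qed

end

text \<open>This is \<open>R_+ M\<close>, in exactly the words in which
  \<open>minimal_free_resolution\<close> expresses minimality.\<close>

definition irr_span :: "'a gring \<Rightarrow> ('a, 'b) gmodule \<Rightarrow> 'b set" where
  "irr_span R M = generate (add_monoid M) {a \<odot>\<^bsub>M\<^esub> x | a x. a \<in> irrelevant_ideal R \<and> x \<in> carrier M}"

text \<open>The finiteness condition behind Nakayama's lemma. It passes to submodules for trivial
  reasons, so it applies to kernels directly.\<close>

definition bounded_below :: "('a, 'b) gmodule \<Rightarrow> bool" where
  "bounded_below M \<longleftrightarrow> (\<exists>n0. \<forall>n<n0. mpart M n \<subseteq> {\<zero>\<^bsub>M\<^esub>})"

text \<open>Being tested against submodules of the ambient module, it makes sense for a subset, and
  for a B-module it means the same over A and over B (\<open>fgen_restr\<close>).\<close>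

definition fgen :: "'a gring \<Rightarrow> ('a, 'b) gmodule \<Rightarrow> 'b set \<Rightarrow> bool" where
  "fgen R M H \<longleftrightarrow> (\<exists>S. finite S \<and> S \<subseteq> H \<and> (\<forall>H'. submodule H' R M \<and> S \<subseteq> H' \<longrightarrow> H \<subseteq> H'))"

lemma fgenE:
  assumes "fgen R M H"
  obtains S where "finite S" "S \<subseteq> H" "\<And>H'. submodule H' R M \<Longrightarrow> S \<subseteq> H' \<Longrightarrow> H \<subseteq> H'"
proof -
  from assms obtain S where S: "finite S" "S \<subseteq> H" "\<forall>H'. submodule H' R M \<and> S \<subseteq> H' \<longrightarrow> H \<subseteq> H'"
    unfolding fgen_def by (elim exE conjE)
  then show thesis by (intro that[of S]) simp_all
qed

locale pos_graded_module = pos_graded_ring R + graded_left_module R M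
  for R :: "'a gring" (structure) and M :: "('a, 'b) gmodule" (structure)
begin

lemma irr_gens: "{a \<odot>\<^bsub>M\<^esub> x | a x. a \<in> irrelevant_ideal R \<and> x \<in> carrier M} \<subseteq> carrier (add_monoid M)"
  using irr_closed lsmult_closed by auto

lemma irr_span_subgroup: "subgroup (irr_span R M) (add_monoid M)"
  unfolding irr_span_def by (rule group.generate_is_subgroup[OF M.a_group irr_gens])

lemma irr_span_carrier: "x \<in> irr_span R M \<Longrightarrow> x \<in> carrier M"
  using subgroup.subset[OF irr_span_subgroup] by auto

lemma irr_span_zero [simp]: "\<zero>\<^bsub>M\<^esub> \<in> irr_span R M"
  using subgroup.one_closed[OF irr_span_subgroup] by simp

lemma irr_span_add: "x \<in> irr_span R M \<Longrightarrow> y \<in> irr_span R M \<Longrightarrow> x \<oplus>\<^bsub>M\<^esub> y \<in> irr_span R M"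
  using subgroup.m_closed[OF irr_span_subgroup] by simp

lemma irr_span_smult: "a \<in> irrelevant_ideal R \<Longrightarrow> x \<in> carrier M \<Longrightarrow> a \<odot>\<^bsub>M\<^esub> x \<in> irr_span R M"
  unfolding irr_span_def by (rule generate.incl) blast

lemma irr_span_finsum:
  assumes "finite S" "\<And>s. s \<in> S \<Longrightarrow> c s \<in> irr_span R M"
  shows "finsum M c S \<in> irr_span R M"
  using assms
proof (induction S rule: finite_induct)
  case (insert s S)
  then show ?case by (subst M.finsum_insert) (auto intro!: irr_span_add irr_span_carrier)
qed simp

lemma irr_span_induct [consumes 1, case_names zero smult add]:
  assumes x: "x \<in> irr_span R M" and z: "Q \<zero>\<^bsub>M\<^esub>"
    and sm: "\<And>a x. a \<in> irrelevant_ideal R \<Longrightarrow> x \<in> carrier M \<Longrightarrow> Q (a \<odot>\<^bsub>M\<^esub> x)"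
    and add: "\<And>x y. x \<in> irr_span R M \<Longrightarrow> y \<in> irr_span R M \<Longrightarrow> Q x \<Longrightarrow> Q y \<Longrightarrow> Q (x \<oplus>\<^bsub>M\<^esub> y)"
  shows "Q x"
  using x unfolding irr_span_def
proof (induction x rule: generate.induct)
  case (inv h)
  then obtain a y where ay: "h = a \<odot>\<^bsub>M\<^esub> y" "a \<in> irrelevant_ideal R" "y \<in> carrier M" by blast
  then have "inv\<^bsub>add_monoid M\<^esub> h = (\<ominus>\<^bsub>R\<^esub> a) \<odot>\<^bsub>M\<^esub> y"
    using irr_closed by (simp add: lsmult_l_minus flip: a_inv_def)
  then show ?case using sm irr_uminus ay by simp
qed (use z sm add in \<open>auto simp: irr_span_def\<close>)

lemma irr_span_homog_induct [consumes 1, case_names zero smult add]: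
  assumes x: "x \<in> irr_span R M" and z: "Q \<zero>\<^bsub>M\<^esub>"
    and sm: "\<And>a x i j. i > 0 \<Longrightarrow> a \<in> rpart R i \<Longrightarrow> x \<in> mpart M j \<Longrightarrow> Q (a \<odot>\<^bsub>M\<^esub> x)"
    and add: "\<And>x y. x \<in> carrier M \<Longrightarrow> y \<in> carrier M \<Longrightarrow> Q x \<Longrightarrow> Q y \<Longrightarrow> Q (x \<oplus>\<^bsub>M\<^esub> y)"
  shows "Q x"
  using x
proof (induction x rule: irr_span_induct)
  case zero then show ?case by (rule z)
next
  case (add x y) then show ?case using irr_span_carrier assms(4) by blast
next
  case (smult a x)
  from smult(1) show ?case
  proof (induction a rule: irr_induct)
    case zero then show ?case using z smult by simp
  next
    case (add a b)
    then show ?case using smult(2) by (simp add: lsmult_l_distr assms(4) lsmult_closed)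
  next
    case (homog n a)
    note a = homog
    have ac: "a \<in> carrier R" using a by (auto intro: rgr.D_carrier)
    from smult(2) show ?case
    proof (induction x rule: mgr.homog_induct)
      case zero then show ?case using z ac by simp
    next
      case (add x y)
      then show ?case using ac by (simp add: lsmult_r_distr assms(4) lsmult_closed)
    next
      case (homog j x) then show ?case using sm a by blast
    qed
  qed
qed

text \<open>If a has positive degree and \<open>a x\<close> has degree n, then x has degree below n
  and so lies in H. This is the inductive step of \<open>nakayama\<close>.\<close>

lemma gcomp_irr_span:
  assumes H: "submodule H R M" and low: "\<And>m. m < n \<Longrightarrow> mpart M m \<subseteq> H" and x: "x \<in> irr_span R M"
  shows "mgr.cp x n \<in> H"
  using x
proof (induction x rule: irr_span_homog_induct)
  case zero then show ?case using submoduleD(2)[OF H] by simp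
next
  case (smult a x i j)
  have "a \<odot>\<^bsub>M\<^esub> x \<in> mpart M (i + j)" using smult mpart_smult by blast
  moreover have "a \<odot>\<^bsub>M\<^esub> x \<in> H" if "n = i + j"
    using low[of j] smult that submoduleD(4)[OF H] rgr.D_carrier by auto
  ultimately show ?case using submoduleD(2)[OF H] by (auto simp: mgr.cp_homog)
next
  case (add x y) then show ?case using submoduleD(3)[OF H] by (simp add: mgr.cp_add)
qed

lemma nakayama:
  assumes bb: "bounded_below M" and H: "graded_submodule R M H"
    and gen: "\<And>y. y \<in> carrier M \<Longrightarrow> \<exists>h\<in>H. \<exists>z\<in>irr_span R M. y = h \<oplus>\<^bsub>M\<^esub> z"
  shows "H = carrier M"
proof -
  have sm: "submodule H R M" and gr: "\<And>x n. x \<in> H \<Longrightarrow> mgr.cp x n \<in> H"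
    using H by (auto simp: graded_submodule_def)
  obtain n0 where n0: "\<And>n. n < n0 \<Longrightarrow> mpart M n \<subseteq> {\<zero>\<^bsub>M\<^esub>}" using bb by (auto simp: bounded_below_def)
  have *: "mpart M n \<subseteq> H" for n
  \<comment> \<open>The summand 1 makes the measure positive from n0 on, so that it strictly drops
    on passing from such a degree to any smaller one.\<close>
  proof (induction "nat (n - n0 + 1)" arbitrary: n rule: less_induct)
    case less
    show ?case
    proof (cases "n < n0")
      case True then show ?thesis using n0 submoduleD(2)[OF sm] by blast
    next
      case False
      show ?thesis
      proof
        fix y assume y: "y \<in> mpart M n"
        obtain h z where hz: "h \<in> H" "z \<in> irr_span R M" "y = h \<oplus>\<^bsub>M\<^esub> z" using gen mgr.D_carrier[OF y] by blast
        have hc: "h \<in> carrier M" using hz submoduleD(1)[OF sm] by blast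
        have "y = mgr.cp h n \<oplus>\<^bsub>M\<^esub> mgr.cp z n"
          using mgr.cp_homog[OF y, of n] hz hc irr_span_carrier by (simp add: mgr.cp_add)
        moreover have "mgr.cp z n \<in> H"
        proof (rule gcomp_irr_span[OF sm _ hz(2)])
          fix m assume "m < n" then show "mpart M m \<subseteq> H"
            by (intro less) (use False in auto)
        qed
        ultimately show "y \<in> H" using gr[OF hz(1)] submoduleD(3)[OF sm] by metis
      qed
    qed
  qed
  have "x \<in> H" if "x \<in> carrier M" for x
    using that by (induction x rule: mgr.homog_induct) (use * submoduleD[OF sm] in auto)
  then show ?thesis using submoduleD(1)[OF sm] by blast
qed

lemma nakayama_zero:
  assumes bb: "bounded_below M" and gen: "carrier M \<subseteq> irr_span R M"
  shows "carrier M = {\<zero>\<^bsub>M\<^esub>}"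
proof -
  have "graded_submodule R M {\<zero>\<^bsub>M\<^esub>}"
    by (auto simp: graded_submodule_def intro!: submoduleI')
  from nakayama[OF bb this] show ?thesis
    using gen by (metis M.l_zero insertI1 subsetD)
qed

end

lemma irr_span_hom:
  assumes "pos_graded_module R M" "pos_graded_module R N" "h \<in> gmod_hom R M N" "x \<in> irr_span R M"
  shows "h x \<in> irr_span R N"
proof -
  interpret M: pos_graded_module R M by fact
  interpret N: pos_graded_module R N by fact
  note z = gmod_hom_zero[OF M.graded_left_module_axioms N.graded_left_module_axioms assms(3)]
  show ?thesis
    using assms(4)
    by (induction x rule: M.irr_span_induct)
      (auto simp: z gmod_homD[OF assms(3)] M.irr_closed M.irr_span_carrier N.irr_span_add N.irr_span_smult)
qed

lemma irr_span_hom_onto: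
  assumes "pos_graded_module R M" "pos_graded_module R N" "h \<in> gmod_hom R M N" "h ` carrier M = carrier N"
    "y \<in> irr_span R N"
  shows "\<exists>x\<in>irr_span R M. h x = y"
proof -
  interpret M: pos_graded_module R M by fact
  interpret N: pos_graded_module R N by fact
  note z = gmod_hom_zero[OF M.graded_left_module_axioms N.graded_left_module_axioms assms(3)]
  show ?thesis
    using assms(5)
  proof (induction y rule: N.irr_span_induct)
    case zero then show ?case using z M.irr_span_zero by blast
  next
    case (smult a x)
    then obtain w where "w \<in> carrier M" "h w = x" using assms(4) by (metis imageE)
    then show ?case using smult gmod_homD(3)[OF assms(3)] M.irr_span_smult M.irr_closed
      by (intro bexI[of _ "a \<odot>\<^bsub>M\<^esub> w"]) auto
  next
    case (add x y)
    then obtain v w where "v \<in> irr_span R M" "w \<in> irr_span R M" "h v = x" "h w = y" by blast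
    then show ?case using gmod_homD(2)[OF assms(3)] M.irr_span_carrier M.irr_span_add
      by (intro bexI[of _ "v \<oplus>\<^bsub>M\<^esub> w"]) auto
  qed
qed

lemma bounded_below_onto:
  assumes "graded_left_module R M" "graded_left_module R N" "h \<in> gmod_hom R M N"
    "h ` carrier M = carrier N" "bounded_below M"
  shows "bounded_below N"
proof -
  interpret M: graded_left_module R M by fact
  interpret N: graded_left_module R N by fact
  obtain n0 where n0: "\<And>n. n < n0 \<Longrightarrow> mpart M n \<subseteq> {\<zero>\<^bsub>M\<^esub>}" using assms(5) by (auto simp: bounded_below_def)
  have "y = \<zero>\<^bsub>N\<^esub>" if "n < n0" "y \<in> mpart N n" for n y
  proof -
    have "y \<in> h ` carrier M" unfolding assms(4) by (rule N.mgr.D_carrier[OF that(2)])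
    then obtain x where x: "x \<in> carrier M" "h x = y" by (rule imageE) simp
    have "N.mgr.cp y n = y" by (simp add: N.mgr.cp_homog[OF that(2)])
    moreover have "N.mgr.cp (h x) n = h (M.mgr.cp x n)" by (rule gmod_hom_gcomp[OF assms(1-3) x(1)])
    ultimately have "y = h (M.mgr.cp x n)" unfolding x(2) by metis
    moreover have "M.mgr.cp x n = \<zero>\<^bsub>M\<^esub>" using M.mgr.cp_D[OF x(1)] n0[OF that(1)] by blast
    ultimately show ?thesis using gmod_hom_zero[OF assms(1-3)] by simp
  qed
  then show ?thesis unfolding bounded_below_def by blast
qed

lemma bounded_below_gsub: "bounded_below M \<Longrightarrow> bounded_below (gsub M H)"
  by (auto simp: bounded_below_def)

lemma bounded_below_tw: "bounded_below M \<Longrightarrow> bounded_below (tw s e M)"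
  unfolding bounded_below_def
proof (erule exE)
  fix n0 assume "\<forall>n<n0. mpart M n \<subseteq> {\<zero>\<^bsub>M\<^esub>}"
  then show "\<exists>n0. \<forall>n<n0. mpart (tw s e M) n \<subseteq> {\<zero>\<^bsub>tw s e M\<^esub>}"
    by (intro exI[of _ "n0 + e"]) auto
qed

lemma (in pos_graded_ring) bounded_below_Fr: "bounded_below (Fr R r \<delta>)"
proof -
  \<comment> \<open>The extra 0 keeps the set nonempty when r = 0.\<close>
  have *: "v = (\<lambda>_. \<zero>)" if n: "n < Min (\<delta> ` {..<r} \<union> {0})" and v: "v \<in> mpart (Fr R r \<delta>) n" for n v
  proof
    fix j
    show "v j = \<zero>"
    proof (cases "j < r")
      case True
      have "Min (\<delta> ` {..<r} \<union> {0}) \<le> \<delta> j" using True by (intro Min_le) auto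
      then show ?thesis using True v n rpart_prod_neg[of "v j" "n - \<delta> j"] by auto
    qed (use v in auto)
  qed
  have "mpart (Fr R r \<delta>) n \<subseteq> {\<zero>\<^bsub>Fr R r \<delta>\<^esub>}" if "n < Min (\<delta> ` {..<r} \<union> {0})" for n
    using *[OF that] by (simp add: subset_iff del: Fr_simps(5))
  then show ?thesis unfolding bounded_below_def by blast
qed

section \<open>Noetherian rings and freeness of projective modules\<close>

lemma reg_module_simps [simp]:
  "carrier (reg_module R) = carrier R" "ring.add (reg_module R) = ring.add R"
  "\<zero>\<^bsub>reg_module R\<^esub> = \<zero>\<^bsub>R\<^esub>" "smult (reg_module R) = monoid.mult R" "mpart (reg_module R) = rpart R"
  by (simp_all add: reg_module_def)

text \<open>The regular module is the free module of rank one read at coordinate 0, so its structure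
  is pushed forward from \<open>Fr\<close>.\<close>

lemma (in graded_ring) glm_reg_module: "graded_left_module A (reg_module A)"
proof (rule glm_pushforward(1)[OF glm_Fr[of 1 "\<lambda>_. 0"], where h = "\<lambda>v. v 0"])
  let ?F = "Fr A 1 (\<lambda>_. 0)"
  have *: "(\<lambda>i. if i = 0 then a else \<zero>) \<in> carrier ?F" if "a \<in> carrier A" for a using that by simp
  show "carrier (reg_module A) = (\<lambda>v. v 0) ` carrier ?F"
  proof
    show "carrier (reg_module A) \<subseteq> (\<lambda>v. v 0) ` carrier ?F"
      by (rule subsetI, rule image_eqI[OF _ *]) auto
  qed auto
  have **: "(\<lambda>i. if i = 0 then a else \<zero>) \<in> mpart ?F n" if "a \<in> rpart A n" for a n using that by simp
  show "mpart (reg_module A) n = (\<lambda>v. v 0) ` mpart ?F n" for n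
  proof
    show "mpart (reg_module A) n \<subseteq> (\<lambda>v. v 0) ` mpart ?F n"
      by (rule subsetI, rule image_eqI[OF _ **]) auto
  qed auto
  show "gcomp ?F (mpart ?F) x n 0 = gcomp ?F (mpart ?F) y n 0"
    if "x \<in> carrier ?F" "y \<in> carrier ?F" "x 0 = y 0" for x y n
    using that(3) gcomp_Fr[OF that(1), of 0 n] gcomp_Fr[OF that(2), of 0 n] by simp
qed auto

text \<open>Induction on the rank. The last coordinates of H form a left ideal, which has finitely
  many generators; lifts of these to H, together with generators of the part of H with vanishing
  last coordinate, generate H. That part is a submodule of \<open>Fr A r \<delta>\<close> because
  vectors are padded with zeros.\<close>

lemma (in graded_ring) Fr_noetherian:
  assumes noeth: "left_noetherian A"
  shows "submodule H A (Fr A r \<delta>) \<Longrightarrow> fgen A (Fr A r \<delta>) H"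
proof (induction r arbitrary: H)
  case 0
  have "H \<subseteq> {\<lambda>_. \<zero>}" using submoduleD(1)[OF 0] by auto
  then have "H \<subseteq> H'" if "submodule H' A (Fr A 0 \<delta>)" for H' using submoduleD(2)[OF that] by auto
  then show ?case unfolding fgen_def by (intro exI[of _ "{}"]) auto
next
  case (Suc r)
  let ?F = "Fr A (Suc r) \<delta>" and ?E = "Fr A r \<delta>"
  interpret F: graded_left_module A ?F by (rule glm_Fr)
  interpret E: graded_left_module A ?E by (rule glm_Fr)
  interpret G: graded_left_module A "reg_module A" by (rule glm_reg_module)
  have H: "submodule H A ?F" by fact
  note HD = submoduleD[OF H]
  have sub_I: "submodule ((\<lambda>v. v r) ` G) A (reg_module A)" if "submodule G A ?F" for G
  proof (rule G.submoduleI')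
    note GD = submoduleD[OF that]
    show "(\<lambda>v. v r) ` G \<subseteq> carrier (reg_module A)" using GD(1) Fr_carrier by (simp del: Fr_simps) blast
    show "\<zero>\<^bsub>reg_module A\<^esub> \<in> (\<lambda>v. v r) ` G" using GD(2) by force
    show "a \<oplus>\<^bsub>reg_module A\<^esub> b \<in> (\<lambda>v. v r) ` G" if "a \<in> (\<lambda>v. v r) ` G" "b \<in> (\<lambda>v. v r) ` G" for a b
      using that GD(3) by (force simp: image_iff)
    show "a \<odot>\<^bsub>reg_module A\<^esub> b \<in> (\<lambda>v. v r) ` G" if "a \<in> carrier A" "b \<in> (\<lambda>v. v r) ` G" for a b
      using that GD(4) by (force simp: image_iff)
  qed
  from noeth[unfolded left_noetherian_def, rule_format, OF sub_I[OF H]]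
  obtain T where T: "finite T" "T \<subseteq> (\<lambda>v. v r) ` H"
    "(\<lambda>v. v r) ` H = (\<lambda>I. submodule I A (reg_module A)) hull T"
    by (elim exE conjE)
  define t where "t = inv_into H (\<lambda>v. v r)"
  have t: "t a \<in> H \<and> t a r = a" if "a \<in> T" for a
    using inv_into_into[of a "\<lambda>v. v r" H] f_inv_into_f[of a "\<lambda>v. v r" H] subsetD[OF T(2) that]
    unfolding t_def by simp
  let ?H0 = "{v \<in> H. v r = \<zero>}"
  have H0E: "submodule (G \<inter> {v. v r = \<zero>}) A ?E" if "submodule G A ?F" for G
  proof (rule E.submoduleI')
    note GD = submoduleD[OF that]
    show "G \<inter> {v. v r = \<zero>} \<subseteq> carrier ?E" 
    proof
      fix v assume v: "v \<in> G \<inter> {v. v r = \<zero>}"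
      then have "v \<in> carrier ?F" using GD(1) by blast
      moreover have "v j = \<zero>" if "j \<ge> r" for j
        using that v calculation by (cases "j = r") auto
      ultimately show "v \<in> carrier ?E" by simp
    qed
    show "\<zero>\<^bsub>?E\<^esub> \<in> G \<inter> {v. v r = \<zero>}" using GD(2) by simp
    show "a \<oplus>\<^bsub>?E\<^esub> b \<in> G \<inter> {v. v r = \<zero>}" if "a \<in> G \<inter> {v. v r = \<zero>}" "b \<in> G \<inter> {v. v r = \<zero>}" for a b
      using GD(3)[of a b] that by simp
    show "a \<odot>\<^bsub>?E\<^esub> b \<in> G \<inter> {v. v r = \<zero>}" if "a \<in> carrier A" "b \<in> G \<inter> {v. v r = \<zero>}" for a b
      using GD(4)[of a b] that by simp
  qed
  have "?H0 = H \<inter> {v. v r = \<zero>}" by blast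
  then have "submodule ?H0 A ?E" using H0E[OF H] by simp
  from Suc.IH[OF this] obtain S where S: "finite S" "S \<subseteq> ?H0"
    "\<And>H'. submodule H' A ?E \<Longrightarrow> S \<subseteq> H' \<Longrightarrow> ?H0 \<subseteq> H'" by (rule fgenE) (rule that)
  show ?case
    unfolding fgen_def
  proof (intro exI conjI allI impI)
    show "finite (S \<union> t ` T)" using S T by simp
    show "S \<union> t ` T \<subseteq> H" using S t by auto
    fix H' assume "submodule H' A ?F \<and> S \<union> t ` T \<subseteq> H'"
    then have H': "submodule H' A ?F" and S': "S \<subseteq> H'" and t': "t ` T \<subseteq> H'" by auto
    note H'D = submoduleD[OF H']
    \<comment> \<open>An element w with the same last coordinate as v has to be found in H as well
      as in H'; only then does the difference of v and w lie in the part of H that S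
      generates.\<close>
    have HH: "submodule (H \<inter> H') A ?F"
      by (rule F.submoduleI') (use HD H'D in auto)
    have sub0: "?H0 \<subseteq> H'"
      using S(3)[OF H0E[OF H']] S' S(2) by auto
    have "T \<subseteq> (\<lambda>v. v r) ` (H \<inter> H')"
    proof
      fix a assume a: "a \<in> T"
      have "t a \<in> H \<inter> H'" using t[OF a] subsetD[OF t' imageI[OF a]] by blast
      then show "a \<in> (\<lambda>v. v r) ` (H \<inter> H')" using t[OF a] by (intro image_eqI[of _ _ "t a"]) simp_all
    qed
    then have sub1: "(\<lambda>v. v r) ` H \<subseteq> (\<lambda>v. v r) ` (H \<inter> H')"
      unfolding T(3) using sub_I[OF HH] by (auto simp: hull_def)
    show "H \<subseteq> H'"
    proof
      fix v assume v: "v \<in> H"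
      have "v r \<in> (\<lambda>v. v r) ` (H \<inter> H')" by (rule subsetD[OF sub1]) (rule imageI[OF v])
      then obtain w where w: "w \<in> H" "w \<in> H'" "w r = v r" by (elim imageE IntE) simp
      have c: "v \<in> carrier ?F" "w \<in> carrier ?F" using v w HD(1) by auto
      have "v \<ominus>\<^bsub>?F\<^esub> w \<in> H" using v w HD(3,5) by (simp add: a_minus_def del: Fr_simps)
      moreover have "(v \<ominus>\<^bsub>?F\<^esub> w) r = \<zero>"
        using w Fr_uminus[OF c(2)] Fr_carrier[OF c(1), of r] by (simp add: a_minus_def r_neg)
      ultimately have "v \<ominus>\<^bsub>?F\<^esub> w \<in> H'" using sub0 by blast
      then have "v \<ominus>\<^bsub>?F\<^esub> w \<oplus>\<^bsub>?F\<^esub> w \<in> H'" using w H'D(3) by blast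
      moreover have "v \<ominus>\<^bsub>?F\<^esub> w \<oplus>\<^bsub>?F\<^esub> w = v"
        using c by (simp add: a_minus_def F.M.a_assoc F.M.l_neg del: Fr_simps)
      ultimately show "v \<in> H'" by simp
    qed
  qed
qed

lemma fgen_homogeneous:
  assumes M: "graded_left_module R M" and H: "graded_submodule R M H" and fg: "fgen R M H"
  shows "\<exists>S. finite S \<and> S \<subseteq> H \<and> S \<subseteq> (\<Union>n. mpart M n) \<and> (\<forall>H'. submodule H' R M \<and> S \<subseteq> H' \<longrightarrow> H \<subseteq> H')"
proof -
  interpret M: graded_left_module R M by fact
  have sm: "submodule H R M" and gr: "\<And>x n. x \<in> H \<Longrightarrow> M.mgr.cp x n \<in> H"
    using H by (auto simp: graded_submodule_def)
  obtain S where S: "finite S" "S \<subseteq> H" "\<And>H'. submodule H' R M \<Longrightarrow> S \<subseteq> H' \<Longrightarrow> H \<subseteq> H'"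
    by (rule fgenE[OF fg]) (rule that)
  let ?T = "\<Union>s\<in>S. M.mgr.cp s ` {n. M.mgr.cp s n \<noteq> \<zero>\<^bsub>M\<^esub>}"
  have Sc: "s \<in> carrier M" if "s \<in> S" for s using that S submoduleD(1)[OF sm] by blast
  show ?thesis
  proof (intro exI conjI allI impI)
    show "finite ?T" using S(1) Sc M.mgr.cp_finite by auto
    show "?T \<subseteq> H" using gr S by auto
    show "?T \<subseteq> (\<Union>n. mpart M n)" using Sc M.mgr.cp_D by blast
    fix H' assume H': "submodule H' R M \<and> ?T \<subseteq> H'"
    then have smH: "submodule H' R M" by simp
    have "s \<in> H'" if s: "s \<in> S" for s
    proof -
      have "finsum M (M.mgr.cp s) U \<in> H'" if "finite U" "U \<subseteq> {n. M.mgr.cp s n \<noteq> \<zero>\<^bsub>M\<^esub>}" for U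
        using that
      proof (induction U rule: finite_induct)
        case empty then show ?case using submoduleD(2)[OF smH] by simp
      next
        case (insert n U)
        have "M.mgr.cp s n \<in> H'" using H' s insert(4) by blast
        then show ?case using insert Sc[OF s] submoduleD(3)[OF smH]
          by (subst M.M.finsum_insert) auto
      qed
      from this[OF M.mgr.cp_finite[OF Sc[OF s]]] show ?thesis unfolding M.mgr.cp_sum[OF Sc[OF s]] by simp
    qed
    then show "H \<subseteq> H'" using S(3)[OF smH] by blast
  qed
qed

lemma (in left_module) submodule_finsum:
  assumes "submodule H R M" "finite S" "\<And>s. s \<in> S \<Longrightarrow> c s \<in> H"
  shows "finsum M c S \<in> H"
  using assms(2,3)
proof (induction S rule: finite_induct)
  case empty then show ?case using submoduleD(2)[OF assms(1)] by simp
next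
  case (insert s S)
  then show ?case using submoduleD(1,3)[OF assms(1)] by (subst M.finsum_insert) auto
qed

lemma gmod_hom_inj:
  assumes M: "graded_left_module R M" and N: "graded_left_module R N" and h: "h \<in> gmod_hom R M N"
    and ker: "\<And>x. x \<in> carrier M \<Longrightarrow> h x = \<zero>\<^bsub>N\<^esub> \<Longrightarrow> x = \<zero>\<^bsub>M\<^esub>"
  shows "inj_on h (carrier M)"
proof (rule inj_onI)
  interpret M: graded_left_module R M by (rule M)
  interpret N: graded_left_module R N by (rule N)
  fix x y assume xy: "x \<in> carrier M" "y \<in> carrier M" "h x = h y"
  have "h (x \<ominus>\<^bsub>M\<^esub> y) = h x \<oplus>\<^bsub>N\<^esub> \<ominus>\<^bsub>N\<^esub> h y"
    using xy gmod_homD(2)[OF h] gmod_hom_minus[OF M N h] by (simp add: a_minus_def)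
  also have "\<dots> = \<zero>\<^bsub>N\<^esub>" using xy gmod_homD(1)[OF h] by (simp add: N.M.r_neg)
  finally have "x \<ominus>\<^bsub>M\<^esub> y = \<zero>\<^bsub>M\<^esub>" using ker xy by simp
  then show "x = y" using xy by (metis M.M.add.inv_closed M.M.minus_equality M.M.minus_minus a_minus_def)
qed

lemma gmod_hom_eq_diff:
  assumes M: "graded_left_module R M" and N: "graded_left_module R N" and h: "h \<in> gmod_hom R M N"
    and xy: "x \<in> carrier M" "y \<in> carrier M"
  shows "h (x \<ominus>\<^bsub>M\<^esub> y) = h x \<ominus>\<^bsub>N\<^esub> h y"
proof -
  interpret M: graded_left_module R M by (rule M)
  show ?thesis using xy gmod_homD(2)[OF h] gmod_hom_minus[OF M N h] by (simp add: a_minus_def)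
qed

lemma factor_through_injection:
  assumes U: "graded_left_module R U" and V: "graded_left_module R V" and P: "graded_left_module R P"
    and j: "j \<in> gmod_hom R V P" "inj_on j (carrier V)" and h: "h \<in> gmod_hom R U P"
    and im: "\<And>x. x \<in> carrier U \<Longrightarrow> h x \<in> j ` carrier V"
  shows "\<exists>k\<in>gmod_hom R U V. \<forall>x\<in>carrier U. j (k x) = h x"
proof -
  interpret U: graded_left_module R U by (rule U)
  interpret V: graded_left_module R V by (rule V)
  interpret P: graded_left_module R P by (rule P)
  define k where "k x = inv_into (carrier V) j (h x)" for x
  have kc: "k x \<in> carrier V" and jk: "j (k x) = h x" if "x \<in> carrier U" for x
    using im[OF that] by (simp_all add: k_def inv_into_into f_inv_into_f)
  have eqI: "v = w" if "j v = j w" "v \<in> carrier V" "w \<in> carrier V" for v w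
    using that j(2) by (auto dest: inj_onD)
  have "k \<in> gmod_hom R U V"
  proof (rule gmod_homI)
    show "k (x \<oplus>\<^bsub>U\<^esub> y) = k x \<oplus>\<^bsub>V\<^esub> k y" if "x \<in> carrier U" "y \<in> carrier U" for x y
      by (rule eqI) (use that in \<open>simp_all add: kc jk gmod_homD[OF j(1)] gmod_homD[OF h]\<close>)
    show "k (a \<odot>\<^bsub>U\<^esub> x) = a \<odot>\<^bsub>V\<^esub> k x" if "a \<in> carrier R" "x \<in> carrier U" for a x
      by (rule eqI) (use that in \<open>simp_all add: kc jk gmod_homD[OF j(1)] gmod_homD[OF h] U.lsmult_closed V.lsmult_closed\<close>)
    show "k x \<in> mpart V n" if "x \<in> mpart U n" for x n
    proof -
      have x: "x \<in> carrier U" using that U.mgr.D_carrier by blast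
      have "j (V.mgr.cp (k x) n) = P.mgr.cp (j (k x)) n"
        by (rule gmod_hom_gcomp[OF V P j(1) kc[OF x], symmetric])
      also have "\<dots> = j (k x)"
        unfolding jk[OF x] using P.mgr.cp_homog[OF gmod_homD(4)[OF h that], of n] by simp
      finally have "V.mgr.cp (k x) n = k x" using kc[OF x] by (intro eqI) auto
      then show ?thesis using V.mgr.cp_D[OF kc[OF x], of n] by simp
    qed
  qed (rule kc)
  then show ?thesis using jk by blast
qed

text \<open>Two preimages under q differ by an element of its kernel, so the value does not depend
  on the preimage. Degrees are preserved because the component of a preimage of a homogeneous
  element, taken in the degree of that element, is still a preimage.\<close>

lemma factor_through_surjection:
  assumes G: "graded_left_module R G" and N: "graded_left_module R N" and U: "graded_left_module R U"
    and q: "q \<in> gmod_hom R G N" "q ` carrier G = carrier N" and h: "h \<in> gmod_hom R G U"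
    and ker: "\<And>x. x \<in> carrier G \<Longrightarrow> q x = \<zero>\<^bsub>N\<^esub> \<Longrightarrow> h x = \<zero>\<^bsub>U\<^esub>"
  shows "\<exists>k\<in>gmod_hom R N U. \<forall>x\<in>carrier G. k (q x) = h x"
proof -
  interpret G: graded_left_module R G by (rule G)
  interpret N: graded_left_module R N by (rule N)
  interpret U: graded_left_module R U by (rule U)
  define k where "k y = h (inv_into (carrier G) q y)" for y
  have kq: "k (q x) = h x" if x: "x \<in> carrier G" for x
  proof -
    let ?z = "inv_into (carrier G) q (q x)"
    have z: "?z \<in> carrier G" "q ?z = q x" using x by (auto intro: inv_into_into f_inv_into_f)
    have "q (?z \<ominus>\<^bsub>G\<^esub> x) = \<zero>\<^bsub>N\<^esub>"
      using z x gmod_hom_eq_diff[OF G N q(1) z(1) x] gmod_homD(1)[OF q(1) x]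
      by (simp add: a_minus_def N.M.r_neg)
    then have "h (?z \<ominus>\<^bsub>G\<^esub> x) = \<zero>\<^bsub>U\<^esub>" using ker z x by simp
    then have "h ?z \<ominus>\<^bsub>U\<^esub> h x = \<zero>\<^bsub>U\<^esub>" using gmod_hom_eq_diff[OF G U h z(1) x] by simp
    then show ?thesis
      using gmod_homD(1)[OF h z(1)] gmod_homD(1)[OF h x] unfolding k_def
      by (metis U.M.add.inv_closed U.M.minus_equality U.M.minus_minus a_minus_def)
  qed
  have ex: "\<exists>x\<in>carrier G. q x = y" if "y \<in> carrier N" for y
    using that q(2) by (metis imageE)
  have "k \<in> gmod_hom R N U"
  proof (rule gmod_homI)
    show "k y \<in> carrier U" if "y \<in> carrier N" for y
      using ex[OF that] kq gmod_homD(1)[OF h] by auto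
    show "k (y \<oplus>\<^bsub>N\<^esub> y') = k y \<oplus>\<^bsub>U\<^esub> k y'" if y: "y \<in> carrier N" "y' \<in> carrier N" for y y'
      using ex[OF y(1)] ex[OF y(2)] kq gmod_homD(2)[OF h] gmod_homD(2)[OF q(1)] G.M.a_closed by metis
    show "k (a \<odot>\<^bsub>N\<^esub> y) = a \<odot>\<^bsub>U\<^esub> k y" if y: "a \<in> carrier R" "y \<in> carrier N" for a y
      using ex[OF y(2)] kq gmod_homD(3)[OF h] gmod_homD(3)[OF q(1)] G.lsmult_closed y(1) by metis
    show "k y \<in> mpart U n" if y: "y \<in> mpart N n" for y n
    proof -
      obtain x where x: "x \<in> carrier G" "q x = y" using ex N.mgr.D_carrier[OF y] by blast
      have "q (G.mgr.cp x n) = N.mgr.cp (q x) n" by (rule gmod_hom_gcomp[OF G N q(1) x(1), symmetric])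
      also have "\<dots> = y" unfolding x(2) using N.mgr.cp_homog[OF y, of n] by simp
      finally have "k y = h (G.mgr.cp x n)" using kq[of "G.mgr.cp x n"] x(1) by simp
      then show ?thesis using gmod_homD(4)[OF h G.mgr.cp_D[OF x(1)], of n] by simp
    qed
  qed
  then show ?thesis using kq by blast
qed

lemma pos_graded_moduleI: "pos_graded_ring R \<Longrightarrow> graded_left_module R M \<Longrightarrow> pos_graded_module R M"
  by (simp add: pos_graded_module_def)

lemma bdeg_mpart: "x \<in> (\<Union>n. mpart N n) \<Longrightarrow> x \<in> mpart N (bdeg N x)"
  unfolding bdeg_def by (auto intro: someI)

text \<open>The kernel of a minimal cover \<open>\<pi>\<close> by a free module \<open>F\<close> lies in \<open>R\<^sub>+F\<close>, and being a direct summand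
  it equals \<open>R\<^sub>+\<close> times itself.\<close>

lemma (in pos_graded_ring) free_of_split:
  fixes N :: "('a, 'b) gmodule"
  assumes N: "graded_left_module R N"
    and S: "finite S" "S \<subseteq> (\<Union>n. mpart N n)" "\<And>H'. submodule H' R N \<Longrightarrow> S \<subseteq> H' \<Longrightarrow> carrier N \<subseteq> H'"
    and field: "\<And>c. c \<in> rpart R 0 \<Longrightarrow> c \<noteq> \<zero> \<Longrightarrow> \<exists>c'\<in>carrier R. c' \<otimes> c = \<one>"
    and split: "\<And>r \<delta> \<pi>. \<pi> \<in> gmod_hom R (Fr R r \<delta>) N \<Longrightarrow> \<pi> ` carrier (Fr R r \<delta>) = carrier N \<Longrightarrow>
      \<exists>s\<in>gmod_hom R N (Fr R r \<delta>). \<forall>x\<in>carrier N. \<pi> (s x) = x"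
  shows "\<exists>r \<delta> h. h \<in> gmod_iso R (Fr R r \<delta>) N"
proof -
  interpret N: graded_left_module R N by (rule N)
  \<comment> \<open>The cover is built on a homogeneous generating set of least possible size; this
    minimality is what pushes the relations into \<open>R_+ F\<close>.\<close>
  define Q where "Q m \<longleftrightarrow> (\<exists>S. finite S \<and> card S = m \<and> S \<subseteq> (\<Union>n. mpart N n) \<and>
    (\<forall>H'. submodule H' R N \<longrightarrow> S \<subseteq> H' \<longrightarrow> carrier N \<subseteq> H'))" for m
  define r where "r = (LEAST m. Q m)"
  have "Q (card S)" unfolding Q_def using S by blast
  then have "Q r" unfolding r_def by (rule LeastI)
  then obtain T where T: "finite T" "card T = r" "T \<subseteq> (\<Union>n. mpart N n)"
    and genT: "\<forall>H'. submodule H' R N \<longrightarrow> T \<subseteq> H' \<longrightarrow> carrier N \<subseteq> H'"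
    unfolding Q_def by (elim exE conjE)
  obtain x where x: "bij_betw x {..<r} T"
    using ex_bij_betw_nat_finite[OF T(1)] unfolding T(2) lessThan_atLeast0[symmetric] by blast
  define \<delta> where "\<delta> j = bdeg N (x j)" for j
  have xT: "x j \<in> T" if "j < r" for j using x that by (auto simp: bij_betw_def)
  have xm: "x j \<in> mpart N (\<delta> j)" if "j < r" for j
    unfolding \<delta>_def by (rule bdeg_mpart[OF subsetD[OF T(3) xT[OF that]]])
  have xc: "x j \<in> carrier N" if "j < r" for j using xm[OF that] by (rule N.mgr.D_carrier)
  let ?F = "Fr R r \<delta>"
  interpret F: graded_left_module R ?F by (rule glm_Fr)
  interpret F: pos_graded_module R ?F by (intro pos_graded_moduleI pos_graded_ring_axioms glm_Fr)
  define \<pi> where "\<pi> v = finsum N (\<lambda>j. v j \<odot>\<^bsub>N\<^esub> x j) {..<r}" for v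
  have \<pi>: "\<pi> \<in> gmod_hom R ?F N"
    unfolding \<pi>_def by (rule Fr_lin_hom[OF N xm])
  have \<pi>unit: "\<pi> (unit_vec j) = x j" if "j < r" for j
  proof -
    have "\<pi> (unit_vec j) = finsum N (\<lambda>i. if j = i then x i else \<zero>\<^bsub>N\<^esub>) {..<r}"
      unfolding \<pi>_def by (rule N.M.add.finprod_cong') (auto simp: unit_vec_def xc N.lsmult_one)
    also have "\<dots> = x j" using that xc by (intro N.M.finsum_singleton) auto
    finally show ?thesis .
  qed
  have smim: "submodule (\<pi> ` carrier ?F) R N"
    using submodule_himage[OF glm_Fr N \<pi>] by (simp add: graded_submodule_def)
  have "T \<subseteq> \<pi> ` carrier ?F"
  proof
    fix t assume "t \<in> T"
    then obtain j where "j < r" "t = x j" using x by (auto simp: bij_betw_def)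
    then show "t \<in> \<pi> ` carrier ?F" using \<pi>unit unit_vec_carrier by (metis imageI)
  qed
  then have surj: "\<pi> ` carrier ?F = carrier N"
    using genT smim submoduleD(1)[OF smim] by blast
  have ker: "v j \<in> irrelevant_ideal R" if v: "v \<in> carrier ?F" "\<pi> v = \<zero>\<^bsub>N\<^esub>" and j: "j < r" for v j
  proof (rule ccontr)
    assume "v j \<notin> irrelevant_ideal R"
    then have c0: "rgr.cp (v j) 0 \<noteq> \<zero>" using Fr_carrier[OF v(1)] by (simp add: irrelevant_ideal_iff)
    obtain c' where c': "c' \<in> carrier R" "c' \<otimes> rgr.cp (v j) 0 = \<one>"
      using field[OF rgr.cp_D c0] Fr_carrier[OF v(1)] by blast
    \<comment> \<open>The part of degree \<open>\<delta> j\<close> of the relation v has the degree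
      0 part of \<open>v j\<close> as its j-th entry. Scaling that entry to 1 gives a relation
      expressing \<open>x j\<close> by the other generators, contrary to the choice of r.\<close>
    define w where "w = c' \<odot>\<^bsub>?F\<^esub> F.mgr.cp v (\<delta> j)"
    have wc: "w \<in> carrier ?F" unfolding w_def by (intro F.lsmult_closed c' F.mgr.cp_closed v(1))
    note wj = Fr_carrier[OF wc]
    have w1: "w j = \<one>" unfolding w_def using c'(2) gcomp_Fr[OF v(1) j, of "\<delta> j"] by simp
    have "\<pi> (F.mgr.cp v (\<delta> j)) = \<zero>\<^bsub>N\<^esub>"
      using gmod_hom_gcomp[OF glm_Fr N \<pi> v(1), of "\<delta> j"] v(2) by simp
    then have "\<pi> w = \<zero>\<^bsub>N\<^esub>"
      unfolding w_def using gmod_homD(3)[OF \<pi> c'(1) F.mgr.cp_closed[OF v(1)]] c'(1) by simp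
    moreover have "\<pi> w = finsum N (\<lambda>j. w j \<odot>\<^bsub>N\<^esub> x j) (insert j ({..<r} - {j}))"
      unfolding \<pi>_def using j by (simp add: insert_absorb)
    moreover have "\<dots> = x j \<oplus>\<^bsub>N\<^esub> finsum N (\<lambda>j. w j \<odot>\<^bsub>N\<^esub> x j) ({..<r} - {j})"
      using wj xc j w1 by (subst N.M.finsum_insert) (auto simp: N.lsmult_closed N.lsmult_one)
    ultimately have rel: "x j \<oplus>\<^bsub>N\<^esub> finsum N (\<lambda>j. w j \<odot>\<^bsub>N\<^esub> x j) ({..<r} - {j}) = \<zero>\<^bsub>N\<^esub>" by simp
    have "Q (card (T - {x j}))"
      unfolding Q_def
    proof (intro exI conjI allI impI)
      fix H' assume H': "submodule H' R N" and sub: "T - {x j} \<subseteq> H'"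
      let ?s = "finsum N (\<lambda>j. w j \<odot>\<^bsub>N\<^esub> x j) ({..<r} - {j})"
      have "x l \<in> H'" if "l \<in> {..<r} - {j}" for l
      proof -
        have "x l \<noteq> x j" using x that j by (auto simp: bij_betw_def inj_on_def)
        then show ?thesis using sub xT[of l] that by blast
      qed
      then have s: "?s \<in> H'"
        using wj submoduleD(4)[OF H'] by (intro N.submodule_finsum[OF H']) auto
      have "x j = \<ominus>\<^bsub>N\<^esub> ?s"
        by (rule N.M.minus_equality[OF rel subsetD[OF submoduleD(1)[OF H'] s] xc[OF j], symmetric])
      then have "x j \<in> H'" using submoduleD(5)[OF H' s] by simp
      then have "T \<subseteq> H'" using sub by blast
      then show "carrier N \<subseteq> H'" using genT H' by blast
    qed (use T in auto)
    then have "r \<le> card (T - {x j})" unfolding r_def by (rule Least_le)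
    moreover have "card (T - {x j}) < r" using T xT[OF j] by (metis card_Diff1_less)
    ultimately show False by simp
  qed
  have ker_irr: "v \<in> irr_span R ?F" if v: "v \<in> carrier ?F" "\<pi> v = \<zero>\<^bsub>N\<^esub>" for v
  proof -
    have "finsum ?F (\<lambda>j. v j \<odot>\<^bsub>?F\<^esub> unit_vec j) {..<r} \<in> irr_span R ?F"
      by (rule F.irr_span_finsum) (use ker[OF v] unit_vec_carrier in \<open>auto intro!: F.irr_span_smult simp del: Fr_simps\<close>)
    then show ?thesis unfolding Fr_expand[OF v(1)] .
  qed
  obtain s where s: "s \<in> gmod_hom R N ?F" "\<And>y. y \<in> carrier N \<Longrightarrow> \<pi> (s y) = y"
    using split[OF \<pi> surj] by blast
  let ?K = "gsub ?F (hker ?F N \<pi>)"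
  have K: "graded_left_module R ?K" by (rule glm_gsub[OF glm_Fr submodule_hker[OF glm_Fr N \<pi>]])
  interpret K: pos_graded_module R ?K by (intro pos_graded_moduleI pos_graded_ring_axioms K)
  \<comment> \<open>Projection onto the kernel along the section s. It fixes the kernel pointwise
    and maps \<open>R_+ F\<close> into \<open>R_+\<close> times the kernel, which is how Nakayama's
    lemma comes to apply to the kernel.\<close>
  let ?e = "\<lambda>v. v \<ominus>\<^bsub>?F\<^esub> s (\<pi> v)"
  have e: "?e \<in> gmod_hom R ?F ?F"
    by (rule gmod_hom_diff[OF glm_Fr gmod_hom_id gmod_hom_comp[OF \<pi> s(1)]])
  have eK: "?e \<in> gmod_hom R ?F ?K"
  proof (rule gmod_hom_gsub_cod[OF e])
    fix v assume v: "v \<in> carrier ?F"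
    have "\<pi> (?e v) = \<pi> v \<ominus>\<^bsub>N\<^esub> \<pi> (s (\<pi> v))"
      by (rule gmod_hom_eq_diff[OF glm_Fr N \<pi> v]) (intro gmod_homD(1)[OF s(1)] gmod_homD(1)[OF \<pi> v])
    also have "\<dots> = \<zero>\<^bsub>N\<^esub>"
      using s(2)[OF gmod_homD(1)[OF \<pi> v]] gmod_homD(1)[OF \<pi> v] by (simp add: a_minus_def N.M.r_neg)
    finally show "?e v \<in> hker ?F N \<pi>"
      using gmod_homD(1)[OF e v] by (simp add: hker_def del: Fr_simps)
  qed (rule F.mgr.D_carrier)
  have "carrier ?K \<subseteq> irr_span R ?K"
  proof
    fix v assume "v \<in> carrier ?K"
    then have v: "v \<in> carrier ?F" "\<pi> v = \<zero>\<^bsub>N\<^esub>" by (auto simp: hker_def)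
    have "?e v = v"
      using v gmod_hom_zero[OF N glm_Fr s(1)] by (simp add: a_minus_def del: Fr_simps)
    then show "v \<in> irr_span R ?K"
      using irr_span_hom[OF F.pos_graded_module_axioms K.pos_graded_module_axioms eK ker_irr[OF v]] by simp
  qed
  then have "carrier ?K = {\<zero>\<^bsub>?K\<^esub>}"
    by (rule K.nakayama_zero[OF bounded_below_gsub[OF bounded_below_Fr]])
  then have "hker ?F N \<pi> = {\<zero>\<^bsub>?F\<^esub>}" by simp
  then have "inj_on \<pi> (carrier ?F)"
    by (intro gmod_hom_inj[OF glm_Fr N \<pi>]) (auto simp: hker_def simp del: Fr_simps)
  then have "\<pi> \<in> gmod_iso R ?F N" using \<pi> surj by (simp add: gmod_iso_def bij_betw_def)
  then show ?thesis by blast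
qed

section \<open>Comparison of syzygies\<close>

text \<open>\<open>U'\<close> and \<open>V'\<close> are the first syzygies of \<open>U\<close> and \<open>V\<close>. If the identity of \<open>U\<close> factors through \<open>V\<close>
  up to a map that factors through a free module, then the same holds for \<open>U'\<close> and \<open>V'\<close>.\<close>

lemma syzygy_step:
  assumes L: "graded_left_module R L" and L2: "graded_left_module R L2" and U: "graded_left_module R U"
    and U': "graded_left_module R U'" and P: "graded_left_module R P" and V: "graded_left_module R V"
    and V': "graded_left_module R V'"
    and g: "g \<in> gmod_hom R L U"
    and j: "j \<in> gmod_hom R U' L" "inj_on j (carrier U')" "j ` carrier U' = hker L U g"
    and g': "g' \<in> gmod_hom R P V"
    and j': "j' \<in> gmod_hom R V' P" "inj_on j' (carrier V')" "j' ` carrier V' = hker P V g'"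
    and a: "a \<in> gmod_hom R U V" and b: "b \<in> gmod_hom R V U" and u: "u \<in> gmod_hom R U L"
    and eq: "\<And>x. x \<in> carrier U \<Longrightarrow> x = b (a x) \<oplus>\<^bsub>U\<^esub> g (u x)"
    and liftL: "\<And>h. h \<in> gmod_hom R L V \<Longrightarrow> \<exists>k\<in>gmod_hom R L P. \<forall>x\<in>carrier L. g' (k x) = h x"
    and liftP: "\<And>h. h \<in> gmod_hom R P U \<Longrightarrow> \<exists>k\<in>gmod_hom R P L. \<forall>x\<in>carrier P. g (k x) = h x"
    and liftL2: "\<And>h. h \<in> gmod_hom R L U' \<Longrightarrow> \<exists>k\<in>gmod_hom R L L2. \<forall>x\<in>carrier L. g2 (k x) = h x"
  shows "\<exists>a'\<in>gmod_hom R U' V'. \<exists>b'\<in>gmod_hom R V' U'. \<exists>u'\<in>gmod_hom R U' L2.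
    \<forall>x\<in>carrier U'. x = b' (a' x) \<oplus>\<^bsub>U'\<^esub> g2 (u' x)"
proof -
  interpret L: graded_left_module R L by (rule L)
  interpret U: graded_left_module R U by (rule U)
  interpret U': graded_left_module R U' by (rule U')
  interpret P: graded_left_module R P by (rule P)
  interpret V: graded_left_module R V by (rule V)
  note gD = gmod_homD[OF g] and g'D = gmod_homD[OF g'] and aD = gmod_homD[OF a] and bD = gmod_homD[OF b]
    and uD = gmod_homD[OF u] and jD = gmod_homD[OF j(1)] and j'D = gmod_homD[OF j'(1)]
  obtain \<alpha> where \<alpha>: "\<alpha> \<in> gmod_hom R L P" "\<And>x. x \<in> carrier L \<Longrightarrow> g' (\<alpha> x) = a (g x)"
    using liftL[OF gmod_hom_comp[OF g a]] by blast
  obtain \<beta> where \<beta>: "\<beta> \<in> gmod_hom R P L" "\<And>x. x \<in> carrier P \<Longrightarrow> g (\<beta> x) = b (g' x)"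
    using liftP[OF gmod_hom_comp[OF g' b]] by blast
  note \<alpha>D = gmod_homD[OF \<alpha>(1)] and \<beta>D = gmod_homD[OF \<beta>(1)]
  have gj: "g (j x) = \<zero>\<^bsub>U\<^esub>" if "x \<in> carrier U'" for x
    using j(3) that by (auto simp: hker_def)
  have g'j': "g' (j' x) = \<zero>\<^bsub>V\<^esub>" if "x \<in> carrier V'" for x
    using j'(3) that by (auto simp: hker_def)
  have "\<exists>k\<in>gmod_hom R U' V'. \<forall>x\<in>carrier U'. j' (k x) = \<alpha> (j x)"
  proof (rule factor_through_injection[OF U' V' P j'(1,2) gmod_hom_comp[OF j(1) \<alpha>(1)]])
    show "\<alpha> (j x) \<in> j' ` carrier V'" if "x \<in> carrier U'" for x
      unfolding j'(3) using that \<alpha> \<alpha>D jD gj gmod_hom_zero[OF U V a] by (simp add: hker_def)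
  qed
  then obtain a' where a': "a' \<in> gmod_hom R U' V'" "\<And>x. x \<in> carrier U' \<Longrightarrow> j' (a' x) = \<alpha> (j x)" by blast
  have "\<exists>k\<in>gmod_hom R V' U'. \<forall>x\<in>carrier V'. j (k x) = \<beta> (j' x)"
  proof (rule factor_through_injection[OF V' U' L j(1,2) gmod_hom_comp[OF j'(1) \<beta>(1)]])
    show "\<beta> (j' x) \<in> j ` carrier U'" if "x \<in> carrier V'" for x
      unfolding j(3) using that \<beta> \<beta>D j'D g'j' gmod_hom_zero[OF V U b] by (simp add: hker_def)
  qed
  then obtain b' where b': "b' \<in> gmod_hom R V' U'" "\<And>x. x \<in> carrier V' \<Longrightarrow> j (b' x) = \<beta> (j' x)" by blast
  \<comment> \<open>The defect of \<open>\<beta> \<alpha>\<close> from the identity of L, corrected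
    by \<open>u g\<close> so that its image lies in the kernel of g, that is, in U'. On U' itself g
    vanishes and the correction drops out; what remains is x = b' (a' x) + k (j x), with k liftable
    to L2.\<close>
  let ?h = "\<lambda>x. x \<ominus>\<^bsub>L\<^esub> (\<beta> (\<alpha> x) \<oplus>\<^bsub>L\<^esub> u (g x))"
  have hL: "?h \<in> gmod_hom R L L"
    by (intro gmod_hom_diff[OF L] gmod_hom_id gmod_hom_add[OF L] gmod_hom_comp[OF \<alpha>(1) \<beta>(1)] gmod_hom_comp[OF g u])
  have "\<exists>k\<in>gmod_hom R L U'. \<forall>x\<in>carrier L. j (k x) = ?h x"
  proof (rule factor_through_injection[OF L U' L j(1,2) hL])
    fix x assume x: "x \<in> carrier L"
    have "g (?h x) = g x \<ominus>\<^bsub>U\<^esub> (b (a (g x)) \<oplus>\<^bsub>U\<^esub> g (u (g x)))"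
      using x by (subst gmod_hom_eq_diff[OF L U g]) (simp_all add: gD \<alpha>D \<beta>D uD \<alpha>(2) \<beta>(2))
    also have "\<dots> = \<zero>\<^bsub>U\<^esub>"
      using eq[OF gD(1)[OF x], symmetric] gD(1)[OF x] by (simp add: a_minus_def U.M.r_neg)
    finally show "?h x \<in> j ` carrier U'"
      unfolding j(3) using gmod_homD(1)[OF hL x] by (simp add: hker_def)
  qed
  then obtain k where k: "k \<in> gmod_hom R L U'" "\<And>x. x \<in> carrier L \<Longrightarrow> j (k x) = ?h x" by blast
  obtain w where w: "w \<in> gmod_hom R L L2" "\<And>x. x \<in> carrier L \<Longrightarrow> g2 (w x) = k x"
    using liftL2[OF k(1)] by blast
  have main: "x = b' (a' x) \<oplus>\<^bsub>U'\<^esub> g2 (w (j x))" if x: "x \<in> carrier U'" for x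
  proof -
    note jx = jD(1)[OF x]
    have c: "b' (a' x) \<in> carrier U'" "k (j x) \<in> carrier U'"
      using gmod_homD(1)[OF b'(1)] gmod_homD(1)[OF a'(1) x] gmod_homD(1)[OF k(1) jx] by auto
    have "j (b' (a' x) \<oplus>\<^bsub>U'\<^esub> k (j x)) = \<beta> (\<alpha> (j x)) \<oplus>\<^bsub>L\<^esub> (j x \<ominus>\<^bsub>L\<^esub> (\<beta> (\<alpha> (j x)) \<oplus>\<^bsub>L\<^esub> u (g (j x))))"
      using c a' b' k(2) x jx gmod_homD(1)[OF a'(1) x] by (simp add: jD)
    also have "u (g (j x)) = \<zero>\<^bsub>L\<^esub>" using gj[OF x] gmod_hom_zero[OF U L u] by simp
    also have "\<beta> (\<alpha> (j x)) \<oplus>\<^bsub>L\<^esub> (j x \<ominus>\<^bsub>L\<^esub> (\<beta> (\<alpha> (j x)) \<oplus>\<^bsub>L\<^esub> \<zero>\<^bsub>L\<^esub>)) = j x"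
    proof -
      have y: "\<beta> (\<alpha> (j x)) \<in> carrier L" using jx by (intro \<beta>D \<alpha>D)
      have "\<beta> (\<alpha> (j x)) \<oplus>\<^bsub>L\<^esub> (j x \<oplus>\<^bsub>L\<^esub> \<ominus>\<^bsub>L\<^esub> \<beta> (\<alpha> (j x))) = j x \<oplus>\<^bsub>L\<^esub> (\<beta> (\<alpha> (j x)) \<oplus>\<^bsub>L\<^esub> \<ominus>\<^bsub>L\<^esub> \<beta> (\<alpha> (j x)))"
        using y jx by (intro L.M.a_lcomm) auto
      then show ?thesis using y jx by (simp add: a_minus_def L.M.r_neg)
    qed
    finally have "b' (a' x) \<oplus>\<^bsub>U'\<^esub> k (j x) = x" using j(2) c x by (auto dest: inj_onD)
    then show ?thesis using w(2)[OF jx] by simp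
  qed
  show ?thesis
    by (rule bexI[OF _ a'(1)], rule bexI[OF _ b'(1)], rule bexI[OF _ gmod_hom_comp[OF j(1) w(1)]],
        rule ballI) (rule main)
qed

text \<open>Once V is isomorphic to a module P from which maps to U lift along g, the map b itself
  lifts. The lift preceded by a, plus u, is the section. Here a factorization up to a free module
  turns into a genuine splitting.\<close>

lemma syzygy_last:
  assumes L: "graded_left_module R L" and U: "graded_left_module R U"
    and P: "graded_left_module R P" and V: "graded_left_module R V"
    and g: "g \<in> gmod_hom R L U" and g': "g' \<in> gmod_iso R P V"
    and a: "a \<in> gmod_hom R U V" and b: "b \<in> gmod_hom R V U" and u: "u \<in> gmod_hom R U L"
    and eq: "\<And>x. x \<in> carrier U \<Longrightarrow> x = b (a x) \<oplus>\<^bsub>U\<^esub> g (u x)"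
    and liftP: "\<And>h. h \<in> gmod_hom R P U \<Longrightarrow> \<exists>k\<in>gmod_hom R P L. \<forall>x\<in>carrier P. g (k x) = h x"
  shows "\<exists>s\<in>gmod_hom R U L. \<forall>x\<in>carrier U. g (s x) = x"
proof -
  define k where "k = inv_into (carrier P) g'"
  note kk = gmod_iso_inverse[OF P V g', folded k_def]
  have kh: "k \<in> gmod_hom R V P" by (rule gmod_isoD(1)[OF kk(1)])
  have g'h: "g' \<in> gmod_hom R P V" by (rule gmod_isoD(1)[OF g'])
  obtain \<beta> where \<beta>: "\<beta> \<in> gmod_hom R P L" "\<And>x. x \<in> carrier P \<Longrightarrow> g (\<beta> x) = b (g' x)"
    using liftP[OF gmod_hom_comp[OF g'h b]] by blast
  let ?s = "\<lambda>x. \<beta> (k (a x)) \<oplus>\<^bsub>L\<^esub> u x"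
  have s: "?s \<in> gmod_hom R U L"
    by (intro gmod_hom_add[OF L] u gmod_hom_comp[OF gmod_hom_comp[OF a kh] \<beta>(1)])
  have main: "g (?s x) = x" if x: "x \<in> carrier U" for x
  proof -
    have ax: "a x \<in> carrier V" by (rule gmod_homD(1)[OF a x])
    have kax: "k (a x) \<in> carrier P" by (rule gmod_homD(1)[OF kh ax])
    have "g (?s x) = g (\<beta> (k (a x))) \<oplus>\<^bsub>U\<^esub> g (u x)"
      by (rule gmod_homD(2)[OF g]) (intro gmod_homD(1)[OF \<beta>(1)] gmod_homD(1)[OF u] kax x)+
    then show ?thesis using \<beta>(2)[OF kax] kk(3)[OF ax] eq[OF x] by simp
  qed
  show ?thesis by (rule bexI[OF _ s], rule ballI) (rule main)
qed

section \<open>Modules over the quotient by a normal regular element\<close>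

lemma glm_zero_closed: "graded_left_module R M \<Longrightarrow> \<zero>\<^bsub>M\<^esub> \<in> carrier M"
  by (metis abelian_group_def abelian_monoid.zero_closed glm_abelian)

section \<open>The normal regular element and its twist\<close>

locale mf_setting = pos_graded_ring A for A :: "'a gring" (structure) +
  fixes f :: 'a and e :: int and \<sigma> :: "'a \<Rightarrow> 'a"
  assumes e_pos: "0 < e" and f_deg: "f \<in> rpart A e" and f_regular: "regular_element A f"
    and \<sigma>_iso: "\<sigma> \<in> ring_iso A A" and \<sigma>_part: "\<And>n. \<sigma> ` rpart A n = rpart A n"
    and f_normal: "\<And>a. a \<in> carrier A \<Longrightarrow> a \<otimes> f = f \<otimes> \<sigma> a"
    and degree_0_field: "\<And>c. c \<in> rpart A 0 \<Longrightarrow> c \<noteq> \<zero> \<Longrightarrow> \<exists>c'\<in>carrier A. c' \<otimes> c = \<one>"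
    and noetherian: "left_noetherian A"
begin

abbreviation tws where "tws M \<equiv> tw \<sigma> e M"

definition \<sigma>i :: "'a \<Rightarrow> 'a" where "\<sigma>i = inv_into (carrier A) \<sigma>"

definition fim :: "('a, 'b) gmodule \<Rightarrow> 'b set" where
  "fim M = (\<lambda>x. f \<odot>\<^bsub>M\<^esub> x) ` carrier M"

lemma fc [simp]: "f \<in> carrier A"
  using f_deg by (rule rgr.D_carrier)

lemma \<sigma>_hom: "\<sigma> \<in> ring_hom A A" and \<sigma>_bij: "bij_betw \<sigma> (carrier A) (carrier A)"
  using \<sigma>_iso by (auto simp: ring_iso_def)

lemma \<sigma>_closed [simp]: "a \<in> carrier A \<Longrightarrow> \<sigma> a \<in> carrier A"
  using ring_hom_closed[OF \<sigma>_hom] .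

lemma \<sigma>_mult: "a \<in> carrier A \<Longrightarrow> b \<in> carrier A \<Longrightarrow> \<sigma> (a \<otimes> b) = \<sigma> a \<otimes> \<sigma> b"
  using ring_hom_mult[OF \<sigma>_hom] .

lemma \<sigma>_add: "a \<in> carrier A \<Longrightarrow> b \<in> carrier A \<Longrightarrow> \<sigma> (a \<oplus> b) = \<sigma> a \<oplus> \<sigma> b"
  using ring_hom_add[OF \<sigma>_hom] .

lemma \<sigma>_one [simp]: "\<sigma> \<one> = \<one>"
  using ring_hom_one[OF \<sigma>_hom] .

lemma \<sigma>_zero [simp]: "\<sigma> \<zero> = \<zero>"
  using ring_hom_zero[OF \<sigma>_hom ring_axioms ring_axioms] .

lemma \<sigma>i_closed [simp]: "a \<in> carrier A \<Longrightarrow> \<sigma>i a \<in> carrier A"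
  unfolding \<sigma>i_def using \<sigma>_bij by (metis bij_betw_def inv_into_into)

lemma \<sigma>_\<sigma>i [simp]: "a \<in> carrier A \<Longrightarrow> \<sigma> (\<sigma>i a) = a"
  unfolding \<sigma>i_def using \<sigma>_bij by (metis bij_betw_inv_into_right)

lemma \<sigma>i_\<sigma> [simp]: "a \<in> carrier A \<Longrightarrow> \<sigma>i (\<sigma> a) = a"
  unfolding \<sigma>i_def using \<sigma>_bij by (metis bij_betw_inv_into_left)

lemma \<sigma>_part': "a \<in> rpart A n \<Longrightarrow> \<sigma> a \<in> rpart A n"
  using \<sigma>_part by blast

lemma \<sigma>i_part: "a \<in> rpart A n \<Longrightarrow> \<sigma>i a \<in> rpart A n"
  using \<sigma>_part[of n] \<sigma>i_\<sigma> rgr.D_carrier by (metis imageE)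

lemma \<sigma>i_mult: "a \<in> carrier A \<Longrightarrow> b \<in> carrier A \<Longrightarrow> \<sigma>i (a \<otimes> b) = \<sigma>i a \<otimes> \<sigma>i b"
  by (metis \<sigma>_\<sigma>i \<sigma>_mult \<sigma>i_\<sigma> \<sigma>i_closed m_closed)

lemma \<sigma>i_add: "a \<in> carrier A \<Longrightarrow> b \<in> carrier A \<Longrightarrow> \<sigma>i (a \<oplus> b) = \<sigma>i a \<oplus> \<sigma>i b"
  by (metis \<sigma>_\<sigma>i \<sigma>_add \<sigma>i_\<sigma> \<sigma>i_closed a_closed)

lemma \<sigma>_irr: "a \<in> irrelevant_ideal A \<Longrightarrow> \<sigma> a \<in> irrelevant_ideal A"
  by (induction a rule: irr_induct) (auto simp: \<sigma>_add irr_add intro: irr_homog \<sigma>_part')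

lemma \<sigma>i_zero [simp]: "\<sigma>i \<zero> = \<zero>"
  using \<sigma>i_\<sigma>[of \<zero>] by simp

lemma \<sigma>i_irr: "a \<in> irrelevant_ideal A \<Longrightarrow> \<sigma>i a \<in> irrelevant_ideal A"
  by (induction a rule: irr_induct) (auto simp: \<sigma>i_add irr_add intro: irr_homog \<sigma>i_part)

lemma f_irr: "f \<in> irrelevant_ideal A"
  using irr_homog[OF f_deg e_pos] .

lemma f_reg: "a \<in> carrier A \<Longrightarrow> f \<otimes> a = \<zero> \<Longrightarrow> a = \<zero>"
  using f_regular unfolding regular_element_def by blast

lemma f_cancel:
  assumes "f \<otimes> a = f \<otimes> b" "a \<in> carrier A" "b \<in> carrier A"
  shows "a = b"
proof -
  have "f \<otimes> (a \<ominus> b) = f \<otimes> a \<ominus> f \<otimes> b" using assms(2,3) by (simp add: a_minus_def r_distr r_minus)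
  also have "\<dots> = \<zero>" unfolding assms(1) using assms(3) by (simp add: a_minus_def r_neg)
  finally have "f \<otimes> (a \<ominus> b) = \<zero>" .
  then have "a \<ominus> b = \<zero>" by (rule f_reg[OF minus_closed[OF assms(2,3)]])
  then show ?thesis using assms(2,3) by simp
qed

text \<open>Cancel f in f f = f \<sigma>(f), the normality relation at f itself.\<close>

lemma \<sigma>_f [simp]: "\<sigma> f = f"
  by (rule f_cancel[OF f_normal[OF fc, symmetric]]) auto

lemma f_normal_\<sigma>i: "a \<in> carrier A \<Longrightarrow> \<sigma>i a \<otimes> f = f \<otimes> a"
  using f_normal[of "\<sigma>i a"] by simp

lemma glm_tws: "graded_left_module A M \<Longrightarrow> graded_left_module A (tws M)"
  by (rule glm_tw[OF _ \<sigma>_hom \<sigma>_part'])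

lemma graded_free_tws: "graded_free A M \<Longrightarrow> graded_free A (tws M)"
  by (rule graded_free_tw[OF _ \<sigma>_iso \<sigma>_part])

lemma gmod_hom_tws: "h \<in> gmod_hom A M N \<Longrightarrow> h \<in> gmod_hom A (tws M) (tws N)"
  by (rule gmod_homI) (simp_all add: gmod_homD)

lemma f_smult_twist:
  assumes "graded_left_module A M" "a \<in> carrier A" "x \<in> carrier M"
  shows "f \<odot>\<^bsub>M\<^esub> (\<sigma> a \<odot>\<^bsub>M\<^esub> x) = a \<odot>\<^bsub>M\<^esub> (f \<odot>\<^bsub>M\<^esub> x)"
proof -
  interpret M: graded_left_module A M by fact
  show ?thesis using assms f_normal by (simp flip: M.lsmult_assoc)
qed

lemma f_smult_twist_i:
  assumes "graded_left_module A M" "a \<in> carrier A" "x \<in> carrier M"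
  shows "f \<odot>\<^bsub>M\<^esub> (a \<odot>\<^bsub>M\<^esub> x) = \<sigma>i a \<odot>\<^bsub>M\<^esub> (f \<odot>\<^bsub>M\<^esub> x)"
  using f_smult_twist[OF assms(1) \<sigma>i_closed[OF assms(2)] assms(3)] assms(2) by simp

lemma left_mult_hom:
  assumes "graded_left_module A M"
  shows "(\<lambda>x. f \<odot>\<^bsub>M\<^esub> x) \<in> gmod_hom A (tws M) M"
proof -
  interpret M: graded_left_module A M by fact
  show ?thesis
  proof (rule gmod_homI)
    show "f \<odot>\<^bsub>M\<^esub> x \<in> mpart M n" if "x \<in> mpart (tws M) n" for x n
      using M.mpart_smult[OF f_deg, of x "n - e"] that by simp
  qed (simp_all add: M.lsmult_closed M.lsmult_r_distr f_smult_twist[OF assms])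
qed

lemma graded_submodule_fim:
  assumes "graded_left_module A M"
  shows "graded_submodule A M (fim M)"
  using submodule_himage[OF glm_tws[OF assms] assms left_mult_hom[OF assms]] by (simp add: fim_def)

lemma f_torsion_free:
  assumes "graded_free A G" "x \<in> carrier G" "f \<odot>\<^bsub>G\<^esub> x = \<zero>\<^bsub>G\<^esub>"
  shows "x = \<zero>\<^bsub>G\<^esub>"
proof -
  obtain X where X: "graded_left_module A G" "graded_basis A G X" using assms(1) by (auto simp: graded_free_def)
  interpret G: free_basis A G X using X by (rule free_basisI)
  have "G.cf x y = \<zero>" for y
  proof (rule f_reg[OF G.cf_closed[OF assms(2)]])
    show "f \<otimes> G.cf x y = \<zero>" using G.cf_smult[OF assms(2) fc, of y] assms(3) by simp
  qed
  then show ?thesis by (intro G.cf_eqI[OF assms(2) G.M.zero_closed]) simp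
qed

lemma f_inj:
  assumes "graded_free A G" "x \<in> carrier G" "y \<in> carrier G" "f \<odot>\<^bsub>G\<^esub> x = f \<odot>\<^bsub>G\<^esub> y"
  shows "x = y"
proof -
  interpret G: graded_left_module A G by (rule graded_free_glm[OF assms(1)])
  have "inj_on (\<lambda>x. f \<odot>\<^bsub>G\<^esub> x) (carrier (tws G))"
    by (rule gmod_hom_inj[OF glm_tws[OF graded_free_glm[OF assms(1)]] graded_free_glm[OF assms(1)]
          left_mult_hom[OF graded_free_glm[OF assms(1)]]])
      (use f_torsion_free[OF assms(1)] in simp)
  then show ?thesis using assms by (auto simp: inj_on_def)
qed

section \<open>Modules of the form \<open>G / f G\<close>, and uniqueness of minimal complexes of
  them\<close>

lemma pgm: "graded_left_module A M \<Longrightarrow> pos_graded_module A M"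
  by (intro pos_graded_moduleI pos_graded_ring_axioms)

text \<open>Presents N as \<open>G / f G\<close> with G free over A, so that N plays the part of a
  graded free B-module. Keeping the presentation instead of B lets the arguments about free
  B-modules take place over A; boundedness is included for Nakayama's lemma.\<close>

definition rel_cover :: "('a, nat \<Rightarrow> 'a) gmodule \<Rightarrow> ('a, 'b) gmodule \<Rightarrow> ((nat \<Rightarrow> 'a) \<Rightarrow> 'b) \<Rightarrow> bool" where
  "rel_cover G N q \<longleftrightarrow> graded_free A G \<and> bounded_below G \<and> graded_left_module A N \<and> q \<in> gmod_hom A G N \<and>
     q ` carrier G = carrier N \<and> (\<forall>x\<in>carrier G. q x = \<zero>\<^bsub>N\<^esub> \<longleftrightarrow> x \<in> fim G)"

lemma rel_coverD:
  assumes "rel_cover G N q"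
  shows "graded_free A G" "bounded_below G" "graded_left_module A N" "q \<in> gmod_hom A G N" "q ` carrier G = carrier N"
    "\<And>x. x \<in> carrier G \<Longrightarrow> q x = \<zero>\<^bsub>N\<^esub> \<longleftrightarrow> x \<in> fim G" "graded_left_module A G"
  using assms graded_free_glm by (auto simp: rel_cover_def)

lemma rel_cover_killed:
  assumes "rel_cover G N q" "y \<in> carrier N"
  shows "f \<odot>\<^bsub>N\<^esub> y = \<zero>\<^bsub>N\<^esub>"
proof -
  note c = rel_coverD[OF assms(1)]
  interpret G: graded_left_module A G by (rule c(7))
  have "y \<in> q ` carrier G" using assms(2) c(5) by simp
  then obtain x where x: "x \<in> carrier G" "y = q x" by blast
  have "q (f \<odot>\<^bsub>G\<^esub> x) = \<zero>\<^bsub>N\<^esub>" using c(6)[of "f \<odot>\<^bsub>G\<^esub> x"] x by (simp add: G.lsmult_closed fim_def)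
  then show ?thesis using gmod_homD(3)[OF c(4) fc x(1)] x(2) by simp
qed

lemma rel_cover_bounded: "rel_cover G N q \<Longrightarrow> bounded_below N"
  using bounded_below_onto rel_coverD by metis

text \<open>Projectivity relative to modules killed by f: a lift starting from G sends
  \<open>f G\<close> to \<open>f U = 0\<close>, hence descends to N.\<close>

lemma rel_cover_lifting:
  assumes c: "rel_cover G N q" and U: "graded_left_module A U" and V: "graded_left_module A V"
    and g: "g \<in> gmod_hom A U V" "g ` carrier U = carrier V" and h: "h \<in> gmod_hom A N V"
    and killed: "\<And>x. x \<in> carrier U \<Longrightarrow> f \<odot>\<^bsub>U\<^esub> x = \<zero>\<^bsub>U\<^esub>"
  shows "\<exists>k\<in>gmod_hom A N U. \<forall>x\<in>carrier N. g (k x) = h x"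
proof -
  note c = rel_coverD[OF c]
  obtain \<kappa> where \<kappa>: "\<kappa> \<in> gmod_hom A G U" "\<And>x. x \<in> carrier G \<Longrightarrow> g (\<kappa> x) = h (q x)"
    using graded_free_lifting[OF c(1) U V g gmod_hom_comp[OF c(4) h]] by (elim bexE) simp
  have "\<exists>k\<in>gmod_hom A N U. \<forall>x\<in>carrier G. k (q x) = \<kappa> x"
  proof (rule factor_through_surjection[OF c(7) c(3) U c(4) c(5) \<kappa>(1)])
    fix x assume "x \<in> carrier G" "q x = \<zero>\<^bsub>N\<^esub>"
    then obtain y where "y \<in> carrier G" "x = f \<odot>\<^bsub>G\<^esub> y" using c(6) by (auto simp: fim_def)
    then show "\<kappa> x = \<zero>\<^bsub>U\<^esub>" using killed[OF gmod_homD(1)[OF \<kappa>(1)]] gmod_homD(3)[OF \<kappa>(1) fc] by simp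
  qed
  then obtain k where k: "k \<in> gmod_hom A N U" "\<And>x. x \<in> carrier G \<Longrightarrow> k (q x) = \<kappa> x" by (elim bexE) simp
  have "g (k y) = h y" if "y \<in> carrier N" for y
  proof -
    have "y \<in> q ` carrier G" using that c(5) by simp
    then obtain x where "x \<in> carrier G" "y = q x" by blast
    then show ?thesis using k(2) \<kappa>(2) by simp
  qed
  then show ?thesis using k(1) by (intro bexI[of _ k]) simp_all
qed

text \<open>Uniqueness of projective covers. A lift h of g along g' is onto by Nakayama's lemma, as
  the kernel of g' lies in \<open>A_+ N'\<close>; therefore h splits. Its kernel is a direct summand
  contained in \<open>A_+ N\<close>, so it equals \<open>A_+\<close> times itself and
  vanishes.\<close>

lemma minimal_cover_iso:
  assumes c: "rel_cover G N q" and c': "rel_cover G' N' q'" and V: "graded_left_module A V"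
    and g: "g \<in> gmod_hom A N V" "g ` carrier N = carrier V"
    and g': "g' \<in> gmod_hom A N' V" "g' ` carrier N' = carrier V"
    and m: "\<And>x. x \<in> carrier N \<Longrightarrow> g x = \<zero>\<^bsub>V\<^esub> \<Longrightarrow> x \<in> irr_span A N"
    and m': "\<And>x. x \<in> carrier N' \<Longrightarrow> g' x = \<zero>\<^bsub>V\<^esub> \<Longrightarrow> x \<in> irr_span A N'"
  shows "\<exists>h\<in>gmod_iso A N N'. \<forall>x\<in>carrier N. g' (h x) = g x"
proof -
  note N = rel_coverD(3)[OF c] and N' = rel_coverD(3)[OF c']
  interpret N: pos_graded_module A N by (rule pgm[OF N])
  interpret N': pos_graded_module A N' by (rule pgm[OF N'])
  interpret V: graded_left_module A V by (rule V)
  have "\<exists>h\<in>gmod_hom A N N'. \<forall>x\<in>carrier N. g' (h x) = g x"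
    by (rule rel_cover_lifting[OF c N' V g' g(1)]) (rule rel_cover_killed[OF c'])
  then obtain h where h: "h \<in> gmod_hom A N N'" "\<And>x. x \<in> carrier N \<Longrightarrow> g' (h x) = g x"
    by (elim bexE) simp
  note hD = gmod_homD[OF h(1)]
  have surj: "h ` carrier N = carrier N'"
  proof (rule N'.nakayama[OF rel_cover_bounded[OF c'] submodule_himage[OF N N' h(1)]])
    fix y assume y: "y \<in> carrier N'"
    have "g' y \<in> g ` carrier N" using gmod_homD(1)[OF g'(1) y] g(2) by simp
    then obtain x where x: "x \<in> carrier N" "g' y = g x" by blast
    note hx = hD(1)[OF x(1)]
    have "g' (y \<ominus>\<^bsub>N'\<^esub> h x) = \<zero>\<^bsub>V\<^esub>"
      using gmod_hom_eq_diff[OF N' V g'(1) y hx] h(2)[OF x(1)] x gmod_homD(1)[OF g(1) x(1)]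
      by (simp add: a_minus_def V.M.r_neg)
    then have "y \<ominus>\<^bsub>N'\<^esub> h x \<in> irr_span A N'" using m' y hx by simp
    moreover have "y = h x \<oplus>\<^bsub>N'\<^esub> (y \<ominus>\<^bsub>N'\<^esub> h x)"
      using y hx by (simp add: a_minus_def N'.M.a_lcomm N'.M.r_neg)
    ultimately show "\<exists>h\<in>h ` carrier N. \<exists>z\<in>irr_span A N'. y = h \<oplus>\<^bsub>N'\<^esub> z"
      using x(1) by (intro bexI[of _ "h x"] bexI[of _ "y \<ominus>\<^bsub>N'\<^esub> h x"]) simp_all
  qed
  have "\<exists>s\<in>gmod_hom A N' N. \<forall>y\<in>carrier N'. h (s y) = y"
    by (rule rel_cover_lifting[OF c' N N' h(1) surj gmod_hom_id]) (rule rel_cover_killed[OF c])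
  then obtain s where s: "s \<in> gmod_hom A N' N" "\<And>y. y \<in> carrier N' \<Longrightarrow> h (s y) = y"
    by (elim bexE) simp
  let ?K = "gsub N (hker N N' h)"
  have K: "graded_left_module A ?K" by (rule glm_gsub[OF N submodule_hker[OF N N' h(1)]])
  interpret K: pos_graded_module A ?K by (rule pgm[OF K])
  let ?e = "\<lambda>v. v \<ominus>\<^bsub>N\<^esub> s (h v)"
  have e: "?e \<in> gmod_hom A N N"
    by (rule gmod_hom_diff[OF N gmod_hom_id gmod_hom_comp[OF h(1) s(1)]])
  have eK: "?e \<in> gmod_hom A N ?K"
  proof (rule gmod_hom_gsub_cod[OF e])
    fix v assume v: "v \<in> carrier N"
    have "h (?e v) = h v \<ominus>\<^bsub>N'\<^esub> h (s (h v))"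
      by (rule gmod_hom_eq_diff[OF N N' h(1) v]) (intro gmod_homD(1)[OF s(1)] hD v)
    also have "\<dots> = \<zero>\<^bsub>N'\<^esub>"
      using s(2)[OF hD(1)[OF v]] hD(1)[OF v] by (simp add: a_minus_def N'.M.r_neg)
    finally show "?e v \<in> hker N N' h"
      using gmod_homD(1)[OF e v] by (simp add: hker_def)
  qed (rule N.mgr.D_carrier)
  have "carrier ?K \<subseteq> irr_span A ?K"
  proof
    fix v assume "v \<in> carrier ?K"
    then have v: "v \<in> carrier N" "h v = \<zero>\<^bsub>N'\<^esub>" by (auto simp: hker_def)
    have "g v = \<zero>\<^bsub>V\<^esub>" using h(2)[OF v(1)] v(2) gmod_hom_zero[OF N' V g'(1)] by simp
    then have "v \<in> irr_span A N" using m v(1) by simp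
    moreover have "?e v = v"
      using v gmod_hom_zero[OF N' N s(1)] by (simp add: a_minus_def)
    ultimately show "v \<in> irr_span A ?K"
      using irr_span_hom[OF N.pos_graded_module_axioms K.pos_graded_module_axioms eK, of v] by simp
  qed
  then have "carrier ?K = {\<zero>\<^bsub>?K\<^esub>}"
    by (rule K.nakayama_zero[OF bounded_below_gsub[OF rel_cover_bounded[OF c]]])
  then have "hker N N' h = {\<zero>\<^bsub>N\<^esub>}" by simp
  then have "inj_on h (carrier N)"
    by (intro gmod_hom_inj[OF N N' h(1)]) (auto simp: hker_def)
  then have "h \<in> gmod_iso A N N'" using h(1) surj by (simp add: gmod_iso_def bij_betw_def)
  then show ?thesis using h(2) by (intro bexI[of _ h]) simp_all
qed

text \<open>Exactness is imposed from degree one on. The augmentation in degree 0 is a separate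
  datum, so that truncations remain minimal complexes
  (\<open>minimal_complex_shift\<close>).\<close>

definition minimal_complex :: "(nat \<Rightarrow> ('a, 'q) gmodule) \<Rightarrow> (nat \<Rightarrow> 'q \<Rightarrow> 'q) \<Rightarrow> bool" where
  "minimal_complex C D \<longleftrightarrow> (\<forall>i. (\<exists>G q. rel_cover G (C i) q) \<and> D i \<in> gmod_hom A (C (Suc i)) (C i) \<and>
     (\<forall>x\<in>carrier (C (Suc i)). D i x = \<zero>\<^bsub>C i\<^esub> \<longleftrightarrow> x \<in> D (Suc i) ` carrier (C (Suc (Suc i)))) \<and>
     D i ` carrier (C (Suc i)) \<subseteq> irr_span A (C i))"

theorem minimal_complex_unique:
  fixes C :: "nat \<Rightarrow> ('a, 'q) gmodule" and C' :: "nat \<Rightarrow> ('a, 'p) gmodule"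
  assumes C: "minimal_complex C D" and C': "minimal_complex C' D'" and V: "graded_left_module A V"
    and \<epsilon>: "\<epsilon> \<in> gmod_hom A (C 0) V" "\<epsilon> ` carrier (C 0) = carrier V"
      "\<And>x. x \<in> carrier (C 0) \<Longrightarrow> \<epsilon> x = \<zero>\<^bsub>V\<^esub> \<longleftrightarrow> x \<in> D 0 ` carrier (C 1)"
    and \<epsilon>': "\<epsilon>' \<in> gmod_hom A (C' 0) V" "\<epsilon>' ` carrier (C' 0) = carrier V"
      "\<And>x. x \<in> carrier (C' 0) \<Longrightarrow> \<epsilon>' x = \<zero>\<^bsub>V\<^esub> \<longleftrightarrow> x \<in> D' 0 ` carrier (C' 1)"
  shows "\<exists>h. (\<forall>i. h i \<in> gmod_iso A (C i) (C' i)) \<and>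
    (\<forall>i. \<forall>x\<in>carrier (C (Suc i)). D' i (h (Suc i) x) = h i (D i x))"
proof -
  have cov: "\<exists>G q. rel_cover G (C i) q" and D: "D i \<in> gmod_hom A (C (Suc i)) (C i)"
    and ex: "x \<in> carrier (C (Suc i)) \<Longrightarrow> D i x = \<zero>\<^bsub>C i\<^esub> \<longleftrightarrow> x \<in> D (Suc i) ` carrier (C (Suc (Suc i)))"
    and mi: "D i ` carrier (C (Suc i)) \<subseteq> irr_span A (C i)" for i x
    using C by (auto simp: minimal_complex_def)
  have cov': "\<exists>G q. rel_cover G (C' i) q" and D': "D' i \<in> gmod_hom A (C' (Suc i)) (C' i)"
    and ex': "x \<in> carrier (C' (Suc i)) \<Longrightarrow> D' i x = \<zero>\<^bsub>C' i\<^esub> \<longleftrightarrow> x \<in> D' (Suc i) ` carrier (C' (Suc (Suc i)))"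
    and mi': "D' i ` carrier (C' (Suc i)) \<subseteq> irr_span A (C' i)" for i x
    using C' by (auto simp: minimal_complex_def)
  have gC: "graded_left_module A (C i)" for i using cov[of i] rel_coverD(3) by blast
  have gC': "graded_left_module A (C' i)" for i using cov'[of i] rel_coverD(3) by blast
  have Dc: "D i x \<in> carrier (C i)" if "x \<in> carrier (C (Suc i))" for i x using gmod_homD(1)[OF D that] .
  have Dc': "D' i x \<in> carrier (C' i)" if "x \<in> carrier (C' (Suc i))" for i x using gmod_homD(1)[OF D' that] .
  let ?Im = "\<lambda>i. D i ` carrier (C (Suc i))" and ?Im' = "\<lambda>i. D' i ` carrier (C' (Suc i))"
  have step: "\<exists>h. h \<in> gmod_iso A (C i) (C' i) \<and> h ` ?Im i = ?Im' i \<and> (\<forall>x\<in>carrier (C i). g' (h x) = g x)"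
    if W: "graded_left_module A W" and g: "g \<in> gmod_hom A (C i) W" "g ` carrier (C i) = carrier W"
        "\<And>x. x \<in> carrier (C i) \<Longrightarrow> g x = \<zero>\<^bsub>W\<^esub> \<longleftrightarrow> x \<in> ?Im i"
      and g': "g' \<in> gmod_hom A (C' i) W" "g' ` carrier (C' i) = carrier W"
        "\<And>x. x \<in> carrier (C' i) \<Longrightarrow> g' x = \<zero>\<^bsub>W\<^esub> \<longleftrightarrow> x \<in> ?Im' i"
    for i g g' and W :: "('a, 'w) gmodule"
  proof -
    obtain G q where c: "rel_cover G (C i) q" using cov[of i] by (elim exE)
    obtain G' q' where c': "rel_cover G' (C' i) q'" using cov'[of i] by (elim exE)
    have "\<exists>h\<in>gmod_iso A (C i) (C' i). \<forall>x\<in>carrier (C i). g' (h x) = g x"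
      by (rule minimal_cover_iso[OF c c' W g(1,2) g'(1,2)])
        (use g(3) g'(3) mi[of i] mi'[of i] in auto)
    then obtain h where h: "h \<in> gmod_iso A (C i) (C' i)" "\<And>x. x \<in> carrier (C i) \<Longrightarrow> g' (h x) = g x" by (elim bexE) simp
    note hi = gmod_isoD[OF h(1)]
    have "h ` ?Im i = ?Im' i"
    proof
      show "h ` ?Im i \<subseteq> ?Im' i"
      proof
        fix y assume "y \<in> h ` ?Im i"
        then obtain x where x: "x \<in> ?Im i" "y = h x" by blast
        have xc: "x \<in> carrier (C i)" using x(1) Dc by blast
        have "g' (h x) = \<zero>\<^bsub>W\<^esub>" using h(2)[OF xc] g(3)[OF xc] x(1) by simp
        then show "y \<in> ?Im' i" using g'(3) gmod_homD(1)[OF hi(1) xc] x(2) by simp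
      qed
      show "?Im' i \<subseteq> h ` ?Im i"
      proof
        fix y assume y: "y \<in> ?Im' i"
        have yc: "y \<in> carrier (C' i)" using y Dc' by blast
        then have "y \<in> h ` carrier (C i)" using hi(4) by simp
        then obtain x where x: "x \<in> carrier (C i)" "y = h x" by blast
        have "g x = \<zero>\<^bsub>W\<^esub>" using h(2)[OF x(1)] g'(3)[OF yc] y x(2) by simp
        then show "y \<in> h ` ?Im i" using g(3)[OF x(1)] x(2) by simp
      qed
    qed
    then show ?thesis using h by (intro exI[of _ h]) simp
  qed
  \<comment> \<open>The recursion carries along that \<open>h i\<close> matches the images of the
    incoming differentials. The image inside \<open>C' i\<close> is then a common target onto which
    both \<open>C (Suc i)\<close> and \<open>C' (Suc i)\<close> map, so covers can be compared
    again.\<close>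
  have "\<exists>h. \<forall>i. (h i \<in> gmod_iso A (C i) (C' i) \<and> h i ` ?Im i = ?Im' i) \<and>
      (\<forall>x\<in>carrier (C (Suc i)). D' i (h (Suc i) x) = h i (D i x))"
  proof (rule dependent_nat_choice)
    show "\<exists>h. h \<in> gmod_iso A (C 0) (C' 0) \<and> h ` ?Im 0 = ?Im' 0"
      using step[OF V, of \<epsilon> 0 \<epsilon>'] \<epsilon> \<epsilon>' by auto
  next
    fix h i assume h: "h \<in> gmod_iso A (C i) (C' i) \<and> h ` ?Im i = ?Im' i"
    then have hi: "h \<in> gmod_iso A (C i) (C' i)" and him: "h ` ?Im i = ?Im' i" by auto
    note hh = gmod_isoD(1)[OF hi]
    let ?W = "gsub (C' i) (?Im' i)"
    have sub: "?Im' i \<subseteq> carrier (C' i)" using Dc' by blast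
    have W: "graded_left_module A ?W" by (rule glm_gsub[OF gC' submodule_himage[OF gC' gC' D']])
    have mc: "x \<in> mpart (C (Suc i)) n \<Longrightarrow> x \<in> carrier (C (Suc i))" for x n
      using glm_mpart_carrier[OF gC] .
    have mc': "x \<in> mpart (C' (Suc i)) n \<Longrightarrow> x \<in> carrier (C' (Suc i))" for x n
      using glm_mpart_carrier[OF gC'] .
    have g: "(\<lambda>x. h (D i x)) \<in> gmod_hom A (C (Suc i)) ?W"
      by (rule gmod_hom_gsub_cod[OF gmod_hom_comp[OF D hh] _ mc]) (use him in auto)
    have gs: "(\<lambda>x. h (D i x)) ` carrier (C (Suc i)) = carrier ?W"
      using him by (simp add: image_image)
    have gk: "h (D i x) = \<zero>\<^bsub>?W\<^esub> \<longleftrightarrow> x \<in> ?Im (Suc i)" if x: "x \<in> carrier (C (Suc i))" for x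
    proof -
      have "h (D i x) = \<zero>\<^bsub>C' i\<^esub> \<longleftrightarrow> D i x = \<zero>\<^bsub>C i\<^esub>"
      proof
        assume "h (D i x) = \<zero>\<^bsub>C' i\<^esub>"
        then have "h (D i x) = h \<zero>\<^bsub>C i\<^esub>" using gmod_hom_zero[OF gC gC' hh] by simp
        then show "D i x = \<zero>\<^bsub>C i\<^esub>"
          by (rule inj_onD[OF gmod_isoD(3)[OF hi] _ Dc[OF x] glm_zero_closed[OF gC]])
      qed (simp add: gmod_hom_zero[OF gC gC' hh])
      then show ?thesis using ex[OF x] by simp
    qed
    have g': "D' i \<in> gmod_hom A (C' (Suc i)) ?W"
      by (rule gmod_hom_gsub_cod[OF D' _ mc']) auto
    have "\<exists>h'. h' \<in> gmod_iso A (C (Suc i)) (C' (Suc i)) \<and> h' ` ?Im (Suc i) = ?Im' (Suc i) \<and>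
        (\<forall>x\<in>carrier (C (Suc i)). D' i (h' x) = h (D i x))"
    proof (rule step[OF W g gs gk g'])
      show "D' i ` carrier (C' (Suc i)) = carrier ?W" by simp
      show "(D' i x = \<zero>\<^bsub>?W\<^esub>) = (x \<in> ?Im' (Suc i))" if "x \<in> carrier (C' (Suc i))" for x
        using ex'[OF that] by simp
    qed
    then show "\<exists>h'. (h' \<in> gmod_iso A (C (Suc i)) (C' (Suc i)) \<and> h' ` ?Im (Suc i) = ?Im' (Suc i)) \<and>
        (\<forall>x\<in>carrier (C (Suc i)). D' i (h' x) = h (D i x))" by (elim exE conjE) (intro exI conjI)
  qed
  then obtain h where "\<forall>i. (h i \<in> gmod_iso A (C i) (C' i) \<and> h i ` ?Im i = ?Im' i) \<and>
      (\<forall>x\<in>carrier (C (Suc i)). D' i (h (Suc i) x) = h i (D i x))" by (elim exE)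
  then show ?thesis by (intro exI[of _ h]) simp
qed

end

section \<open>Preimages, direct sums, and resolutions in terms of elements\<close>

lemma submodule_preimage:
  assumes "graded_left_module R M" "graded_left_module R N" "h \<in> gmod_hom R M N" "graded_submodule R N H"
  shows "graded_submodule R M {x \<in> carrier M. h x \<in> H}"
proof -
  interpret M: graded_left_module R M by fact
  interpret N: graded_left_module R N by fact
  have sm: "submodule H R N" and gr: "\<And>x n. x \<in> H \<Longrightarrow> N.mgr.cp x n \<in> H"
    using assms(4) by (auto simp: graded_submodule_def)
  have "submodule {x \<in> carrier M. h x \<in> H} R M"
    by (rule M.submoduleI')
      (use submoduleD[OF sm] in \<open>auto simp: gmod_hom_zero[OF assms(1-3)] gmod_homD[OF assms(3)] M.lsmult_closed\<close>)
  then show ?thesis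
    unfolding graded_submodule_def
    using gmod_hom_gcomp[OF assms(1-3), symmetric] gr by auto
qed

lemma gsum_pair_hom:
  assumes "h \<in> gmod_hom R M U" "k \<in> gmod_hom R M V"
  shows "(\<lambda>x. (h x, k x)) \<in> gmod_hom R M (gsum U V)"
  by (rule gmod_homI) (simp_all add: gmod_homD[OF assms(1)] gmod_homD[OF assms(2)])

lemma gsum_fst_hom: "fst \<in> gmod_hom R (gsum U V) U"
  by (rule gmod_homI) auto

lemma gsum_snd_hom: "snd \<in> gmod_hom R (gsum U V) V"
  by (rule gmod_homI) auto

lemma gmod_hom_const_zero:
  assumes "graded_left_module R N"
  shows "(\<lambda>_. \<zero>\<^bsub>N\<^esub>) \<in> gmod_hom R M N"
proof -
  interpret N: graded_left_module R N by fact
  show ?thesis by (rule gmod_homI) auto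
qed

text \<open>Lift on both summands and add. This is the form in which projectivity of the modules
  \<open>T i\<close> enters later.\<close>

lemma gsum_lifting:
  assumes L1: "graded_free R L1" and L2: "graded_free R L2"
    and U: "graded_left_module R U" and V: "graded_left_module R V"
    and g: "g \<in> gmod_hom R U V" "g ` carrier U = carrier V" and h: "h \<in> gmod_hom R (gsum L1 L2) V"
  shows "\<exists>k\<in>gmod_hom R (gsum L1 L2) U. \<forall>x\<in>carrier (gsum L1 L2). g (k x) = h x"
proof -
  note G1 = graded_free_glm[OF L1] and G2 = graded_free_glm[OF L2]
  interpret G1: graded_left_module R L1 by (rule G1)
  interpret G2: graded_left_module R L2 by (rule G2)
  have h1: "(\<lambda>x. h (x, \<zero>\<^bsub>L2\<^esub>)) \<in> gmod_hom R L1 V"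
    by (rule gmod_hom_comp[OF gsum_pair_hom[OF gmod_hom_id gmod_hom_const_zero[OF G2]] h])
  have h2: "(\<lambda>y. h (\<zero>\<^bsub>L1\<^esub>, y)) \<in> gmod_hom R L2 V"
    by (rule gmod_hom_comp[OF gsum_pair_hom[OF gmod_hom_const_zero[OF G1] gmod_hom_id] h])
  obtain k1 where k1: "k1 \<in> gmod_hom R L1 U" "\<And>x. x \<in> carrier L1 \<Longrightarrow> g (k1 x) = h (x, \<zero>\<^bsub>L2\<^esub>)"
    using graded_free_lifting[OF L1 U V g h1] by (elim bexE) simp
  obtain k2 where k2: "k2 \<in> gmod_hom R L2 U" "\<And>x. x \<in> carrier L2 \<Longrightarrow> g (k2 x) = h (\<zero>\<^bsub>L1\<^esub>, x)"
    using graded_free_lifting[OF L2 U V g h2] by (elim bexE) simp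
  let ?k = "\<lambda>z. k1 (fst z) \<oplus>\<^bsub>U\<^esub> k2 (snd z)"
  have k: "?k \<in> gmod_hom R (gsum L1 L2) U"
    by (rule gmod_hom_add[OF U gmod_hom_comp[OF gsum_fst_hom k1(1)] gmod_hom_comp[OF gsum_snd_hom k2(1)]])
  have "g (?k z) = h z" if z: "z \<in> carrier (gsum L1 L2)" for z
  proof -
    obtain x y where xy: "z = (x, y)" "x \<in> carrier L1" "y \<in> carrier L2" using z by (cases z) auto
    have "g (?k z) = h (x, \<zero>\<^bsub>L2\<^esub>) \<oplus>\<^bsub>V\<^esub> h (\<zero>\<^bsub>L1\<^esub>, y)"
      using xy k1 k2 gmod_homD(1)[OF k1(1)] gmod_homD(1)[OF k2(1)] by (simp add: gmod_homD(2)[OF g(1)])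
    also have "\<dots> = h ((x, \<zero>\<^bsub>L2\<^esub>) \<oplus>\<^bsub>gsum L1 L2\<^esub> (\<zero>\<^bsub>L1\<^esub>, y))"
      using xy by (intro gmod_homD(2)[OF h, symmetric]) auto
    also have "\<dots> = h z" using xy by simp
    finally show ?thesis .
  qed
  then show ?thesis using k by (intro bexI[of _ ?k]) simp_all
qed

lemma is_resolutionD:
  assumes "is_resolution R N P \<epsilon>"
  shows "graded_left_module R (cobj P i)" "cdiff P i \<in> gmod_hom R (cobj P (Suc i)) (cobj P i)"
    "x \<in> carrier (cobj P (Suc i)) \<Longrightarrow> cdiff P i x = \<zero>\<^bsub>cobj P i\<^esub> \<longleftrightarrow> x \<in> cdiff P (Suc i) ` carrier (cobj P (Suc (Suc i)))"
    "\<epsilon> \<in> gmod_hom R (cobj P 0) N" "\<epsilon> ` carrier (cobj P 0) = carrier N"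
    "x \<in> carrier (cobj P 0) \<Longrightarrow> \<epsilon> x = \<zero>\<^bsub>N\<^esub> \<longleftrightarrow> x \<in> cdiff P 0 ` carrier (cobj P (Suc 0))"
proof -
  note R = assms[unfolded is_resolution_def is_complex_def]
  show "graded_left_module R (cobj P i)" "cdiff P i \<in> gmod_hom R (cobj P (Suc i)) (cobj P i)"
    "\<epsilon> \<in> gmod_hom R (cobj P 0) N" "\<epsilon> ` carrier (cobj P 0) = carrier N"
    using R by simp_all
  have "{x \<in> carrier (cobj P (Suc i)). cdiff P i x = \<zero>\<^bsub>cobj P i\<^esub>} = cdiff P (Suc i) ` carrier (cobj P (Suc (Suc i)))"
    using R by simp
  then show "cdiff P i x = \<zero>\<^bsub>cobj P i\<^esub> \<longleftrightarrow> x \<in> cdiff P (Suc i) ` carrier (cobj P (Suc (Suc i)))"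
    if "x \<in> carrier (cobj P (Suc i))" using that by blast
  have "{x \<in> carrier (cobj P 0). \<epsilon> x = \<zero>\<^bsub>N\<^esub>} = cdiff P 0 ` carrier (cobj P (Suc 0))"
    using R by simp
  then show "\<epsilon> x = \<zero>\<^bsub>N\<^esub> \<longleftrightarrow> x \<in> cdiff P 0 ` carrier (cobj P (Suc 0))" if "x \<in> carrier (cobj P 0)"
    using that by blast
qed

section \<open>Syzygies over the quotient and over the ring\<close>

context mf_setting
begin

text \<open>Since \<open>f (a x) = \<sigma>\<^sup>-\<^sup>1(a) f x\<close>, applying \<open>\<sigma>\<close> to the coordinates of \<open>f x\<close> gives linear maps.\<close>

lemma f_coordinate:
  fixes G :: "('a, 'b) gmodule"
  assumes G: "graded_left_module A G" and Y: "free_basis A (gsub G H) Y"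
    and fH: "\<And>x. x \<in> carrier G \<Longrightarrow> f \<odot>\<^bsub>G\<^esub> x \<in> H"
  defines "\<xi> y x \<equiv> \<sigma> (coef A (gsub G H) Y (f \<odot>\<^bsub>G\<^esub> x) y)"
  shows "y \<in> Y \<Longrightarrow> \<xi> y \<in> gmod_hom A G (gshift (e - bdeg (gsub G H) y) (reg_module A))"
    "x \<in> H \<Longrightarrow> \<exists>c\<in>carrier A. \<xi> y x = f \<otimes> c"
    "\<lbrakk>x \<in> carrier G; \<And>y. y \<in> Y \<Longrightarrow> \<xi> y x \<in> irrelevant_ideal A\<rbrakk> \<Longrightarrow> f \<odot>\<^bsub>G\<^esub> x \<in> irr_span A (gsub G H)"
proof -
  interpret G: graded_left_module A G by (rule G)
  interpret H: free_basis A "gsub G H" Y by (rule Y)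
  interpret HP: pos_graded_module A "gsub G H" by (rule pgm[OF H.graded_left_module_axioms])
  have fK: "f \<odot>\<^bsub>G\<^esub> x \<in> carrier (gsub G H)" if "x \<in> carrier G" for x using fH[OF that] by simp
  note cfc = H.cf_closed[OF fK]
  show "\<xi> y \<in> gmod_hom A G (gshift (e - bdeg (gsub G H) y) (reg_module A))" if y: "y \<in> Y"
  proof (rule gmod_homI)
    show "\<xi> y x \<in> carrier (gshift (e - bdeg (gsub G H) y) (reg_module A))" if "x \<in> carrier G" for x
      unfolding \<xi>_def using cfc[OF that] by simp
    show "\<xi> y (x \<oplus>\<^bsub>G\<^esub> z) = \<xi> y x \<oplus>\<^bsub>gshift (e - bdeg (gsub G H) y) (reg_module A)\<^esub> \<xi> y z"
      if "x \<in> carrier G" "z \<in> carrier G" for x z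
      using H.cf_add[OF fK[OF that(1)] fK[OF that(2)], of y] cfc[OF that(1)] cfc[OF that(2)] that
      by (simp add: \<xi>_def G.lsmult_r_distr \<sigma>_add)
    show "\<xi> y (a \<odot>\<^bsub>G\<^esub> x) = a \<odot>\<^bsub>gshift (e - bdeg (gsub G H) y) (reg_module A)\<^esub> \<xi> y x"
      if a: "a \<in> carrier A" and x: "x \<in> carrier G" for a x
      using H.cf_smult[OF fK[OF x] \<sigma>i_closed[OF a], of y] cfc[OF x] a
      by (simp add: \<xi>_def f_smult_twist_i[OF G a x] \<sigma>_mult)
    show "\<xi> y x \<in> mpart (gshift (e - bdeg (gsub G H) y) (reg_module A)) n" if x: "x \<in> mpart G n" for x n
    proof -
      have "f \<odot>\<^bsub>G\<^esub> x \<in> mpart (gsub G H) (e + n)"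
        using G.mpart_smult[OF f_deg x] fH[OF G.mgr.D_carrier[OF x]] by simp
      from \<sigma>_part'[OF H.cf_graded[OF this y]] show ?thesis by (simp add: \<xi>_def algebra_simps)
    qed
  qed
  show "\<exists>c\<in>carrier A. \<xi> y x = f \<otimes> c" if x: "x \<in> H"
  proof -
    have xk: "x \<in> carrier (gsub G H)" using x by simp
    have "coef A (gsub G H) Y (f \<odot>\<^bsub>G\<^esub> x) y = f \<otimes> H.cf x y" using H.cf_smult[OF xk fc, of y] by simp
    then have "\<xi> y x = f \<otimes> \<sigma> (H.cf x y)" unfolding \<xi>_def using \<sigma>_mult[OF fc H.cf_closed[OF xk]] by simp
    then show ?thesis using \<sigma>_closed[OF H.cf_closed[OF xk]] by blast
  qed
  show "f \<odot>\<^bsub>G\<^esub> x \<in> irr_span A (gsub G H)"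
    if x: "x \<in> carrier G" and irr: "\<And>y. y \<in> Y \<Longrightarrow> \<xi> y x \<in> irrelevant_ideal A"
  proof -
    have "finsum (gsub G H) (\<lambda>y. H.cf (f \<odot>\<^bsub>G\<^esub> x) y \<odot>\<^bsub>gsub G H\<^esub> y) {y. H.cf (f \<odot>\<^bsub>G\<^esub> x) y \<noteq> \<zero>} \<in> irr_span A (gsub G H)"
    proof (rule HP.irr_span_finsum[OF H.cf_finite[OF fK[OF x]]])
      fix y assume "y \<in> {y. H.cf (f \<odot>\<^bsub>G\<^esub> x) y \<noteq> \<zero>}"
      then have y: "y \<in> Y" using H.supp_subset[OF fK[OF x]] by blast
      have "H.cf (f \<odot>\<^bsub>G\<^esub> x) y \<in> irrelevant_ideal A"
        using \<sigma>i_irr[OF irr[OF y]] cfc[OF x] by (simp add: \<xi>_def)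
      then show "H.cf (f \<odot>\<^bsub>G\<^esub> x) y \<odot>\<^bsub>gsub G H\<^esub> y \<in> irr_span A (gsub G H)"
        by (rule HP.irr_span_smult[OF _ H.basis_carrier[OF y]])
    qed
    then show ?thesis unfolding H.cf_sum[OF fK[OF x]] .
  qed
qed

end

text \<open>\<open>G i\<close> is the free module over the ring that covers the \<open>i\<close>-th term \<open>Qm i\<close> of a minimal resolution over the
  quotient by \<open>f\<close>, and \<open>D\<close> lifts the differential. The \<open>K i\<close> are up to isomorphism the syzygies of the
  resolution over the ring with terms \<open>G (i + 1) \<oplus> G i\<^sup>t\<^sup>w\<close>.\<close>

locale mf_tower = mf_setting A f e \<sigma> for A :: "'a gring" (structure) and f e \<sigma> +
  fixes r :: "nat \<Rightarrow> nat" and \<delta> :: "nat \<Rightarrow> nat \<Rightarrow> int" and Qm :: "nat \<Rightarrow> ('a, 'q) gmodule"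
    and d :: "nat \<Rightarrow> 'q \<Rightarrow> 'q" and q :: "nat \<Rightarrow> (nat \<Rightarrow> 'a) \<Rightarrow> 'q" and D :: "nat \<Rightarrow> (nat \<Rightarrow> 'a) \<Rightarrow> nat \<Rightarrow> 'a"
  assumes cover: "\<And>i. rel_cover (Fr A (r i) (\<delta> i)) (Qm i) (q i)"
    and d_hom: "\<And>i. d i \<in> gmod_hom A (Qm (Suc i)) (Qm i)"
    and d_exact: "\<And>i x. x \<in> carrier (Qm (Suc i)) \<Longrightarrow>
      d i x = \<zero>\<^bsub>Qm i\<^esub> \<longleftrightarrow> x \<in> d (Suc i) ` carrier (Qm (Suc (Suc i)))"
    and d_min: "\<And>i. d i ` carrier (Qm (Suc i)) \<subseteq> irr_span A (Qm i)"
    and D_hom: "\<And>i. D i \<in> gmod_hom A (Fr A (r (Suc i)) (\<delta> (Suc i))) (Fr A (r i) (\<delta> i))"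
    and D_lift: "\<And>i x. x \<in> carrier (Fr A (r (Suc i)) (\<delta> (Suc i))) \<Longrightarrow> q i (D i x) = d i (q (Suc i) x)"
begin

abbreviation G where "G i \<equiv> Fr A (r i) (\<delta> i)"

definition K where "K i = {x \<in> carrier (G i). q i x \<in> d i ` carrier (Qm (Suc i))}"

abbreviation KM where "KM i \<equiv> gsub (G i) (K i)"

abbreviation T where "T i \<equiv> gsum (G (Suc i)) (tws (G i))"

text \<open>\<open>K i\<close> is generated by the image of \<open>D i\<close> and by
  \<open>f G i\<close>; this is the corresponding cover. It is linear because the second summand of
  \<open>T i\<close> is twisted.\<close>

definition gT where "gT i z = D i (fst z) \<oplus>\<^bsub>G i\<^esub> f \<odot>\<^bsub>G i\<^esub> snd z"

lemma free_G: "graded_free A (G i)"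
  by (rule graded_free_Fr[OF nontrivial])

lemma glm_G: "graded_left_module A (G i)"
  by (rule glm_Fr)

lemma glm_Qm: "graded_left_module A (Qm i)"
  by (rule rel_coverD(3)[OF cover])

lemma q_hom: "q i \<in> gmod_hom A (G i) (Qm i)"
  by (rule rel_coverD(4)[OF cover])

lemma q_surj: "q i ` carrier (G i) = carrier (Qm i)"
  by (rule rel_coverD(5)[OF cover])

lemma q_ker: "x \<in> carrier (G i) \<Longrightarrow> q i x = \<zero>\<^bsub>Qm i\<^esub> \<longleftrightarrow> x \<in> fim (G i)"
  by (rule rel_coverD(6)[OF cover])

lemma im_d_gsub: "graded_submodule A (Qm i) (d i ` carrier (Qm (Suc i)))"
  by (rule submodule_himage[OF glm_Qm glm_Qm d_hom])

lemma K_graded: "graded_submodule A (G i) (K i)"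
  unfolding K_def by (rule submodule_preimage[OF glm_G glm_Qm q_hom im_d_gsub])

lemma K_submodule: "submodule (K i) A (G i)"
  using K_graded by (simp add: graded_submodule_def)

lemma K_carrier: "x \<in> K i \<Longrightarrow> x \<in> carrier (G i)"
  unfolding K_def by (elim CollectE conjE)

lemma glm_KM: "graded_left_module A (KM i)"
  by (rule glm_gsub[OF glm_G K_graded])

lemma q_zero_K:
  assumes "x \<in> carrier (G i)" "q i x = \<zero>\<^bsub>Qm i\<^esub>"
  shows "x \<in> K i"
proof -
  have "submodule (d i ` carrier (Qm (Suc i))) A (Qm i)" using im_d_gsub by (simp add: graded_submodule_def)
  then show ?thesis using submoduleD(2) assms unfolding K_def by (intro CollectI conjI) auto
qed

lemma f_smult_K:
  assumes "y \<in> carrier (G i)"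
  shows "f \<odot>\<^bsub>G i\<^esub> y \<in> K i"
proof -
  interpret G: graded_left_module A "G i" by (rule glm_G)
  have c: "f \<odot>\<^bsub>G i\<^esub> y \<in> carrier (G i)" by (rule G.lsmult_closed[OF fc assms])
  have "f \<odot>\<^bsub>G i\<^esub> y \<in> fim (G i)" unfolding fim_def by (rule imageI[OF assms])
  then show ?thesis using q_zero_K[OF c] q_ker[OF c] by simp
qed

lemma D_K:
  assumes "x \<in> carrier (G (Suc i))"
  shows "D i x \<in> K i"
proof -
  have "d i (q (Suc i) x) \<in> d i ` carrier (Qm (Suc i))" by (rule imageI[OF gmod_homD(1)[OF q_hom assms]])
  then show ?thesis using gmod_homD(1)[OF D_hom assms] D_lift[OF assms] unfolding K_def by (intro CollectI conjI) auto
qed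

text \<open>Exactness over the quotient. Together with \<open>q_ker\<close> it says that
  \<open>D i x\<close> is a multiple of f, which is what identifies the kernel of
  \<open>gT i\<close>.\<close>

lemma K_Suc_iff:
  assumes "x \<in> carrier (G (Suc i))"
  shows "x \<in> K (Suc i) \<longleftrightarrow> q i (D i x) = \<zero>\<^bsub>Qm i\<^esub>"
proof -
  have "x \<in> K (Suc i) \<longleftrightarrow> q (Suc i) x \<in> d (Suc i) ` carrier (Qm (Suc (Suc i)))"
    using assms unfolding K_def by blast
  also have "\<dots> \<longleftrightarrow> q i (D i x) = \<zero>\<^bsub>Qm i\<^esub>"
    using d_exact[OF gmod_homD(1)[OF q_hom assms]] D_lift[OF assms] by simp
  finally show ?thesis .
qed

text \<open>Modulo \<open>f G i\<close> an element of \<open>K i\<close> agrees with an element of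
  \<open>A_+ G i\<close>, because the resolution over the quotient is minimal; and
  \<open>f G i\<close> lies in \<open>A_+ G i\<close> as well, f having positive degree.\<close>

lemma K_irr: "K i \<subseteq> irr_span A (G i)"
proof
  fix x assume x: "x \<in> K i"
  interpret G: pos_graded_module A "G i" by (rule pgm[OF glm_G])
  interpret Q: pos_graded_module A "Qm i" by (rule pgm[OF glm_Qm])
  note xc = K_carrier[OF x]
  have "q i x \<in> irr_span A (Qm i)" using x d_min[of i] unfolding K_def by blast
  then obtain z where z: "z \<in> irr_span A (G i)" "q i z = q i x"
    using irr_span_hom_onto[OF G.pos_graded_module_axioms Q.pos_graded_module_axioms q_hom q_surj] by blast
  note zc = G.irr_span_carrier[OF z(1)]
  have dc: "x \<ominus>\<^bsub>G i\<^esub> z \<in> carrier (G i)" by (rule G.M.minus_closed[OF xc zc])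
  have "q i (x \<ominus>\<^bsub>G i\<^esub> z) = \<zero>\<^bsub>Qm i\<^esub>"
    using gmod_hom_eq_diff[OF glm_G glm_Qm q_hom xc zc] z(2) gmod_homD(1)[OF q_hom xc]
    by (simp add: a_minus_def Q.M.r_neg)
  then obtain y where y: "y \<in> carrier (G i)" "x \<ominus>\<^bsub>G i\<^esub> z = f \<odot>\<^bsub>G i\<^esub> y"
    using q_ker[OF dc] unfolding fim_def by blast
  have "x = (x \<ominus>\<^bsub>G i\<^esub> z) \<oplus>\<^bsub>G i\<^esub> z" using xc zc by (simp add: a_minus_def G.M.a_assoc G.M.l_neg del: Fr_simps)
  also have "\<dots> \<in> irr_span A (G i)"
    unfolding y(2) by (intro G.irr_span_add z(1) G.irr_span_smult f_irr y(1))
  finally show "x \<in> irr_span A (G i)" .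
qed

lemma glm_T: "graded_left_module A (T i)"
  by (intro glm_gsum glm_G glm_tws)

lemma T_lifting:
  assumes "graded_left_module A U" "graded_left_module A V" "g \<in> gmod_hom A U V" "g ` carrier U = carrier V"
    "h \<in> gmod_hom A (T i) V"
  shows "\<exists>k\<in>gmod_hom A (T i) U. \<forall>x\<in>carrier (T i). g (k x) = h x"
  by (rule gsum_lifting[OF free_G graded_free_tws[OF free_G] assms])

lemma gT_hom: "gT i \<in> gmod_hom A (T i) (KM i)"
proof -
  interpret G: graded_left_module A "G i" by (rule glm_G)
  interpret T: graded_left_module A "T i" by (rule glm_T)
  have "gT i \<in> gmod_hom A (T i) (G i)"
    unfolding gT_def
    by (rule gmod_hom_add[OF glm_G gmod_hom_comp[OF gsum_fst_hom D_hom]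
        gmod_hom_comp[OF gsum_snd_hom left_mult_hom[OF glm_G]]])
  then show ?thesis
  proof (rule gmod_hom_gsub_cod)
    fix z assume z: "z \<in> carrier (T i)"
    then have "fst z \<in> carrier (G (Suc i))" "snd z \<in> carrier (G i)" by (auto simp del: Fr_simps)
    then show "gT i z \<in> K i"
      unfolding gT_def by (intro submoduleD(3)[OF K_submodule] D_K f_smult_K)
  qed (rule T.mgr.D_carrier)
qed

lemma gT_surj: "gT i ` carrier (T i) = carrier (KM i)"
proof
  show "gT i ` carrier (T i) \<subseteq> carrier (KM i)" using gmod_homD(1)[OF gT_hom] by (intro image_subsetI)
  interpret G: graded_left_module A "G i" by (rule glm_G)
  interpret Q: graded_left_module A "Qm i" by (rule glm_Qm)
  show "carrier (KM i) \<subseteq> gT i ` carrier (T i)"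
  proof
    fix k assume "k \<in> carrier (KM i)"
    then have k: "k \<in> K i" by simp
    note kc = K_carrier[OF k]
    have "q i k \<in> d i ` carrier (Qm (Suc i))" using k unfolding K_def by blast
    then obtain w where w: "w \<in> carrier (Qm (Suc i))" "q i k = d i w" by (rule imageE) simp
    have "w \<in> q (Suc i) ` carrier (G (Suc i))" unfolding q_surj by (rule w(1))
    then obtain x where x: "x \<in> carrier (G (Suc i))" "w = q (Suc i) x" by (rule imageE) simp
    note Dx = gmod_homD(1)[OF D_hom x(1)]
    have "q i (k \<ominus>\<^bsub>G i\<^esub> D i x) = \<zero>\<^bsub>Qm i\<^esub>"
      using gmod_hom_eq_diff[OF glm_G glm_Qm q_hom kc Dx] D_lift[OF x(1)] w(2) x(2) gmod_homD(1)[OF q_hom kc]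
      by (simp add: a_minus_def Q.M.r_neg)
    then obtain y where y: "y \<in> carrier (G i)" "k \<ominus>\<^bsub>G i\<^esub> D i x = f \<odot>\<^bsub>G i\<^esub> y"
      using q_ker[OF G.M.minus_closed[OF kc Dx]] unfolding fim_def by blast
    have "gT i (x, y) = D i x \<oplus>\<^bsub>G i\<^esub> (k \<ominus>\<^bsub>G i\<^esub> D i x)" unfolding gT_def y(2) by simp
    also have "\<dots> = k" using kc Dx by (simp add: a_minus_def G.M.a_lcomm G.M.r_neg del: Fr_simps)
    finally have "gT i (x, y) = k" .
    moreover have "(x, y) \<in> carrier (T i)" using x(1) y(1) by (simp del: Fr_simps)
    ultimately show "k \<in> gT i ` carrier (T i)" by (intro image_eqI[of _ _ "(x, y)"]) simp_all
  qed
qed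

text \<open>On \<open>K (i + 1)\<close> the map \<open>D i\<close> is divisible by f, say
  \<open>D i = f \<theta>\<close>, with \<theta> unique since f acts injectively on
  \<open>G i\<close>. The kernel of \<open>gT i\<close> consists of the pairs of x and
  \<open>- \<theta> x\<close> for x in \<open>K (i + 1)\<close>, so the next syzygy over A is
  \<open>K (i + 1)\<close> again.\<close>

lemma jT_exists:
  "\<exists>j. j \<in> gmod_hom A (KM (Suc i)) (T i) \<and> inj_on j (carrier (KM (Suc i))) \<and>
     j ` carrier (KM (Suc i)) = hker (T i) (KM i) (gT i)"
proof -
  interpret G: graded_left_module A "G i" by (rule glm_G)
  interpret TG: graded_left_module A "tws (G i)" by (rule glm_tws[OF glm_G])
  have Kc: "K (Suc i) \<subseteq> carrier (G (Suc i))" using K_carrier by blast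
  have "\<exists>\<theta>\<in>gmod_hom A (KM (Suc i)) (tws (G i)). \<forall>x\<in>carrier (KM (Suc i)). f \<odot>\<^bsub>G i\<^esub> \<theta> x = D i x"
  proof (rule factor_through_injection[OF glm_KM glm_tws[OF glm_G] glm_G left_mult_hom[OF glm_G] _
        gmod_hom_gsub_dom[OF D_hom Kc]])
    show "inj_on (\<lambda>x. f \<odot>\<^bsub>G i\<^esub> x) (carrier (tws (G i)))"
      using f_inj[OF free_G] by (auto simp: inj_on_def simp del: Fr_simps)
    fix x assume "x \<in> carrier (KM (Suc i))"
    then have x: "x \<in> K (Suc i)" by simp
    note xc = K_carrier[OF x]
    have "D i x \<in> fim (G i)" using K_Suc_iff[OF xc] x q_ker[OF gmod_homD(1)[OF D_hom xc]] by simp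
    then show "D i x \<in> (\<lambda>x. f \<odot>\<^bsub>G i\<^esub> x) ` carrier (tws (G i))" unfolding fim_def by (simp del: Fr_simps)
  qed
  then obtain \<theta> where \<theta>: "\<theta> \<in> gmod_hom A (KM (Suc i)) (tws (G i))"
    "\<And>x. x \<in> K (Suc i) \<Longrightarrow> f \<odot>\<^bsub>G i\<^esub> \<theta> x = D i x" by (elim bexE) simp
  have \<theta>c: "\<theta> x \<in> carrier (G i)" if "x \<in> K (Suc i)" for x
    using gmod_homD(1)[OF \<theta>(1), of x] that by (simp del: Fr_simps)
  have inv: "\<ominus>\<^bsub>tws (G i)\<^esub> y = \<ominus>\<^bsub>G i\<^esub> y" for y by (rule a_inv_cong) auto
  define j where "j x = (x, \<ominus>\<^bsub>tws (G i)\<^esub> \<theta> x)" for x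
  have j: "j \<in> gmod_hom A (KM (Suc i)) (T i)"
    unfolding j_def
    by (rule gsum_pair_hom[OF gmod_hom_gsub_dom[OF gmod_hom_id Kc] gmod_hom_uminus[OF glm_tws[OF glm_G] \<theta>(1)]])
  have "j ` carrier (KM (Suc i)) = hker (T i) (KM i) (gT i)"
  proof
    show "j ` carrier (KM (Suc i)) \<subseteq> hker (T i) (KM i) (gT i)"
    proof
      fix z assume "z \<in> j ` carrier (KM (Suc i))"
      then obtain x where x: "x \<in> K (Suc i)" "z = j x" by auto
      have Dc: "D i x \<in> carrier (G i)" by (rule gmod_homD(1)[OF D_hom K_carrier[OF x(1)]])
      have "gT i z = D i x \<oplus>\<^bsub>G i\<^esub> \<ominus>\<^bsub>G i\<^esub> (f \<odot>\<^bsub>G i\<^esub> \<theta> x)"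
        unfolding x(2) j_def gT_def inv using \<theta>c[OF x(1)] by (simp add: G.lsmult_r_minus del: Fr_simps)
      also have "\<dots> = \<zero>\<^bsub>G i\<^esub>" unfolding \<theta>(2)[OF x(1)] by (rule G.M.r_neg[OF Dc])
      finally show "z \<in> hker (T i) (KM i) (gT i)"
        using gmod_homD(1)[OF j] x by (simp add: hker_def del: Fr_simps)
    qed
    show "hker (T i) (KM i) (gT i) \<subseteq> j ` carrier (KM (Suc i))"
    proof
      fix z assume z: "z \<in> hker (T i) (KM i) (gT i)"
      obtain x y where xy: "z = (x, y)" by (cases z)
      have c: "x \<in> carrier (G (Suc i))" "y \<in> carrier (G i)" and eq: "D i x \<oplus>\<^bsub>G i\<^esub> f \<odot>\<^bsub>G i\<^esub> y = \<zero>\<^bsub>G i\<^esub>"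
        using z unfolding xy by (auto simp: hker_def gT_def simp del: Fr_simps)
      have Dc: "D i x \<in> carrier (G i)" by (rule gmod_homD(1)[OF D_hom c(1)])
      have fy: "f \<odot>\<^bsub>G i\<^esub> y \<in> carrier (G i)" by (rule G.lsmult_closed[OF fc c(2)])
      have "\<ominus>\<^bsub>G i\<^esub> (f \<odot>\<^bsub>G i\<^esub> y) = D i x" by (rule G.M.minus_equality[OF eq fy Dc])
      then have Dx: "D i x = f \<odot>\<^bsub>G i\<^esub> (\<ominus>\<^bsub>G i\<^esub> y)" using G.lsmult_r_minus[OF fc c(2)] by simp
      have "D i x \<in> fim (G i)" unfolding fim_def Dx by (rule imageI[OF G.M.a_inv_closed[OF c(2)]])
      then have xK: "x \<in> K (Suc i)" using K_Suc_iff[OF c(1)] q_ker[OF Dc] by simp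
      have "\<theta> x = \<ominus>\<^bsub>G i\<^esub> y"
        by (rule f_inj[OF free_G \<theta>c[OF xK] G.M.a_inv_closed[OF c(2)]]) (simp only: \<theta>(2)[OF xK] Dx)
      then have "z = j x" unfolding xy j_def inv using G.M.minus_minus[OF c(2)] by simp
      then show "z \<in> j ` carrier (KM (Suc i))" using xK by simp
    qed
  qed
  moreover have "inj_on j (carrier (KM (Suc i)))" by (simp add: inj_on_def j_def)
  ultimately show ?thesis using j by (intro exI[of _ j] conjI)
qed

text \<open>By \<open>syzygy_step\<close> the identity of \<open>KM n\<close> factors, up to a free module, through the last term of \<open>P\<close>.\<close>

lemma pd_split:
  fixes N :: "('a, 'm) gmodule" and P :: "('a, 'p) gcomplex"
  assumes N: "graded_left_module A N" and g0: "g0 \<in> gmod_hom A (G 0) N" "g0 ` carrier (G 0) = carrier N"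
    "\<And>x. x \<in> carrier (G 0) \<Longrightarrow> g0 x = \<zero>\<^bsub>N\<^esub> \<longleftrightarrow> x \<in> K 0"
    and P: "projective_resolution A N P" and len: "\<And>i. i > Suc n \<Longrightarrow> carrier (cobj P i) = {\<zero>\<^bsub>cobj P i\<^esub>}"
  shows "\<exists>s\<in>gmod_hom A (KM n) (T n). \<forall>x\<in>carrier (KM n). gT n (s x) = x"
proof -
  have proj: "graded_projective A (cobj P i)" for i using P by (simp add: projective_resolution_def)
  obtain \<epsilon> where res: "is_resolution A N P \<epsilon>" using P by (auto simp: projective_resolution_def)
  note R = is_resolutionD[OF res]
  let ?PS = "\<lambda>i. gsub (cobj P i) (cdiff P i ` carrier (cobj P (Suc i)))"
  have PS: "graded_left_module A (?PS i)" for i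
    by (rule glm_gsub[OF R(1) submodule_himage[OF R(1) R(1) R(2)]])
  have PSsub: "cdiff P i ` carrier (cobj P (Suc i)) \<subseteq> carrier (cobj P i)" for i
    using gmod_homD(1)[OF R(2)] by blast
  have dP: "cdiff P i \<in> gmod_hom A (cobj P (Suc i)) (?PS i)" for i
    by (rule gmod_hom_gsub_cod[OF R(2) _ glm_mpart_carrier[OF R(1)]]) simp_all
  have dPs: "cdiff P i ` carrier (cobj P (Suc i)) = carrier (?PS i)" for i by simp
  have incl: "(\<lambda>x. x) \<in> gmod_hom A (?PS i) (cobj P i)" for i
    by (rule gmod_hom_gsub_dom[OF gmod_hom_id PSsub])
  have inclim: "(\<lambda>x. x) ` carrier (?PS (Suc i)) = hker (cobj P (Suc i)) (?PS i) (cdiff P i)" for i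
    using R(3) PSsub[of "Suc i"] by (auto simp: hker_def)
  have incl0: "(\<lambda>x. x) ` carrier (?PS 0) = hker (cobj P 0) N \<epsilon>"
    using R(6) PSsub[of 0] by (auto simp: hker_def)
  have K0: "(\<lambda>x. x) ` carrier (KM 0) = hker (G 0) N g0"
    using g0(3) K_carrier[of _ 0] by (auto simp: hker_def simp del: Fr_simps)
  interpret N: graded_left_module A N by (rule N)
  have K0c: "K 0 \<subseteq> carrier (G 0)" using K_carrier by blast
  have main: "\<exists>a\<in>gmod_hom A (KM i) (?PS i). \<exists>b\<in>gmod_hom A (?PS i) (KM i). \<exists>u\<in>gmod_hom A (KM i) (T i).
      \<forall>x\<in>carrier (KM i). x = b (a x) \<oplus>\<^bsub>KM i\<^esub> gT i (u x)" for i
  proof (induction i)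
    case 0
    show ?case
    \<comment> \<open>The comparison starts at N itself, with the identity in both directions and u
      = 0.\<close>
    proof (rule syzygy_step[OF glm_G[of 0] glm_T N glm_KM R(1)[of 0] N PS g0(1)
          gmod_hom_gsub_dom[OF gmod_hom_id K0c] inj_on_id2 K0 R(4) incl inj_on_id2 incl0 gmod_hom_id gmod_hom_id
          gmod_hom_const_zero[OF glm_G]])
      show "x = x \<oplus>\<^bsub>N\<^esub> g0 \<zero>\<^bsub>G 0\<^esub>" if "x \<in> carrier N" for x
        using that gmod_hom_zero[OF glm_G N g0(1)] by simp
      show "\<exists>k\<in>gmod_hom A (G 0) (cobj P 0). \<forall>x\<in>carrier (G 0). \<epsilon> (k x) = h x" if "h \<in> gmod_hom A (G 0) N" for h
        by (rule graded_free_lifting[OF free_G R(1) N R(4,5) that])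
      show "\<exists>k\<in>gmod_hom A (cobj P 0) (G 0). \<forall>x\<in>carrier (cobj P 0). g0 (k x) = h x"
        if "h \<in> gmod_hom A (cobj P 0) N" for h
        by (rule graded_projective_lifting[OF proj glm_G N g0(1,2) that])
      show "\<exists>k\<in>gmod_hom A (G 0) (T 0). \<forall>x\<in>carrier (G 0). gT 0 (k x) = h x" if "h \<in> gmod_hom A (G 0) (KM 0)" for h
        by (rule graded_free_lifting[OF free_G glm_T glm_KM gT_hom gT_surj that])
    qed
  next
    case (Suc i)
    obtain a b u where a: "a \<in> gmod_hom A (KM i) (?PS i)" and b: "b \<in> gmod_hom A (?PS i) (KM i)"
      and u: "u \<in> gmod_hom A (KM i) (T i)"
      and eq: "\<And>x. x \<in> carrier (KM i) \<Longrightarrow> x = b (a x) \<oplus>\<^bsub>KM i\<^esub> gT i (u x)"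
      using Suc by (elim bexE) simp
    obtain j where j: "j \<in> gmod_hom A (KM (Suc i)) (T i)" "inj_on j (carrier (KM (Suc i)))"
      "j ` carrier (KM (Suc i)) = hker (T i) (KM i) (gT i)" using jT_exists[of i] by (elim exE conjE)
    show ?case
    proof (rule syzygy_step[OF glm_T glm_T glm_KM glm_KM R(1) PS PS gT_hom j dP incl inj_on_id2 inclim a b u eq])
      show "\<exists>k\<in>gmod_hom A (T i) (cobj P (Suc i)). \<forall>x\<in>carrier (T i). cdiff P i (k x) = h x"
        if "h \<in> gmod_hom A (T i) (?PS i)" for h
        by (rule T_lifting[OF R(1) PS dP dPs that])
      show "\<exists>k\<in>gmod_hom A (cobj P (Suc i)) (T i). \<forall>x\<in>carrier (cobj P (Suc i)). gT i (k x) = h x"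
        if "h \<in> gmod_hom A (cobj P (Suc i)) (KM i)" for h
        by (rule graded_projective_lifting[OF proj glm_T glm_KM gT_hom gT_surj that])
      show "\<exists>k\<in>gmod_hom A (T i) (T (Suc i)). \<forall>x\<in>carrier (T i). gT (Suc i) (k x) = h x"
        if "h \<in> gmod_hom A (T i) (KM (Suc i))" for h
        by (rule T_lifting[OF glm_T glm_KM gT_hom gT_surj that])
    qed
  qed
  obtain a b u where a: "a \<in> gmod_hom A (KM n) (?PS n)" and b: "b \<in> gmod_hom A (?PS n) (KM n)"
    and u: "u \<in> gmod_hom A (KM n) (T n)"
    and eq: "\<And>x. x \<in> carrier (KM n) \<Longrightarrow> x = b (a x) \<oplus>\<^bsub>KM n\<^esub> gT n (u x)"
    using main[of n] by (elim bexE) simp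
  \<comment> \<open>Since P ends at place n + 1, its syzygy at place n is isomorphic to that last
    term, and maps from a projective module lift along \<open>gT n\<close>.\<close>
  have "inj_on (cdiff P n) (carrier (cobj P (Suc n)))"
  proof (rule gmod_hom_inj[OF R(1) R(1) R(2)])
    fix x assume "x \<in> carrier (cobj P (Suc n))" "cdiff P n x = \<zero>\<^bsub>cobj P n\<^esub>"
    then have "x \<in> cdiff P (Suc n) ` carrier (cobj P (Suc (Suc n)))" using R(3) by blast
    then have "x = cdiff P (Suc n) \<zero>\<^bsub>cobj P (Suc (Suc n))\<^esub>" using len[of "Suc (Suc n)"] by simp
    then show "x = \<zero>\<^bsub>cobj P (Suc n)\<^esub>" using gmod_hom_zero[OF R(1) R(1) R(2)] by simp
  qed
  then have iso: "cdiff P n \<in> gmod_iso A (cobj P (Suc n)) (?PS n)"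
    using dP by (simp add: gmod_iso_def bij_betw_def)
  show ?thesis
  proof (rule syzygy_last[OF glm_T glm_KM R(1) PS gT_hom iso a b u eq])
    show "\<exists>k\<in>gmod_hom A (cobj P (Suc n)) (T n). \<forall>x\<in>carrier (cobj P (Suc n)). gT n (k x) = h x"
      if "h \<in> gmod_hom A (cobj P (Suc n)) (KM n)" for h
      by (rule graded_projective_lifting[OF proj glm_T glm_KM gT_hom gT_surj that])
  qed
qed

section \<open>Freeness of split syzygies, and the inclusion of \<open>f G\<close> in
  \<open>A_+ K\<close>\<close>

lemma K_generators:
  "\<exists>S. finite S \<and> S \<subseteq> (\<Union>n. mpart (KM i) n) \<and> (\<forall>H'. submodule H' A (KM i) \<longrightarrow> S \<subseteq> H' \<longrightarrow> carrier (KM i) \<subseteq> H')"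
proof -
  interpret G: graded_left_module A "G i" by (rule glm_G)
  obtain S where S: "finite S" "S \<subseteq> K i" "S \<subseteq> (\<Union>n. mpart (G i) n)"
    "\<forall>H'. submodule H' A (G i) \<and> S \<subseteq> H' \<longrightarrow> K i \<subseteq> H'"
    using fgen_homogeneous[OF glm_G K_graded[of i] Fr_noetherian[OF noetherian K_submodule]] by (elim exE conjE)
  have "S \<subseteq> (\<Union>n. mpart (KM i) n)" using S(2,3) by (simp add: subset_iff del: Fr_simps)
  moreover have "carrier (KM i) \<subseteq> H'" if H': "submodule H' A (KM i)" and SH: "S \<subseteq> H'" for H'
  proof -
    note HD = submoduleD[OF H']
    have sub: "H' \<subseteq> carrier (G i)" using HD(1) K_carrier by auto
    have "submodule H' A (G i)"
    proof (rule G.submoduleI'[OF sub])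
      show "\<zero>\<^bsub>G i\<^esub> \<in> H'" using HD(2) by (simp del: Fr_simps)
      show "a \<oplus>\<^bsub>G i\<^esub> b \<in> H'" if "a \<in> H'" "b \<in> H'" for a b using HD(3)[OF that] by (simp del: Fr_simps)
      show "a \<odot>\<^bsub>G i\<^esub> b \<in> H'" if "a \<in> carrier A" "b \<in> H'" for a b using HD(4)[OF that] by (simp del: Fr_simps)
    qed
    then show ?thesis using S(4) SH by simp
  qed
  ultimately show ?thesis using S(1) by (intro exI[of _ S]) simp
qed

text \<open>A section of \<open>gT i\<close> yields a section of every cover by a finite free
  module: maps out of \<open>T i\<close> lift, so \<open>gT i\<close> lifts along that cover, and
  the lift is preceded by s. This is what \<open>free_of_split\<close> asks for.\<close>

lemma KM_free:
  assumes s: "s \<in> gmod_hom A (KM i) (T i)" "\<And>x. x \<in> carrier (KM i) \<Longrightarrow> gT i (s x) = x"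
  shows "graded_free A (KM i)"
proof -
  obtain S where S: "finite S" "S \<subseteq> (\<Union>n. mpart (KM i) n)"
    "\<forall>H'. submodule H' A (KM i) \<longrightarrow> S \<subseteq> H' \<longrightarrow> carrier (KM i) \<subseteq> H'" using K_generators[of i] by (elim exE conjE)
  have "\<exists>r' \<delta>' h. h \<in> gmod_iso A (Fr A r' \<delta>') (KM i)"
  proof (rule free_of_split[OF glm_KM S(1,2) _ degree_0_field])
    show "carrier (KM i) \<subseteq> H'" if "submodule H' A (KM i)" "S \<subseteq> H'" for H' using S(3) that by simp
    fix r' \<delta>' \<pi> assume \<pi>: "\<pi> \<in> gmod_hom A (Fr A r' \<delta>') (KM i)" "\<pi> ` carrier (Fr A r' \<delta>') = carrier (KM i)"
    obtain \<omega> where \<omega>: "\<omega> \<in> gmod_hom A (T i) (Fr A r' \<delta>')" "\<And>x. x \<in> carrier (T i) \<Longrightarrow> \<pi> (\<omega> x) = gT i x"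
      using T_lifting[OF glm_Fr glm_KM \<pi> gT_hom] by (elim bexE) (simp del: Fr_simps gsum_simps)
    show "\<exists>s\<in>gmod_hom A (KM i) (Fr A r' \<delta>'). \<forall>x\<in>carrier (KM i). \<pi> (s x) = x"
    proof (rule bexI[OF ballI gmod_hom_comp[OF s(1) \<omega>(1)]])
      fix x assume x: "x \<in> carrier (KM i)"
      show "\<pi> (\<omega> (s x)) = x" using \<omega>(2)[OF gmod_homD(1)[OF s(1) x]] s(2)[OF x] by simp
    qed
  qed
  then obtain r' \<delta>' h where "h \<in> gmod_iso A (Fr A r' \<delta>') (KM i)" by (elim exE)
  then show ?thesis by (rule graded_free_iso[OF graded_free_Fr[OF nontrivial] glm_KM])
qed

text \<open>A coordinate \<xi> of x |-> f x with respect to a basis of \<open>K (i + 1)\<close>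
  sends \<open>K (i + 1)\<close> into fA. Composing it with the first component \<open>s1\<close> of
  the splitting gives \<pi> on \<open>K i\<close>. Since \<open>s1\<close> takes
  \<open>f G i\<close> into \<open>K (i + 1)\<close>, the value \<pi>(f z) lies in fA, and even in
  \<open>f A_+\<close> when z lies in \<open>A_+ G i\<close>. As \<open>K i\<close> is contained in
  \<open>A_+ G i\<close>, cancelling f in \<pi>(f k) = f \<pi>(k) puts \<pi>(k) into
  \<open>A_+\<close>. Finally x0 differs from \<open>s1 (D i x0)\<close> by an element of
  \<open>K (i + 1)\<close>, so \<xi>(x0) lies in \<open>A_+\<close> too.\<close>

lemma minimal_next:
  assumes s: "s \<in> gmod_hom A (KM i) (T i)" "\<And>x. x \<in> carrier (KM i) \<Longrightarrow> gT i (s x) = x"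
    and free: "graded_free A (KM (Suc i))" and x0: "x0 \<in> carrier (G (Suc i))"
  shows "f \<odot>\<^bsub>G (Suc i)\<^esub> x0 \<in> irr_span A (KM (Suc i))"
proof -
  obtain Y where "graded_left_module A (KM (Suc i))" "graded_basis A (KM (Suc i)) Y"
    using free by (auto simp: graded_free_def)
  then have Y: "free_basis A (KM (Suc i)) Y" by (rule free_basisI)
  interpret G: pos_graded_module A "G i" by (rule pgm[OF glm_G])
  interpret G': graded_left_module A "G (Suc i)" by (rule glm_G)
  interpret Q: graded_left_module A "Qm i" by (rule glm_Qm)
  note coord = f_coordinate[OF glm_G Y f_smult_K]
  have irr: "\<sigma> (coef A (KM (Suc i)) Y (f \<odot>\<^bsub>G (Suc i)\<^esub> x0) y) \<in> irrelevant_ideal A" if y: "y \<in> Y" for y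
  proof -
    define \<xi> where "\<xi> x = \<sigma> (coef A (KM (Suc i)) Y (f \<odot>\<^bsub>G (Suc i)\<^esub> x) y)" for x
    have \<xi>: "\<xi> \<in> gmod_hom A (G (Suc i)) (gshift (e - bdeg (KM (Suc i)) y) (reg_module A))"
      unfolding \<xi>_def by (rule coord(1)[OF _ y])
    have \<xi>c: "\<xi> x \<in> carrier A" if "x \<in> carrier (G (Suc i))" for x
      using gmod_homD(1)[OF \<xi> that] by simp
    have \<xi>add: "\<xi> (x \<oplus>\<^bsub>G (Suc i)\<^esub> z) = \<xi> x \<oplus> \<xi> z"
      if "x \<in> carrier (G (Suc i))" "z \<in> carrier (G (Suc i))" for x z
      using gmod_homD(2)[OF \<xi> that] by (simp del: Fr_simps)
    have \<xi>sm: "\<xi> (a \<odot>\<^bsub>G (Suc i)\<^esub> x) = a \<otimes> \<xi> x" if "a \<in> carrier A" "x \<in> carrier (G (Suc i))" for a x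
      using gmod_homD(3)[OF \<xi> that] by (simp del: Fr_simps)
    have \<xi>K: "\<exists>c\<in>carrier A. \<xi> x = f \<otimes> c" if "x \<in> K (Suc i)" for x
      unfolding \<xi>_def by (rule coord(2)[OF _ that])
    define s1 where "s1 k = fst (s k)" for k
    define \<pi> where "\<pi> k = \<xi> (s1 k)" for k
    have s1h: "s1 \<in> gmod_hom A (KM i) (G (Suc i))" unfolding s1_def by (rule gmod_hom_comp[OF s(1) gsum_fst_hom])
    have s1c: "s1 k \<in> carrier (G (Suc i))" if "k \<in> K i" for k using gmod_homD(1)[OF s1h, of k] that by (simp del: Fr_simps)
    have s1add: "s1 (k \<oplus>\<^bsub>G i\<^esub> l) = s1 k \<oplus>\<^bsub>G (Suc i)\<^esub> s1 l" if "k \<in> K i" "l \<in> K i" for k l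
      using gmod_homD(2)[OF s1h, of k l] that by (simp del: Fr_simps)
    have s1sm: "s1 (a \<odot>\<^bsub>G i\<^esub> k) = a \<odot>\<^bsub>G (Suc i)\<^esub> s1 k" if "a \<in> carrier A" "k \<in> K i" for a k
      using gmod_homD(3)[OF s1h, of a k] that by (simp del: Fr_simps)
    have qDs1: "q i (D i (s1 k)) = q i k" if k: "k \<in> K i" for k
    proof -
      have sk: "s k \<in> carrier (T i)" using gmod_homD(1)[OF s(1), of k] k by simp
      then have c: "snd (s k) \<in> carrier (G i)" by (auto simp del: Fr_simps)
      have fc': "f \<odot>\<^bsub>G i\<^esub> snd (s k) \<in> carrier (G i)" by (rule G.lsmult_closed[OF fc c])
      have qf: "q i (f \<odot>\<^bsub>G i\<^esub> snd (s k)) = \<zero>\<^bsub>Qm i\<^esub>"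
        using q_ker[OF fc'] c unfolding fim_def by blast
      have "k = D i (s1 k) \<oplus>\<^bsub>G i\<^esub> f \<odot>\<^bsub>G i\<^esub> snd (s k)" using s(2)[of k] k unfolding gT_def s1_def by simp
      then have "q i k = q i (D i (s1 k)) \<oplus>\<^bsub>Qm i\<^esub> q i (f \<odot>\<^bsub>G i\<^esub> snd (s k))"
        using gmod_homD(2)[OF q_hom gmod_homD(1)[OF D_hom s1c[OF k]] fc'] by metis
      then show ?thesis using qf gmod_homD(1)[OF q_hom gmod_homD(1)[OF D_hom s1c[OF k]]] by simp
    qed
    \<comment> \<open>Modulo f the map \<open>s1\<close> is a right inverse of \<open>D i\<close> on
      \<open>K i\<close>, and \<open>f z\<close> is zero modulo f.\<close>
    have s1f: "s1 (f \<odot>\<^bsub>G i\<^esub> z) \<in> K (Suc i)" if z: "z \<in> carrier (G i)" for z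
    proof -
      have fz: "f \<odot>\<^bsub>G i\<^esub> z \<in> K i" by (rule f_smult_K[OF z])
      have "q i (f \<odot>\<^bsub>G i\<^esub> z) = \<zero>\<^bsub>Qm i\<^esub>"
        using q_ker[OF K_carrier[OF fz]] z unfolding fim_def by blast
      then show ?thesis using K_Suc_iff[OF s1c[OF fz]] qDs1[OF fz] by simp
    qed
    \<comment> \<open>The factor f has to stay on the left. Moving f past a scalar a turns a into
      \<open>\<sigma>i a\<close>, and \<open>\<sigma>i a \<otimes> f = f \<otimes> a\<close> brings
      back a itself, which lies in \<open>A_+\<close>.\<close>
    have claim: "\<exists>c\<in>irrelevant_ideal A. \<pi> (f \<odot>\<^bsub>G i\<^esub> z) = f \<otimes> c" if "z \<in> irr_span A (G i)" for z
      using that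
    proof (induction z rule: G.irr_span_induct)
      case zero
      have "s1 \<zero>\<^bsub>G i\<^esub> = \<zero>\<^bsub>G (Suc i)\<^esub>" using gmod_hom_zero[OF glm_KM glm_G s1h] by (simp del: Fr_simps)
      moreover have "\<xi> \<zero>\<^bsub>G (Suc i)\<^esub> = \<zero>"
        using \<xi>sm[OF zero_closed G'.M.zero_closed] \<xi>c[OF G'.M.zero_closed] G'.lsmult_r_null[OF zero_closed]
        by (simp del: Fr_simps)
      ultimately have "\<pi> (f \<odot>\<^bsub>G i\<^esub> \<zero>\<^bsub>G i\<^esub>) = f \<otimes> \<zero>"
        unfolding \<pi>_def G.lsmult_r_null[OF fc] by simp
      then show ?case by (intro bexI[of _ \<zero>]) simp_all
    next
      case (smult a z)
      have ac: "a \<in> carrier A" by (rule irr_closed[OF smult(1)])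
      have fz: "f \<odot>\<^bsub>G i\<^esub> z \<in> K i" by (rule f_smult_K[OF smult(2)])
      obtain c where c: "c \<in> carrier A" "\<pi> (f \<odot>\<^bsub>G i\<^esub> z) = f \<otimes> c"
        using \<xi>K[OF s1f[OF smult(2)]] unfolding \<pi>_def by blast
      have "\<pi> (f \<odot>\<^bsub>G i\<^esub> (a \<odot>\<^bsub>G i\<^esub> z)) = \<sigma>i a \<otimes> \<pi> (f \<odot>\<^bsub>G i\<^esub> z)"
        unfolding \<pi>_def f_smult_twist_i[OF glm_G ac smult(2)]
        using s1sm[OF \<sigma>i_closed[OF ac] fz] \<xi>sm[OF \<sigma>i_closed[OF ac] s1c[OF fz]] by simp
      also have "\<dots> = (\<sigma>i a \<otimes> f) \<otimes> c" unfolding c(2) using ac c(1) by (simp add: m_assoc)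
      also have "\<dots> = f \<otimes> (a \<otimes> c)" unfolding f_normal_\<sigma>i[OF ac] using ac c(1) by (simp add: m_assoc)
      finally show ?case using irr_mult_r[OF smult(1) c(1)] by blast
    next
      case (add z w)
      have zc: "z \<in> carrier (G i)" and wc: "w \<in> carrier (G i)" using add(1,2)[THEN G.irr_span_carrier] .
      obtain b c where bc: "b \<in> irrelevant_ideal A" "\<pi> (f \<odot>\<^bsub>G i\<^esub> z) = f \<otimes> b"
        "c \<in> irrelevant_ideal A" "\<pi> (f \<odot>\<^bsub>G i\<^esub> w) = f \<otimes> c" using add(3,4) by (elim bexE)
      have "\<pi> (f \<odot>\<^bsub>G i\<^esub> (z \<oplus>\<^bsub>G i\<^esub> w)) = \<pi> (f \<odot>\<^bsub>G i\<^esub> z) \<oplus> \<pi> (f \<odot>\<^bsub>G i\<^esub> w)"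
        unfolding \<pi>_def G.lsmult_r_distr[OF fc zc wc] s1add[OF f_smult_K[OF zc] f_smult_K[OF wc]]
        by (rule \<xi>add[OF s1c[OF f_smult_K[OF zc]] s1c[OF f_smult_K[OF wc]]])
      also have "\<dots> = f \<otimes> (b \<oplus> c)" unfolding bc(2,4) using bc(1,3) irr_closed by (simp add: r_distr)
      finally show ?case using irr_add[OF bc(1,3)] by blast
    qed
    have \<pi>irr: "\<pi> k \<in> irrelevant_ideal A" if k: "k \<in> K i" for k
    proof -
      obtain c where c: "c \<in> irrelevant_ideal A" "\<pi> (f \<odot>\<^bsub>G i\<^esub> k) = f \<otimes> c"
        using claim[OF subsetD[OF K_irr k]] by blast
      have "\<pi> (f \<odot>\<^bsub>G i\<^esub> k) = f \<otimes> \<pi> k" unfolding \<pi>_def s1sm[OF fc k] by (rule \<xi>sm[OF fc s1c[OF k]])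
      then have "f \<otimes> \<pi> k = f \<otimes> c" using c(2) by simp
      moreover have "\<pi> k \<in> carrier A" unfolding \<pi>_def by (rule \<xi>c[OF s1c[OF k]])
      ultimately have "\<pi> k = c" using irr_closed[OF c(1)] by (intro f_cancel[of "\<pi> k" c])
      then show ?thesis using c(1) by simp
    qed
    let ?k = "D i x0"
    have k: "?k \<in> K i" by (rule D_K[OF x0])
    note s1k = s1c[OF k]
    \<comment> \<open>x0 and \<open>s1 (D i x0)\<close> have the same image under \<open>D i\<close>
      modulo f, so their difference lies in \<open>K (i + 1)\<close>, where \<xi> takes values in
      fA.\<close>
    let ?z = "x0 \<ominus>\<^bsub>G (Suc i)\<^esub> s1 ?k"
    have zc: "?z \<in> carrier (G (Suc i))" by (rule G'.M.minus_closed[OF x0 s1k])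
    have "D i ?z = ?k \<ominus>\<^bsub>G i\<^esub> D i (s1 ?k)" by (rule gmod_hom_eq_diff[OF glm_G glm_G D_hom x0 s1k])
    then have "q i (D i ?z) = q i ?k \<ominus>\<^bsub>Qm i\<^esub> q i (D i (s1 ?k))"
      using gmod_hom_eq_diff[OF glm_G glm_Qm q_hom K_carrier[OF k] gmod_homD(1)[OF D_hom s1k]] by simp
    then have "q i (D i ?z) = \<zero>\<^bsub>Qm i\<^esub>"
      unfolding qDs1[OF k] using gmod_homD(1)[OF q_hom K_carrier[OF k]] by (simp add: a_minus_def Q.M.r_neg)
    then have zK: "?z \<in> K (Suc i)" using K_Suc_iff[OF zc] by simp
    obtain c where c: "c \<in> carrier A" "\<xi> ?z = f \<otimes> c" using \<xi>K[OF zK] by blast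
    have "x0 = s1 ?k \<oplus>\<^bsub>G (Suc i)\<^esub> ?z"
      using x0 s1k by (simp add: a_minus_def G'.M.a_lcomm G'.M.r_neg del: Fr_simps)
    then have "\<xi> x0 = \<pi> ?k \<oplus> \<xi> ?z" using \<xi>add[OF s1k zc] unfolding \<pi>_def by simp
    then have "\<xi> x0 \<in> irrelevant_ideal A"
      unfolding c(2) using irr_add[OF \<pi>irr[OF k] irr_mult_r[OF f_irr c(1)]] by simp
    then show ?thesis unfolding \<xi>_def .
  qed
  show ?thesis by (rule coord(3)[OF _ x0 irr])
qed

end

lemma restrict_scalars_simps [simp]:
  "carrier (restrict_scalars p M) = carrier M" "ring.add (restrict_scalars p M) = ring.add M"
  "\<zero>\<^bsub>restrict_scalars p M\<^esub> = \<zero>\<^bsub>M\<^esub>" "smult (restrict_scalars p M) = (\<lambda>a. smult M (p a))"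
  "mpart (restrict_scalars p M) = mpart M"
  by (simp_all add: restrict_scalars_def)

section \<open>Finite generation, and finiteness of minimal bases\<close>

lemma fgen_image:
  assumes M: "graded_left_module R M" and N: "graded_left_module R N" and h: "h \<in> gmod_hom R M N"
    and H: "H \<subseteq> carrier M" and fg: "fgen R M H"
  shows "fgen R N (h ` H)"
proof -
  interpret M: graded_left_module R M by (rule M)
  obtain S where S: "finite S" "S \<subseteq> H" "\<And>H'. submodule H' R M \<Longrightarrow> S \<subseteq> H' \<Longrightarrow> H \<subseteq> H'"
    by (rule fgenE[OF fg]) (rule that)
  have "h ` H \<subseteq> H'" if H': "submodule H' R N" and SH: "h ` S \<subseteq> H'" for H'
  proof -
    note HD = submoduleD[OF H']
    have "submodule {x \<in> carrier M. h x \<in> H'} R M"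
      by (rule M.submoduleI')
        (use HD in \<open>auto simp: gmod_hom_zero[OF M N h] gmod_homD[OF h] M.lsmult_closed\<close>)
    moreover have "S \<subseteq> {x \<in> carrier M. h x \<in> H'}" using SH S(2) H by blast
    ultimately show ?thesis using S(3) by blast
  qed
  then show ?thesis unfolding fgen_def using S(1,2) by (intro exI[of _ "h ` S"]) auto
qed

lemma fgen_gsub:
  assumes M: "graded_left_module R M" and H: "graded_submodule R M H" and fg: "fgen R M H"
  shows "fgen R (gsub M H) (carrier (gsub M H))"
proof -
  interpret M: graded_left_module R M by (rule M)
  obtain S where S: "finite S" "S \<subseteq> H" "\<And>H'. submodule H' R M \<Longrightarrow> S \<subseteq> H' \<Longrightarrow> H \<subseteq> H'"
    by (rule fgenE[OF fg]) (rule that)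
  have Hc: "H \<subseteq> carrier M" using H submoduleD(1) by (auto simp: graded_submodule_def)
  have "H \<subseteq> H'" if H': "submodule H' R (gsub M H)" and SH: "S \<subseteq> H'" for H'
  proof (rule S(3)[OF _ SH])
    note HD = submoduleD[OF H']
    show "submodule H' R M"
    proof (rule M.submoduleI')
      show "H' \<subseteq> carrier M" using HD(1) Hc by simp
      show "\<zero>\<^bsub>M\<^esub> \<in> H'" using HD(2) by simp
      show "a \<oplus>\<^bsub>M\<^esub> b \<in> H'" if "a \<in> H'" "b \<in> H'" for a b using HD(3)[OF that] by simp
      show "a \<odot>\<^bsub>M\<^esub> b \<in> H'" if "a \<in> carrier R" "b \<in> H'" for a b using HD(4)[OF that] by simp
    qed
  qed
  then show ?thesis unfolding fgen_def using S(1,2) by (intro exI[of _ S]) auto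
qed

lemma fin_gen_iff_fgen:
  assumes M: "graded_left_module R M"
  shows "fin_gen R M \<longleftrightarrow> fgen R M (carrier M)"
proof -
  interpret M: graded_left_module R M by (rule M)
  have sm: "submodule (carrier M) R M" by (rule M.submoduleI') (auto simp: M.lsmult_closed)
  have *: "carrier M = (\<lambda>H. submodule H R M) hull S \<longleftrightarrow> (\<forall>H'. submodule H' R M \<and> S \<subseteq> H' \<longrightarrow> carrier M \<subseteq> H')"
    if "S \<subseteq> carrier M" for S
  proof -
    have "(\<lambda>H. submodule H R M) hull S \<subseteq> carrier M" unfolding hull_def using sm that by blast
    then show ?thesis unfolding hull_def by blast
  qed
  show ?thesis unfolding fin_gen_def fgen_def
    by (intro iff_exI conj_cong refl *)
qed

text \<open>Lifts of finitely many generators of N involve only a finite set X' of basis elements. A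
  basis element outside X' would agree with a combination of X' up to the kernel, hence up to
  \<open>R_+ Q\<close>, and comparing its own coordinate would put 1 into \<open>R_+\<close>. The
  terms of a resolution come without finiteness assumptions; this is how they acquire finite
  rank.\<close>

lemma (in pos_graded_ring) finite_minimal_basis:
  assumes Q: "free_basis R Q X" and N: "graded_left_module R N"
    and \<epsilon>: "\<epsilon> \<in> gmod_hom R Q N" "\<epsilon> ` carrier Q = carrier N"
    and min: "\<And>x. x \<in> carrier Q \<Longrightarrow> \<epsilon> x = \<zero>\<^bsub>N\<^esub> \<Longrightarrow> x \<in> irr_span R Q"
    and fg: "fgen R N (carrier N)"
  shows "finite X"
proof -
  interpret Q: free_basis R Q X by (rule Q)
  have Qm: "graded_left_module R Q" by (rule Q.graded_left_module_axioms)
  interpret QP: pos_graded_module R Q by (intro pos_graded_moduleI pos_graded_ring_axioms Qm)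
  interpret N: graded_left_module R N by (rule N)
  obtain S where S: "finite S" "S \<subseteq> carrier N" "\<And>H'. submodule H' R N \<Longrightarrow> S \<subseteq> H' \<Longrightarrow> carrier N \<subseteq> H'"
    by (rule fgenE[OF fg]) (rule that)
  define t where "t = inv_into (carrier Q) \<epsilon>"
  have t: "t y \<in> carrier Q" "\<epsilon> (t y) = y" if "y \<in> carrier N" for y
    using that \<epsilon>(2) by (simp_all add: t_def inv_into_into f_inv_into_f)
  define X' where "X' = (\<Union>y\<in>S. {x. Q.cf (t y) x \<noteq> \<zero>})"
  have fin: "finite X'" unfolding X'_def using S t Q.cf_finite by blast
  let ?H = "{m \<in> carrier Q. \<forall>x. x \<notin> X' \<longrightarrow> Q.cf m x = \<zero>}"
  have H: "submodule (\<epsilon> ` ?H) R N"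
  proof (rule N.submoduleI')
    show "\<epsilon> ` ?H \<subseteq> carrier N" using gmod_homD(1)[OF \<epsilon>(1)] by blast
    show "\<zero>\<^bsub>N\<^esub> \<in> \<epsilon> ` ?H"
      by (rule image_eqI[of _ _ "\<zero>\<^bsub>Q\<^esub>"]) (auto simp: gmod_hom_zero[OF Qm N \<epsilon>(1)])
    show "a \<oplus>\<^bsub>N\<^esub> b \<in> \<epsilon> ` ?H" if ab: "a \<in> \<epsilon> ` ?H" "b \<in> \<epsilon> ` ?H" for a b
    proof -
      obtain m n where "m \<in> ?H" "n \<in> ?H" "a = \<epsilon> m" "b = \<epsilon> n" using ab by blast
      then show ?thesis
        by (intro image_eqI[of _ _ "m \<oplus>\<^bsub>Q\<^esub> n"]) (auto simp: gmod_homD[OF \<epsilon>(1)] Q.cf_add)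
    qed
    show "a \<odot>\<^bsub>N\<^esub> b \<in> \<epsilon> ` ?H" if ab: "a \<in> carrier R" "b \<in> \<epsilon> ` ?H" for a b
    proof -
      obtain m where "m \<in> ?H" "b = \<epsilon> m" using ab by blast
      then show ?thesis using ab(1)
        by (intro image_eqI[of _ _ "a \<odot>\<^bsub>Q\<^esub> m"]) (auto simp: gmod_homD[OF \<epsilon>(1)] Q.cf_smult Q.lsmult_closed)
    qed
  qed
  have "S \<subseteq> \<epsilon> ` ?H"
  proof
    fix y assume y: "y \<in> S"
    then have yc: "y \<in> carrier N" using S(2) by blast
    have "t y \<in> ?H" using t(1)[OF yc] y unfolding X'_def by blast
    then show "y \<in> \<epsilon> ` ?H" using t(2)[OF yc] by (intro image_eqI[of _ _ "t y"]) simp_all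
  qed
  then have all: "carrier N \<subseteq> \<epsilon> ` ?H" by (rule S(3)[OF H])
  have cfi: "Q.cf z x \<in> irrelevant_ideal R" if "z \<in> irr_span R Q" for z x
    using that
  proof (induction z rule: QP.irr_span_induct)
    case (smult a y) then show ?case by (simp add: Q.cf_smult irr_closed irr_mult_r)
  next
    case (add y z) then show ?case by (simp add: Q.cf_add QP.irr_span_carrier irr_add)
  qed simp
  have "X \<subseteq> X'"
  proof
    fix x assume x: "x \<in> X"
    note xc = Q.basis_carrier[OF x]
    show "x \<in> X'"
    proof (rule ccontr)
      assume nx: "x \<notin> X'"
      have "\<epsilon> x \<in> \<epsilon> ` ?H" by (rule subsetD[OF all gmod_homD(1)[OF \<epsilon>(1) xc]])
      then obtain m where m: "m \<in> ?H" "\<epsilon> x = \<epsilon> m" by blast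
      then have mc: "m \<in> carrier Q" "Q.cf m x = \<zero>" using nx by auto
      have dc: "x \<ominus>\<^bsub>Q\<^esub> m \<in> carrier Q" using xc mc by simp
      have "\<epsilon> (x \<ominus>\<^bsub>Q\<^esub> m) = \<zero>\<^bsub>N\<^esub>"
        using gmod_hom_eq_diff[OF Qm N \<epsilon>(1) xc mc(1)] m(2) gmod_homD(1)[OF \<epsilon>(1) mc(1)]
        by (simp add: a_minus_def N.M.r_neg)
      then have i1: "Q.cf (x \<ominus>\<^bsub>Q\<^esub> m) x \<in> irrelevant_ideal R" using cfi min dc by blast
      have "x = (x \<ominus>\<^bsub>Q\<^esub> m) \<oplus>\<^bsub>Q\<^esub> m" using xc mc by (simp add: a_minus_def Q.M.a_assoc Q.M.l_neg)
      then have "Q.cf x x = Q.cf (x \<ominus>\<^bsub>Q\<^esub> m) x \<oplus> Q.cf m x" using Q.cf_add[OF dc mc(1)] by metis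
      then have "\<one> = Q.cf (x \<ominus>\<^bsub>Q\<^esub> m) x" using Q.cf_basis[OF x] mc Q.cf_closed[OF dc] by simp
      then show False using i1 irr_one by simp
    qed
  qed
  then show ?thesis using fin by (rule finite_subset)
qed

section \<open>Restriction of scalars along the quotient map\<close>

context mf_setting
begin

abbreviation B where "B \<equiv> quot_ring A f"

abbreviation p where "p \<equiv> quot_map A f"

abbreviation restr where "restr M \<equiv> restrict_scalars p M"

text \<open>An explicit form of the ideal generated by f; it is two-sided because x f = f
  \<sigma>(x).\<close>

definition fA where "fA = (\<lambda>a. f \<otimes> a) ` carrier A"

lemma ideal_fA: "ideal fA A"
proof (rule idealI[OF ring_axioms])
  show "subgroup fA (add_monoid A)"
  proof (rule group.subgroupI[OF a_group])
    show "inv\<^bsub>add_monoid A\<^esub> a \<in> fA" if "a \<in> fA" for a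
    proof -
      obtain c where c: "c \<in> carrier A" "a = f \<otimes> c" using \<open>a \<in> fA\<close> by (auto simp: fA_def)
      then have "\<ominus> a = f \<otimes> (\<ominus> c)" by (simp add: r_minus)
      then show ?thesis using c(1) unfolding fA_def a_inv_def[symmetric] by simp
    qed
    show "a \<otimes>\<^bsub>add_monoid A\<^esub> b \<in> fA" if ab: "a \<in> fA" "b \<in> fA" for a b
    proof -
      obtain c d where "c \<in> carrier A" "a = f \<otimes> c" "d \<in> carrier A" "b = f \<otimes> d" using ab by (auto simp: fA_def)
      then have "a \<oplus> b = f \<otimes> (c \<oplus> d)" "c \<oplus> d \<in> carrier A" by (simp_all add: r_distr)
      then show ?thesis unfolding fA_def by auto
    qed
  qed (auto simp: fA_def)
  show "x \<otimes> a \<in> fA" if a: "a \<in> fA" and x: "x \<in> carrier A" for a x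
  proof -
    obtain c where c: "c \<in> carrier A" "a = f \<otimes> c" using a by (auto simp: fA_def)
    have "x \<otimes> a = (x \<otimes> f) \<otimes> c" using c x by (simp add: m_assoc)
    also have "\<dots> = f \<otimes> (\<sigma> x \<otimes> c)" using c x f_normal by (simp add: m_assoc)
    finally show ?thesis unfolding fA_def using c x by simp
  qed
  show "a \<otimes> x \<in> fA" if a: "a \<in> fA" and x: "x \<in> carrier A" for a x
  proof -
    obtain c where c: "c \<in> carrier A" "a = f \<otimes> c" using a by (auto simp: fA_def)
    then have "a \<otimes> x = f \<otimes> (c \<otimes> x)" using x by (simp add: m_assoc)
    then show ?thesis unfolding fA_def using c x by simp
  qed
qed

lemma Idl_f: "Idl {f} = fA"
proof
  have "f = f \<otimes> \<one>" by simp
  then have "f \<in> fA" unfolding fA_def by (rule image_eqI) simp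
  then show "Idl {f} \<subseteq> fA" using genideal_minimal[OF ideal_fA] by simp
  have I: "ideal (Idl {f}) A" by (rule genideal_ideal) simp
  have "f \<in> Idl {f}" using genideal_self'[OF fc] .
  then show "fA \<subseteq> Idl {f}" unfolding fA_def using ideal.I_r_closed[OF I] by blast
qed

lemma fA_irr: "fA \<subseteq> irrelevant_ideal A"
  unfolding fA_def using irr_mult_r[OF f_irr] by blast

lemma p_def': "p a = fA +> a"
  by (simp add: quot_map_def Idl_f)

lemma B_simps: "carrier B = a_rcosets fA" "ring.add B = set_add A" "monoid.mult B = rcoset_mult A fA"
  "\<one>\<^bsub>B\<^esub> = fA +> \<one>" "\<zero>\<^bsub>B\<^esub> = fA" "rpart B n = p ` rpart A n"
  unfolding quot_ring_def Idl_f p_def'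
  by (simp_all add: FactRing_def ring.extend_def)

lemma p_surj: "carrier B = p ` carrier A"
  by (auto simp: B_simps p_def' A_RCOSETS_def')

lemma p_closed [simp]: "a \<in> carrier A \<Longrightarrow> p a \<in> carrier B"
  using p_surj by simp

lemma p_add: "a \<in> carrier A \<Longrightarrow> b \<in> carrier A \<Longrightarrow> p (a \<oplus> b) = p a \<oplus>\<^bsub>B\<^esub> p b"
  using ring_hom_add[OF ideal.rcos_ring_hom[OF ideal_fA]]
  by (simp add: B_simps p_def' FactRing_def)

lemma p_mult: "a \<in> carrier A \<Longrightarrow> b \<in> carrier A \<Longrightarrow> p (a \<otimes> b) = p a \<otimes>\<^bsub>B\<^esub> p b"
  using ring_hom_mult[OF ideal.rcos_ring_hom[OF ideal_fA]]
  by (simp add: B_simps p_def' FactRing_def)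

lemma p_one [simp]: "p \<one> = \<one>\<^bsub>B\<^esub>"
  by (simp add: B_simps p_def')

lemma p_eq_0_iff: "a \<in> carrier A \<Longrightarrow> p a = \<zero>\<^bsub>B\<^esub> \<longleftrightarrow> a \<in> fA"
proof -
  assume a: "a \<in> carrier A"
  have sg: "subgroup fA (add_monoid A)"
    using ideal_fA by (simp add: ideal_def additive_subgroup_def)
  have "fA +> a = fA \<longleftrightarrow> a \<in> fA"
    using a_coset_join1[of fA a] a_coset_join2[of a fA] a sg by blast
  then show ?thesis by (simp add: B_simps p_def')
qed

lemma p_zero [simp]: "p \<zero> = \<zero>\<^bsub>B\<^esub>"
  using p_eq_0_iff[of \<zero>] ideal_fA by (simp add: additive_subgroup.zero_closed ideal_def)

lemma p_part: "a \<in> rpart A n \<Longrightarrow> p a \<in> rpart B n"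
  by (simp add: B_simps)

lemma ring_B: "ring B"
proof -
  interpret Q: ring "A Quot fA" by (rule ideal.quotient_is_ring[OF ideal_fA])
  have eq: "carrier B = carrier (A Quot fA)" "ring.add B = ring.add (A Quot fA)" "monoid.mult B = monoid.mult (A Quot fA)"
    "\<one>\<^bsub>B\<^esub> = \<one>\<^bsub>A Quot fA\<^esub>" "\<zero>\<^bsub>B\<^esub> = \<zero>\<^bsub>A Quot fA\<^esub>"
    by (simp_all add: B_simps FactRing_def)
  show ?thesis
  proof (rule ringI)
    show "abelian_group B"
    proof (rule abelian_groupI)
      show "\<exists>y\<in>carrier B. y \<oplus>\<^bsub>B\<^esub> x = \<zero>\<^bsub>B\<^esub>" if "x \<in> carrier B" for x
        using Q.l_neg[of x] Q.a_inv_closed[of x] that unfolding eq by blast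
    qed (unfold eq, simp_all add: Q.a_ac)
    show "monoid B" by (rule monoidI) (unfold eq, simp_all add: Q.m_assoc)
  qed (unfold eq, simp_all add: Q.l_distr Q.r_distr)
qed

lemma B_nontrivial: "\<one>\<^bsub>B\<^esub> \<noteq> \<zero>\<^bsub>B\<^esub>"
  using p_eq_0_iff[of \<one>] fA_irr irr_one by auto

text \<open>That B is graded is contained in being given a graded left B-module, and it is taken
  from there (\<open>glm_ring\<close>).\<close>

lemma pos_graded_ring_B: "graded_ring B \<Longrightarrow> pos_graded_ring B"
  by (simp add: pos_graded_ring_def pos_graded_ring_axioms_def B_simps(6) rpart_negative)
    (use B_nontrivial in \<open>simp add: B_simps\<close>)

lemma irrelevant_ideal_B: "irrelevant_ideal B = p ` irrelevant_ideal A"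
proof
  interpret BR: ring B by (rule ring_B)
  have neg: "\<ominus>\<^bsub>B\<^esub> p a = p (\<ominus> a)" if "a \<in> carrier A" for a
    using that by (intro BR.minus_equality) (simp_all add: l_neg flip: p_add)
  have sg: "subgroup (p ` irrelevant_ideal A) (add_monoid B)"
  proof (rule group.subgroupI[OF BR.a_group])
    show "inv\<^bsub>add_monoid B\<^esub> b \<in> p ` irrelevant_ideal A" if "b \<in> p ` irrelevant_ideal A" for b
      using that irr_uminus irr_closed by (auto simp flip: a_inv_def simp: neg)
    show "b \<otimes>\<^bsub>add_monoid B\<^esub> c \<in> p ` irrelevant_ideal A" if "b \<in> p ` irrelevant_ideal A" "c \<in> p ` irrelevant_ideal A" for b c
      using that irr_add irr_closed by (auto simp flip: p_add)
    show "p ` irrelevant_ideal A \<noteq> {}" using irr_zero by blast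
  qed (use irr_closed in auto)
  show "irrelevant_ideal B \<subseteq> p ` irrelevant_ideal A"
    unfolding irrelevant_ideal_def[of B]
    by (rule group.generate_subgroup_incl[OF BR.a_group _ sg]) (auto simp: B_simps(6) intro: irr_homog)
  have Uc: "(\<Union>n\<in>{0<..}. rpart B n) \<subseteq> carrier (add_monoid B)" by (auto simp: B_simps(6) rgr.D_carrier)
  have sgB: "subgroup (irrelevant_ideal B) (add_monoid B)"
    unfolding irrelevant_ideal_def by (rule group.generate_is_subgroup[OF BR.a_group Uc])
  have "p a \<in> irrelevant_ideal B" if "a \<in> irrelevant_ideal A" for a
    using that
  proof (induction a rule: irr_induct)
    case zero then show ?case using subgroup.one_closed[OF sgB] by simp
  next
    case (homog n a)
    then show ?case unfolding irrelevant_ideal_def by (intro generate.incl) (auto simp: B_simps(6))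
  next
    case (add a b) then show ?case using subgroup.m_closed[OF sgB] by (simp add: p_add)
  qed
  then show "p ` irrelevant_ideal A \<subseteq> irrelevant_ideal B" by blast
qed

lemma glm_restr:
  assumes "graded_left_module B M"
  shows "graded_left_module A (restr M)"
proof -
  interpret M: graded_left_module B M by fact
  have ab: "abelian_group (restr M)"
  proof (rule abelian_groupI)
    show "\<exists>y\<in>carrier (restr M). y \<oplus>\<^bsub>restr M\<^esub> x = \<zero>\<^bsub>restr M\<^esub>" if "x \<in> carrier (restr M)" for x
      using that M.M.l_neg by (intro bexI[of _ "\<ominus>\<^bsub>M\<^esub> x"]) auto
  qed (auto simp: M.M.a_ac)
  interpret N: abelian_group "restr M" by (rule ab)
  have neg: "\<ominus>\<^bsub>restr M\<^esub> x = \<ominus>\<^bsub>M\<^esub> x" if "x \<in> carrier M" for x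
    using that by (intro N.minus_equality) (auto simp: M.M.l_neg)
  have fs: "finsum (restr M) c S = finsum M c S" if "finite S" "c \<in> S \<rightarrow> carrier M" for c :: "int \<Rightarrow> _" and S
    using additive_finsum[OF M.M.abelian_group_axioms ab _ _ that, of "\<lambda>x. x"] by simp
  have ids: "internal_direct_sum (restr M) (mpart (restr M))"
  proof (rule internal_direct_sumI[where p = "M.mgr.cp", OF ab])
    show "additive_subgroup (mpart (restr M) n) (restr M)" for n
      by (rule additive_subgroupI') (auto simp: M.mgr.D_carrier M.mgr.D_add M.mgr.D_neg neg)
    show "finsum (restr M) (M.mgr.cp x) {n. M.mgr.cp x n \<noteq> \<zero>\<^bsub>restr M\<^esub>} = x" if "x \<in> carrier (restr M)" for x
      using that fs[OF M.mgr.cp_finite, of x "M.mgr.cp x"] by (simp add: M.mgr.cp_sum)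
  qed (auto simp: M.mgr.cp_D M.mgr.cp_finite M.mgr.cp_add M.mgr.cp_homog)
  show ?thesis
    by (rule glmI[OF graded_ring_axioms ab _ _ _ _ _ ids])
      (auto simp: M.lsmult_l_distr M.lsmult_r_distr M.lsmult_assoc M.lsmult_one M.lsmult_closed
        M.mpart_smult p_add p_mult p_part)
qed

lemma restr_killed:
  assumes "graded_left_module B M" "x \<in> carrier M"
  shows "f \<odot>\<^bsub>restr M\<^esub> x = \<zero>\<^bsub>restr M\<^esub>"
proof -
  interpret M: graded_left_module B M by fact
  have "f = f \<otimes> \<one>" by simp
  then have "f \<in> fA" unfolding fA_def by (rule image_eqI) simp
  then show ?thesis using p_eq_0_iff[OF fc] assms(2) by simp
qed

text \<open>Since p is onto, linearity over A and over B coincide for maps between B-modules.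
  Isomorphism statements over B can therefore be settled over A.\<close>

lemma gmod_hom_restr: "gmod_hom A (restr M) (restr N) = gmod_hom B M N"
  unfolding gmod_hom_def p_surj by (auto simp: Pi_def)

lemma gmod_iso_restr: "gmod_iso A (restr M) (restr N) = gmod_iso B M N"
  by (simp add: gmod_iso_def gmod_hom_restr)

lemma submodule_restr:
  assumes "graded_left_module B M"
  shows "submodule H A (restr M) \<longleftrightarrow> submodule H B M"
proof -
  interpret M: graded_left_module B M by fact
  interpret N: graded_left_module A "restr M" by (rule glm_restr[OF assms])
  show ?thesis
  proof
    assume "submodule H A (restr M)"
    note HD = submoduleD[OF this]
    show "submodule H B M"
    proof (rule M.submoduleI')
      show "a \<odot>\<^bsub>M\<^esub> x \<in> H" if ax: "a \<in> carrier B" "x \<in> H" for a x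
      proof -
        obtain c where "c \<in> carrier A" "a = p c" using ax(1) unfolding p_surj by blast
        then show ?thesis using HD(4)[of c x] ax(2) by simp
      qed
    qed (use HD(1-3) in auto)
  next
    assume "submodule H B M"
    note HD = submoduleD[OF this]
    show "submodule H A (restr M)"
      by (rule N.submoduleI') (use HD in auto)
  qed
qed

lemma fgen_restr:
  assumes "graded_left_module B M"
  shows "fgen A (restr M) H \<longleftrightarrow> fgen B M H"
  unfolding fgen_def submodule_restr[OF assms] ..

lemma irr_span_restr:
  assumes M: "graded_left_module B M"
  shows "irr_span A (restr M) = irr_span B M"
proof
  have RB: "pos_graded_ring B" by (rule pos_graded_ring_B[OF glm_ring[OF M]])
  interpret M: pos_graded_module B M by (rule pos_graded_moduleI[OF RB M])
  interpret N: pos_graded_module A "restr M" by (rule pgm[OF glm_restr[OF M]])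
  show "irr_span A (restr M) \<subseteq> irr_span B M"
  proof
    fix x assume "x \<in> irr_span A (restr M)"
    then show "x \<in> irr_span B M"
    proof (induction x rule: N.irr_span_induct)
      case (smult a x)
      then have "p a \<in> irrelevant_ideal B" unfolding irrelevant_ideal_B by blast
      then show ?case using M.irr_span_smult smult(2) by simp
    next
      case (add x y) then show ?case using M.irr_span_add by simp
    qed simp
  qed
  show "irr_span B M \<subseteq> irr_span A (restr M)"
  proof
    fix x assume "x \<in> irr_span B M"
    then show "x \<in> irr_span A (restr M)"
    proof (induction x rule: M.irr_span_induct)
      case zero then show ?case using N.irr_span_zero by simp
    next
      case (smult b x)
      then obtain a where "a \<in> irrelevant_ideal A" "b = p a" unfolding irrelevant_ideal_B by blast
      then show ?case using N.irr_span_smult[of a x] smult(2) by simp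
    next
      case (add x y) then show ?case using N.irr_span_add by simp
    qed
  qed
qed

text \<open>The unit vectors of the free A-module with the same rank and degrees are sent to the
  basis. By uniqueness of coordinates a vector goes to 0 exactly when the classes of all its entries
  vanish, that is, when all entries lie in fA.\<close>

lemma free_cover:
  assumes Q: "free_basis B Q X" and fin: "finite X"
  shows "\<exists>r \<delta> q. rel_cover (Fr A r \<delta>) (restr Q) q"
proof -
  interpret Q: free_basis B Q X by (rule Q)
  have Qm: "graded_left_module B Q" by (rule Q.graded_left_module_axioms)
  have RQ: "graded_left_module A (restr Q)" by (rule glm_restr[OF Qm])
  interpret RQ: graded_left_module A "restr Q" by (rule RQ)
  obtain x where x: "bij_betw x {..<card X} X"
    using ex_bij_betw_nat_finite[OF fin] unfolding lessThan_atLeast0[symmetric] by blast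
  let ?r = "card X"
  define \<delta> where "\<delta> j = bdeg Q (x j)" for j
  have xX: "x j \<in> X" if "j < ?r" for j using x that by (auto simp: bij_betw_def)
  have xm: "x j \<in> mpart (restr Q) (\<delta> j)" if "j < ?r" for j
    unfolding \<delta>_def using Q.basis_mpart[OF xX[OF that]] by simp
  have xc: "x j \<in> carrier Q" if "j < ?r" for j by (rule Q.basis_carrier[OF xX[OF that]])
  let ?F = "Fr A ?r \<delta>"
  interpret F: graded_left_module A ?F by (rule glm_Fr)
  define q where "q v = finsum (restr Q) (\<lambda>j. v j \<odot>\<^bsub>restr Q\<^esub> x j) {..<?r}" for v
  have q: "q \<in> gmod_hom A ?F (restr Q)"
    unfolding q_def by (rule Fr_lin_hom[OF RQ xm])
  have qunit: "q (unit_vec j) = x j" if "j < ?r" for j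
  proof -
    have "q (unit_vec j) = finsum (restr Q) (\<lambda>i. if j = i then x i else \<zero>\<^bsub>restr Q\<^esub>) {..<?r}"
      unfolding q_def by (rule RQ.M.add.finprod_cong') (auto simp: unit_vec_def xc Q.lsmult_one)
    also have "\<dots> = x j" using that xc by (intro RQ.M.finsum_singleton) auto
    finally show ?thesis .
  qed
  have "submodule (q ` carrier ?F) A (restr Q)"
    using submodule_himage[OF glm_Fr RQ q] by (simp add: graded_submodule_def)
  then have sm: "submodule (q ` carrier ?F) B Q" using submodule_restr[OF Qm] by simp
  have XF: "X \<subseteq> q ` carrier ?F"
  proof
    fix y assume "y \<in> X"
    then obtain j where "j < ?r" "y = x j" using x by (auto simp: bij_betw_def)
    then show "y \<in> q ` carrier ?F" using qunit unit_vec_carrier by (metis imageI)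
  qed
  have surj: "q ` carrier ?F = carrier (restr Q)"
  proof
    show "q ` carrier ?F \<subseteq> carrier (restr Q)" using gmod_homD(1)[OF q] by blast
    show "carrier (restr Q) \<subseteq> q ` carrier ?F"
    proof
      fix m assume "m \<in> carrier (restr Q)"
      then have m: "m \<in> carrier Q" by simp
      have "finsum Q (\<lambda>y. Q.cf m y \<odot>\<^bsub>Q\<^esub> y) {y. Q.cf m y \<noteq> \<zero>\<^bsub>B\<^esub>} \<in> q ` carrier ?F"
        by (rule Q.submodule_finsum[OF sm Q.cf_finite[OF m]])
          (intro submoduleD(4)[OF sm] Q.cf_closed[OF m] subsetD[OF XF] subsetD[OF Q.supp_subset[OF m]])
      then show "m \<in> q ` carrier ?F" unfolding Q.cf_sum[OF m] .
    qed
  qed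
  have ker: "q v = \<zero>\<^bsub>restr Q\<^esub> \<longleftrightarrow> v \<in> fim ?F" if v: "v \<in> carrier ?F" for v
  proof
    note vc = Fr_carrier[OF v]
    assume q0: "q v = \<zero>\<^bsub>restr Q\<^esub>"
    define k where "k = inv_into {..<?r} x"
    have kx: "k (x j) = j" if "j < ?r" for j
      unfolding k_def using x that by (simp add: bij_betw_def)
    let ?c = "\<lambda>y. if y \<in> X then p (v (k y)) else \<zero>\<^bsub>B\<^esub>"
    have "q v = finsum Q (\<lambda>j. p (v j) \<odot>\<^bsub>Q\<^esub> x j) {..<?r}"
      unfolding q_def
      using additive_finsum[OF Q.M.abelian_group_axioms RQ.M.abelian_group_axioms, of "\<lambda>x. x" "{..<?r}" "\<lambda>j. p (v j) \<odot>\<^bsub>Q\<^esub> x j"]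
        vc xc by (auto simp: Q.lsmult_closed)
    also have "\<dots> = finsum Q (\<lambda>j. ?c (x j) \<odot>\<^bsub>Q\<^esub> x j) {..<?r}"
      using vc xc xX kx by (intro Q.M.add.finprod_cong') (auto simp: Q.lsmult_closed)
    also have "\<dots> = finsum Q (\<lambda>y. ?c y \<odot>\<^bsub>Q\<^esub> y) (x ` {..<?r})"
      by (rule Q.M.add.finprod_reindex[symmetric])
        (use x vc Q.basis_carrier in \<open>auto simp: bij_betw_def Q.lsmult_closed\<close>)
    also have "x ` {..<?r} = X" using x by (simp add: bij_betw_def)
    finally have qv: "q v = finsum Q (\<lambda>y. ?c y \<odot>\<^bsub>Q\<^esub> y) X" .
    have "Q.cf (q v) = ?c"
      unfolding qv using vc fin by (intro Q.cf_unique) auto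
    moreover have "Q.cf (q v) y = \<zero>\<^bsub>B\<^esub>" for y unfolding q0 by simp
    ultimately have c0: "?c y = \<zero>\<^bsub>B\<^esub>" for y by metis
    have "p (v j) = \<zero>\<^bsub>B\<^esub>" if "j < ?r" for j using c0[of "x j"] xX[OF that] kx[OF that] by simp
    then have "\<exists>c\<in>carrier A. v j = f \<otimes> c" if "j < ?r" for j
      using that p_eq_0_iff[OF vc[of j]] unfolding fA_def by blast
    then obtain w where w: "\<And>j. j < ?r \<Longrightarrow> w j \<in> carrier A \<and> v j = f \<otimes> w j" by metis
    have "(\<lambda>j. if j < ?r then w j else \<zero>) \<in> carrier ?F" using w by simp
    moreover have "v = f \<odot>\<^bsub>?F\<^esub> (\<lambda>j. if j < ?r then w j else \<zero>)"
      using w v by (auto simp: fun_eq_iff)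
    ultimately show "v \<in> fim ?F" unfolding fim_def by blast
  next
    assume "v \<in> fim ?F"
    then obtain w where w: "w \<in> carrier ?F" "v = f \<odot>\<^bsub>?F\<^esub> w" unfolding fim_def by blast
    have "q v = f \<odot>\<^bsub>restr Q\<^esub> q w" unfolding w(2) by (rule gmod_homD(3)[OF q fc w(1)])
    then show "q v = \<zero>\<^bsub>restr Q\<^esub>" using restr_killed[OF Qm, of "q w"] gmod_homD(1)[OF q w(1)] by simp
  qed
  have "rel_cover ?F (restr Q) q"
    unfolding rel_cover_def
    using graded_free_Fr[OF nontrivial] bounded_below_Fr RQ q surj ker by blast
  then show ?thesis by blast
qed

end

section \<open>Quotient modules and extension of scalars\<close>

lemma gquot_simps [simp]:
  "carrier (gquot M H) = a_rcosets\<^bsub>M\<^esub> H" "ring.add (gquot M H) = set_add M" "\<zero>\<^bsub>gquot M H\<^esub> = H"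
  "smult (gquot M H) = (\<lambda>a X. H <+>\<^bsub>M\<^esub> (smult M a ` X))"
  "mpart (gquot M H) n = (\<lambda>x. H +>\<^bsub>M\<^esub> x) ` mpart M n"
  by (simp_all add: gquot_def)

lemma gquot_module:
  fixes M :: "('a, 'b) gmodule"
  assumes M: "graded_left_module R M" and H: "graded_submodule R M H"
  defines "\<pi> \<equiv> \<lambda>x. H +>\<^bsub>M\<^esub> x"
  shows "graded_left_module R (gquot M H)" "\<pi> \<in> gmod_hom R M (gquot M H)"
    "\<pi> ` carrier M = carrier (gquot M H)" "\<And>x. x \<in> carrier M \<Longrightarrow> \<pi> x = \<zero>\<^bsub>gquot M H\<^esub> \<longleftrightarrow> x \<in> H"
proof -
  interpret M: graded_left_module R M by (rule M)
  have sm: "submodule H R M" and gr: "\<And>x n. x \<in> H \<Longrightarrow> M.mgr.cp x n \<in> H"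
    using H by (auto simp: graded_submodule_def)
  note HD = submoduleD[OF sm]
  have ads: "additive_subgroup H M" by (rule additive_subgroupI') (use HD in auto)
  then interpret H: abelian_subgroup H M
    by (intro abelian_subgroupI3 M.M.abelian_group_axioms)
  have sg: "subgroup H (add_monoid M)" using ads by (simp add: additive_subgroup_def)
  have eq_iff: "\<pi> x = \<pi> y \<longleftrightarrow> x \<ominus>\<^bsub>M\<^esub> y \<in> H" if "x \<in> carrier M" "y \<in> carrier M" for x y
  proof
    assume "\<pi> x = \<pi> y"
    then have "x \<in> H +>\<^bsub>M\<^esub> y" using H.a_rcos_self[OF that(1)] unfolding \<pi>_def by simp
    then show "x \<ominus>\<^bsub>M\<^esub> y \<in> H" using H.a_rcos_module[OF that(2,1)] by (simp add: a_minus_def)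
  next
    assume "x \<ominus>\<^bsub>M\<^esub> y \<in> H"
    then have "x \<in> H +>\<^bsub>M\<^esub> y" using H.a_rcos_module[OF that(2,1)] by (simp add: a_minus_def)
    then show "\<pi> x = \<pi> y" unfolding \<pi>_def by (rule H.a_repr_independence'[OF _ that(2), symmetric])
  qed
  show ker: "\<pi> x = \<zero>\<^bsub>gquot M H\<^esub> \<longleftrightarrow> x \<in> H" if "x \<in> carrier M" for x
    using M.M.a_coset_join1[of H x] M.M.a_coset_join2[of x H] sg that unfolding \<pi>_def by auto
  show surj: "\<pi> ` carrier M = carrier (gquot M H)"
    by (auto simp: \<pi>_def A_RCOSETS_def')
  have smult: "\<pi> (a \<odot>\<^bsub>M\<^esub> x) = H <+>\<^bsub>M\<^esub> (smult M a ` \<pi> x)" if a: "a \<in> carrier R" and x: "x \<in> carrier M" for a x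
  proof
    have ax: "a \<odot>\<^bsub>M\<^esub> x \<in> carrier M" by (rule M.lsmult_closed[OF a x])
    have xin: "x \<in> \<pi> x" unfolding \<pi>_def by (rule H.a_rcos_self[OF x])
    show "\<pi> (a \<odot>\<^bsub>M\<^esub> x) \<subseteq> H <+>\<^bsub>M\<^esub> (smult M a ` \<pi> x)"
    proof
      fix z assume "z \<in> \<pi> (a \<odot>\<^bsub>M\<^esub> x)"
      then obtain h where "h \<in> H" "z = h \<oplus>\<^bsub>M\<^esub> a \<odot>\<^bsub>M\<^esub> x" unfolding \<pi>_def a_r_coset_def' by blast
      then show "z \<in> H <+>\<^bsub>M\<^esub> (smult M a ` \<pi> x)" using imageI[OF xin, of "smult M a"] unfolding set_add_def' by blast
    qed
    show "H <+>\<^bsub>M\<^esub> (smult M a ` \<pi> x) \<subseteq> \<pi> (a \<odot>\<^bsub>M\<^esub> x)"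
    proof
      fix z assume "z \<in> H <+>\<^bsub>M\<^esub> (smult M a ` \<pi> x)"
      then obtain h h' where h: "h \<in> H" "h' \<in> H" "z = h \<oplus>\<^bsub>M\<^esub> a \<odot>\<^bsub>M\<^esub> (h' \<oplus>\<^bsub>M\<^esub> x)"
        by (auto simp: \<pi>_def a_r_coset_def' set_add_def')
      then have hc: "h \<in> carrier M" "h' \<in> carrier M" using HD(1) by auto
      have "z = (h \<oplus>\<^bsub>M\<^esub> a \<odot>\<^bsub>M\<^esub> h') \<oplus>\<^bsub>M\<^esub> a \<odot>\<^bsub>M\<^esub> x"
        using h(3) hc a x ax by (simp add: M.lsmult_r_distr M.M.a_assoc M.lsmult_closed)
      moreover have "h \<oplus>\<^bsub>M\<^esub> a \<odot>\<^bsub>M\<^esub> h' \<in> H" using HD(3,4) h a by blast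
      ultimately show "z \<in> \<pi> (a \<odot>\<^bsub>M\<^esub> x)" unfolding \<pi>_def a_r_coset_def' by blast
    qed
  qed
  have cpeq: "\<pi> (gcomp M (mpart M) x n) = \<pi> (gcomp M (mpart M) y n)"
      if xy: "x \<in> carrier M" "y \<in> carrier M" "\<pi> x = \<pi> y" for x y n
    proof -
      have "M.mgr.cp (x \<ominus>\<^bsub>M\<^esub> y) n \<in> H" using gr eq_iff[OF xy(1,2)] xy(3) by blast
      moreover have "M.mgr.cp (x \<ominus>\<^bsub>M\<^esub> y) n = M.mgr.cp x n \<ominus>\<^bsub>M\<^esub> M.mgr.cp y n"
      proof -
        have "M.mgr.cp x n = M.mgr.cp ((x \<ominus>\<^bsub>M\<^esub> y) \<oplus>\<^bsub>M\<^esub> y) n"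
          using xy by (simp add: a_minus_def M.M.a_assoc M.M.l_neg)
        also have "\<dots> = M.mgr.cp (x \<ominus>\<^bsub>M\<^esub> y) n \<oplus>\<^bsub>M\<^esub> M.mgr.cp y n"
          using xy by (intro M.mgr.cp_add) auto
        finally show ?thesis using xy by (simp add: a_minus_def M.M.a_assoc M.M.r_neg)
      qed
      ultimately show ?thesis using eq_iff xy by simp
    qed
  have zero: "\<pi> \<zero>\<^bsub>M\<^esub> = \<zero>\<^bsub>gquot M H\<^esub>" using ker[of "\<zero>\<^bsub>M\<^esub>"] HD(2) by simp
  have add: "\<pi> (x \<oplus>\<^bsub>M\<^esub> y) = \<pi> x \<oplus>\<^bsub>gquot M H\<^esub> \<pi> y" if "x \<in> carrier M" "y \<in> carrier M" for x y
    unfolding \<pi>_def using H.a_rcos_sum[OF that] by simp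
  have sm': "\<pi> (a \<odot>\<^bsub>M\<^esub> x) = a \<odot>\<^bsub>gquot M H\<^esub> \<pi> x" if "a \<in> carrier R" "x \<in> carrier M" for a x
    using smult[OF that] by simp
  have part: "mpart (gquot M H) n = \<pi> ` mpart M n" for n by (simp add: \<pi>_def)
  note push = glm_pushforward[OF M, where N = "gquot M H" and h = \<pi>, OF surj[symmetric] zero add sm' part cpeq]
  show "graded_left_module R (gquot M H)" "\<pi> \<in> gmod_hom R M (gquot M H)" by (rule push; assumption)+
qed

text \<open>Scalar multiplication on \<open>base_change\<close> and \<open>base_change_map\<close>
  both have this shape: the relation subgroup times the image of a coset. For an additive E that
  respects the relations this is just the coset of the image of a representative.\<close>

lemma coset_image:
  assumes T1: "\<And>t. t \<in> T1 \<Longrightarrow> E t \<in> T2" "0 \<in> T1" and T2: "\<And>s t. s \<in> T2 \<Longrightarrow> t \<in> T2 \<Longrightarrow> s + t \<in> T2"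
    and E: "\<And>u v. E (u + v) = E u + E v"
  shows "T2 <#>\<^bsub>free_Abelian_group S2\<^esub> (E ` (T1 #>\<^bsub>free_Abelian_group S1\<^esub> v)) = T2 #>\<^bsub>free_Abelian_group S2\<^esub> E v"
proof
  show "T2 <#>\<^bsub>free_Abelian_group S2\<^esub> (E ` (T1 #>\<^bsub>free_Abelian_group S1\<^esub> v)) \<subseteq> T2 #>\<^bsub>free_Abelian_group S2\<^esub> E v"
  proof
    fix z assume "z \<in> T2 <#>\<^bsub>free_Abelian_group S2\<^esub> (E ` (T1 #>\<^bsub>free_Abelian_group S1\<^esub> v))"
    then obtain s t where "s \<in> T2" "t \<in> T1" "z = s + E (t + v)" by (auto simp: set_mult_def r_coset_def)
    then have "s + E t \<in> T2" "z = (s + E t) + E v" using T1 T2 E by (auto simp: add.assoc)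
    then show "z \<in> T2 #>\<^bsub>free_Abelian_group S2\<^esub> E v" by (auto simp: r_coset_def)
  qed
  show "T2 #>\<^bsub>free_Abelian_group S2\<^esub> E v \<subseteq> T2 <#>\<^bsub>free_Abelian_group S2\<^esub> (E ` (T1 #>\<^bsub>free_Abelian_group S1\<^esub> v))"
    using T1(2) by (force simp: set_mult_def r_coset_def)
qed

section \<open>The extension of scalars of W identified with W / fW\<close>

context mf_setting
begin

abbreviation FW where "FW W \<equiv> free_Abelian_group (carrier B \<times> carrier W)"

abbreviation TR where "TR W \<equiv> tensor_rel A p B W"

abbreviation frag1 where "frag1 x \<equiv> frag_of (\<one>\<^bsub>B\<^esub>, x)"

abbreviation supp where "supp W u \<equiv> Poly_Mapping.keys u \<subseteq> carrier B \<times> carrier W"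

text \<open>The map sending x to the class of 1 \<otimes> x. It is onto the tensor product because p
  is onto.\<close>

definition \<kappa> :: "('a, 'b) gmodule \<Rightarrow> 'b \<Rightarrow> ('a set \<times> 'b \<Rightarrow>\<^sub>0 int) set" where
  "\<kappa> W x = TR W #>\<^bsub>FW W\<^esub> frag1 x"

definition trel :: "('a, 'b) gmodule \<Rightarrow> ('a set \<times> 'b \<Rightarrow>\<^sub>0 int) set" where
  "trel W = {frag_of (b \<oplus>\<^bsub>B\<^esub> b', x) - frag_of (b, x) - frag_of (b', x) | b b' x.
         b \<in> carrier B \<and> b' \<in> carrier B \<and> x \<in> carrier W} \<union>
      {frag_of (b, x \<oplus>\<^bsub>W\<^esub> x') - frag_of (b, x) - frag_of (b, x') | b x x'.
         b \<in> carrier B \<and> x \<in> carrier W \<and> x' \<in> carrier W} \<union>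
      {frag_of (b \<otimes>\<^bsub>B\<^esub> p a, x) - frag_of (b, a \<odot>\<^bsub>W\<^esub> x) | a b x.
         a \<in> carrier A \<and> b \<in> carrier B \<and> x \<in> carrier W}"

lemma TR_def': "TR W = generate (FW W) (trel W)"
  unfolding tensor_rel_def trel_def ..

end

locale base_change_setting = mf_setting A f e \<sigma> for A :: "'a gring" (structure) and f e \<sigma> +
  fixes W :: "('a, 'b) gmodule"
  assumes W: "graded_left_module A W"
begin

interpretation BR: ring B by (rule ring_B)

interpretation W: graded_left_module A W by (rule W)

interpretation FW: comm_group "FW W" by (rule abelian_free_Abelian_group)

lemma trel_carrier: "trel W \<subseteq> carrier (FW W)"
proof -
  have d: "Poly_Mapping.keys (u - v) \<subseteq> S" if "Poly_Mapping.keys u \<subseteq> S" "Poly_Mapping.keys v \<subseteq> S"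
    for u v :: "('a set \<times> 'b) \<Rightarrow>\<^sub>0 int" and S using keys_diff[of u v] that by blast
  show ?thesis
  proof
    fix u assume "u \<in> trel W"
    then have "supp W u"
      unfolding trel_def
    proof (elim UnE CollectE exE conjE)
      fix b b' y assume h: "u = frag_of (b \<oplus>\<^bsub>B\<^esub> b', y) - frag_of (b, y) - frag_of (b', y)"
        "b \<in> carrier B" "b' \<in> carrier B" "y \<in> carrier W"
      show ?thesis unfolding h(1) by (intro d) (use h BR.a_closed[OF h(2,3)] in \<open>simp_all add: keys_frag_of\<close>)
    next
      fix b y y' assume h: "u = frag_of (b, y \<oplus>\<^bsub>W\<^esub> y') - frag_of (b, y) - frag_of (b, y')"
        "b \<in> carrier B" "y \<in> carrier W" "y' \<in> carrier W"
      show ?thesis unfolding h(1) by (intro d) (use h in \<open>simp_all add: keys_frag_of\<close>)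
    next
      fix a b y assume h: "u = frag_of (b \<otimes>\<^bsub>B\<^esub> p a, y) - frag_of (b, a \<odot>\<^bsub>W\<^esub> y)"
        "a \<in> carrier A" "b \<in> carrier B" "y \<in> carrier W"
      show ?thesis unfolding h(1)
        by (intro d) (use h BR.m_closed[OF h(3) p_closed[OF h(2)]] in \<open>simp_all add: keys_frag_of W.lsmult_closed\<close>)
    qed
    then show "u \<in> carrier (FW W)" by simp
  qed
qed

lemma TR_subgroup: "subgroup (TR W) (FW W)"
  unfolding TR_def' by (rule FW.generate_is_subgroup[OF trel_carrier])

lemma TR_keys: "t \<in> TR W \<Longrightarrow> supp W t"
  using subsetD[OF subgroup.subset[OF TR_subgroup], of t] by simp

lemma TR_zero: "0 \<in> TR W"
  using subgroup.one_closed[OF TR_subgroup] by simp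

lemma TR_add: "s \<in> TR W \<Longrightarrow> t \<in> TR W \<Longrightarrow> s + t \<in> TR W"
  using subgroup.m_closed[OF TR_subgroup] by simp

lemma TR_uminus: "s \<in> TR W \<Longrightarrow> - s \<in> TR W"
  using subgroup.m_inv_closed[OF TR_subgroup, of s] TR_keys[of s] by simp

lemma TR_diff: "s \<in> TR W \<Longrightarrow> t \<in> TR W \<Longrightarrow> s - t \<in> TR W"
  using TR_add[of s "- t"] TR_uminus by simp

lemma TR_gen: "u \<in> trel W \<Longrightarrow> u \<in> TR W"
  unfolding TR_def' by (rule generate.incl)

lemma rel_right: "b \<in> carrier B \<Longrightarrow> x \<in> carrier W \<Longrightarrow> y \<in> carrier W \<Longrightarrow>
    frag_of (b, x \<oplus>\<^bsub>W\<^esub> y) - frag_of (b, x) - frag_of (b, y) \<in> TR W"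
  by (rule TR_gen) (unfold trel_def, blast)

lemma rel_scalar: "a \<in> carrier A \<Longrightarrow> x \<in> carrier W \<Longrightarrow>
    frag_of (p a, x) - frag1 (a \<odot>\<^bsub>W\<^esub> x) \<in> TR W"
proof -
  assume ax: "a \<in> carrier A" "x \<in> carrier W"
  have "frag_of (\<one>\<^bsub>B\<^esub> \<otimes>\<^bsub>B\<^esub> p a, x) - frag1 (a \<odot>\<^bsub>W\<^esub> x) \<in> trel W"
    unfolding trel_def using ax BR.one_closed by blast
  moreover have "\<one>\<^bsub>B\<^esub> \<otimes>\<^bsub>B\<^esub> p a = p a" using ax(1) by (intro BR.l_one p_closed)
  ultimately show ?thesis by (intro TR_gen) simp
qed

text \<open>Well-definedness of b \<otimes> x |-> s b \<otimes> h x. Allowing semilinearity along s'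
  covers scalar multiplication and \<open>phi\<close>, with s' the identity, as well as
  \<open>tau\<close>, with s' the inverse of \<sigma>.\<close>

lemma TR_map:
  fixes W' :: "('a, 'c) gmodule"
  assumes W': "graded_left_module A W'"
    and s: "\<And>b. b \<in> carrier B \<Longrightarrow> s b \<in> carrier B"
      "\<And>b b'. b \<in> carrier B \<Longrightarrow> b' \<in> carrier B \<Longrightarrow> s (b \<oplus>\<^bsub>B\<^esub> b') = s b \<oplus>\<^bsub>B\<^esub> s b'"
      "\<And>b a. b \<in> carrier B \<Longrightarrow> a \<in> carrier A \<Longrightarrow> s (b \<otimes>\<^bsub>B\<^esub> p a) = s b \<otimes>\<^bsub>B\<^esub> p (s' a)"
    and h: "\<And>x. x \<in> carrier W \<Longrightarrow> h x \<in> carrier W'"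
      "\<And>x y. x \<in> carrier W \<Longrightarrow> y \<in> carrier W \<Longrightarrow> h (x \<oplus>\<^bsub>W\<^esub> y) = h x \<oplus>\<^bsub>W'\<^esub> h y"
      "\<And>a x. a \<in> carrier A \<Longrightarrow> x \<in> carrier W \<Longrightarrow> h (a \<odot>\<^bsub>W\<^esub> x) = s' a \<odot>\<^bsub>W'\<^esub> h x"
    and t: "t \<in> TR W" and s': "\<And>a. a \<in> carrier A \<Longrightarrow> s' a \<in> carrier A"
  shows "frag_extend (\<lambda>(b, x). frag_of (s b, h x)) t \<in> TR W'"
proof -
  interpret W': base_change_setting A f e \<sigma> W'
    using W' mf_setting_axioms by (simp add: base_change_setting_def base_change_setting_axioms_def)
  let ?E = "frag_extend (\<lambda>(b, x). frag_of (s b, h x))"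
  have gen: "?E u \<in> TR W'" if u: "u \<in> trel W" for u
    using u unfolding trel_def
  proof (elim UnE CollectE exE conjE)
    fix b b' y assume u: "u = frag_of (b \<oplus>\<^bsub>B\<^esub> b', y) - frag_of (b, y) - frag_of (b', y)"
      "b \<in> carrier B" "b' \<in> carrier B" "y \<in> carrier W"
    have "?E u = frag_of (s b \<oplus>\<^bsub>B\<^esub> s b', h y) - frag_of (s b, h y) - frag_of (s b', h y)"
      unfolding u(1) using s(2)[OF u(2,3)] by (simp add: frag_extend_diff)
    also have "\<dots> \<in> trel W'" unfolding trel_def using s(1)[OF u(2)] s(1)[OF u(3)] h(1)[OF u(4)] by blast
    finally show ?thesis by (rule W'.TR_gen)
  next
    fix b y y' assume u: "u = frag_of (b, y \<oplus>\<^bsub>W\<^esub> y') - frag_of (b, y) - frag_of (b, y')"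
      "b \<in> carrier B" "y \<in> carrier W" "y' \<in> carrier W"
    show ?thesis unfolding u(1) using W'.rel_right[OF s(1)[OF u(2)] h(1)[OF u(3)] h(1)[OF u(4)]] h(2)[OF u(3,4)]
      by (simp add: frag_extend_diff)
  next
    fix a b y assume u: "u = frag_of (b \<otimes>\<^bsub>B\<^esub> p a, y) - frag_of (b, a \<odot>\<^bsub>W\<^esub> y)"
      "a \<in> carrier A" "b \<in> carrier B" "y \<in> carrier W"
    have "?E u = frag_of (s b \<otimes>\<^bsub>B\<^esub> p (s' a), h y) - frag_of (s b, s' a \<odot>\<^bsub>W'\<^esub> h y)"
      unfolding u(1) using s(3)[OF u(3,2)] h(3)[OF u(2,4)] by (simp add: frag_extend_diff)
    also have "\<dots> \<in> trel W'" unfolding trel_def using h(1)[OF u(4)] s(1)[OF u(3)] s'[OF u(2)] by blast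
    finally show ?thesis by (rule W'.TR_gen)
  qed
  show ?thesis
    using t unfolding TR_def'
  proof (induction t rule: generate.induct)
    case (inv h)
    then have "supp W h" using subsetD[OF trel_carrier inv] by simp
    then show ?case using W'.TR_uminus[OF gen[OF inv]] by (simp add: frag_extend_minus TR_def')
  qed (use W'.TR_zero W'.TR_add gen in \<open>simp_all add: frag_extend_add TR_def'\<close>)
qed

lemma coset_eq_iff:
  assumes "supp W u" "supp W v"
  shows "TR W #>\<^bsub>FW W\<^esub> u = TR W #>\<^bsub>FW W\<^esub> v \<longleftrightarrow> u - v \<in> TR W"
proof
  assume eq: "TR W #>\<^bsub>FW W\<^esub> u = TR W #>\<^bsub>FW W\<^esub> v"
  have "u \<in> TR W #>\<^bsub>FW W\<^esub> u" using TR_zero by (force simp: r_coset_def)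
  then show "u - v \<in> TR W" unfolding eq by (auto simp: r_coset_def)
next
  assume d: "u - v \<in> TR W"
  show "TR W #>\<^bsub>FW W\<^esub> u = TR W #>\<^bsub>FW W\<^esub> v"
  proof
    show "TR W #>\<^bsub>FW W\<^esub> u \<subseteq> TR W #>\<^bsub>FW W\<^esub> v"
    proof
      fix z assume "z \<in> TR W #>\<^bsub>FW W\<^esub> u"
      then obtain t where "t \<in> TR W" "z = t + u" by (auto simp: r_coset_def)
      then have "t + (u - v) \<in> TR W" "z = (t + (u - v)) + v" using d TR_add by auto
      then show "z \<in> TR W #>\<^bsub>FW W\<^esub> v" unfolding r_coset_def mult_free_Abelian_group by blast
    qed
    show "TR W #>\<^bsub>FW W\<^esub> v \<subseteq> TR W #>\<^bsub>FW W\<^esub> u"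
    proof
      fix z assume "z \<in> TR W #>\<^bsub>FW W\<^esub> v"
      then obtain t where "t \<in> TR W" "z = t + v" by (auto simp: r_coset_def)
      then have "t - (u - v) \<in> TR W" "z = (t - (u - v)) + u" using d TR_diff by auto
      then show "z \<in> TR W #>\<^bsub>FW W\<^esub> u" unfolding r_coset_def mult_free_Abelian_group by blast
    qed
  qed
qed

lemma frag_keys: "b \<in> carrier B \<Longrightarrow> x \<in> carrier W \<Longrightarrow> supp W (frag_of (b, x))"
  by (simp add: keys_frag_of)

lemma one_keys: "x \<in> carrier W \<Longrightarrow> supp W (frag1 x)"
  by (rule frag_keys[OF BR.one_closed])

lemma frag_zero: "frag1 \<zero>\<^bsub>W\<^esub> \<in> TR W"
  using TR_uminus[OF rel_right[OF BR.one_closed W.M.zero_closed W.M.zero_closed]] by simp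

lemma frag_diff: "x \<in> carrier W \<Longrightarrow> y \<in> carrier W \<Longrightarrow>
    frag1 x - frag1 y - frag1 (x \<ominus>\<^bsub>W\<^esub> y) \<in> TR W"
proof -
  assume xy: "x \<in> carrier W" "y \<in> carrier W"
  have "x \<ominus>\<^bsub>W\<^esub> y \<oplus>\<^bsub>W\<^esub> y = x" using xy by (simp add: a_minus_def W.M.a_assoc W.M.l_neg)
  then show ?thesis
    using rel_right[OF BR.one_closed W.M.minus_closed[OF xy] xy(2)] by (simp add: diff_right_commute)
qed

text \<open>Write b = p a and move a to the right: the generator b \<otimes> x equals 1 \<otimes> a
  x, and sums of such elements have the same form.\<close>

lemma representative:
  assumes "supp W u"
  shows "\<exists>x\<in>carrier W. u - frag1 x \<in> TR W"
  using assms
proof (induction u rule: frag_induction)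
  case zero
  show ?case using TR_uminus[OF frag_zero] by (intro bexI[of _ "\<zero>\<^bsub>W\<^esub>"]) simp_all
next
  case (one bx)
  then obtain a x where "bx = (p a, x)" "a \<in> carrier A" "x \<in> carrier W" unfolding p_surj by blast
  then show ?case using rel_scalar W.lsmult_closed by blast
next
  case (diff u v)
  then obtain x y where xy: "x \<in> carrier W" "u - frag1 x \<in> TR W"
    "y \<in> carrier W" "v - frag1 y \<in> TR W" by blast
  have "(u - frag1 x) - (v - frag1 y) +
      (frag1 x - frag1 y - frag1 (x \<ominus>\<^bsub>W\<^esub> y)) \<in> TR W"
    by (intro TR_add TR_diff xy frag_diff)
  then show ?case using W.M.minus_closed[OF xy(1,3)]
    by (intro bexI[of _ "x \<ominus>\<^bsub>W\<^esub> y"]) (simp_all add: algebra_simps)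
qed

text \<open>The relations are detected by a test map: the additive map \<Phi> from the free abelian
  group to W / fW that sends (b, y) to the class of a y, for any a with p a = b. Two choices of a
  differ by an element of fA, which does not matter modulo fW. As \<Phi> kills every relation, it
  kills the generator 1 \<otimes> x, and its value there is the class of x.\<close>

lemma \<kappa>_kernel:
  assumes x: "x \<in> carrier W" and T: "frag1 x \<in> TR W"
  shows "x \<in> fim W"
proof -
  let ?N = "gquot W (fim W)" and ?q = "\<lambda>x. fim W +>\<^bsub>W\<^esub> x"
  note N = gquot_module[OF W graded_submodule_fim[OF W]]
  interpret N: graded_left_module A ?N by (rule N(1))
  note qD = gmod_homD[OF N(2)]
  have cg: "comm_group (add_monoid ?N)" using N.M.a_comm_group .
  define g where "g bx = (let (b, x) = bx in ?q (inv_into (carrier A) p b \<odot>\<^bsub>W\<^esub> x))" for bx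
  have g: "g (p a, y) = ?q (a \<odot>\<^bsub>W\<^esub> y)" if a: "a \<in> carrier A" and y: "y \<in> carrier W" for a y
  proof -
    let ?a = "inv_into (carrier A) p (p a)"
    have a': "?a \<in> carrier A" "p ?a = p a"
      using inv_into_into[of "p a" p "carrier A"] f_inv_into_f[of "p a" p "carrier A"] imageI[OF a, of p] by simp_all
    have "p (?a \<ominus> a) = \<zero>\<^bsub>B\<^esub>"
    proof -
      have "p ?a = p (?a \<ominus> a) \<oplus>\<^bsub>B\<^esub> p a"
        using a a'(1) by (simp add: a_minus_def a_assoc l_neg flip: p_add)
      then have "p (?a \<ominus> a) \<oplus>\<^bsub>B\<^esub> p a = p a" using a'(2) by simp
      then show ?thesis
        using BR.add.r_cancel_one[of "p a" "p (?a \<ominus> a)"] p_closed[OF a] p_closed[OF minus_closed[OF a'(1) a]] by simp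
    qed
    then obtain c where c: "c \<in> carrier A" "?a \<ominus> a = f \<otimes> c"
      using p_eq_0_iff[OF minus_closed[OF a'(1) a]] unfolding fA_def by blast
    have "?a = f \<otimes> c \<oplus> a" unfolding c(2)[symmetric] using a a'(1) by (simp add: a_minus_def a_assoc l_neg)
    then have "?a \<odot>\<^bsub>W\<^esub> y = f \<odot>\<^bsub>W\<^esub> (c \<odot>\<^bsub>W\<^esub> y) \<oplus>\<^bsub>W\<^esub> a \<odot>\<^bsub>W\<^esub> y"
      using c(1) a y by (metis W.lsmult_assoc W.lsmult_l_distr fc m_closed)
    moreover have fcy: "f \<odot>\<^bsub>W\<^esub> (c \<odot>\<^bsub>W\<^esub> y) \<in> fim W" unfolding fim_def using c(1) y W.lsmult_closed by blast
    ultimately have "?q (?a \<odot>\<^bsub>W\<^esub> y) = ?q (f \<odot>\<^bsub>W\<^esub> (c \<odot>\<^bsub>W\<^esub> y)) \<oplus>\<^bsub>?N\<^esub> ?q (a \<odot>\<^bsub>W\<^esub> y)"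
      using qD(2)[of "f \<odot>\<^bsub>W\<^esub> (c \<odot>\<^bsub>W\<^esub> y)" "a \<odot>\<^bsub>W\<^esub> y"] a y c(1) by (simp add: W.lsmult_closed del: gquot_simps)
    also have "?q (f \<odot>\<^bsub>W\<^esub> (c \<odot>\<^bsub>W\<^esub> y)) = \<zero>\<^bsub>?N\<^esub>"
      using N(4)[of "f \<odot>\<^bsub>W\<^esub> (c \<odot>\<^bsub>W\<^esub> y)"] fcy c(1) y by (simp add: W.lsmult_closed del: gquot_simps)
    finally show ?thesis
      unfolding g_def using qD(1)[of "a \<odot>\<^bsub>W\<^esub> y"] a y by (simp add: W.lsmult_closed del: gquot_simps)
  qed
  have gim: "g ` (carrier B \<times> carrier W) \<subseteq> carrier (add_monoid ?N)"
  proof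
    fix z assume "z \<in> g ` (carrier B \<times> carrier W)"
    then obtain a y where ay: "a \<in> carrier A" "y \<in> carrier W" "z = g (p a, y)" unfolding p_surj by blast
    then show "z \<in> carrier (add_monoid ?N)" using g qD(1)[OF W.lsmult_closed] by (simp del: gquot_simps)
  qed
  obtain \<Phi> where \<Phi>: "\<Phi> \<in> hom (FW W) (add_monoid ?N)"
    "\<forall>bx \<in> carrier B \<times> carrier W. \<Phi> (frag_of bx) = g bx"
    by (rule comm_group.free_Abelian_group_universal[OF cg gim]) blast
  interpret \<Phi>: group_hom "FW W" "add_monoid ?N" \<Phi>
    using \<Phi>(1) FW.group_axioms comm_group.axioms(2)[OF cg] by (simp add: group_hom_def group_hom_axioms_def)
  have \<Phi>f: "\<Phi> (frag_of (p a, y)) = ?q (a \<odot>\<^bsub>W\<^esub> y)" if "a \<in> carrier A" "y \<in> carrier W" for a y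
    using \<Phi>(2) g[OF that] that p_closed by simp
  have \<Phi>add: "\<Phi> (u + v) = \<Phi> u \<oplus>\<^bsub>?N\<^esub> \<Phi> v"
    if "supp W u" "supp W v" for u v
    using \<Phi>.hom_mult[of u v] that by (simp del: gquot_simps)
  have \<Phi>eq0: "\<Phi> (u - v) = \<zero>\<^bsub>?N\<^esub>"
    if k: "supp W u" "supp W v" and e: "\<Phi> u = \<Phi> v" for u v
  proof -
    have kd: "supp W (u - v)" using keys_diff[of u v] k by blast
    have "\<Phi> u = \<Phi> (u - v) \<oplus>\<^bsub>?N\<^esub> \<Phi> v" using \<Phi>add[OF kd k(2)] by simp
    then show ?thesis
      using e \<Phi>.hom_closed[of v] \<Phi>.hom_closed[of "u - v"] k(2) kd N.M.add.r_cancel_one[of "\<Phi> v" "\<Phi> (u - v)"]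
      by (simp del: gquot_simps)
  qed
  have kk: "supp W (frag_of (p a, y))" if "a \<in> carrier A" "y \<in> carrier W" for a y
    by (rule frag_keys) (use that in auto)
  have kadd: "supp W (u + v)"
    if "supp W u" "supp W v" for u v :: "'a set \<times> 'b \<Rightarrow>\<^sub>0 int"
    using keys_add[of u v] that by blast
  have gen: "\<Phi> u = \<zero>\<^bsub>?N\<^esub>" if u: "u \<in> trel W" for u
    using u unfolding trel_def
  proof (elim UnE CollectE exE conjE)
    fix b b' y assume h: "u = frag_of (b \<oplus>\<^bsub>B\<^esub> b', y) - frag_of (b, y) - frag_of (b', y)"
      "b \<in> carrier B" "b' \<in> carrier B" "y \<in> carrier W"
    obtain a a' where a: "a \<in> carrier A" "b = p a" "a' \<in> carrier A" "b' = p a'" using h(2,3) unfolding p_surj by blast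
    have u': "u = frag_of (p (a \<oplus> a'), y) - (frag_of (p a, y) + frag_of (p a', y))"
      unfolding h(1) a p_add[OF a(1,3)] by simp
    have "\<Phi> (frag_of (p (a \<oplus> a'), y)) = \<Phi> (frag_of (p a, y) + frag_of (p a', y))"
      using a h(4) qD(2)[OF W.lsmult_closed W.lsmult_closed, of a y a' y]
      by (simp add: \<Phi>add kk \<Phi>f W.lsmult_l_distr del: gquot_simps)
    then show ?thesis unfolding u' using a h(4) by (intro \<Phi>eq0 kk kadd) auto
  next
    fix b y y' assume h: "u = frag_of (b, y \<oplus>\<^bsub>W\<^esub> y') - frag_of (b, y) - frag_of (b, y')"
      "b \<in> carrier B" "y \<in> carrier W" "y' \<in> carrier W"
    obtain a where a: "a \<in> carrier A" "b = p a" using h(2) unfolding p_surj by blast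
    have u': "u = frag_of (p a, y \<oplus>\<^bsub>W\<^esub> y') - (frag_of (p a, y) + frag_of (p a, y'))"
      unfolding h(1) a by simp
    have "\<Phi> (frag_of (p a, y \<oplus>\<^bsub>W\<^esub> y')) = \<Phi> (frag_of (p a, y) + frag_of (p a, y'))"
      using a h(3,4) qD(2)[OF W.lsmult_closed W.lsmult_closed, of a y a y']
      by (simp add: \<Phi>add kk \<Phi>f W.lsmult_r_distr del: gquot_simps)
    then show ?thesis unfolding u' using a h(3,4) by (intro \<Phi>eq0 kk kadd) auto
  next
    fix a b y assume h: "u = frag_of (b \<otimes>\<^bsub>B\<^esub> p a, y) - frag_of (b, a \<odot>\<^bsub>W\<^esub> y)"
      "a \<in> carrier A" "b \<in> carrier B" "y \<in> carrier W"
    obtain c where c: "c \<in> carrier A" "b = p c" using h(3) unfolding p_surj by blast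
    have u': "u = frag_of (p (c \<otimes> a), y) - frag_of (p c, a \<odot>\<^bsub>W\<^esub> y)"
      unfolding h(1) c p_mult[OF c(1) h(2)] by simp
    have "\<Phi> (frag_of (p (c \<otimes> a), y)) = \<Phi> (frag_of (p c, a \<odot>\<^bsub>W\<^esub> y))"
      using c h(2,4) by (simp add: \<Phi>f W.lsmult_closed W.lsmult_assoc del: gquot_simps)
    then show ?thesis unfolding u' using c h(2,4) by (intro \<Phi>eq0 kk) (auto simp: W.lsmult_closed)
  qed
  have all0: "\<Phi> t = \<zero>\<^bsub>?N\<^esub> \<and> supp W t" if "t \<in> TR W" for t
    using that unfolding TR_def'
  proof (induction t rule: generate.induct)
    case one then show ?case using \<Phi>.hom_one by (simp del: gquot_simps)
  next
    case (incl h) then show ?case using gen[OF incl] subsetD[OF trel_carrier incl] by simp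
  next
    case (inv h)
    then have k: "supp W h" using subsetD[OF trel_carrier inv] by simp
    have "\<Phi> (0 - h) = \<zero>\<^bsub>?N\<^esub>"
      using \<Phi>.hom_one gen[OF inv] k by (intro \<Phi>eq0) (auto simp del: gquot_simps)
    then show ?case using k by simp
  next
    case (eng h1 h2)
    then show ?case using \<Phi>add kadd by (simp del: gquot_simps)
  qed
  have "?q (\<one> \<odot>\<^bsub>W\<^esub> x) = \<zero>\<^bsub>?N\<^esub>" using \<Phi>f[OF one_closed x] all0[OF T] by (simp del: gquot_simps)
  then show ?thesis using N(4)[OF x] x by (simp add: W.lsmult_one del: gquot_simps)
qed

abbreviation BC where "BC \<equiv> base_change A p B W"

lemma BC_simps:
  "carrier BC = rcosets\<^bsub>FW W\<^esub> TR W" "ring.add BC = set_mult (FW W)" "\<zero>\<^bsub>BC\<^esub> = TR W"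
  "smult BC b X = TR W <#>\<^bsub>FW W\<^esub> (frag_extend (\<lambda>(b', x). frag_of (b \<otimes>\<^bsub>B\<^esub> b', x)) ` X)"
  "mpart BC n = (\<lambda>u. TR W #>\<^bsub>FW W\<^esub> u) `
        generate (FW W) {frag_of (b, x) | b x i. b \<in> rpart B i \<and> x \<in> mpart W (n - i)}"
  by (simp_all add: base_change_def)

lemma \<kappa>_eq_zero_iff: "x \<in> carrier W \<Longrightarrow> \<kappa> W x = TR W \<longleftrightarrow> x \<in> fim W"
proof -
  assume x: "x \<in> carrier W"
  have TR0: "TR W = TR W #>\<^bsub>FW W\<^esub> 0" by (auto simp: r_coset_def)
  have "\<kappa> W x = TR W \<longleftrightarrow> frag1 x - 0 \<in> TR W"
    unfolding \<kappa>_def by (subst TR0, subst coset_eq_iff) (use one_keys[OF x] in simp_all)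
  also have "\<dots> \<longleftrightarrow> x \<in> fim W"
  proof
    assume "x \<in> fim W"
    then obtain y where y: "y \<in> carrier W" "x = f \<odot>\<^bsub>W\<^esub> y" unfolding fim_def by blast
    have "f = f \<otimes> \<one>" by simp
    then have "f \<in> fA" unfolding fA_def by (rule image_eqI) simp
    then have pf: "p f = p \<zero>" using p_eq_0_iff[OF fc] by simp
    have "(frag_of (p \<zero>, y) - frag_of (\<one>\<^bsub>B\<^esub>, \<zero> \<odot>\<^bsub>W\<^esub> y)) - (frag_of (p f, y) - frag1 (f \<odot>\<^bsub>W\<^esub> y)) +
        frag1 \<zero>\<^bsub>W\<^esub> \<in> TR W"
      by (intro TR_add TR_diff rel_scalar frag_zero fc zero_closed y(1))
    then show "frag1 x - 0 \<in> TR W" unfolding pf y(2) using y(1) by simp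
  qed (use \<kappa>_kernel[OF x] in simp)
  finally show ?thesis .
qed

lemma \<kappa>_representative:
  assumes "supp W u" "x \<in> carrier W" "u - frag1 x \<in> TR W"
  shows "TR W #>\<^bsub>FW W\<^esub> u = \<kappa> W x"
  unfolding \<kappa>_def using coset_eq_iff[OF assms(1) one_keys[OF assms(2)]] assms(3) by simp

text \<open>By \<open>representative\<close> and \<open>\<kappa>_kernel\<close> the tensor product
  is W / fW by way of \<kappa>, and its graded structure over A is pushed forward from W. For W free
  and bounded below this is precisely a \<open>rel_cover\<close>.\<close>

lemma base_change_module:
  "graded_left_module A (restr BC)" "\<kappa> W \<in> gmod_hom A W (restr BC)"
  "\<kappa> W ` carrier W = carrier (restr BC)"
  "\<And>x. x \<in> carrier W \<Longrightarrow> \<kappa> W x = \<zero>\<^bsub>restr BC\<^esub> \<longleftrightarrow> x \<in> fim W"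
proof -
  show ker: "\<kappa> W x = \<zero>\<^bsub>restr BC\<^esub> \<longleftrightarrow> x \<in> fim W" if "x \<in> carrier W" for x
    using \<kappa>_eq_zero_iff[OF that] by (simp add: BC_simps)
  have normal: "TR W \<lhd> FW W" by (rule FW.subgroup_imp_normal[OF TR_subgroup])
  show surj: "\<kappa> W ` carrier W = carrier (restr BC)"
  proof
    show "\<kappa> W ` carrier W \<subseteq> carrier (restr BC)"
    proof
      fix X assume "X \<in> \<kappa> W ` carrier W"
      then obtain x where x: "x \<in> carrier W" "X = \<kappa> W x" by blast
      have "frag1 x \<in> carrier (FW W)" using one_keys[OF x(1)] by simp
      then show "X \<in> carrier (restr BC)"
        unfolding x(2) \<kappa>_def restrict_scalars_simps BC_simps(1) RCOSETS_def by blast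
    qed
    show "carrier (restr BC) \<subseteq> \<kappa> W ` carrier W"
    proof
      fix X assume "X \<in> carrier (restr BC)"
      then obtain u where u: "supp W u" "X = TR W #>\<^bsub>FW W\<^esub> u"
        by (auto simp: BC_simps RCOSETS_def)
      then obtain x where "x \<in> carrier W" "u - frag1 x \<in> TR W" using representative by blast
      then show "X \<in> \<kappa> W ` carrier W" using \<kappa>_representative u by blast
    qed
  qed
  have add: "\<kappa> W (x \<oplus>\<^bsub>W\<^esub> y) = \<kappa> W x \<oplus>\<^bsub>restr BC\<^esub> \<kappa> W y" if xy: "x \<in> carrier W" "y \<in> carrier W" for x y
  proof -
    have k: "supp W (frag1 x + frag1 y)"
      using keys_add[of "frag1 x" "frag1 y"] one_keys[OF xy(1)] one_keys[OF xy(2)] by blast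
    have "\<kappa> W x <#>\<^bsub>FW W\<^esub> \<kappa> W y = TR W #>\<^bsub>FW W\<^esub> (frag1 x + frag1 y)"
      unfolding \<kappa>_def using normal.rcos_sum[OF normal, of "frag1 x" "frag1 y"]
        one_keys[OF xy(1)] one_keys[OF xy(2)] by simp
    also have "\<dots> = \<kappa> W (x \<oplus>\<^bsub>W\<^esub> y)"
      using TR_uminus[OF rel_right[OF BR.one_closed xy]]
      by (intro \<kappa>_representative k W.M.a_closed xy) (simp add: algebra_simps)
    finally show ?thesis by (simp add: BC_simps)
  qed
  have smult: "\<kappa> W (a \<odot>\<^bsub>W\<^esub> x) = a \<odot>\<^bsub>restr BC\<^esub> \<kappa> W x" if a: "a \<in> carrier A" and x: "x \<in> carrier W" for a x
  proof -
    let ?E = "frag_extend (\<lambda>(b', x). frag_of (p a \<otimes>\<^bsub>B\<^esub> b', x))"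
    have pa: "p a \<in> carrier B" by (rule p_closed[OF a])
    have ET: "?E t \<in> TR W" if "t \<in> TR W" for t
      by (rule TR_map[OF W, where s' = "\<lambda>a. a" and h = "\<lambda>x. x", OF _ _ _ _ _ _ that])
        (simp_all add: pa BR.r_distr BR.m_assoc)
    have "a \<odot>\<^bsub>restr BC\<^esub> \<kappa> W x = TR W #>\<^bsub>FW W\<^esub> ?E (frag1 x)"
      unfolding \<kappa>_def restrict_scalars_simps BC_simps(4)
      by (rule coset_image[OF ET TR_zero TR_add]) (simp_all add: frag_extend_add)
    also have "?E (frag1 x) = frag_of (p a, x)" using BR.r_one[OF pa] by simp
    also have "TR W #>\<^bsub>FW W\<^esub> frag_of (p a, x) = \<kappa> W (a \<odot>\<^bsub>W\<^esub> x)"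
      by (rule \<kappa>_representative[OF frag_keys[OF pa x] W.lsmult_closed[OF a x] rel_scalar[OF a x]])
    finally show ?thesis ..
  qed
  have part: "mpart (restr BC) n = \<kappa> W ` mpart W n" for n
  proof
    let ?U = "{frag_of (b, x) | b x i. b \<in> rpart B i \<and> x \<in> mpart W (n - i)}"
    have gen: "\<exists>x\<in>mpart W n. u - frag1 x \<in> TR W" if "u \<in> ?U" for u
    proof -
      from that obtain b y i where u: "u = frag_of (b, y)" "b \<in> rpart B i" "y \<in> mpart W (n - i)" by blast
      obtain a where a: "a \<in> rpart A i" "b = p a" using u(2) by (auto simp: B_simps(6))
      have ac: "a \<in> carrier A" by (rule rgr.D_carrier[OF a(1)])
      have "a \<odot>\<^bsub>W\<^esub> y \<in> mpart W n" using W.mpart_smult[OF a(1) u(3)] by simp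
      then show ?thesis unfolding u(1) a(2) using rel_scalar[OF ac W.mgr.D_carrier[OF u(3)]] by blast
    qed
    have Uk: "?U \<subseteq> carrier (FW W)"
    proof
      fix u assume "u \<in> ?U"
      then obtain b y i where "u = frag_of (b, y)" "b \<in> rpart B i" "y \<in> mpart W (n - i)" by blast
      then show "u \<in> carrier (FW W)"
        using frag_keys[of b y] p_surj W.mgr.D_carrier rgr.D_carrier by (auto simp: B_simps(6))
    qed
    have rep: "supp W u \<and> (\<exists>x\<in>mpart W n. u - frag1 x \<in> TR W)"
      if "u \<in> generate (FW W) ?U" for u
      using that
    proof (induction u rule: generate.induct)
      case one
      show ?case using TR_uminus[OF frag_zero] W.mgr.D_zero by (auto intro!: bexI[of _ "\<zero>\<^bsub>W\<^esub>"])
    next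
      case (incl h)
      have "supp W h" using subsetD[OF Uk incl] by simp
      then show ?case using gen[OF incl] by blast
    next
      case (inv h)
      have k: "supp W h" using subsetD[OF Uk inv] by simp
      obtain x where x: "x \<in> mpart W n" "h - frag1 x \<in> TR W" using gen[OF inv] by blast
      have xc: "x \<in> carrier W" by (rule W.mgr.D_carrier[OF x(1)])
      have "\<zero>\<^bsub>W\<^esub> \<ominus>\<^bsub>W\<^esub> x = \<ominus>\<^bsub>W\<^esub> x" using xc by (simp add: a_minus_def)
      then have fd: "frag1 \<zero>\<^bsub>W\<^esub> - frag1 x - frag1 (\<ominus>\<^bsub>W\<^esub> x) \<in> TR W"
        using frag_diff[OF W.M.zero_closed xc] by simp
      have "(frag1 \<zero>\<^bsub>W\<^esub> - frag1 x - frag1 (\<ominus>\<^bsub>W\<^esub> x)) - frag1 \<zero>\<^bsub>W\<^esub> -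
          (h - frag1 x) \<in> TR W"
        by (intro TR_diff fd frag_zero x(2))
      moreover have "(frag1 \<zero>\<^bsub>W\<^esub> - frag1 x - frag1 (\<ominus>\<^bsub>W\<^esub> x)) - frag1 \<zero>\<^bsub>W\<^esub> -
          (h - frag1 x) = - h - frag1 (\<ominus>\<^bsub>W\<^esub> x)" by (simp add: algebra_simps)
      ultimately have "- h - frag1 (\<ominus>\<^bsub>W\<^esub> x) \<in> TR W" by (simp only:)
      then show ?case using k W.mgr.D_neg[OF x(1)] by auto
    next
      case (eng h1 h2)
      obtain x y where xy: "x \<in> mpart W n" "h1 - frag1 x \<in> TR W"
        "y \<in> mpart W n" "h2 - frag1 y \<in> TR W" using eng by blast
      have c: "x \<in> carrier W" "y \<in> carrier W" using xy W.mgr.D_carrier by auto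
      have "(h1 - frag1 x) + (h2 - frag1 y) -
          (frag1 (x \<oplus>\<^bsub>W\<^esub> y) - frag1 x - frag1 y) \<in> TR W"
        by (intro TR_add TR_diff xy rel_right[OF BR.one_closed c])
      then have "h1 + h2 - frag1 (x \<oplus>\<^bsub>W\<^esub> y) \<in> TR W" by (simp add: algebra_simps)
      moreover have "supp W (h1 + h2)"
        using keys_add[of h1 h2] eng by blast
      ultimately show ?case using W.mgr.D_add[OF xy(1,3)] by auto
    qed
    show "mpart (restr BC) n \<subseteq> \<kappa> W ` mpart W n"
    proof
      fix X assume "X \<in> mpart (restr BC) n"
      then obtain u where u: "u \<in> generate (FW W) ?U" "X = TR W #>\<^bsub>FW W\<^esub> u" by (auto simp: BC_simps)
      then obtain x where "x \<in> mpart W n" "u - frag1 x \<in> TR W" using rep by blast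
      then show "X \<in> \<kappa> W ` mpart W n"
        using \<kappa>_representative[OF conjunct1[OF rep[OF u(1)]] W.mgr.D_carrier] u(2) by blast
    qed
    show "\<kappa> W ` mpart W n \<subseteq> mpart (restr BC) n"
    proof
      fix X assume "X \<in> \<kappa> W ` mpart W n"
      then obtain x where x: "x \<in> mpart W n" "X = \<kappa> W x" by blast
      have "\<one>\<^bsub>B\<^esub> \<in> rpart B 0" using p_part[OF rpart_one] by simp
      then have "frag1 x \<in> ?U" using x(1) by force
      then have "frag1 x \<in> generate (FW W) ?U" by (rule generate.incl)
      then show "X \<in> mpart (restr BC) n" unfolding x(2) \<kappa>_def by (simp add: BC_simps)
    qed
  qed
  have "\<zero>\<^bsub>W\<^esub> \<in> fim W"
    using submoduleD(2)[of "fim W" A W] graded_submodule_fim[OF W] by (simp add: graded_submodule_def)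
  then have z: "\<kappa> W \<zero>\<^bsub>W\<^esub> = \<zero>\<^bsub>restr BC\<^esub>" using ker by simp
  have cpeq: "\<kappa> W (gcomp W (mpart W) x n) = \<kappa> W (gcomp W (mpart W) y n)"
    if xy: "x \<in> carrier W" "y \<in> carrier W" "\<kappa> W x = \<kappa> W y" for x y n
  proof -
    have sm: "submodule (fim W) A W" and gr: "\<And>x n. x \<in> fim W \<Longrightarrow> W.mgr.cp x n \<in> fim W"
      using graded_submodule_fim[OF W] by (auto simp: graded_submodule_def)
    have d: "\<kappa> W x = \<kappa> W y \<longleftrightarrow> x \<ominus>\<^bsub>W\<^esub> y \<in> fim W" if xy: "x \<in> carrier W" "y \<in> carrier W" for x y
    proof -
      have "\<kappa> W x = \<kappa> W y \<longleftrightarrow> frag1 x - frag1 y \<in> TR W"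
        unfolding \<kappa>_def by (rule coset_eq_iff[OF one_keys one_keys]) (use xy in auto)
      also have "\<dots> \<longleftrightarrow> frag1 (x \<ominus>\<^bsub>W\<^esub> y) \<in> TR W"
        using TR_diff[OF _ frag_diff[OF xy]] TR_add[OF _ frag_diff[OF xy]] by fastforce
      also have "\<dots> \<longleftrightarrow> \<kappa> W (x \<ominus>\<^bsub>W\<^esub> y) = TR W #>\<^bsub>FW W\<^esub> 0"
        unfolding \<kappa>_def using coset_eq_iff[of "frag1 (x \<ominus>\<^bsub>W\<^esub> y)" 0] one_keys[OF W.M.minus_closed[OF xy]] by simp
      also have "TR W #>\<^bsub>FW W\<^esub> 0 = TR W" by (auto simp: r_coset_def)
      finally show ?thesis using \<kappa>_eq_zero_iff[OF W.M.minus_closed[OF xy]] by simp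
    qed
    have "W.mgr.cp (x \<ominus>\<^bsub>W\<^esub> y) n \<in> fim W" using gr d[OF xy(1,2)] xy(3) by blast
    moreover have "W.mgr.cp (x \<ominus>\<^bsub>W\<^esub> y) n = W.mgr.cp x n \<ominus>\<^bsub>W\<^esub> W.mgr.cp y n"
    proof -
      have "W.mgr.cp x n = W.mgr.cp ((x \<ominus>\<^bsub>W\<^esub> y) \<oplus>\<^bsub>W\<^esub> y) n"
        using xy by (simp add: a_minus_def W.M.a_assoc W.M.l_neg)
      also have "\<dots> = W.mgr.cp (x \<ominus>\<^bsub>W\<^esub> y) n \<oplus>\<^bsub>W\<^esub> W.mgr.cp y n"
        using xy by (intro W.mgr.cp_add) auto
      finally show ?thesis using xy by (simp add: a_minus_def W.M.a_assoc W.M.r_neg)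
    qed
    ultimately show ?thesis using d xy by simp
  qed
  note push = glm_pushforward[OF W, where N = "restr BC" and h = "\<kappa> W", OF surj[symmetric] z add smult part cpeq]
  show "graded_left_module A (restr BC)" "\<kappa> W \<in> gmod_hom A W (restr BC)" by (rule push; assumption)+
qed

end

section \<open>The complex of a twisted matrix factorization\<close>

context mf_setting
begin

lemma \<sigma>_image_fA: "\<sigma> ` fA = fA"
proof
  show "\<sigma> ` fA \<subseteq> fA" unfolding fA_def by (auto simp: \<sigma>_mult)
  show "fA \<subseteq> \<sigma> ` fA"
  proof
    fix x assume "x \<in> fA"
    then obtain c where c: "c \<in> carrier A" "x = f \<otimes> c" unfolding fA_def by blast
    have "x = \<sigma> (f \<otimes> \<sigma>i c)" using c by (simp add: \<sigma>_mult)
    moreover have "f \<otimes> \<sigma>i c \<in> fA" unfolding fA_def using c(1) by simp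
    ultimately show "x \<in> \<sigma> ` fA" by (rule image_eqI)
  qed
qed

lemma image_\<sigma>_p: "a \<in> carrier A \<Longrightarrow> \<sigma> ` p a = p (\<sigma> a)"
proof -
  assume a: "a \<in> carrier A"
  have c: "x \<in> carrier A" if "x \<in> fA" for x using fA_irr irr_closed that by blast
  have "\<sigma> ` p a = (\<lambda>x. \<sigma> x \<oplus> \<sigma> a) ` fA"
    unfolding p_def' a_r_coset_def' using a c \<sigma>_add by (auto simp: image_iff)
  also have "\<dots> = (\<lambda>x. x \<oplus> \<sigma> a) ` (\<sigma> ` fA)" by (simp add: image_image)
  also have "\<dots> = p (\<sigma> a)" unfolding \<sigma>_image_fA p_def' a_r_coset_def' by blast
  finally show ?thesis .
qed

lemma image_\<sigma>_inj: "inj_on (image \<sigma>) (carrier B)"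
proof (rule inj_onI)
  fix b b' assume b: "b \<in> carrier B" "b' \<in> carrier B" "\<sigma> ` b = \<sigma> ` b'"
  have "b \<subseteq> carrier A" "b' \<subseteq> carrier A"
    using b(1,2) ideal_fA unfolding B_simps
    by (auto simp: A_RCOSETS_def' a_r_coset_def' dest: additive_subgroup.a_Hcarr[OF ideal.axioms(1)])
  then show "b = b'" using b(3) \<sigma>_bij by (metis bij_betw_def inj_on_image_eq_iff)
qed

definition \<sigma>Bi :: "'a set \<Rightarrow> 'a set" where
  "\<sigma>Bi = inv_into (carrier B) (image \<sigma>)"

lemma \<sigma>Bi_p: "a \<in> carrier A \<Longrightarrow> \<sigma>Bi (p a) = p (\<sigma>i a)"
  unfolding \<sigma>Bi_def
  by (rule inv_into_f_eq[OF image_\<sigma>_inj]) (simp_all add: image_\<sigma>_p)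

lemma base_change_map_\<kappa>:
  fixes W :: "('a, 'b) gmodule" and W' :: "('a, 'c) gmodule"
  assumes W: "graded_left_module A W" and W': "graded_left_module A W'"
    and s: "\<And>a. a \<in> carrier A \<Longrightarrow> s (p a) = p (s' a)" "\<And>a. a \<in> carrier A \<Longrightarrow> s' a \<in> carrier A"
      "\<And>a b. a \<in> carrier A \<Longrightarrow> b \<in> carrier A \<Longrightarrow> s' (a \<oplus> b) = s' a \<oplus> s' b"
      "\<And>a b. a \<in> carrier A \<Longrightarrow> b \<in> carrier A \<Longrightarrow> s' (a \<otimes> b) = s' a \<otimes> s' b" "s' \<one> = \<one>"
    and h: "\<And>x. x \<in> carrier W \<Longrightarrow> h x \<in> carrier W'"
      "\<And>x y. x \<in> carrier W \<Longrightarrow> y \<in> carrier W \<Longrightarrow> h (x \<oplus>\<^bsub>W\<^esub> y) = h x \<oplus>\<^bsub>W'\<^esub> h y"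
      "\<And>a x. a \<in> carrier A \<Longrightarrow> x \<in> carrier W \<Longrightarrow> h (a \<odot>\<^bsub>W\<^esub> x) = s' a \<odot>\<^bsub>W'\<^esub> h x"
  shows "base_change_map A p B W' s h (\<kappa> W x) = \<kappa> W' (h x)"
proof -
  interpret W: base_change_setting A f e \<sigma> W
    using W mf_setting_axioms by (simp add: base_change_setting_def base_change_setting_axioms_def)
  interpret W': base_change_setting A f e \<sigma> W'
    using W' mf_setting_axioms by (simp add: base_change_setting_def base_change_setting_axioms_def)
  let ?E = "frag_extend (\<lambda>(b, x). frag_of (s b, h x))"
  have ET: "?E t \<in> TR W'" if "t \<in> TR W" for t
  proof (rule W.TR_map[OF W' _ _ _ h that])
    show "s b \<in> carrier B" if "b \<in> carrier B" for b using that s(1,2) unfolding p_surj by auto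
    show "s (b \<oplus>\<^bsub>B\<^esub> b') = s b \<oplus>\<^bsub>B\<^esub> s b'" if b: "b \<in> carrier B" "b' \<in> carrier B" for b b'
    proof -
      obtain a a' where a: "a \<in> carrier A" "b = p a" "a' \<in> carrier A" "b' = p a'" using b unfolding p_surj by blast
      have "s (p (a \<oplus> a')) = p (s' (a \<oplus> a'))" by (rule s(1)[OF a_closed[OF a(1,3)]])
      also have "\<dots> = p (s' a) \<oplus>\<^bsub>B\<^esub> p (s' a')" unfolding s(3)[OF a(1,3)] by (rule p_add[OF s(2)[OF a(1)] s(2)[OF a(3)]])
      finally show ?thesis unfolding a(2,4) p_add[OF a(1,3)] s(1)[OF a(1)] s(1)[OF a(3)] .
    qed
    show "s (b \<otimes>\<^bsub>B\<^esub> p a) = s b \<otimes>\<^bsub>B\<^esub> p (s' a)" if b: "b \<in> carrier B" and a: "a \<in> carrier A" for b a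
    proof -
      obtain c where c: "c \<in> carrier A" "b = p c" using b unfolding p_surj by blast
      have "s (p (c \<otimes> a)) = p (s' (c \<otimes> a))" by (rule s(1)[OF m_closed[OF c(1) a]])
      also have "\<dots> = p (s' c) \<otimes>\<^bsub>B\<^esub> p (s' a)" unfolding s(4)[OF c(1) a] by (rule p_mult[OF s(2)[OF c(1)] s(2)[OF a]])
      finally show ?thesis unfolding c(2) p_mult[OF c(1) a] s(1)[OF c(1)] .
    qed
  qed (use s(2) in simp_all)
  have "base_change_map A p B W' s h (\<kappa> W x) = TR W' #>\<^bsub>FW W'\<^esub> ?E (frag1 x)"
    unfolding \<kappa>_def base_change_map_def
    by (rule coset_image[OF ET W.TR_zero W'.TR_add]) (simp_all add: frag_extend_add)
  also have "?E (frag1 x) = frag1 (h x)"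
    using s(1)[OF one_closed] s(5) by simp
  finally show ?thesis unfolding \<kappa>_def .
qed

lemma twpow_simps [simp]:
  "carrier ((tws ^^ j) M) = carrier M" "ring.add ((tws ^^ j) M) = ring.add M" "\<zero>\<^bsub>(tws ^^ j) M\<^esub> = \<zero>\<^bsub>M\<^esub>"
  by (induction j) simp_all

lemma twpow_smult_f [simp]: "f \<odot>\<^bsub>(tws ^^ j) M\<^esub> x = f \<odot>\<^bsub>M\<^esub> x"
  by (induction j) simp_all

lemma fim_twpow [simp]: "fim ((tws ^^ j) M) = fim M"
  unfolding fim_def by simp

lemma glm_twpow: "graded_left_module A M \<Longrightarrow> graded_left_module A ((tws ^^ j) M)"
  by (induction j) (simp_all add: glm_tws)

lemma gmod_hom_twpow: "h \<in> gmod_hom A M N \<Longrightarrow> h \<in> gmod_hom A ((tws ^^ j) M) ((tws ^^ j) N)"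
  by (induction j) (simp_all add: gmod_hom_tws)

lemma irr_span_tws:
  assumes "graded_left_module A M" "x \<in> irr_span A M"
  shows "x \<in> irr_span A (tws M)"
proof -
  interpret M: pos_graded_module A M by (rule pgm[OF assms(1)])
  interpret N: pos_graded_module A "tws M" by (rule pgm[OF glm_tws[OF assms(1)]])
  show ?thesis
    using assms(2)
  proof (induction x rule: M.irr_span_induct)
    case zero then show ?case using N.irr_span_zero by simp
  next
    case (smult a x)
    then show ?case using N.irr_span_smult[OF \<sigma>i_irr[OF smult(1)], of x] irr_closed[OF smult(1)] by simp
  next
    case (add x y) then show ?case using N.irr_span_add by simp
  qed
qed

lemma irr_span_twpow:
  "graded_left_module A M \<Longrightarrow> x \<in> irr_span A M \<Longrightarrow> x \<in> irr_span A ((tws ^^ j) M)"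
  by (induction j) (simp_all add: irr_span_tws glm_twpow)

text \<open>\<sigma> on A and \<open>image \<sigma>\<close> on B correspond under p, so twisting the
  cover over A and twisting the quotient over B fit together.\<close>

lemma rel_cover_tw:
  assumes c: "rel_cover W (restr N) q"
  shows "rel_cover (tws W) (restr (tw (image \<sigma>) e N)) q"
proof -
  note c = rel_coverD[OF c]
  let ?M = "tws (restr N)" and ?N = "restr (tw (image \<sigma>) e N)"
  have M: "graded_left_module A ?M" by (rule glm_tws[OF c(3)])
  have sm: "(\<lambda>x. x) (a \<odot>\<^bsub>?M\<^esub> x) = a \<odot>\<^bsub>?N\<^esub> (\<lambda>x. x) x" if "a \<in> carrier A" for a x
    using image_\<sigma>_p[OF that] by simp
  have N: "graded_left_module A ?N" and h: "(\<lambda>x. x) \<in> gmod_hom A ?M ?N"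
    by (rule glm_pushforward[OF M, where h = "\<lambda>x. x" and N = ?N]; (rule sm)?; simp)+
  have "q \<in> gmod_hom A (tws W) ?N"
    using gmod_hom_comp[OF gmod_hom_tws[OF c(4)] h] .
  then show ?thesis
    unfolding rel_cover_def
    using graded_free_tws[OF c(1)] bounded_below_tw[OF c(2)] N c(5,6) fim_twpow[of 1 W] by simp
qed

lemma rel_cover_twpow:
  "rel_cover W (restr N) q \<Longrightarrow> rel_cover ((tws ^^ j) W) (restr ((tw (image \<sigma>) e ^^ j) N)) q"
  by (induction j) (simp_all add: rel_cover_tw)

text \<open>D is given by a formula on cosets, with no linearity known in advance. It agrees with
  the map that \<psi> induces on the quotients, and is a homomorphism for that reason.\<close>

lemma hom_descends:
  assumes q: "rel_cover W N q" and q': "rel_cover W' N' q'" and \<psi>: "\<psi> \<in> gmod_hom A W W'"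
    and D: "\<And>x. x \<in> carrier W \<Longrightarrow> D (q x) = q' (\<psi> x)"
  shows "D \<in> gmod_hom A N N'"
proof -
  note c = rel_coverD[OF q] and c' = rel_coverD[OF q']
  have "\<exists>k\<in>gmod_hom A N N'. \<forall>x\<in>carrier W. k (q x) = q' (\<psi> x)"
  proof (rule factor_through_surjection[OF c(7) c(3) c'(3) c(4,5) gmod_hom_comp[OF \<psi> c'(4)]])
    fix x assume "x \<in> carrier W" "q x = \<zero>\<^bsub>N\<^esub>"
    then obtain y where y: "y \<in> carrier W" "x = f \<odot>\<^bsub>W\<^esub> y" using c(6) unfolding fim_def by blast
    have \<psi>y: "\<psi> y \<in> carrier W'" by (rule gmod_homD(1)[OF \<psi> y(1)])
    have "\<psi> x = f \<odot>\<^bsub>W'\<^esub> \<psi> y" unfolding y(2) by (rule gmod_homD(3)[OF \<psi> fc y(1)])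
    then show "q' (\<psi> x) = \<zero>\<^bsub>N'\<^esub>"
      using c'(6)[of "\<psi> x"] \<psi>y gmod_homD(1)[OF \<psi>, of x] \<open>x \<in> carrier W\<close> unfolding fim_def by blast
  qed
  then obtain k where k: "k \<in> gmod_hom A N N'" "\<And>x. x \<in> carrier W \<Longrightarrow> k (q x) = q' (\<psi> x)" by (elim bexE) simp
  interpret N: graded_left_module A N by (rule c(3))
  have eq: "D y = k y" if "y \<in> carrier N" for y
  proof -
    have "y \<in> q ` carrier W" using that c(5) by simp
    then show ?thesis using k(2) D by auto
  qed
  show ?thesis
    by (rule gmod_homI)
      (simp_all add: eq gmod_homD[OF k(1)] N.M.a_closed N.lsmult_closed N.mgr.D_carrier)
qed

text \<open>Both matrices have entries in \<open>A_+\<close>. This implies \<open>reduced_mf\<close>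
  (\<open>minimal_mf_reduced\<close>) and makes \<open>Omega\<close> a minimal complex; it is the
  form of reducedness that is verified for syzygies.\<close>

definition minimal_mf :: "('a, nat \<Rightarrow> 'a) factorization \<Rightarrow> bool" where
  "minimal_mf X \<longleftrightarrow> twisted_mf A \<sigma> e f X \<and> bounded_below (srcF X) \<and> bounded_below (tgtG X) \<and>
     phi X ` carrier (srcF X) \<subseteq> irr_span A (tgtG X) \<and> tau X ` carrier (tgtG X) \<subseteq> irr_span A (srcF X)"

context
  fixes X :: "('a, nat \<Rightarrow> 'a) factorization"
  assumes X: "minimal_mf X"
begin

lemma mfD:
  "graded_free A (srcF X)" "graded_free A (tgtG X)" "phi X \<in> gmod_hom A (srcF X) (tgtG X)"
  "tau X \<in> gmod_hom A (tws (tgtG X)) (srcF X)"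
  "\<And>x. x \<in> carrier (tgtG X) \<Longrightarrow> phi X (tau X x) = f \<odot>\<^bsub>tgtG X\<^esub> x"
  "\<And>x. x \<in> carrier (srcF X) \<Longrightarrow> tau X (phi X x) = f \<odot>\<^bsub>srcF X\<^esub> x"
  "graded_left_module A (srcF X)" "graded_left_module A (tgtG X)"
  using X graded_free_glm by (auto simp: minimal_mf_def twisted_mf_def left_mult_def)

definition Wm where "Wm i = (if even i then tgtG X else srcF X)"

text \<open>Lifts to A of the differentials of \<open>Omega\<close>, with the twists left to the
  modules. Two consecutive ones compose to multiplication by f, which is the source of
  exactness.\<close>

definition \<psi>m where "\<psi>m i = (if even i then phi X else tau X)"

abbreviation Om where "Om \<equiv> Omega A \<sigma> e f X"

lemma cobj_Om: "cobj Om i = (tw (image \<sigma>) e ^^ (i div 2)) (base_change A p B (Wm i))"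
  by (simp add: Omega_def Wm_def Let_def)

lemma cdiff_Om: "cdiff Om i = (if even i then base_change_map A p B (tgtG X) id (phi X)
     else base_change_map A p B (srcF X) \<sigma>Bi (tau X))"
  by (simp add: Omega_def \<sigma>Bi_def Let_def)

lemma free_Wm: "graded_free A (Wm i)"
  unfolding Wm_def using mfD(1,2) by simp

lemma glm_Wm: "graded_left_module A (Wm i)"
  by (rule graded_free_glm[OF free_Wm])

lemma cover_Om: "rel_cover ((tws ^^ (i div 2)) (Wm i)) (restr (cobj Om i)) (\<kappa> (Wm i))"
proof -
  interpret W: base_change_setting A f e \<sigma> "Wm i"
    using glm_Wm mf_setting_axioms by (simp add: base_change_setting_def base_change_setting_axioms_def)
  have "bounded_below (Wm i)" using X by (simp add: Wm_def minimal_mf_def)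
  then have "rel_cover (Wm i) (restr (base_change A p B (Wm i))) (\<kappa> (Wm i))"
    unfolding rel_cover_def using free_Wm W.base_change_module by blast
  then show ?thesis unfolding cobj_Om by (rule rel_cover_twpow)
qed

lemma \<psi>m_hom: "\<psi>m i \<in> gmod_hom A ((tws ^^ (Suc i div 2)) (Wm (Suc i))) ((tws ^^ (i div 2)) (Wm i))"
proof (cases "even i")
  case True
  then have "Suc i div 2 = i div 2" by presburger
  then show ?thesis using True gmod_hom_twpow[OF mfD(3)] by (simp add: \<psi>m_def Wm_def)
next
  case False
  then have "Suc i div 2 = Suc (i div 2)" by presburger
  moreover have "(tws ^^ Suc j) M = (tws ^^ j) (tws M)" for j and M :: "('a, nat \<Rightarrow> 'a) gmodule" by (simp only: funpow_Suc_right comp_apply)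
  ultimately show ?thesis using False gmod_hom_twpow[OF mfD(4)] by (simp add: \<psi>m_def Wm_def del: funpow.simps)
qed

lemma \<psi>m_carrier: "x \<in> carrier (Wm (Suc i)) \<Longrightarrow> \<psi>m i x \<in> carrier (Wm i)"
  using gmod_homD(1)[OF \<psi>m_hom[of i], of x] by simp

lemma \<psi>m_\<psi>m: "x \<in> carrier (Wm i) \<Longrightarrow> \<psi>m i (\<psi>m (Suc i) x) = f \<odot>\<^bsub>Wm i\<^esub> x"
  using mfD(5,6) by (auto simp: \<psi>m_def Wm_def split: if_splits)

lemma \<psi>m_inj: "x \<in> carrier (Wm (Suc i)) \<Longrightarrow> y \<in> carrier (Wm (Suc i)) \<Longrightarrow> \<psi>m i x = \<psi>m i y \<Longrightarrow> x = y"
proof -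
  assume xy: "x \<in> carrier (Wm (Suc i))" "y \<in> carrier (Wm (Suc i))" "\<psi>m i x = \<psi>m i y"
  have *: "\<psi>m (Suc i) (\<psi>m i z) = f \<odot>\<^bsub>Wm (Suc i)\<^esub> z" if "z \<in> carrier (Wm (Suc i))" for z
    using mfD(5,6) that by (auto simp: \<psi>m_def Wm_def split: if_splits)
  show "x = y" using xy *[OF xy(1)] *[OF xy(2)] by (intro f_inj[OF free_Wm xy(1,2)]) simp
qed

lemma cdiff_\<kappa>: "cdiff Om i (\<kappa> (Wm (Suc i)) x) = \<kappa> (Wm i) (\<psi>m i x)"
proof (cases "even i")
  case True
  have "base_change_map A p B (tgtG X) id (phi X) (\<kappa> (srcF X) x) = \<kappa> (tgtG X) (phi X x)"
    by (rule base_change_map_\<kappa>[where s' = "\<lambda>a. a"])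
      (simp_all add: mfD(7,8) gmod_homD[OF mfD(3)])
  then show ?thesis using True by (simp add: cdiff_Om \<psi>m_def Wm_def)
next
  case False
  \<comment> \<open>\<open>tau\<close> is linear on the twist of \<open>tgtG X\<close>, so on
    \<open>tgtG X\<close> itself it is semilinear for the inverse of \<sigma>. This accounts for
    \<open>\<sigma>Bi\<close> in the odd differentials.\<close>
  have tsm: "tau X (a \<odot>\<^bsub>tgtG X\<^esub> x) = \<sigma>i a \<odot>\<^bsub>srcF X\<^esub> tau X x" if "a \<in> carrier A" "x \<in> carrier (tgtG X)" for a x
    using gmod_homD(3)[OF mfD(4), of "\<sigma>i a" x] that by simp
  have tadd: "tau X (x \<oplus>\<^bsub>tgtG X\<^esub> y) = tau X x \<oplus>\<^bsub>srcF X\<^esub> tau X y" if "x \<in> carrier (tgtG X)" "y \<in> carrier (tgtG X)" for x y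
    using gmod_homD(2)[OF mfD(4), of x y] that by simp
  have tcl: "tau X x \<in> carrier (srcF X)" if "x \<in> carrier (tgtG X)" for x
    using gmod_homD(1)[OF mfD(4), of x] that by simp
  have \<sigma>i1: "\<sigma>i \<one> = \<one>" using \<sigma>i_\<sigma>[of \<one>] by simp
  have "base_change_map A p B (srcF X) \<sigma>Bi (tau X) (\<kappa> (tgtG X) x) = \<kappa> (srcF X) (tau X x)"
    by (rule base_change_map_\<kappa>[where s' = \<sigma>i])
      (simp_all add: mfD(7,8) \<sigma>Bi_p \<sigma>i_add \<sigma>i_mult \<sigma>i1 tsm tadd tcl)
  then show ?thesis using False by (simp add: cdiff_Om \<psi>m_def Wm_def)
qed

lemma \<kappa>_zero_iff: "x \<in> carrier (Wm i) \<Longrightarrow> \<kappa> (Wm i) x = \<zero>\<^bsub>restr (cobj Om i)\<^esub> \<longleftrightarrow> x \<in> fim (Wm i)"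
  using rel_coverD(6)[OF cover_Om[of i], of x] by (simp del: restrict_scalars_simps)

lemma \<kappa>_onto: "y \<in> carrier (restr (cobj Om i)) \<Longrightarrow> \<exists>x\<in>carrier (Wm i). y = \<kappa> (Wm i) x"
  using rel_coverD(5)[OF cover_Om[of i]] by (auto simp del: restrict_scalars_simps)

lemma im_cdiff: "cdiff Om i ` carrier (restr (cobj Om (Suc i))) = \<kappa> (Wm i) ` \<psi>m i ` carrier (Wm (Suc i))"
proof -
  have "carrier (restr (cobj Om (Suc i))) = \<kappa> (Wm (Suc i)) ` carrier (Wm (Suc i))"
    using rel_coverD(5)[OF cover_Om[of "Suc i"]] by (simp del: restrict_scalars_simps funpow.simps)
  then show ?thesis using cdiff_\<kappa>[of i] by (simp add: image_image del: restrict_scalars_simps)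
qed

text \<open>The kernel fW of \<kappa> is already contained in the image of \<open>\<psi>m i\<close>,
  since f z is \<open>\<psi>m i (\<psi>m (Suc i) z)\<close>. So membership in the image is not
  affected by reduction modulo f.\<close>

lemma \<kappa>_in_image_iff:
  assumes x: "x \<in> carrier (Wm i)"
  shows "\<kappa> (Wm i) x \<in> cdiff Om i ` carrier (restr (cobj Om (Suc i))) \<longleftrightarrow> x \<in> \<psi>m i ` carrier (Wm (Suc i))"
proof
  assume "\<kappa> (Wm i) x \<in> cdiff Om i ` carrier (restr (cobj Om (Suc i)))"
  then obtain y where y: "y \<in> carrier (Wm (Suc i))" "\<kappa> (Wm i) x = \<kappa> (Wm i) (\<psi>m i y)" unfolding im_cdiff by blast
  note c = rel_coverD[OF cover_Om[of i]]
  interpret Wi: graded_left_module A "Wm i" by (rule glm_Wm)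
  interpret T: graded_left_module A "(tws ^^ (i div 2)) (Wm i)" by (rule c(7))
  interpret N: graded_left_module A "restr (cobj Om i)" by (rule c(3))
  note \<psi>y = \<psi>m_carrier[OF y(1)]
  have \<kappa>c: "\<kappa> (Wm i) x \<in> carrier (restr (cobj Om i))" using gmod_homD(1)[OF c(4), of x] x by simp
  have inv: "\<ominus>\<^bsub>(tws ^^ (i div 2)) (Wm i)\<^esub> v = \<ominus>\<^bsub>Wm i\<^esub> v" for v by (rule a_inv_cong) auto
  have "\<kappa> (Wm i) (x \<ominus>\<^bsub>Wm i\<^esub> \<psi>m i y) = \<kappa> (Wm i) x \<ominus>\<^bsub>restr (cobj Om i)\<^esub> \<kappa> (Wm i) (\<psi>m i y)"
    using gmod_hom_eq_diff[OF c(7) c(3) c(4), of x "\<psi>m i y"] x \<psi>y unfolding a_minus_def inv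
    by (simp del: restrict_scalars_simps)
  also have "\<dots> = \<zero>\<^bsub>restr (cobj Om i)\<^esub>" unfolding y(2)[symmetric] using N.M.r_neg[OF \<kappa>c] by (simp only: a_minus_def)
  finally have "x \<ominus>\<^bsub>Wm i\<^esub> \<psi>m i y \<in> fim (Wm i)" using \<kappa>_zero_iff[of "x \<ominus>\<^bsub>Wm i\<^esub> \<psi>m i y" i] x \<psi>y by simp
  then obtain z where z: "z \<in> carrier (Wm i)" "x \<ominus>\<^bsub>Wm i\<^esub> \<psi>m i y = f \<odot>\<^bsub>Wm i\<^esub> z" unfolding fim_def by blast
  have z': "z \<in> carrier (Wm (Suc (Suc i)))" using z(1) by (simp add: Wm_def)
  note \<psi>z = \<psi>m_carrier[OF z']
  have "x = (x \<ominus>\<^bsub>Wm i\<^esub> \<psi>m i y) \<oplus>\<^bsub>Wm i\<^esub> \<psi>m i y" using x \<psi>y by (simp add: a_minus_def Wi.M.a_assoc Wi.M.l_neg)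
  also have "\<dots> = \<psi>m i (\<psi>m (Suc i) z) \<oplus>\<^bsub>Wm i\<^esub> \<psi>m i y" unfolding z(2) \<psi>m_\<psi>m[OF z(1)] ..
  also have "\<dots> = \<psi>m i (\<psi>m (Suc i) z \<oplus>\<^bsub>Wm (Suc i)\<^esub> y)"
    using gmod_homD(2)[OF \<psi>m_hom[of i], of "\<psi>m (Suc i) z" y] \<psi>z y(1) by simp
  finally have x_eq: "x = \<psi>m i (\<psi>m (Suc i) z \<oplus>\<^bsub>Wm (Suc i)\<^esub> y)" .
  interpret Wi': graded_left_module A "Wm (Suc i)" by (rule glm_Wm)
  show "x \<in> \<psi>m i ` carrier (Wm (Suc i))"
    unfolding x_eq by (rule imageI) (use \<psi>z y(1) in simp)
qed (simp add: im_cdiff del: restrict_scalars_simps)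

text \<open>For exactness, suppose \<open>\<psi>m i x\<close> is a multiple f z. Then it equals
  \<open>\<psi>m i (\<psi>m (Suc i) z)\<close>, and \<open>\<psi>m i\<close> is injective because it
  is a right factor of multiplication by f. Minimality is inherited from
  \<open>minimal_mf\<close>.\<close>

lemma minimal_complex_Om: "minimal_complex (\<lambda>i. restr (cobj Om i)) (cdiff Om)"
  unfolding minimal_complex_def
proof (intro allI conjI ballI)
  fix i
  show "\<exists>G q. rel_cover G (restr (cobj Om i)) q" using cover_Om by blast
  show hom: "cdiff Om i \<in> gmod_hom A (restr (cobj Om (Suc i))) (restr (cobj Om i))"
    by (rule hom_descends[OF cover_Om cover_Om \<psi>m_hom cdiff_\<kappa>])
  show "cdiff Om i ` carrier (restr (cobj Om (Suc i))) \<subseteq> irr_span A (restr (cobj Om i))"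
  proof
    fix y assume "y \<in> cdiff Om i ` carrier (restr (cobj Om (Suc i)))"
    then obtain x where x: "x \<in> carrier (Wm (Suc i))" "y = \<kappa> (Wm i) (\<psi>m i x)" unfolding im_cdiff by blast
    have "\<psi>m i x \<in> irr_span A (Wm i)"
      using X x(1) by (auto simp: minimal_mf_def \<psi>m_def Wm_def split: if_splits)
    then have "\<psi>m i x \<in> irr_span A ((tws ^^ (i div 2)) (Wm i))" by (rule irr_span_twpow[OF glm_Wm])
    then show "y \<in> irr_span A (restr (cobj Om i))"
      unfolding x(2)
      by (rule irr_span_hom[OF pgm[OF glm_twpow[OF glm_Wm]] pgm[OF rel_coverD(3)[OF cover_Om]] rel_coverD(4)[OF cover_Om]])
  qed
  fix y assume "y \<in> carrier (restr (cobj Om (Suc i)))"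
  then obtain x where x: "x \<in> carrier (Wm (Suc i))" "y = \<kappa> (Wm (Suc i)) x" using \<kappa>_onto by blast
  have "cdiff Om i y = \<zero>\<^bsub>restr (cobj Om i)\<^esub> \<longleftrightarrow> \<psi>m i x \<in> fim (Wm i)"
    unfolding x(2) cdiff_\<kappa> by (rule \<kappa>_zero_iff[OF \<psi>m_carrier[OF x(1)]])
  also have "\<dots> \<longleftrightarrow> x \<in> \<psi>m (Suc i) ` carrier (Wm (Suc (Suc i)))"
  proof
    have WW: "carrier (Wm (Suc (Suc i))) = carrier (Wm i)" by (simp add: Wm_def)
    {
      assume "\<psi>m i x \<in> fim (Wm i)"
      then obtain z where z: "z \<in> carrier (Wm i)" "\<psi>m i x = f \<odot>\<^bsub>Wm i\<^esub> z" unfolding fim_def by blast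
      have z': "z \<in> carrier (Wm (Suc (Suc i)))" using z(1) WW by simp
      have "x = \<psi>m (Suc i) z"
        by (rule \<psi>m_inj[OF x(1) \<psi>m_carrier[OF z']]) (simp add: z(2) \<psi>m_\<psi>m[OF z(1)])
      then show "x \<in> \<psi>m (Suc i) ` carrier (Wm (Suc (Suc i)))" using z' by blast
    next
      assume "x \<in> \<psi>m (Suc i) ` carrier (Wm (Suc (Suc i)))"
      then obtain z where z: "z \<in> carrier (Wm i)" "x = \<psi>m (Suc i) z" unfolding WW by blast
      show "\<psi>m i x \<in> fim (Wm i)" unfolding z(2) \<psi>m_\<psi>m[OF z(1)] fim_def using z(1) by blast
    }
  qed
  also have "\<dots> \<longleftrightarrow> y \<in> cdiff Om (Suc i) ` carrier (restr (cobj Om (Suc (Suc i))))"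
    unfolding x(2) by (rule \<kappa>_in_image_iff[OF x(1), symmetric])
  finally show "cdiff Om i y = \<zero>\<^bsub>restr (cobj Om i)\<^esub> \<longleftrightarrow> y \<in> cdiff Om (Suc i) ` carrier (restr (cobj Om (Suc (Suc i))))" .
qed

text \<open>\<open>phi\<close> and its reduction modulo f have the same cokernel, because f x =
  \<open>phi X (tau X x)\<close> lies in the image of \<open>phi\<close>.\<close>

lemma augmentation_Om:
  fixes N :: "('a, 'm) gmodule"
  assumes N: "graded_left_module A N" and g: "g \<in> gmod_hom A (tgtG X) N" "g ` carrier (tgtG X) = carrier N"
    "\<And>x. x \<in> carrier (tgtG X) \<Longrightarrow> g x = \<zero>\<^bsub>N\<^esub> \<longleftrightarrow> x \<in> phi X ` carrier (srcF X)"
  shows "\<exists>\<epsilon>\<in>gmod_hom A (restr (cobj Om 0)) N. \<epsilon> ` carrier (restr (cobj Om 0)) = carrier N \<and>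
    (\<forall>y\<in>carrier (restr (cobj Om 0)). \<epsilon> y = \<zero>\<^bsub>N\<^esub> \<longleftrightarrow> y \<in> cdiff Om 0 ` carrier (restr (cobj Om 1)))"
proof -
  have c0: "rel_cover (tgtG X) (restr (cobj Om 0)) (\<kappa> (tgtG X))"
    using cover_Om[of 0] by (simp add: Wm_def)
  note c = rel_coverD[OF c0]
  have "\<exists>k\<in>gmod_hom A (restr (cobj Om 0)) N. \<forall>x\<in>carrier (tgtG X). k (\<kappa> (tgtG X) x) = g x"
  proof (rule factor_through_surjection[OF c(7) c(3) N c(4,5) g(1)])
    fix x assume x: "x \<in> carrier (tgtG X)" "\<kappa> (tgtG X) x = \<zero>\<^bsub>restr (cobj Om 0)\<^esub>"
    then have "x \<in> fim (tgtG X)" using c(6) by blast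
    then obtain z where z: "z \<in> carrier (tgtG X)" "x = phi X (tau X z)" unfolding fim_def using mfD(5) by auto
    have "tau X z \<in> carrier (srcF X)" using gmod_homD(1)[OF mfD(4), of z] z(1) by simp
    then have "x \<in> phi X ` carrier (srcF X)" unfolding z(2) by (rule imageI)
    then show "g x = \<zero>\<^bsub>N\<^esub>" using g(3)[OF x(1)] by simp
  qed
  then obtain k where k: "k \<in> gmod_hom A (restr (cobj Om 0)) N" "\<And>x. x \<in> carrier (tgtG X) \<Longrightarrow> k (\<kappa> (tgtG X) x) = g x"
    by (elim bexE) simp
  have surj: "k ` carrier (restr (cobj Om 0)) = carrier N"
    unfolding c(5)[symmetric] g(2)[symmetric] image_image using k(2) by (intro image_cong) simp_all
  have "k y = \<zero>\<^bsub>N\<^esub> \<longleftrightarrow> y \<in> cdiff Om 0 ` carrier (restr (cobj Om 1))" if y: "y \<in> carrier (restr (cobj Om 0))" for y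
  proof -
    obtain x where x: "x \<in> carrier (tgtG X)" "y = \<kappa> (tgtG X) x" using y c(5) by blast
    have "k y = \<zero>\<^bsub>N\<^esub> \<longleftrightarrow> x \<in> phi X ` carrier (srcF X)" unfolding x(2) k(2)[OF x(1)] by (rule g(3)[OF x(1)])
    also have "\<dots> \<longleftrightarrow> y \<in> cdiff Om 0 ` carrier (restr (cobj Om 1))"
      using \<kappa>_in_image_iff[of x 0] x by (simp add: Wm_def \<psi>m_def del: restrict_scalars_simps)
    finally show ?thesis .
  qed
  then show ?thesis using k(1) surj by blast
qed

end

lemma mf_phi_inj:
  assumes Y: "twisted_mf A \<sigma> e f Y" and xy: "x \<in> carrier (srcF Y)" "y \<in> carrier (srcF Y)" "phi Y x = phi Y y"
  shows "x = y"
proof -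
  have fr: "graded_free A (srcF Y)" and t: "\<And>x. x \<in> carrier (srcF Y) \<Longrightarrow> tau Y (phi Y x) = f \<odot>\<^bsub>srcF Y\<^esub> x"
    using Y by (auto simp: twisted_mf_def left_mult_def)
  show ?thesis using t[OF xy(1)] t[OF xy(2)] xy(3) by (intro f_inj[OF fr xy(1,2)]) simp
qed

text \<open>In a trivial summand one of the two maps is an isomorphism: if \<open>phi\<close> is
  multiplication by f, cancelling f shows that \<open>tau\<close> sends 1 to 1, and the other way
  round. Transported through an isomorphism with a minimal factorization, this would put 1 into
  \<open>A_+\<close>.\<close>

lemma minimal_mf_reduced:
  fixes X :: "('a, nat \<Rightarrow> 'a) factorization"
  assumes X: "minimal_mf X"
  shows "reduced_mf A \<sigma> e f X"
  unfolding reduced_mf_def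
proof (intro conjI notI)
  show "twisted_mf A \<sigma> e f X" using X by (simp add: minimal_mf_def)
  assume "\<exists>(Y :: ('a, nat \<Rightarrow> 'a) factorization) T. twisted_mf A \<sigma> e f Y \<and> trivial_mf A \<sigma> e f T \<and> mf_isomorphic A X (mf_sum Y T)"
  then obtain Y :: "('a, nat \<Rightarrow> 'a) factorization" and T where Y: "twisted_mf A \<sigma> e f Y" and triv: "trivial_mf A \<sigma> e f T"
    and iso: "mf_isomorphic A X (mf_sum Y T)" by (elim exE conjE)
  have T: "twisted_mf A \<sigma> e f T" using triv by (simp add: trivial_mf_def)
  obtain \<Psi>G \<Psi>F where \<Psi>G: "\<Psi>G \<in> gmod_iso A (tgtG X) (gsum (tgtG Y) (tgtG T))"
    and \<Psi>F: "\<Psi>F \<in> gmod_iso A (srcF X) (gsum (srcF Y) (srcF T))"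
    and comm: "\<And>x. x \<in> carrier (srcF X) \<Longrightarrow> \<Psi>G (phi X x) = map_prod (phi Y) (phi T) (\<Psi>F x)"
    using iso unfolding mf_isomorphic_def mf_sum_def by auto
  note X' = mfD[OF X]
  note \<Psi>Gh = gmod_isoD(1)[OF \<Psi>G] and \<Psi>Fh = gmod_isoD(1)[OF \<Psi>F]
  have fY: "graded_free A (srcF Y)" "graded_free A (tgtG Y)" and fT: "graded_free A (srcF T)" "graded_free A (tgtG T)"
    and pY: "phi Y \<in> gmod_hom A (srcF Y) (tgtG Y)" and pT: "phi T \<in> gmod_hom A (srcF T) (tgtG T)"
    and tY: "tau Y \<in> gmod_hom A (tws (tgtG Y)) (srcF Y)" and tT: "tau T \<in> gmod_hom A (tws (tgtG T)) (srcF T)"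
    and ptY: "\<And>x. x \<in> carrier (tgtG Y) \<Longrightarrow> phi Y (tau Y x) = f \<odot>\<^bsub>tgtG Y\<^esub> x"
    and ptT: "\<And>x. x \<in> carrier (tgtG T) \<Longrightarrow> phi T (tau T x) = f \<odot>\<^bsub>tgtG T\<^esub> x"
    and tpT: "\<And>x. x \<in> carrier (srcF T) \<Longrightarrow> tau T (phi T x) = f \<odot>\<^bsub>srcF T\<^esub> x"
    using Y T by (auto simp: twisted_mf_def left_mult_def)
  note gY = fY[THEN graded_free_glm] and gT = fT[THEN graded_free_glm]
  have gsF: "graded_left_module A (gsum (srcF Y) (srcF T))" and gsG: "graded_left_module A (gsum (tgtG Y) (tgtG T))"
    by (intro glm_gsum gY gT)+
  have sndF: "snd (\<Psi>F x) \<in> irr_span A (srcF T)" if "x \<in> irr_span A (srcF X)" for x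
    by (rule irr_span_hom[OF pgm[OF X'(7)] pgm[OF gT(1)] gmod_hom_comp[OF \<Psi>Fh gsum_snd_hom] that])
  have sndG: "snd (\<Psi>G x) \<in> irr_span A (tgtG T)" if "x \<in> irr_span A (tgtG X)" for x
    by (rule irr_span_hom[OF pgm[OF X'(8)] pgm[OF gT(2)] gmod_hom_comp[OF \<Psi>Gh gsum_snd_hom] that])
  obtain n where n: "let L = gshift n (reg_module A) in
        (srcF T = tws L \<and> tgtG T = L \<and> (\<forall>x\<in>carrier L. phi T x = left_mult L f x)) \<or>
        (srcF T = L \<and> tgtG T = L \<and> (\<forall>x\<in>carrier L. tau T x = left_mult L f x))"
    using triv unfolding trivial_mf_def by blast
  let ?L = "gshift n (reg_module A)"
  have L: "graded_left_module A ?L" by (rule glm_gshift[OF glm_reg_module])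
  have irrL: "x \<in> irrelevant_ideal A" if "x \<in> irr_span A ?L" for x
  proof -
    interpret L: pos_graded_module A ?L by (rule pgm[OF L])
    show ?thesis using that by (induction x rule: L.irr_span_induct) (auto intro: irr_mult_r irr_add)
  qed
  have irrLt: "x \<in> irrelevant_ideal A" if "x \<in> irr_span A (tws ?L)" for x
  proof -
    interpret L: pos_graded_module A "tws ?L" by (rule pgm[OF glm_tws[OF L]])
    show ?thesis using that by (induction x rule: L.irr_span_induct) (auto intro: irr_mult_r irr_add \<sigma>_irr)
  qed
  interpret XF: graded_left_module A "srcF X" by (rule X'(7))
  interpret XG: graded_left_module A "tgtG X" by (rule X'(8))
  from n consider (phi) "srcF T = tws ?L" "tgtG T = ?L" "\<And>x. x \<in> carrier A \<Longrightarrow> phi T x = f \<otimes> x"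
    | (tau) "srcF T = ?L" "tgtG T = ?L" "\<And>x. x \<in> carrier A \<Longrightarrow> tau T x = f \<otimes> x"
    by (auto simp: Let_def left_mult_def)
  then show False
  proof cases
    case phi
    have tau1: "tau T \<one> = \<one>"
    proof -
      have c: "tau T \<one> \<in> carrier A" using gmod_homD(1)[OF tT, of \<one>] phi by simp
      have "f \<otimes> tau T \<one> = f \<otimes> \<one>" using ptT[of \<one>] phi(3)[OF c] phi(2) by simp
      then show ?thesis by (rule f_cancel[OF _ c one_closed])
    qed
    have "(\<zero>\<^bsub>tgtG Y\<^esub>, \<one>) \<in> \<Psi>G ` carrier (tgtG X)"
      using gmod_isoD(4)[OF \<Psi>G] glm_zero_closed[OF gY(2)] phi(2) by simp
    then obtain y where y: "y \<in> carrier (tgtG X)" "\<Psi>G y = (\<zero>\<^bsub>tgtG Y\<^esub>, \<one>)" by force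
    have ty: "tau X y \<in> carrier (srcF X)" using gmod_homD(1)[OF X'(4), of y] y(1) by simp
    obtain u v where uv: "\<Psi>F (tau X y) = (u, v)" "u \<in> carrier (srcF Y)" "v \<in> carrier (srcF T)"
      using gmod_homD(1)[OF \<Psi>Fh ty] by (cases "\<Psi>F (tau X y)") auto
    \<comment> \<open>Isomorphisms of factorizations are only required to commute with
      \<open>phi\<close>. The compatibility with \<open>tau\<close> needed here is recovered by
      applying the injective map \<open>phi T\<close>.\<close>
    have "map_prod (phi Y) (phi T) (u, v) = \<Psi>G (phi X (tau X y))" using comm[OF ty] uv(1) by simp
    also have "\<dots> = f \<odot>\<^bsub>gsum (tgtG Y) (tgtG T)\<^esub> \<Psi>G y"
      unfolding X'(5)[OF y(1)] by (rule gmod_homD(3)[OF \<Psi>Gh fc y(1)])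
    finally have "phi T v = f \<odot>\<^bsub>tgtG T\<^esub> \<one>" unfolding y(2) by simp
    then have "phi T v = phi T (tau T \<one>)" using ptT[of \<one>] phi(2) by simp
    then have "v = \<one>"
      using mf_phi_inj[OF T uv(3), of "tau T \<one>"] tau1 phi(1) by simp
    moreover have "v \<in> irr_span A (srcF T)"
    proof -
      have "tau X y \<in> irr_span A (srcF X)" using X y(1) unfolding minimal_mf_def by blast
      then show ?thesis using sndF[of "tau X y"] uv(1) by simp
    qed
    ultimately show False using irrLt irr_one unfolding phi(1) by blast
  next
    case tau
    have phi1: "phi T \<one> = \<one>"
    proof -
      have c: "phi T \<one> \<in> carrier A" using gmod_homD(1)[OF pT, of \<one>] tau by simp
      have "f \<otimes> phi T \<one> = f \<otimes> \<one>" using tpT[of \<one>] tau(3)[OF c] tau(1) by simp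
      then show ?thesis by (rule f_cancel[OF _ c one_closed])
    qed
    have "(\<zero>\<^bsub>srcF Y\<^esub>, \<one>) \<in> \<Psi>F ` carrier (srcF X)"
      using gmod_isoD(4)[OF \<Psi>F] glm_zero_closed[OF gY(1)] tau(1) by simp
    then obtain y where y: "y \<in> carrier (srcF X)" "\<Psi>F y = (\<zero>\<^bsub>srcF Y\<^esub>, \<one>)" by force
    have "snd (\<Psi>G (phi X y)) = \<one>" using comm[OF y(1)] y(2) phi1 by simp
    moreover have "phi X y \<in> irr_span A (tgtG X)" using X y(1) unfolding minimal_mf_def by blast
    ultimately have "\<one> \<in> irr_span A (tgtG T)" using sndG[of "phi X y"] by simp
    then show False using irrL irr_one unfolding tau(2) by blast
  qed
qed

end

section \<open>Factorizations from free syzygies\<close>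

context mf_setting
begin

text \<open>What the inclusion of H and multiplication by f need in order to form a minimal
  factorization: a free source, and images in \<open>A_+\<close> times the target for both
  maps.\<close>

definition good_syzygy :: "nat \<Rightarrow> (nat \<Rightarrow> int) \<Rightarrow> (nat \<Rightarrow> 'a) set \<Rightarrow> bool" where
  "good_syzygy r \<delta> H \<longleftrightarrow> graded_submodule A (Fr A r \<delta>) H \<and> graded_free A (gsub (Fr A r \<delta>) H) \<and>
     H \<subseteq> irr_span A (Fr A r \<delta>) \<and>
     (\<forall>x\<in>carrier (Fr A r \<delta>). f \<odot>\<^bsub>Fr A r \<delta>\<^esub> x \<in> irr_span A (gsub (Fr A r \<delta>) H))"

definition syzygy_mf :: "nat \<Rightarrow> (nat \<Rightarrow> int) \<Rightarrow> (nat \<Rightarrow> 'a) set \<Rightarrow> ('a, nat \<Rightarrow> 'a) factorization" where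
  "syzygy_mf r \<delta> H = \<lparr>srcF = gsub (Fr A r \<delta>) H, tgtG = Fr A r \<delta>, phi = \<lambda>x. x, tau = \<lambda>x. f \<odot>\<^bsub>Fr A r \<delta>\<^esub> x\<rparr>"

lemma good_syzygyD:
  assumes "good_syzygy r \<delta> H"
  shows "graded_submodule A (Fr A r \<delta>) H" "graded_free A (gsub (Fr A r \<delta>) H)" "H \<subseteq> irr_span A (Fr A r \<delta>)"
    "\<And>x. x \<in> carrier (Fr A r \<delta>) \<Longrightarrow> f \<odot>\<^bsub>Fr A r \<delta>\<^esub> x \<in> irr_span A (gsub (Fr A r \<delta>) H)"
    "\<And>x. x \<in> carrier (Fr A r \<delta>) \<Longrightarrow> f \<odot>\<^bsub>Fr A r \<delta>\<^esub> x \<in> H"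
    "graded_left_module A (gsub (Fr A r \<delta>) H)" "H \<subseteq> carrier (Fr A r \<delta>)"
proof -
  show 1: "graded_submodule A (Fr A r \<delta>) H" "graded_free A (gsub (Fr A r \<delta>) H)" "H \<subseteq> irr_span A (Fr A r \<delta>)"
    and 2: "\<And>x. x \<in> carrier (Fr A r \<delta>) \<Longrightarrow> f \<odot>\<^bsub>Fr A r \<delta>\<^esub> x \<in> irr_span A (gsub (Fr A r \<delta>) H)"
    using assms unfolding good_syzygy_def by (simp_all del: Fr_simps)
  show 3: "graded_left_module A (gsub (Fr A r \<delta>) H)" by (rule graded_free_glm[OF 1(2)])
  show "f \<odot>\<^bsub>Fr A r \<delta>\<^esub> x \<in> H" if "x \<in> carrier (Fr A r \<delta>)" for x
    using pos_graded_module.irr_span_carrier[OF pgm[OF 3] 2[OF that]] by (simp del: Fr_simps)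
  show "H \<subseteq> carrier (Fr A r \<delta>)" by (rule submoduleD(1)[where R = A]) (use 1(1) in \<open>simp add: graded_submodule_def\<close>)
qed

lemma fin_gen_Fr_gsub:
  assumes "graded_submodule A (Fr A r \<delta>) H"
  shows "fin_gen A (gsub (Fr A r \<delta>) H)"
proof -
  have "submodule H A (Fr A r \<delta>)" using assms by (simp add: graded_submodule_def)
  then show ?thesis
    using fgen_gsub[OF glm_Fr assms Fr_noetherian[OF noetherian]]
    by (simp add: fin_gen_iff_fgen[OF glm_gsub[OF glm_Fr assms]] del: gsub_simps)
qed

lemma fgen_Fr: "fgen A (Fr A r \<delta>) (carrier (Fr A r \<delta>))"
proof -
  interpret L: graded_left_module A "Fr A r \<delta>" by (rule glm_Fr)
  show ?thesis
    by (rule Fr_noetherian[OF noetherian], rule L.submoduleI') (simp_all add: L.lsmult_closed del: Fr_simps)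
qed

lemma syzygy_mf_minimal:
  assumes "good_syzygy r \<delta> H"
  shows "minimal_mf (syzygy_mf r \<delta> H)"
proof -
  note g = good_syzygyD[OF assms]
  have fgF: "fin_gen A (Fr A r \<delta>)"
    using fgen_Fr by (simp add: fin_gen_iff_fgen[OF glm_Fr] del: Fr_simps)
  have phi: "(\<lambda>x. x) \<in> gmod_hom A (gsub (Fr A r \<delta>) H) (Fr A r \<delta>)"
    by (rule gmod_hom_gsub_dom[OF gmod_hom_id g(7)])
  have tau: "(\<lambda>x. f \<odot>\<^bsub>Fr A r \<delta>\<^esub> x) \<in> gmod_hom A (tws (Fr A r \<delta>)) (gsub (Fr A r \<delta>) H)"
    by (rule gmod_hom_gsub_cod[OF left_mult_hom[OF glm_Fr]])
      (use g(5) glm_mpart_carrier[OF glm_tws[OF glm_Fr]] in \<open>simp_all del: Fr_simps\<close>)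
  have "twisted_mf A \<sigma> e f (syzygy_mf r \<delta> H)"
    unfolding twisted_mf_def syzygy_mf_def left_mult_def
    using g(2) fin_gen_Fr_gsub[OF g(1)] graded_free_Fr[OF nontrivial] fgF phi tau by (simp del: Fr_simps)
  then show ?thesis
    unfolding minimal_mf_def
    using bounded_below_Fr bounded_below_gsub[OF bounded_below_Fr] g(3,4)
    by (auto simp: syzygy_mf_def simp del: Fr_simps)
qed

lemma syzygy_mf_reduced: "good_syzygy r \<delta> H \<Longrightarrow> reduced_mf A \<sigma> e f (syzygy_mf r \<delta> H)"
  by (intro minimal_mf_reduced syzygy_mf_minimal)

text \<open>C and \<open>Omega\<close> are both minimal complexes augmented onto N, the latter
  because N is \<open>Fr A r \<delta>\<close> modulo H, the cokernel of \<open>phi\<close>. So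
  \<open>minimal_complex_unique\<close> applies.\<close>

lemma chain_isomorphic_Omega:
  fixes C :: "('a set, 'q) gcomplex" and N :: "('a, 'm) gmodule"
  assumes good: "good_syzygy r \<delta> H" and N: "graded_left_module A N"
    and g: "g \<in> gmod_hom A (Fr A r \<delta>) N" "g ` carrier (Fr A r \<delta>) = carrier N"
      "\<And>x. x \<in> carrier (Fr A r \<delta>) \<Longrightarrow> g x = \<zero>\<^bsub>N\<^esub> \<longleftrightarrow> x \<in> H"
    and C: "minimal_complex (\<lambda>i. restr (cobj C i)) (cdiff C)"
    and \<epsilon>: "\<epsilon> \<in> gmod_hom A (restr (cobj C 0)) N" "\<epsilon> ` carrier (cobj C 0) = carrier N"
      "\<And>x. x \<in> carrier (cobj C 0) \<Longrightarrow> \<epsilon> x = \<zero>\<^bsub>N\<^esub> \<longleftrightarrow> x \<in> cdiff C 0 ` carrier (cobj C 1)"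
  shows "chain_isomorphic B C (Omega A \<sigma> e f (syzygy_mf r \<delta> H))"
proof -
  let ?X = "syzygy_mf r \<delta> H"
  note X = syzygy_mf_minimal[OF good]
  have "\<exists>\<epsilon>\<in>gmod_hom A (restr (cobj (Omega A \<sigma> e f ?X) 0)) N. \<epsilon> ` carrier (restr (cobj (Omega A \<sigma> e f ?X) 0)) = carrier N \<and>
    (\<forall>y\<in>carrier (restr (cobj (Omega A \<sigma> e f ?X) 0)). \<epsilon> y = \<zero>\<^bsub>N\<^esub> \<longleftrightarrow>
       y \<in> cdiff (Omega A \<sigma> e f ?X) 0 ` carrier (restr (cobj (Omega A \<sigma> e f ?X) 1)))"
    by (rule augmentation_Om[OF X N, of g]) (use g in \<open>simp_all add: syzygy_mf_def del: Fr_simps\<close>)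
  then obtain \<epsilon>' where \<epsilon>': "\<epsilon>' \<in> gmod_hom A (restr (cobj (Omega A \<sigma> e f ?X) 0)) N"
    "\<epsilon>' ` carrier (restr (cobj (Omega A \<sigma> e f ?X) 0)) = carrier N"
    "\<And>y. y \<in> carrier (restr (cobj (Omega A \<sigma> e f ?X) 0)) \<Longrightarrow> \<epsilon>' y = \<zero>\<^bsub>N\<^esub> \<longleftrightarrow>
       y \<in> cdiff (Omega A \<sigma> e f ?X) 0 ` carrier (restr (cobj (Omega A \<sigma> e f ?X) 1))"
    by (elim bexE conjE) (simp del: restrict_scalars_simps)
  have \<epsilon>2: "\<epsilon> ` carrier (restr (cobj C 0)) = carrier N" and
    \<epsilon>3: "\<And>x. x \<in> carrier (restr (cobj C 0)) \<Longrightarrow> \<epsilon> x = \<zero>\<^bsub>N\<^esub> \<longleftrightarrow> x \<in> cdiff C 0 ` carrier (restr (cobj C 1))"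
    using \<epsilon>(2,3) by simp_all
  have "\<exists>h. (\<forall>i. h i \<in> gmod_iso A (restr (cobj C i)) (restr (cobj (Omega A \<sigma> e f ?X) i))) \<and>
    (\<forall>i. \<forall>x\<in>carrier (restr (cobj C (Suc i))). cdiff (Omega A \<sigma> e f ?X) i (h (Suc i) x) = h i (cdiff C i x))"
    by (rule minimal_complex_unique[OF C minimal_complex_Om[OF X] N \<epsilon>(1) \<epsilon>2 \<epsilon>3 \<epsilon>'])
  then show ?thesis
    unfolding chain_isomorphic_def gmod_iso_restr by simp
qed

lemma minimal_complex_shift:
  assumes "minimal_complex C D"
  shows "minimal_complex (\<lambda>i. C (i + m)) (\<lambda>i. D (i + m))"
  using assms unfolding minimal_complex_def by simp

lemma minimal_cover_exists:
  fixes L :: "('a set, 'q) gmodule" and N :: "('a set, 'm) gmodule"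
  assumes L: "graded_free B L" and N: "graded_left_module B N" and \<epsilon>: "\<epsilon> \<in> gmod_hom B L N" "\<epsilon> ` carrier L = carrier N"
    and min: "\<And>x. x \<in> carrier L \<Longrightarrow> \<epsilon> x = \<zero>\<^bsub>N\<^esub> \<Longrightarrow> x \<in> irr_span B L"
    and fg: "fgen B N (carrier N)"
  shows "\<exists>r \<delta> q. rel_cover (Fr A r \<delta>) (restr L) q"
proof -
  obtain X where "graded_left_module B L" "graded_basis B L X" using L by (auto simp: graded_free_def)
  then have X: "free_basis B L X" by (rule free_basisI)
  have RB: "pos_graded_ring B" by (rule pos_graded_ring_B[OF glm_ring[OF N]])
  have "finite X" by (rule pos_graded_ring.finite_minimal_basis[OF RB X N \<epsilon> min fg])
  then show ?thesis by (rule free_cover[OF X])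
qed

end

section \<open>Minimal resolutions over the quotient as towers over the ring\<close>

locale minimal_resolution = mf_setting A f e \<sigma> for A :: "'a gring" (structure) and f e \<sigma> +
  fixes M :: "('a set, 'm) gmodule" and Q :: "('a set, 'q) gcomplex"
  assumes M: "graded_left_module B M" "fin_gen B M" and Q: "minimal_free_resolution B M Q"
begin

abbreviation QA where "QA i \<equiv> restr (cobj Q i)"

definition aug where "aug = (SOME \<epsilon>. is_resolution B M Q \<epsilon>)"

lemma resolution: "is_resolution B M Q aug"
proof -
  have "\<exists>\<epsilon>. is_resolution B M Q \<epsilon>" using Q by (simp add: minimal_free_resolution_def free_resolution_def)
  then show ?thesis unfolding aug_def by (rule someI_ex)
qed

lemmas resD = is_resolutionD[OF resolution]

lemma free_Q: "graded_free B (cobj Q i)"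
  using Q by (simp add: minimal_free_resolution_def free_resolution_def)

lemma min_Q: "cdiff Q i ` carrier (cobj Q (Suc i)) \<subseteq> irr_span B (cobj Q i)"
  using Q by (simp add: minimal_free_resolution_def irr_span_def)

lemma im_cdiff_graded: "graded_submodule B (cobj Q i) (cdiff Q i ` carrier (cobj Q (Suc i)))"
  by (rule submodule_himage[OF resD(1) resD(1) resD(2)])

text \<open>Finite generation is pushed along the resolution. Once the i-th term has a cover by a
  finite free A-module, the image of the next differential pulls back to a submodule of that cover,
  so it is finitely generated because A is left noetherian; minimality then gives the next term a
  finite basis.\<close>

lemma cover_Q: "\<exists>r \<delta> q. rel_cover (Fr A r \<delta>) (QA i) q"
proof (induction i)
  case 0
  have fg: "fgen B M (carrier M)" using M by (simp add: fin_gen_iff_fgen)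
  show ?case
    by (rule minimal_cover_exists[OF free_Q M(1) resD(4,5) _ fg]) (use resD(6) min_Q[of 0] in auto)
next
  case (Suc i)
  let ?H = "cdiff Q i ` carrier (cobj Q (Suc i))"
  obtain r \<delta> q where "rel_cover (Fr A r \<delta>) (QA i) q" using Suc by (elim exE)
  note c = rel_coverD[OF this]
  let ?P = "{x \<in> carrier (Fr A r \<delta>). q x \<in> ?H}"
  have smH: "submodule ?H B (cobj Q i)" using im_cdiff_graded by (simp add: graded_submodule_def)
  have Hc: "?H \<subseteq> carrier (cobj Q i)" by (rule submoduleD(1)[OF smH])
  have "graded_submodule A (QA i) ?H"
    using submodule_himage[OF glm_restr[OF resD(1)] glm_restr[OF resD(1)], of "cdiff Q i" "Suc i" i] resD(2)[of i]
    by (simp add: gmod_hom_restr)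
  then have "graded_submodule A (Fr A r \<delta>) ?P" by (rule submodule_preimage[OF c(7,3,4)])
  then have "fgen A (Fr A r \<delta>) ?P" by (intro Fr_noetherian[OF noetherian]) (simp add: graded_submodule_def)
  then have "fgen A (QA i) (q ` ?P)" by (intro fgen_image[OF c(7,3,4)]) auto
  moreover have "q ` ?P = ?H"
  proof
    show "?H \<subseteq> q ` ?P"
    proof
      fix y assume y: "y \<in> ?H"
      then have "y \<in> q ` carrier (Fr A r \<delta>)" using Hc c(5) by auto
      then obtain x where x: "x \<in> carrier (Fr A r \<delta>)" "y = q x" by blast
      then have "x \<in> ?P" using y by simp
      then show "y \<in> q ` ?P" unfolding x(2) by (rule imageI)
    qed
  qed blast
  ultimately have "fgen B (cobj Q i) ?H" using fgen_restr[OF resD(1)] by simp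
  then have fg: "fgen B (gsub (cobj Q i) ?H) (carrier (gsub (cobj Q i) ?H))"
    by (rule fgen_gsub[OF resD(1) im_cdiff_graded])
  have hom: "cdiff Q i \<in> gmod_hom B (cobj Q (Suc i)) (gsub (cobj Q i) ?H)"
    by (rule gmod_hom_gsub_cod[OF resD(2)]) (use glm_mpart_carrier[OF resD(1)] in auto)
  show ?case
  proof (rule minimal_cover_exists[OF free_Q glm_gsub[OF resD(1) im_cdiff_graded] hom _ _ fg])
    show "x \<in> irr_span B (cobj Q (Suc i))"
      if "x \<in> carrier (cobj Q (Suc i))" "cdiff Q i x = \<zero>\<^bsub>gsub (cobj Q i) ?H\<^esub>" for x
      using that resD(3) min_Q[of "Suc i"] by auto
  qed simp
qed

lemma minimal_complex_Q: "minimal_complex QA (cdiff Q)"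
  unfolding minimal_complex_def
proof (intro allI conjI ballI)
  fix i
  show "\<exists>G q. rel_cover G (QA i) q" using cover_Q[of i] by blast
  show "cdiff Q i \<in> gmod_hom A (QA (Suc i)) (QA i)" using resD(2) by (simp add: gmod_hom_restr)
  show "cdiff Q i ` carrier (QA (Suc i)) \<subseteq> irr_span A (QA i)"
    using min_Q[of i] by (simp add: irr_span_restr[OF resD(1)])
  show "cdiff Q i x = \<zero>\<^bsub>QA i\<^esub> \<longleftrightarrow> x \<in> cdiff Q (Suc i) ` carrier (QA (Suc (Suc i)))"
    if "x \<in> carrier (QA (Suc i))" for x
    using resD(3)[of x i] that by simp
qed

lemma tower_exists: "\<exists>r \<delta> q D. mf_tower A f e \<sigma> r \<delta> QA (cdiff Q) q D"
proof -
  obtain r \<delta> q where c: "\<And>i. rel_cover (Fr A (r i) (\<delta> i)) (QA i) (q i)"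
    using cover_Q by metis
  note cD = rel_coverD[OF c]
  have "\<exists>D\<in>gmod_hom A (Fr A (r (Suc i)) (\<delta> (Suc i))) (Fr A (r i) (\<delta> i)).
      \<forall>x\<in>carrier (Fr A (r (Suc i)) (\<delta> (Suc i))). q i (D x) = cdiff Q i (q (Suc i) x)" for i
  proof (rule graded_free_lifting[OF cD(1) cD(7) cD(3) cD(4,5)])
    show "(\<lambda>x. cdiff Q i (q (Suc i) x)) \<in> gmod_hom A (Fr A (r (Suc i)) (\<delta> (Suc i))) (QA i)"
      by (rule gmod_hom_comp[OF cD(4)]) (use resD(2) in \<open>simp add: gmod_hom_restr\<close>)
  qed
  then obtain D where D: "\<And>i. D i \<in> gmod_hom A (Fr A (r (Suc i)) (\<delta> (Suc i))) (Fr A (r i) (\<delta> i)) \<and>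
      (\<forall>x\<in>carrier (Fr A (r (Suc i)) (\<delta> (Suc i))). q i (D i x) = cdiff Q i (q (Suc i) x))"
    by metis
  note mc = minimal_complex_Q[unfolded minimal_complex_def]
  have "mf_tower A f e \<sigma> r \<delta> QA (cdiff Q) q D"
    by (intro mf_tower.intro mf_setting_axioms mf_tower_axioms.intro c)
      (use mc D in \<open>simp_all del: Fr_simps restrict_scalars_simps\<close>)
  then show ?thesis by blast
qed

end

section \<open>Consequences of finite global dimension\<close>

context mf_tower
begin

text \<open>\<open>gl_dim\<close> is a supremum over modules carried by sets of functions
  \<open>nat \<Rightarrow> 'a\<close>. The module being resolved need not have this type, so the
  isomorphic module \<open>G 0 / K 0\<close>, whose elements are cosets in \<open>Fr\<close>, takes
  its place.\<close>

lemma global_dimension_split: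
  assumes gd: "gl_dim A \<le> enat m" and n: "m \<le> n"
  shows "\<exists>s\<in>gmod_hom A (KM n) (T n). \<forall>x\<in>carrier (KM n). gT n (s x) = x"
proof -
  note N = gquot_module[OF glm_G K_graded[of 0]]
  have "proj_dim A (gquot (G 0) (K 0)) \<le> gl_dim A"
    unfolding gl_dim_def using N(1) by (intro SUP_upper) simp
  \<comment> \<open>A strict bound turns the infimum in \<open>proj_dim\<close> into an actual
    resolution of length k \<le> m.\<close>
  also have "\<dots> < enat (Suc m)" using gd by (simp add: order_le_less_trans)
  finally obtain k where k: "pd_le A (gquot (G 0) (K 0)) k" "k < Suc m"
    unfolding proj_dim_def by (auto simp: INF_less_iff)
  obtain P :: "('a, ('a + (nat \<Rightarrow> 'a) set) list) gcomplex"
    where P: "projective_resolution A (gquot (G 0) (K 0)) P" "\<And>i. i > k \<Longrightarrow> carrier (cobj P i) = {\<zero>\<^bsub>cobj P i\<^esub>}"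
    using k(1) unfolding pd_le_def by blast
  show ?thesis by (rule pd_split[OF N P(1)]) (use P(2) k(2) n in simp_all)
qed

text \<open>The splitting at n feeds \<open>minimal_next\<close>, the one at n + 1 makes
  \<open>K (n + 1)\<close> free. Splittings for all n \<ge> d thus give good syzygies from d + 1 on,
  whence the d + 1 in the theorem.\<close>

lemma good_K:
  assumes s: "\<exists>s\<in>gmod_hom A (KM n) (T n). \<forall>x\<in>carrier (KM n). gT n (s x) = x"
    and s': "\<exists>s\<in>gmod_hom A (KM (Suc n)) (T (Suc n)). \<forall>x\<in>carrier (KM (Suc n)). gT (Suc n) (s x) = x"
  shows "good_syzygy (r (Suc n)) (\<delta> (Suc n)) (K (Suc n))"
proof -
  obtain s where s: "s \<in> gmod_hom A (KM n) (T n)" "\<And>x. x \<in> carrier (KM n) \<Longrightarrow> gT n (s x) = x"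
    using s by (elim bexE) simp
  obtain s' where s': "s' \<in> gmod_hom A (KM (Suc n)) (T (Suc n))" "\<And>x. x \<in> carrier (KM (Suc n)) \<Longrightarrow> gT (Suc n) (s' x) = x"
    using s' by (elim bexE) simp
  note fr = KM_free[OF s']
  show ?thesis
    unfolding good_syzygy_def
    by (intro conjI ballI K_graded fr K_irr minimal_next[OF s fr])
qed

lemma good_K_global_dimension: "gl_dim A \<le> enat m \<Longrightarrow> m < n \<Longrightarrow> good_syzygy (r n) (\<delta> n) (K n)"
  using good_K[OF global_dimension_split[of m "n - 1"] global_dimension_split[of m "Suc (n - 1)"]] by simp

end

section \<open>Periodicity\<close>

lemma gshift_gshift: "gshift n (gshift m M) = gshift (n + m) M"
  by (simp add: gshift_def add.assoc)

lemma gmod_hom_gshift: "h \<in> gmod_hom R M N \<Longrightarrow> h \<in> gmod_hom R (gshift n M) (gshift n N)"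
  by (rule gmod_homI) (simp_all add: gmod_homD)

lemma gmod_iso_gshift: "h \<in> gmod_iso R M N \<Longrightarrow> h \<in> gmod_iso R (gshift n M) (gshift n N)"
  by (simp add: gmod_iso_def gmod_hom_gshift)

lemma gsub_gshift: "gsub (gshift n M) H = gshift n (gsub M H)"
  by (simp add: gsub_def gshift_def)

lemma irr_span_gshift: "irr_span R (gshift n M) = irr_span R M"
  by (simp add: irr_span_def gshift_def)

lemma graded_submodule_gshift:
  assumes M: "graded_left_module R M" and H: "graded_submodule R M H"
  shows "graded_submodule R (gshift n M) H"
proof -
  have Hc: "H \<subseteq> carrier M" by (rule submoduleD(1)[where R = R]) (use H in \<open>simp add: graded_submodule_def\<close>)
  have "(\<lambda>x. x) \<in> gmod_hom R (gshift n (gsub M H)) (gshift n M)"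
    by (rule gmod_hom_gshift[OF gmod_hom_gsub_dom[OF gmod_hom_id Hc]])
  from submodule_himage[OF glm_gshift[OF glm_gsub[OF M H]] glm_gshift[OF M] this] show ?thesis by simp
qed

lemma shift_periodic_add:
  assumes "shift_periodic R C p" "shift_periodic R C q"
    and d: "\<And>i x. x \<in> carrier (cobj C (Suc i)) \<Longrightarrow> cdiff C i x \<in> carrier (cobj C i)"
  shows "shift_periodic R C (p + q)"
proof -
  obtain n t where t: "\<And>i. t i \<in> gmod_iso R (gshift n (cobj C (i + p))) (cobj C i)"
    "\<And>i x. x \<in> carrier (cobj C (Suc i + p)) \<Longrightarrow> cdiff C i (t (Suc i) x) = t i (cdiff C (i + p) x)"
    using assms(1) unfolding shift_periodic_def by blast
  obtain m s where s: "\<And>i. s i \<in> gmod_iso R (gshift m (cobj C (i + q))) (cobj C i)"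
    "\<And>i x. x \<in> carrier (cobj C (Suc i + q)) \<Longrightarrow> cdiff C i (s (Suc i) x) = s i (cdiff C (i + q) x)"
    using assms(2) unfolding shift_periodic_def by blast
  have assoc: "i + (p + q) = i + p + q" for i by simp
  show ?thesis
    unfolding shift_periodic_def assoc
  proof (intro exI[of _ "n + m"] exI[of _ "\<lambda>i x. t i (s (i + p) x)"] conjI allI ballI)
    show "(\<lambda>x. t i (s (i + p) x)) \<in> gmod_iso R (gshift (n + m) (cobj C (i + p + q))) (cobj C i)" for i
      unfolding gshift_gshift[symmetric] by (rule gmod_iso_comp[OF gmod_iso_gshift[OF s(1)] t(1)])
    fix i x assume x: "x \<in> carrier (cobj C (Suc i + p + q))"
    have sx: "s (Suc i + p) x \<in> carrier (cobj C (Suc i + p))"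
      using gmod_homD(1)[OF gmod_isoD(1)[OF s(1)], of x "Suc i + p"] x by simp
    have "cdiff C i (t (Suc i) (s (Suc i + p) x)) = t i (cdiff C (i + p) (s (Suc (i + p)) x))"
      using t(2)[OF sx] by simp
    also have "\<dots> = t i (s (i + p) (cdiff C (i + p + q) x))" using s(2)[of x "i + p"] x by simp
    finally show "cdiff C i (t (Suc i) (s (Suc i + p) x)) = t i (s (i + p) (cdiff C (i + p + q) x))" .
  qed
qed

lemma shift_periodic_mult:
  assumes "shift_periodic R C p"
    and d: "\<And>i x. x \<in> carrier (cobj C (Suc i)) \<Longrightarrow> cdiff C i x \<in> carrier (cobj C i)"
  shows "shift_periodic R C (Suc k * p)"
proof (induction k)
  case 0 show ?case using assms(1) by simp
next
  case (Suc k)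
  then show ?case using shift_periodic_add[OF assms(1) Suc d] by simp
qed

lemma shift_periodic_transfer:
  assumes C: "\<And>i. graded_left_module R (cobj C i)" and D: "\<And>i. graded_left_module R (cobj D i)"
    and d: "\<And>i x. x \<in> carrier (cobj C (Suc i)) \<Longrightarrow> cdiff C i x \<in> carrier (cobj C i)"
    and iso: "chain_isomorphic R C D" and per: "shift_periodic R D p"
  shows "shift_periodic R C p"
proof -
  obtain h where h: "\<And>i. h i \<in> gmod_iso R (cobj C i) (cobj D i)"
    "\<And>i x. x \<in> carrier (cobj C (Suc i)) \<Longrightarrow> cdiff D i (h (Suc i) x) = h i (cdiff C i x)"
    using iso unfolding chain_isomorphic_def by blast
  obtain n t where t: "\<And>i. t i \<in> gmod_iso R (gshift n (cobj D (i + p))) (cobj D i)"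
    "\<And>i x. x \<in> carrier (cobj D (Suc i + p)) \<Longrightarrow> cdiff D i (t (Suc i) x) = t i (cdiff D (i + p) x)"
    using per unfolding shift_periodic_def by blast
  define k where "k i = inv_into (carrier (cobj C i)) (h i)" for i
  have k: "k i \<in> gmod_iso R (cobj D i) (cobj C i)" "\<And>x. x \<in> carrier (cobj C i) \<Longrightarrow> k i (h i x) = x"
    "\<And>y. y \<in> carrier (cobj D i) \<Longrightarrow> h i (k i y) = y" for i
    unfolding k_def using gmod_iso_inverse[OF C D h(1)] by blast+
  have hc: "h i x \<in> carrier (cobj D i)" if "x \<in> carrier (cobj C i)" for i x
    by (rule gmod_homD(1)[OF gmod_isoD(1)[OF h(1)] that])
  have kc: "k i x \<in> carrier (cobj C i)" if "x \<in> carrier (cobj D i)" for i x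
    by (rule gmod_homD(1)[OF gmod_isoD(1)[OF k(1)] that])
  have tc: "t i x \<in> carrier (cobj D i)" if "x \<in> carrier (cobj D (i + p))" for i x
    using gmod_homD(1)[OF gmod_isoD(1)[OF t(1)[of i]], of x] that by simp
  have kd: "cdiff C i (k (Suc i) y) = k i (cdiff D i y)" if y: "y \<in> carrier (cobj D (Suc i))" for i y
    using k(2)[OF d[OF kc[OF y]]] h(2)[OF kc[OF y]] k(3)[OF y] by simp
  show ?thesis
    unfolding shift_periodic_def
  proof (intro exI[of _ n] exI[of _ "\<lambda>i x. k i (t i (h (i + p) x))"] conjI allI ballI)
    show "(\<lambda>x. k i (t i (h (i + p) x))) \<in> gmod_iso R (gshift n (cobj C (i + p))) (cobj C i)" for i
      by (rule gmod_iso_comp[OF gmod_iso_comp[OF gmod_iso_gshift[OF h(1)] t(1)] k(1)])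
    fix i x assume x: "x \<in> carrier (cobj C (Suc i + p))"
    have "cdiff C i (k (Suc i) (t (Suc i) (h (Suc i + p) x))) = k i (cdiff D i (t (Suc i) (h (Suc i + p) x)))"
      by (rule kd[OF tc[OF hc[OF x]]])
    also have "\<dots> = k i (t i (cdiff D (i + p) (h (Suc i + p) x)))" using t(2)[OF hc[OF x]] by simp
    also have "\<dots> = k i (t i (h (i + p) (cdiff C (i + p) x)))" using h(2)[of x "i + p"] x by simp
    finally show "cdiff C i (k (Suc i) (t (Suc i) (h (Suc i + p) x))) = k i (t i (h (i + p) (cdiff C (i + p) x)))" .
  qed
qed

lemma periodic_least:
  assumes "shift_periodic R C p" "0 < p"
  shows "\<exists>q. periodic_of_period R C q \<and> q \<le> p"
proof -
  define q where "q = (LEAST q. 0 < q \<and> shift_periodic R C q)"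
  have "0 < q \<and> shift_periodic R C q" unfolding q_def by (rule LeastI[of _ p]) (use assms in simp)
  moreover have "q \<le> p" unfolding q_def by (rule Least_le) (use assms in simp)
  moreover have "\<not> shift_periodic R C q'" if "0 < q'" "q' < q" for q'
    using not_less_Least[of q' "\<lambda>q. 0 < q \<and> shift_periodic R C q"] that unfolding q_def by blast
  ultimately show ?thesis unfolding periodic_of_period_def by blast
qed

lemma periodic_of_period_le: "periodic_of_period R C p \<Longrightarrow> shift_periodic R C q \<Longrightarrow> 0 < q \<Longrightarrow> p \<le> q"
  unfolding periodic_of_period_def by (meson not_le)

lemma twpow_B:
  "carrier ((tw s e ^^ j) M) = carrier M" "ring.add ((tw s e ^^ j) M) = ring.add M" "\<zero>\<^bsub>(tw s e ^^ j) M\<^esub> = \<zero>\<^bsub>M\<^esub>"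
  "a \<odot>\<^bsub>(tw s e ^^ j) M\<^esub> x = (s ^^ j) a \<odot>\<^bsub>M\<^esub> x" "mpart ((tw s e ^^ j) M) n = mpart M (n - int j * e)"
  by (induction j arbitrary: a n) (simp_all add: algebra_simps funpow_swap1[of s])

context mf_setting
begin

lemma image_\<sigma>_pow_p: "a \<in> carrier A \<Longrightarrow> (image \<sigma> ^^ j) (p a) = p ((\<sigma> ^^ j) a)"
proof -
  assume a: "a \<in> carrier A"
  have "(\<sigma> ^^ j) a \<in> carrier A \<and> (image \<sigma> ^^ j) (p a) = p ((\<sigma> ^^ j) a)"
    by (induction j) (use a in \<open>simp_all add: image_\<sigma>_p\<close>)
  then show ?thesis ..
qed

lemma Omega_shift_periodic:
  fixes X :: "('a, 'b) factorization"
  assumes s: "\<And>a. a \<in> carrier A \<Longrightarrow> (\<sigma> ^^ s) a = a"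
  shows "shift_periodic B (Omega A \<sigma> e f X) (2 * s)"
proof -
  let ?O = "Omega A \<sigma> e f X"
  have even: "even (i + 2 * s) \<longleftrightarrow> even i" and div: "(i + 2 * s) div 2 = i div 2 + s" for i by auto
  have cobj: "cobj ?O i = (tw (image \<sigma>) e ^^ (i div 2)) (base_change A p B (if even i then tgtG X else srcF X))" for i
    by (simp add: Omega_def Let_def)
  have diff: "cdiff ?O (i + 2 * s) = cdiff ?O i" for i
    unfolding Omega_def Let_def by (simp only: gcomplex.simps even)
  have id: "(image \<sigma> ^^ (j + s)) b = (image \<sigma> ^^ j) b" if b: "b \<in> carrier B" for j b
  proof -
    obtain a where "a \<in> carrier A" "b = p a" using b unfolding p_surj by blast
    then have "(image \<sigma> ^^ s) b = b" using s by (simp add: image_\<sigma>_pow_p)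
    then show ?thesis by (simp only: funpow_add comp_apply)
  qed
  have id': "(image \<sigma> ^^ (s + j)) b = (image \<sigma> ^^ j) b" if "b \<in> carrier B" for j b
    using id[OF that, of j] by (simp only: add.commute)
  show ?thesis
    unfolding shift_periodic_def
  \<comment> \<open>Moving by 2 s places keeps the parity and adds s twists. The automorphism part
    of these is trivial by assumption, and their degree part, a shift by - s e, is undone by the
    internal shift s e.\<close>
  proof (intro exI[of _ "int s * e"] exI[of _ "\<lambda>i x. x"] conjI allI ballI)
    show "(\<lambda>x. x) \<in> gmod_iso B (gshift (int s * e) (cobj ?O (i + 2 * s))) (cobj ?O i)" for i
      unfolding gmod_iso_def cobj even div
    proof (intro CollectI conjI)
      show "(\<lambda>x. x) \<in> gmod_hom B (gshift (int s * e) ((tw (image \<sigma>) e ^^ (i div 2 + s)) (base_change A p B (if even i then tgtG X else srcF X))))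
        ((tw (image \<sigma>) e ^^ (i div 2)) (base_change A p B (if even i then tgtG X else srcF X)))"
        by (rule gmod_homI) (simp_all add: twpow_B id' algebra_simps del: funpow.simps)
    qed (simp add: twpow_B bij_betw_def inj_on_def)
  qed (simp only: diff)
qed

text \<open>Chain isomorphism and shift periodicity do not change on passing to A, and over A the
  terms of \<open>Omega\<close> are known to be graded modules by \<open>cover_Om\<close>.\<close>

definition restr_complex :: "('a set, 'q) gcomplex \<Rightarrow> ('a, 'q) gcomplex" where
  "restr_complex C = \<lparr>cobj = \<lambda>i. restr (cobj C i), cdiff = cdiff C\<rparr>"

lemma restr_gshift: "restr (gshift n N) = gshift n (restr N)"
  by (simp add: restrict_scalars_def gshift_def)

lemma chain_isomorphic_restr: "chain_isomorphic A (restr_complex C) (restr_complex D) \<longleftrightarrow> chain_isomorphic B C D"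
  by (simp add: chain_isomorphic_def restr_complex_def gmod_iso_restr)

lemma shift_periodic_restr: "shift_periodic A (restr_complex C) p' \<longleftrightarrow> shift_periodic B C p'"
  by (simp add: shift_periodic_def restr_complex_def gmod_iso_restr flip: restr_gshift)

lemma good_syzygy_shift:
  assumes "good_syzygy r \<delta> H"
  shows "good_syzygy r (\<lambda>j. \<delta> j - n) H"
  using assms graded_submodule_gshift[OF glm_Fr, of r \<delta> H n] graded_free_gshift[of A "gsub (Fr A r \<delta>) H" n]
    irr_span_gshift[of A n "Fr A r \<delta>"] irr_span_gshift[of A n "gsub (Fr A r \<delta>) H"]
  unfolding good_syzygy_def gshift_Fr[symmetric] gsub_gshift by (simp del: Fr_simps)

end

section \<open>Truncations and periodic resolutions as complexes of factorizations\<close>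

context minimal_resolution
begin

lemma Q_diff: "x \<in> carrier (cobj Q (Suc i)) \<Longrightarrow> cdiff Q i x \<in> carrier (cobj Q i)"
  by (rule gmod_homD(1)[OF resD(2)])

text \<open>The meeting point of the statements on periodic resolutions. It presents Q as an
  \<open>Omega\<close>; for \<sigma> of finite order it is equivalent to periodicity of Q, and for
  nonzero M to projective dimension one in the absence of free summands.\<close>

definition good_presentation :: "nat \<Rightarrow> (nat \<Rightarrow> int) \<Rightarrow> (nat \<Rightarrow> 'a) set \<Rightarrow> ((nat \<Rightarrow> 'a) \<Rightarrow> 'm) \<Rightarrow> bool" where
  "good_presentation r \<delta> H g \<longleftrightarrow> good_syzygy r \<delta> H \<and> g \<in> gmod_hom A (Fr A r \<delta>) (restr M) \<and>
     g ` carrier (Fr A r \<delta>) = carrier M \<and> (\<forall>x\<in>carrier (Fr A r \<delta>). g x = \<zero>\<^bsub>M\<^esub> \<longleftrightarrow> x \<in> H)"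

lemma good_presentation_Omega:
  assumes "good_presentation r \<delta> H g"
  shows "chain_isomorphic B Q (Omega A \<sigma> e f (syzygy_mf r \<delta> H))"
proof (rule chain_isomorphic_Omega[OF _ glm_restr[OF M(1)] _ _ _ minimal_complex_Q])
  show "good_syzygy r \<delta> H" "g \<in> gmod_hom A (Fr A r \<delta>) (restr M)" "g ` carrier (Fr A r \<delta>) = carrier (restr M)"
    "\<And>x. x \<in> carrier (Fr A r \<delta>) \<Longrightarrow> g x = \<zero>\<^bsub>restr M\<^esub> \<longleftrightarrow> x \<in> H"
    using assms unfolding good_presentation_def by (simp_all del: Fr_simps)
  show "aug \<in> gmod_hom A (QA 0) (restr M)" using resD(4) by (simp add: gmod_hom_restr)
  show "aug ` carrier (cobj Q 0) = carrier (restr M)" using resD(5) by simp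
  show "aug x = \<zero>\<^bsub>restr M\<^esub> \<longleftrightarrow> x \<in> cdiff Q 0 ` carrier (cobj Q 1)" if "x \<in> carrier (cobj Q 0)" for x
    using resD(6)[OF that] by simp
qed

lemma Omega_iso_periodic:
  assumes good: "good_syzygy r \<delta> H" and iso: "chain_isomorphic B (ctrunc m Q) (Omega A \<sigma> e f (syzygy_mf r \<delta> H))"
    and s: "\<And>a. a \<in> carrier A \<Longrightarrow> (\<sigma> ^^ s) a = a"
  shows "shift_periodic B (ctrunc m Q) (2 * s)"
proof -
  let ?O = "Omega A \<sigma> e f (syzygy_mf r \<delta> H)"
  have "shift_periodic A (restr_complex (ctrunc m Q)) (2 * s)"
  proof (rule shift_periodic_transfer)
    show "chain_isomorphic A (restr_complex (ctrunc m Q)) (restr_complex ?O)"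
      unfolding chain_isomorphic_restr by (rule iso)
    show "shift_periodic A (restr_complex ?O) (2 * s)"
      unfolding shift_periodic_restr by (rule Omega_shift_periodic[OF s])
    show "graded_left_module A (cobj (restr_complex (ctrunc m Q)) i)" for i
      using glm_restr[OF resD(1)] by (simp add: ctrunc_def restr_complex_def)
    show "graded_left_module A (cobj (restr_complex ?O) i)" for i
      using rel_coverD(3)[OF cover_Om[OF syzygy_mf_minimal[OF good]]] by (simp add: restr_complex_def)
    show "cdiff (restr_complex (ctrunc m Q)) i x \<in> carrier (cobj (restr_complex (ctrunc m Q)) i)"
      if "x \<in> carrier (cobj (restr_complex (ctrunc m Q)) (Suc i))" for i x
      using Q_diff that by (simp add: ctrunc_def restr_complex_def)
  qed
  then show ?thesis unfolding shift_periodic_restr .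
qed

lemma ctrunc_0: "ctrunc 0 C = C"
  by (simp add: ctrunc_def)

text \<open>The truncation resolves the image of the differential at place m. The free module over
  place m + 1 maps onto this image with kernel \<open>K (m + 1)\<close>, by exactness, and this
  syzygy is good.\<close>

lemma truncation_Omega:
  assumes gd: "gl_dim A \<le> enat m"
  shows "\<exists>r \<delta> H. good_syzygy r \<delta> H \<and> chain_isomorphic B (ctrunc (Suc m) Q) (Omega A \<sigma> e f (syzygy_mf r \<delta> H))"
proof -
  obtain r \<delta> q D where "mf_tower A f e \<sigma> r \<delta> QA (cdiff Q) q D" using tower_exists by (elim exE)
  then interpret T: mf_tower A f e \<sigma> r \<delta> QA "cdiff Q" q D .
  let ?H = "cdiff Q m ` carrier (QA (Suc m))"
  note good = T.good_K_global_dimension[OF gd lessI]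
  have diff: "cdiff Q m \<in> gmod_hom A (QA (Suc m)) (gsub (QA m) ?H)"
    by (rule gmod_hom_gsub_cod[OF T.d_hom]) (erule imageI, rule glm_mpart_carrier[OF T.glm_Qm])
  have "chain_isomorphic B (ctrunc (Suc m) Q) (Omega A \<sigma> e f (syzygy_mf (r (Suc m)) (\<delta> (Suc m)) (T.K (Suc m))))"
  proof (rule chain_isomorphic_Omega[OF good glm_gsub[OF T.glm_Qm T.im_d_gsub]])
    show "(\<lambda>x. cdiff Q m (q (Suc m) x)) \<in> gmod_hom A (T.G (Suc m)) (gsub (QA m) ?H)"
      by (rule gmod_hom_comp[OF T.q_hom diff])
    show "(\<lambda>x. cdiff Q m (q (Suc m) x)) ` carrier (T.G (Suc m)) = carrier (gsub (QA m) ?H)"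
      using T.q_surj[of "Suc m"] by (simp add: image_image[symmetric] del: Fr_simps restrict_scalars_simps)
    show "cdiff Q m (q (Suc m) x) = \<zero>\<^bsub>gsub (QA m) ?H\<^esub> \<longleftrightarrow> x \<in> T.K (Suc m)" if x: "x \<in> carrier (T.G (Suc m))" for x
      using T.d_exact[OF gmod_homD(1)[OF T.q_hom x]] x unfolding T.K_def by (simp del: Fr_simps restrict_scalars_simps)
    show "minimal_complex (\<lambda>i. restr (cobj (ctrunc (Suc m) Q) i)) (cdiff (ctrunc (Suc m) Q))"
      using minimal_complex_shift[OF minimal_complex_Q, of "Suc m"] by (simp add: ctrunc_def)
    show "cdiff Q m \<in> gmod_hom A (restr (cobj (ctrunc (Suc m) Q) 0)) (gsub (QA m) ?H)"
      using diff by (simp add: ctrunc_def)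
    show "cdiff Q m ` carrier (cobj (ctrunc (Suc m) Q) 0) = carrier (gsub (QA m) ?H)"
      by (simp add: ctrunc_def)
    show "cdiff Q m x = \<zero>\<^bsub>gsub (QA m) ?H\<^esub> \<longleftrightarrow> x \<in> cdiff (ctrunc (Suc m) Q) 0 ` carrier (cobj (ctrunc (Suc m) Q) 1)"
      if "x \<in> carrier (cobj (ctrunc (Suc m) Q) 0)" for x
      using resD(3)[of x m] that by (simp add: ctrunc_def)
  qed
  then show ?thesis using good by blast
qed

text \<open>\<open>t 0\<close> identifies a shift of the j-th term with the term at 0, and
  \<open>t 1\<close> makes it match the images of the differentials. So M is a shift of the cokernel
  at place j, which is \<open>G j / K j\<close>.\<close>

lemma periodic_good_presentation:
  assumes gd: "gl_dim A \<le> enat m" and per: "shift_periodic B Q k" "0 < k"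
  shows "\<exists>r \<delta> H g. good_presentation r \<delta> H g"
proof -
  obtain r \<delta> q D where "mf_tower A f e \<sigma> r \<delta> QA (cdiff Q) q D" using tower_exists by (elim exE)
  then interpret T: mf_tower A f e \<sigma> r \<delta> QA "cdiff Q" q D .
  \<comment> \<open>A multiple of k beyond m, where the syzygies are good.\<close>
  define j where "j = Suc m * k"
  have "Suc m * 1 \<le> j" unfolding j_def by (rule mult_le_mono2) (use per(2) in simp)
  then have mj: "m < j" by simp
  have "shift_periodic B Q j" unfolding j_def by (rule shift_periodic_mult[OF per(1) Q_diff])
  then obtain n t where t: "\<And>i. t i \<in> gmod_iso B (gshift n (cobj Q (i + j))) (cobj Q i)"
    "\<And>i x. x \<in> carrier (cobj Q (Suc i + j)) \<Longrightarrow> cdiff Q i (t (Suc i) x) = t i (cdiff Q (i + j) x)"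
    unfolding shift_periodic_def by blast
  have t0: "t 0 \<in> gmod_hom B (gshift n (cobj Q j)) (cobj Q 0)" "inj_on (t 0) (carrier (cobj Q j))"
    "t 0 ` carrier (cobj Q j) = carrier (cobj Q 0)"
    using gmod_isoD[OF t(1)[of 0]] by simp_all
  have t1: "t 1 ` carrier (cobj Q (Suc j)) = carrier (cobj Q 1)"
    using gmod_isoD(4)[OF t(1)[of 1]] by simp
  note good = T.good_K_global_dimension[OF gd mj]
  have "q j \<in> gmod_hom A (Fr A (r j) (\<lambda>i. \<delta> j i - n)) (gshift n (QA j))"
    using gmod_hom_gshift[OF T.q_hom[of j], where n = n] by (simp add: gshift_Fr)
  moreover have t0A: "t 0 \<in> gmod_hom A (gshift n (QA j)) (QA 0)"
    using t0(1) by (simp add: gmod_hom_restr flip: restr_gshift)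
  moreover have "aug \<in> gmod_hom A (QA 0) (restr M)" using resD(4) by (simp add: gmod_hom_restr)
  ultimately have g: "(\<lambda>x. aug (t 0 (q j x))) \<in> gmod_hom A (Fr A (r j) (\<lambda>i. \<delta> j i - n)) (restr M)"
    using gmod_hom_comp[OF gmod_hom_comp[of "q j" A _ "gshift n (QA j)" "t 0" "QA 0"]] by blast
  have carr: "carrier (Fr A (r j) (\<lambda>i. \<delta> j i - n)) = carrier (T.G j)" by simp
  have qs: "q j ` carrier (T.G j) = carrier (cobj Q j)" using T.q_surj[of j] by (simp del: Fr_simps)
  have surj: "(\<lambda>x. aug (t 0 (q j x))) ` carrier (T.G j) = carrier M"
    unfolding resD(5)[symmetric] t0(3)[symmetric] qs[symmetric] image_image ..
  have im: "cdiff Q 0 ` carrier (cobj Q 1) = t 0 ` cdiff Q j ` carrier (cobj Q (Suc j))"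
    unfolding t1[symmetric] image_image using t(2)[of _ 0] by (intro image_cong) simp_all
  have ker: "aug (t 0 (q j x)) = \<zero>\<^bsub>M\<^esub> \<longleftrightarrow> x \<in> T.K j" if x: "x \<in> carrier (T.G j)" for x
  proof -
    have qx: "q j x \<in> carrier (cobj Q j)" using x qs by blast
    have "aug (t 0 (q j x)) = \<zero>\<^bsub>M\<^esub> \<longleftrightarrow> t 0 (q j x) \<in> t 0 ` cdiff Q j ` carrier (cobj Q (Suc j))"
      using resD(6)[of "t 0 (q j x)"] imageI[OF qx, of "t 0"] t0(3) im by simp
    also have "\<dots> \<longleftrightarrow> q j x \<in> cdiff Q j ` carrier (cobj Q (Suc j))"
      by (rule inj_on_image_mem_iff[OF t0(2) qx]) (use Q_diff in auto)
    also have "\<dots> \<longleftrightarrow> x \<in> T.K j" using x unfolding T.K_def by (simp del: Fr_simps)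
    finally show ?thesis .
  qed
  have "good_presentation (r j) (\<lambda>i. \<delta> j i - n) (T.K j) (\<lambda>x. aug (t 0 (q j x)))"
    unfolding good_presentation_def carr
    using good_syzygy_shift[OF good, of n] g surj ker by (simp del: Fr_simps)
  then show ?thesis by blast
qed

end

section \<open>Modules of projective dimension one\<close>

text \<open>\<open>pd_le\<close> and \<open>graded_projective\<close> prescribe the carrier types of
  the modules that witness them, so modules have to be copied to another type along an
  injection.\<close>

definition transport :: "('b \<Rightarrow> 'c) \<Rightarrow> ('a, 'b) gmodule \<Rightarrow> ('a, 'c) gmodule" where
  "transport h M = (let k = inv_into (carrier M) h in
     \<lparr>carrier = h ` carrier M, monoid.mult = undefined, one = undefined, ring.zero = h \<zero>\<^bsub>M\<^esub>,
      ring.add = (\<lambda>x y. h (k x \<oplus>\<^bsub>M\<^esub> k y)), smult = (\<lambda>a x. h (a \<odot>\<^bsub>M\<^esub> k x)), mpart = (\<lambda>n. h ` mpart M n)\<rparr>)"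

lemma transport_iso:
  assumes M: "graded_left_module R M" and h: "inj_on h (carrier M)"
  shows "graded_left_module R (transport h M)" "h \<in> gmod_iso R M (transport h M)"
proof -
  interpret M: graded_left_module R M by (rule M)
  have k: "inv_into (carrier M) h (h x) = x" if "x \<in> carrier M" for x by (rule inv_into_f_f[OF h that])
  have ker: "h (gcomp M (mpart M) x n) = h (gcomp M (mpart M) y n)"
    if "x \<in> carrier M" "y \<in> carrier M" "h x = h y" for x y n
    using inj_onD[OF h that(3,1,2)] by simp
  have "graded_left_module R (transport h M)"
    by (rule glm_pushforward(1)[OF M, where h = h]; (rule ker; assumption)?; simp add: transport_def Let_def k)
  moreover have "h \<in> gmod_hom R M (transport h M)"
    by (rule glm_pushforward(2)[OF M, where h = h]; (rule ker; assumption)?; simp add: transport_def Let_def k)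
  ultimately show "graded_left_module R (transport h M)" "h \<in> gmod_iso R M (transport h M)"
    using h by (simp_all add: gmod_iso_def bij_betw_def) (simp add: transport_def Let_def)
qed

text \<open>Projectivity of P demands an ambient free module carried by
  \<open>'c \<Rightarrow> 'a\<close>. The copy of N along J is one, and P is isomorphic to it, hence
  trivially a summand.\<close>

lemma free_transport_projective:
  fixes N :: "('a, 'b) gmodule" and P :: "('a, 'c) gmodule"
  assumes N: "graded_free R N" and k: "k \<in> gmod_iso R N P" and P: "graded_left_module R P"
    and J: "inj (J :: 'b \<Rightarrow> 'c \<Rightarrow> 'a)"
  shows "graded_projective R P"
proof -
  have J': "inj_on J (carrier N)" using J by (rule inj_on_subset) simp
  note L = transport_iso[OF graded_free_glm[OF N] J']
  note ki = gmod_iso_inverse[OF graded_free_glm[OF N] P k]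
  note Ji = gmod_iso_inverse[OF graded_free_glm[OF N] L]
  have fr: "graded_free R (transport J N)" by (rule graded_free_iso[OF N L])
  let ?k = "inv_into (carrier N) k" and ?J = "inv_into (carrier N) J"
  have i: "(\<lambda>x. J (?k x)) \<in> gmod_hom R P (transport J N)"
    by (rule gmod_hom_comp[OF gmod_isoD(1)[OF ki(1)] gmod_isoD(1)[OF L(2)]])
  have r: "(\<lambda>x. k (?J x)) \<in> gmod_hom R (transport J N) P"
    by (rule gmod_hom_comp[OF gmod_isoD(1)[OF Ji(1)] gmod_isoD(1)[OF k]])
  have "k (?J (J (?k x))) = x" if "x \<in> carrier P" for x
    using gmod_homD(1)[OF gmod_isoD(1)[OF ki(1)] that] Ji(2) ki(3)[OF that] by simp
  then show ?thesis
    unfolding graded_projective_def using P fr i r by blast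
qed

lemma is_resolution_transport:
  fixes W :: "('a, 'b) gcomplex" and P :: "nat \<Rightarrow> ('a, 'c) gmodule"
  assumes res: "is_resolution R N W \<epsilon>" and P: "\<And>i. graded_left_module R (P i)"
    and h: "\<And>i. h i \<in> gmod_iso R (cobj W i) (P i)"
  defines "k i \<equiv> inv_into (carrier (cobj W i)) (h i)"
  shows "is_resolution R N \<lparr>cobj = P, cdiff = \<lambda>i x. h i (cdiff W i (k (Suc i) x))\<rparr> (\<lambda>x. \<epsilon> (k 0 x))"
proof -
  note W = is_resolutionD[OF res]
  have k: "k i \<in> gmod_iso R (P i) (cobj W i)" "\<And>x. x \<in> carrier (cobj W i) \<Longrightarrow> k i (h i x) = x"
    "\<And>y. y \<in> carrier (P i) \<Longrightarrow> h i (k i y) = y" for i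
    unfolding k_def using gmod_iso_inverse[OF W(1) P h] by blast+
  have kh: "k i \<in> gmod_hom R (P i) (cobj W i)" and hh: "h i \<in> gmod_hom R (cobj W i) (P i)" for i
    using gmod_isoD(1) k(1) h by blast+
  have kim: "k i ` carrier (P i) = carrier (cobj W i)" for i by (rule gmod_isoD(4)[OF k(1)])
  have kc: "x \<in> carrier (P i) \<Longrightarrow> k i x \<in> carrier (cobj W i)" for x i by (rule gmod_homD(1)[OF kh])
  have dc: "x \<in> carrier (cobj W (Suc i)) \<Longrightarrow> cdiff W i x \<in> carrier (cobj W i)" for x i by (rule gmod_homD(1)[OF W(2)])
  have h0: "h i x = \<zero>\<^bsub>P i\<^esub> \<longleftrightarrow> x = \<zero>\<^bsub>cobj W i\<^esub>" if "x \<in> carrier (cobj W i)" for i x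
    using gmod_hom_zero[OF W(1) P hh, of i] inj_onD[OF gmod_isoD(3)[OF h], of i x "\<zero>\<^bsub>cobj W i\<^esub>"] that
      glm_zero_closed[OF W(1)[of i]] by auto
  let ?d = "\<lambda>i x. h i (cdiff W i (k (Suc i) x))"
  have d: "?d i \<in> gmod_hom R (P (Suc i)) (P i)" for i
    by (rule gmod_hom_comp[OF gmod_hom_comp[OF kh W(2)] hh])
  have mem: "x \<in> ?d i ` carrier (P (Suc i)) \<longleftrightarrow> k i x \<in> cdiff W i ` carrier (cobj W (Suc i))" if x: "x \<in> carrier (P i)" for i x
  proof -
    have "?d i ` carrier (P (Suc i)) = h i ` cdiff W i ` carrier (cobj W (Suc i))"
      unfolding kim[symmetric] image_image ..
    moreover have "h i (k i x) \<in> h i ` cdiff W i ` carrier (cobj W (Suc i)) \<longleftrightarrow> k i x \<in> cdiff W i ` carrier (cobj W (Suc i))"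
      by (rule inj_on_image_mem_iff[OF gmod_isoD(3)[OF h] kc[OF x]]) (use dc in blast)
    ultimately show ?thesis using k(3)[OF x] by simp
  qed
  have ex: "?d i x = \<zero>\<^bsub>P i\<^esub> \<longleftrightarrow> x \<in> ?d (Suc i) ` carrier (P (Suc (Suc i)))" if x: "x \<in> carrier (P (Suc i))" for i x
    using h0[OF dc[OF kc[OF x]]] W(3)[OF kc[OF x]] mem[OF x] by simp
  have ex0: "\<epsilon> (k 0 x) = \<zero>\<^bsub>N\<^esub> \<longleftrightarrow> x \<in> ?d 0 ` carrier (P (Suc 0))" if x: "x \<in> carrier (P 0)" for x
    using W(6)[OF kc[OF x]] mem[OF x] by simp
  have dd: "?d i (?d (Suc i) x) = \<zero>\<^bsub>P i\<^esub>" if "x \<in> carrier (P (Suc (Suc i)))" for i x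
    using ex[OF gmod_homD(1)[OF d that]] imageI[OF that, of "?d (Suc i)"] by simp
  have sub: "?d i ` carrier (P (Suc i)) \<subseteq> carrier (P i)" for i
    using gmod_homD(1)[OF d] by (rule image_subsetI)
  have e: "(\<lambda>x. \<epsilon> (k 0 x)) \<in> gmod_hom R (P 0) N" by (rule gmod_hom_comp[OF kh W(4)])
  have es: "(\<lambda>x. \<epsilon> (k 0 x)) ` carrier (P 0) = carrier N" unfolding W(5)[symmetric] kim[symmetric] image_image ..
  show ?thesis
    unfolding is_resolution_def is_complex_def gcomplex.simps
  proof (intro conjI allI ballI)
    show "{x \<in> carrier (P (Suc i)). ?d i x = \<zero>\<^bsub>P i\<^esub>} = ?d (Suc i) ` carrier (P (Suc (Suc i)))" for i
      using ex[of _ i] sub[of "Suc i"] by blast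
    show "{x \<in> carrier (P 0). \<epsilon> (k 0 x) = \<zero>\<^bsub>N\<^esub>} = ?d 0 ` carrier (P (Suc 0))"
      using ex0 sub[of 0] by blast
  qed (use P d dd e es in simp_all)
qed

section \<open>Projective dimension over A of modules killed by f\<close>

context mf_setting
begin

lemma pd_le_one:
  fixes F0 F1 :: "('a, nat \<Rightarrow> 'a) gmodule" and N :: "('a, 'm) gmodule"
  assumes F0: "graded_free A F0" and F1: "graded_free A F1"
    and \<phi>: "\<phi> \<in> gmod_hom A F1 F0" "inj_on \<phi> (carrier F1)"
    and N: "graded_left_module A N" and g: "g \<in> gmod_hom A F0 N" "g ` carrier F0 = carrier N"
      "\<And>x. x \<in> carrier F0 \<Longrightarrow> g x = \<zero>\<^bsub>N\<^esub> \<longleftrightarrow> x \<in> \<phi> ` carrier F1"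
    and r: "\<And>v j. v \<in> carrier F0 \<union> carrier F1 \<Longrightarrow> r \<le> j \<Longrightarrow> v j = \<zero>"
  shows "pd_le A N 1"
proof -
  \<comment> \<open>The two-term resolution, continued by the free module of rank 0.\<close>
  define W where "W i = (if i = 0 then F0 else if i = Suc 0 then F1 else Fr A 0 (\<lambda>_. 0))" for i :: nat
  define dW where "dW i = (if i = 0 then \<phi> else (\<lambda>_. \<zero>\<^bsub>W i\<^esub>))" for i
  have W0: "W 0 = F0" "W (Suc 0) = F1" "carrier (W (Suc (Suc i))) = {\<zero>\<^bsub>W (Suc (Suc i))\<^esub>}" for i
    by (auto simp: W_def)
  have fW: "graded_free A (W i)" for i
    unfolding W_def using F0 F1 graded_free_Fr[OF nontrivial] by simp
  note gW = graded_free_glm[OF fW]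
  have zc: "\<zero>\<^bsub>W i\<^esub> \<in> carrier (W i)" for i by (rule glm_zero_closed[OF gW])
  have \<phi>0: "x \<in> carrier F1 \<Longrightarrow> \<phi> x = \<zero>\<^bsub>F0\<^esub> \<longleftrightarrow> x = \<zero>\<^bsub>F1\<^esub>" for x
    using gmod_hom_zero[OF graded_free_glm[OF F1] graded_free_glm[OF F0] \<phi>(1)]
      inj_onD[OF \<phi>(2), of x "\<zero>\<^bsub>F1\<^esub>"] zc[of 1] W0(2) by auto
  have res: "is_resolution A N \<lparr>cobj = W, cdiff = dW\<rparr> g"
    unfolding is_resolution_def is_complex_def gcomplex.simps
  proof (intro conjI allI ballI)
    show "dW i \<in> gmod_hom A (W (Suc i)) (W i)" for i
    proof (cases "i = 0")
      case True
      then show ?thesis using \<phi>(1) W0(1,2) by (simp add: dW_def)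
    next
      case False
      then show ?thesis unfolding dW_def by (simp add: gmod_hom_const_zero[OF gW])
    qed
    have z: "dW (Suc i) ` carrier (W (Suc (Suc i))) = {\<zero>\<^bsub>W (Suc i)\<^esub>}" for i
      unfolding W0(3) by (simp add: dW_def)
    show "{x \<in> carrier (W (Suc i)). dW i x = \<zero>\<^bsub>W i\<^esub>} = dW (Suc i) ` carrier (W (Suc (Suc i)))" for i
    proof (cases i)
      case 0
      show ?thesis unfolding z unfolding 0 W0 using \<phi>0 zc[of 1] W0(2) by (auto simp: dW_def)
    next
      case (Suc j)
      show ?thesis unfolding z unfolding Suc W0(3) by (auto simp: dW_def)
    qed
    show "dW i (dW (Suc i) x) = \<zero>\<^bsub>W i\<^esub>" if "x \<in> carrier (W (Suc (Suc i)))" for i x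
      using \<phi>0[of "\<zero>\<^bsub>F1\<^esub>"] zc[of 1] W0 by (simp add: dW_def)
    show "{x \<in> carrier (W 0). g x = \<zero>\<^bsub>N\<^esub>} = dW 0 ` carrier (W (Suc 0))"
      unfolding W0 using g(3) gmod_homD(1)[OF \<phi>(1)] by (auto simp: dW_def)
  qed (use gW g W0(1) in simp_all)
  \<comment> \<open>\<open>pd_le\<close> wants lists over \<open>'a + 'm\<close> as elements.
    Listing the first r entries is injective on the modules involved, since their vectors vanish
    from r on.\<close>
  define h :: "(nat \<Rightarrow> 'a) \<Rightarrow> ('a + 'm) list" where "h v = map (\<lambda>j. Inl (v j)) [0..<r]" for v
  have h: "inj_on h (carrier (W i))" for i
  proof (rule inj_onI)
    fix v w assume vw: "v \<in> carrier (W i)" "w \<in> carrier (W i)" "h v = h w"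
    show "v = w"
    proof (rule ext)
      fix j
      have z: "u j = \<zero>" if "u \<in> carrier (W i)" "r \<le> j" for u
        using that r[of u j] by (auto simp: W_def split: if_splits)
      show "v j = w j"
      proof (cases "j < r")
        case True
        then show ?thesis using vw(3) by (simp add: h_def)
      next
        case False
        then show ?thesis using z[OF vw(1)] z[OF vw(2)] by simp
      qed
    qed
  qed
  note T = transport_iso[OF gW h]
  \<comment> \<open>Lists of every length exist, so reading v at the length of a list embeds vectors
    into functions on lists, the type required for the ambient free module.\<close>
  have J: "inj (\<lambda>(v :: nat \<Rightarrow> 'a) (l :: ('a + 'm) list). v (length l))"
  proof (rule injI, rule ext)
    fix v w :: "nat \<Rightarrow> 'a" and j
    assume "(\<lambda>l :: ('a + 'm) list. v (length l)) = (\<lambda>l. w (length l))"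
    from fun_cong[OF this, of "replicate j undefined"] show "v j = w j" by simp
  qed
  have "projective_resolution A N \<lparr>cobj = \<lambda>i. transport h (W i),
      cdiff = \<lambda>i x. h (dW i (inv_into (carrier (W (Suc i))) h x))\<rparr>"
    unfolding projective_resolution_def gcomplex.simps
  proof (intro conjI allI exI)
    show "graded_projective A (transport h (W i))" for i
      by (rule free_transport_projective[OF fW T(2,1) J])
    show "is_resolution A N \<lparr>cobj = \<lambda>i. transport h (W i),
      cdiff = \<lambda>i x. h (dW i (inv_into (carrier (W (Suc i))) h x))\<rparr> (\<lambda>x. g (inv_into (carrier (W 0)) h x))"
      using is_resolution_transport[OF res T(1), of "\<lambda>_. h"] T(2) by simp
  qed
  moreover have "carrier (transport h (W i)) = {\<zero>\<^bsub>transport h (W i)\<^esub>}" if "i > 1" for i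
  proof -
    have j: "i = Suc (Suc (i - 2))" using that by arith
    have "carrier (W i) = {\<zero>\<^bsub>W i\<^esub>}" by (subst (1 2) j) (rule W0(3))
    then show ?thesis unfolding transport_def Let_def by simp
  qed
  ultimately show ?thesis unfolding pd_le_def by (intro exI[of _ "\<lparr>cobj = \<lambda>i. transport h (W i), cdiff = \<lambda>i x. h (dW i (inv_into (carrier (W (Suc i))) h x))\<rparr>"]) (simp only: gcomplex.simps, blast)
qed

text \<open>A resolution of length 0 makes N isomorphic to its only term, so f kills that term. But
  the term is projective, hence embeds in a free module, where f acts injectively.\<close>

lemma f_killed_not_projective:
  fixes N :: "('a, 'm) gmodule"
  assumes N: "graded_left_module A N" and killed: "\<And>x. x \<in> carrier N \<Longrightarrow> f \<odot>\<^bsub>N\<^esub> x = \<zero>\<^bsub>N\<^esub>"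
    and pd: "pd_le A N 0"
  shows "carrier N = {\<zero>\<^bsub>N\<^esub>}"
proof -
  obtain P :: "('a, ('a + 'm) list) gcomplex" where P: "projective_resolution A N P"
    "\<And>i. i > 0 \<Longrightarrow> carrier (cobj P i) = {\<zero>\<^bsub>cobj P i\<^esub>}"
    using pd unfolding pd_le_def by blast
  obtain \<epsilon> where res: "is_resolution A N P \<epsilon>" and proj: "graded_projective A (cobj P 0)"
    using P(1) unfolding projective_resolution_def by blast
  note W = is_resolutionD[OF res]
  obtain L :: "('a, ('a + 'm) list \<Rightarrow> 'a) gmodule" and i \<rho> where L: "graded_free A L" "i \<in> gmod_hom A (cobj P 0) L"
    "\<rho> \<in> gmod_hom A L (cobj P 0)" "\<And>x. x \<in> carrier (cobj P 0) \<Longrightarrow> \<rho> (i x) = x"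
    using proj unfolding graded_projective_def by (elim conjE exE) simp
  interpret P0: graded_left_module A "cobj P 0" by (rule W(1))
  have "x = \<zero>\<^bsub>cobj P 0\<^esub>" if x: "x \<in> carrier (cobj P 0)" for x
  proof -
    have fx: "f \<odot>\<^bsub>cobj P 0\<^esub> x \<in> carrier (cobj P 0)" by (rule P0.lsmult_closed[OF fc x])
    have "\<epsilon> (f \<odot>\<^bsub>cobj P 0\<^esub> x) = f \<odot>\<^bsub>N\<^esub> \<epsilon> x" by (rule gmod_homD(3)[OF W(4) fc x])
    also have "\<dots> = \<zero>\<^bsub>N\<^esub>" by (rule killed[OF gmod_homD(1)[OF W(4) x]])
    finally have "f \<odot>\<^bsub>cobj P 0\<^esub> x \<in> cdiff P 0 ` carrier (cobj P (Suc 0))" using W(6)[OF fx] by simp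
    also have "\<dots> = {\<zero>\<^bsub>cobj P 0\<^esub>}"
      using P(2)[of "Suc 0"] gmod_hom_zero[OF W(1) W(1) W(2), of 0] by simp
    finally have f0: "f \<odot>\<^bsub>cobj P 0\<^esub> x = \<zero>\<^bsub>cobj P 0\<^esub>" by simp
    have iz: "i \<zero>\<^bsub>cobj P 0\<^esub> = \<zero>\<^bsub>L\<^esub>" by (rule gmod_hom_zero[OF W(1) graded_free_glm[OF L(1)] L(2)])
    have "f \<odot>\<^bsub>L\<^esub> i x = \<zero>\<^bsub>L\<^esub>" using gmod_homD(3)[OF L(2) fc x] f0 iz by simp
    then have "i x = i \<zero>\<^bsub>cobj P 0\<^esub>" using f_torsion_free[OF L(1) gmod_homD(1)[OF L(2) x]] iz by simp
    then have "\<rho> (i x) = \<rho> (i \<zero>\<^bsub>cobj P 0\<^esub>)" by simp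
    then show ?thesis using L(4)[OF x] L(4)[OF P0.M.zero_closed] by simp
  qed
  then have "carrier (cobj P 0) = {\<zero>\<^bsub>cobj P 0\<^esub>}" using P0.M.zero_closed by auto
  then show ?thesis using W(5) gmod_hom_zero[OF W(1) N W(4)] by simp
qed

lemma p_hom: "graded_ring B \<Longrightarrow> p \<in> gmod_hom A (reg_module A) (restr (reg_module B))"
  by (rule gmod_homI) (simp_all add: p_add p_mult p_part)

end

section \<open>Properties of modules with a good presentation\<close>

context minimal_resolution
begin

text \<open>The inclusion of H into \<open>Fr A r \<delta>\<close> is a free resolution of length
  one. Length zero is excluded because f kills the nonzero module M.\<close>

lemma presentation_proj_dim:
  assumes pres: "good_presentation r \<delta> H g" and nz: "carrier M \<noteq> {\<zero>\<^bsub>M\<^esub>}"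
  shows "proj_dim A (restr M) = 1"
proof -
  have good: "good_syzygy r \<delta> H" and g: "g \<in> gmod_hom A (Fr A r \<delta>) (restr M)" "g ` carrier (Fr A r \<delta>) = carrier M"
    "\<And>x. x \<in> carrier (Fr A r \<delta>) \<Longrightarrow> g x = \<zero>\<^bsub>M\<^esub> \<longleftrightarrow> x \<in> H"
    using pres unfolding good_presentation_def by (simp_all del: Fr_simps)
  note G = good_syzygyD[OF good]
  have one: "pd_le A (restr M) 1"
  proof (rule pd_le_one[OF graded_free_Fr[OF nontrivial] G(2) gmod_hom_gsub_dom[OF gmod_hom_id G(7)] _ glm_restr[OF M(1)] g(1)])
    show "v j = \<zero>" if "v \<in> carrier (Fr A r \<delta>) \<union> carrier (gsub (Fr A r \<delta>) H)" "r \<le> j" for v j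
    proof -
      have "v \<in> carrier (Fr A r \<delta>)" using that(1) G(7) by (auto simp del: Fr_simps)
      then show ?thesis using that(2) by simp
    qed
  qed (use g(2,3) in \<open>simp_all del: Fr_simps\<close>)
  have zero: "\<not> pd_le A (restr M) 0"
    using f_killed_not_projective[OF glm_restr[OF M(1)]] restr_killed[OF M(1)] nz by auto
  show ?thesis
  proof (rule antisym)
    show "proj_dim A (restr M) \<le> 1"
      unfolding proj_dim_def using one by (intro INF_lower2[of 1]) (simp_all add: one_enat_def)
    show "1 \<le> proj_dim A (restr M)"
      unfolding proj_dim_def
    proof (rule INF_greatest)
      fix n assume "n \<in> {n. pd_le A (restr M) n}"
      then have "n \<noteq> 0" using zero by (intro notI) simp
      then show "1 \<le> enat n" by (simp add: one_enat_def)
    qed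
  qed
qed

text \<open>A free summand gives a map from M to a shift of B that takes the value 1. Lift it to
  \<pi> from the free A-module to a shift of A. Then \<pi> sends H into fA, hence
  \<open>A_+ H\<close> into \<open>f A_+\<close>. If x0 maps to 1, then f x0 lies in
  \<open>A_+ H\<close> since H is good, so f \<pi>(x0) lies in \<open>f A_+\<close>, and cancelling
  f gives \<pi>(x0) in \<open>A_+\<close>. But \<pi>(x0) is 1 modulo fA, which is contained in
  \<open>A_+\<close>.\<close>

lemma presentation_no_free_summand:
  assumes pres: "good_presentation r \<delta> H g"
  shows "\<not> has_free_summand B M"
proof
  have good: "good_syzygy r \<delta> H" and g: "g \<in> gmod_hom A (Fr A r \<delta>) (restr M)" "g ` carrier (Fr A r \<delta>) = carrier M"
    "\<And>x. x \<in> carrier (Fr A r \<delta>) \<Longrightarrow> g x = \<zero>\<^bsub>M\<^esub> \<longleftrightarrow> x \<in> H"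
    using pres unfolding good_presentation_def by (simp_all del: Fr_simps)
  note G = good_syzygyD[OF good]
  assume "has_free_summand B M"
  then obtain N L :: "('a set, 'm) gmodule" and k where N: "graded_left_module B N" and L: "graded_free B L"
    "carrier L \<noteq> {\<zero>\<^bsub>L\<^esub>}" and k: "k \<in> gmod_iso B M (gsum N L)"
    unfolding has_free_summand_def by blast
  obtain Y where "graded_left_module B L" "graded_basis B L Y" using L(1) by (auto simp: graded_free_def)
  then interpret L: free_basis B L Y by (rule free_basisI)
  have gL: "graded_left_module B L" by (rule L.graded_left_module_axioms)
  have gB: "graded_ring B" by (rule glm_ring[OF gL])
  have "Y \<noteq> {}"
  proof
    assume Y: "Y = {}"
    have "m = \<zero>\<^bsub>L\<^esub>" if "m \<in> carrier L" for m
    proof (rule L.cf_eqI[OF that L.M.zero_closed])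
      show "L.cf m x = L.cf \<zero>\<^bsub>L\<^esub> x" for x
        unfolding L.cf_zero using L.cf_outside[OF that, of x] Y by simp
    qed
    then show False using L(2) L.M.zero_closed by blast
  qed
  then obtain y where y: "y \<in> Y" by blast
  define n where "n = - bdeg L y"
  let ?BR = "gshift n (restr (reg_module B))"
  have rB: "graded_left_module A (restr (reg_module B))" by (rule glm_restr[OF graded_ring.glm_reg_module[OF gB]])
  have gBR: "graded_left_module A ?BR" by (rule glm_gshift[OF rB])
  have cf: "(\<lambda>m. L.cf m y) \<in> gmod_hom B L (gshift n (reg_module B))"
    by (rule gmod_homI) (use L.cf_graded[OF _ y] in \<open>simp_all add: L.cf_add L.cf_smult n_def\<close>)
  have \<theta>: "(\<lambda>m. L.cf (snd (k m)) y) \<in> gmod_hom B M (gshift n (reg_module B))"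
    by (rule gmod_hom_comp[OF gmod_hom_comp[OF gmod_isoD(1)[OF k] gsum_snd_hom] cf])
  then have \<theta>A: "(\<lambda>m. L.cf (snd (k m)) y) \<in> gmod_hom A (restr M) ?BR"
    by (simp add: gmod_hom_restr flip: restr_gshift)
  have ph: "p \<in> gmod_hom A (gshift n (reg_module A)) ?BR" by (rule gmod_hom_gshift[OF p_hom[OF gB]])
  have pim: "p ` carrier (gshift n (reg_module A)) = carrier ?BR" using p_surj by simp
  obtain \<pi> where \<pi>: "\<pi> \<in> gmod_hom A (Fr A r \<delta>) (gshift n (reg_module A))"
    "\<And>x. x \<in> carrier (Fr A r \<delta>) \<Longrightarrow> p (\<pi> x) = L.cf (snd (k (g x))) y"
    using graded_free_lifting[OF graded_free_Fr[OF nontrivial] glm_gshift[OF glm_reg_module] gBR ph pim gmod_hom_comp[OF g(1) \<theta>A]]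
    by (elim bexE) (simp del: Fr_simps)
  have \<pi>c: "\<pi> x \<in> carrier A" if "x \<in> carrier (Fr A r \<delta>)" for x using gmod_homD(1)[OF \<pi>(1) that] by simp
  interpret GH: pos_graded_module A "gsub (Fr A r \<delta>) H" by (rule pgm[OF G(6)])
  have \<pi>H: "\<exists>c\<in>carrier A. \<pi> x = f \<otimes> c" if x: "x \<in> H" for x
  proof -
    have xc: "x \<in> carrier (Fr A r \<delta>)" by (rule subsetD[OF G(7) x])
    have gx: "g x = \<zero>\<^bsub>M\<^esub>" using g(3)[OF xc] x by simp
    have "L.cf (snd (k (g x))) y = \<zero>\<^bsub>B\<^esub>"
      unfolding gx using gmod_hom_zero[OF M(1) glm_gshift[OF graded_ring.glm_reg_module[OF gB]] \<theta>] by simp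
    then have "\<pi> x \<in> fA" using \<pi>(2)[OF xc] p_eq_0_iff[OF \<pi>c[OF xc]] by simp
    then show ?thesis unfolding fA_def by blast
  qed
  \<comment> \<open>A scalar a of positive degree passes through f by a f = f \<sigma>(a), and
    \<sigma> preserves \<open>A_+\<close>.\<close>
  have claim: "z \<in> carrier (Fr A r \<delta>) \<and> (\<exists>c\<in>irrelevant_ideal A. \<pi> z = f \<otimes> c)" if "z \<in> irr_span A (gsub (Fr A r \<delta>) H)" for z
    using that
  proof (induction z rule: GH.irr_span_induct)
    case zero
    have "\<pi> \<zero>\<^bsub>Fr A r \<delta>\<^esub> = \<zero>" using gmod_hom_zero[OF glm_Fr glm_gshift[OF glm_reg_module] \<pi>(1)] by simp
    then show ?case using glm_zero_closed[OF glm_Fr, of r \<delta>] irr_zero r_null[OF fc]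
      by (intro conjI bexI[of _ \<zero>]) (simp_all del: Fr_simps)
  next
    case (smult a x)
    have xH: "x \<in> H" using smult(2) by simp
    then have xc: "x \<in> carrier (Fr A r \<delta>)" by (rule subsetD[OF G(7)])
    obtain c where c: "c \<in> carrier A" "\<pi> x = f \<otimes> c" using \<pi>H[OF xH] by blast
    have a: "a \<in> carrier A" by (rule irr_closed[OF smult(1)])
    interpret Frm: graded_left_module A "Fr A r \<delta>" by (rule glm_Fr)
    have "\<pi> (a \<odot>\<^bsub>Fr A r \<delta>\<^esub> x) = a \<otimes> (f \<otimes> c)" using gmod_homD(3)[OF \<pi>(1) a xc] c(2) by (simp del: Fr_simps)
    also have "\<dots> = f \<otimes> (\<sigma> a \<otimes> c)" using a c(1) f_normal[OF a] by (simp flip: m_assoc)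
    finally show ?case
      using irr_mult_r[OF \<sigma>_irr[OF smult(1)] c(1)] Frm.lsmult_closed[OF a xc] by (auto simp del: Fr_simps)
  next
    case (add x z)
    obtain c where c: "c \<in> irrelevant_ideal A" "\<pi> x = f \<otimes> c" using add by blast
    obtain c' where c': "c' \<in> irrelevant_ideal A" "\<pi> z = f \<otimes> c'" using add by blast
    interpret Frm: graded_left_module A "Fr A r \<delta>" by (rule glm_Fr)
    have xz: "x \<in> carrier (Fr A r \<delta>)" "z \<in> carrier (Fr A r \<delta>)" using add by blast+
    have "\<pi> (x \<oplus>\<^bsub>Fr A r \<delta>\<^esub> z) = f \<otimes> c \<oplus> f \<otimes> c'" using gmod_homD(2)[OF \<pi>(1) xz] c(2) c'(2) by (simp del: Fr_simps)
    also have "\<dots> = f \<otimes> (c \<oplus> c')" by (rule r_distr[OF irr_closed[OF c(1)] irr_closed[OF c'(1)] fc, symmetric])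
    finally show ?case using irr_add[OF c(1) c'(1)] Frm.M.a_closed[OF xz] by (auto simp del: Fr_simps)
  qed
  have ky: "(\<zero>\<^bsub>N\<^esub>, y) \<in> carrier (gsum N L)" using glm_zero_closed[OF N] L.basis_carrier[OF y] by simp
  then have "(\<zero>\<^bsub>N\<^esub>, y) \<in> k ` carrier M" using gmod_isoD(4)[OF k] by simp
  then obtain m0 where m0: "m0 \<in> carrier M" "k m0 = (\<zero>\<^bsub>N\<^esub>, y)" by (metis imageE)
  have "m0 \<in> g ` carrier (Fr A r \<delta>)" unfolding g(2) by (rule m0(1))
  then obtain x0 where x0: "x0 \<in> carrier (Fr A r \<delta>)" "g x0 = m0" by (elim imageE) simp
  have p1: "p (\<pi> x0) = p \<one>" using \<pi>(2)[OF x0(1)] x0(2) m0(2) L.cf_basis[OF y] by (simp del: Fr_simps)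
  obtain c where c: "c \<in> irrelevant_ideal A" "\<pi> (f \<odot>\<^bsub>Fr A r \<delta>\<^esub> x0) = f \<otimes> c" using claim[OF G(4)[OF x0(1)]] by blast
  have "f \<otimes> \<pi> x0 = f \<otimes> c" using gmod_homD(3)[OF \<pi>(1) fc x0(1)] c(2) by (simp del: Fr_simps)
  then have "\<pi> x0 = c" by (rule f_cancel[OF _ \<pi>c[OF x0(1)] irr_closed[OF c(1)]])
  then have pc: "p c = p \<one>" using p1 by simp
  have cc: "c \<in> carrier A" by (rule irr_closed[OF c(1)])
  have "p (\<one> \<ominus> c) \<oplus>\<^bsub>B\<^esub> p c = p (\<one> \<ominus> c \<oplus> c)" using cc by (simp add: p_add)
  also have "\<one> \<ominus> c \<oplus> c = \<one>" using cc by (simp add: a_minus_def a_assoc l_neg)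
  finally have eq: "p (\<one> \<ominus> c) \<oplus>\<^bsub>B\<^esub> p \<one> = p \<one>" unfolding pc .

  have "p (\<one> \<ominus> c) = \<zero>\<^bsub>B\<^esub>"
    using eq group.r_cancel_one[OF abelian_group.a_group[OF ring.is_abelian_group[OF ring_B]], of "p \<one>" "p (\<one> \<ominus> c)"] cc by (simp del: p_one)
  then have "\<one> \<ominus> c \<in> fA" using p_eq_0_iff[of "\<one> \<ominus> c"] cc by simp
  then have "\<one> \<ominus> c \<oplus> c \<in> irrelevant_ideal A" using fA_irr c(1) irr_add by blast
  then show False using \<open>\<one> \<ominus> c \<oplus> c = \<one>\<close> irr_one by simp
qed

end

text \<open>The map \<rho> x = \<eta>(x) m0 is idempotent because \<eta>(m0) = 1. So M is the direct
  sum of the kernel and the image of \<rho>, and the image is free of rank one on m0, which has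
  degree n.\<close>

lemma free_summandI:
  fixes M :: "('a, 'b) gmodule"
  assumes R: "pos_graded_ring R" and M: "graded_left_module R M"
    and \<eta>: "\<eta> \<in> gmod_hom R M (gshift (- n) (reg_module R))" and m0: "m0 \<in> mpart M n" "\<eta> m0 = \<one>\<^bsub>R\<^esub>"
  shows "has_free_summand R M"
proof -
  interpret R: pos_graded_ring R by (rule R)
  interpret M: graded_left_module R M by (rule M)
  have m0c: "m0 \<in> carrier M" by (rule M.mgr.D_carrier[OF m0(1)])
  have \<eta>c: "\<eta> x \<in> carrier R" if "x \<in> carrier M" for x using gmod_homD(1)[OF \<eta> that] by simp
  have \<eta>sm: "\<eta> (a \<odot>\<^bsub>M\<^esub> m0) = a" if "a \<in> carrier R" for a
    using gmod_homD(3)[OF \<eta> that m0c] m0(2) that by simp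
  define \<rho> where "\<rho> x = \<eta> x \<odot>\<^bsub>M\<^esub> m0" for x
  have \<rho>: "\<rho> \<in> gmod_hom R M M"
  proof (rule gmod_homI)
    show "\<rho> x \<in> mpart M k" if "x \<in> mpart M k" for x k
      using M.mpart_smult[OF _ m0(1), of "\<eta> x" "k - n"] gmod_homD(4)[OF \<eta> that] by (simp add: \<rho>_def)
  qed (use m0c \<eta>c gmod_homD(2,3)[OF \<eta>] in \<open>simp_all add: \<rho>_def M.lsmult_closed M.lsmult_l_distr M.lsmult_assoc\<close>)
  have \<rho>c: "\<rho> x \<in> carrier M" if "x \<in> carrier M" for x by (rule gmod_homD(1)[OF \<rho> that])
  have \<rho>\<rho>: "\<rho> (\<rho> x) = \<rho> x" if "x \<in> carrier M" for x using \<eta>sm[OF \<eta>c[OF that]] by (simp add: \<rho>_def)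
  let ?N = "gsub M (hker M M \<rho>)" and ?L = "gsub M (\<rho> ` carrier M)"
  have N: "graded_left_module R ?N" by (rule glm_gsub[OF M submodule_hker[OF M M \<rho>]])
  have L: "graded_left_module R ?L" by (rule glm_gsub[OF M submodule_himage[OF M M \<rho>]])
  define k where "k v = v 0 \<odot>\<^bsub>M\<^esub> m0" for v :: "nat \<Rightarrow> 'a"
  have k\<rho>: "k v = \<rho> (k v)" "k v \<in> carrier M" if "v 0 \<in> carrier R" for v
    unfolding k_def \<rho>_def using \<eta>sm[OF that] M.lsmult_closed[OF that m0c] by simp_all
  have kL: "k v \<in> carrier ?L" if "v \<in> carrier (Fr R 1 (\<lambda>_. n))" for v
    using k\<rho>[of v] imageI[of "k v" "carrier M" \<rho>] that by simp
  have "k \<in> gmod_iso R (Fr R 1 (\<lambda>_. n)) ?L"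
    unfolding gmod_iso_def
  proof (intro CollectI conjI gmod_homI)
    show "k v \<in> carrier ?L" if "v \<in> carrier (Fr R 1 (\<lambda>_. n))" for v by (rule kL[OF that])
    show "k v \<in> mpart ?L j" if "v \<in> mpart (Fr R 1 (\<lambda>_. n)) j" for v j
    proof -
      have v0: "v 0 \<in> rpart R (j - n)" using that by simp
      have "k v \<in> mpart M j" unfolding k_def using M.mpart_smult[OF v0 m0(1)] by simp
      then show ?thesis using k\<rho>[of v] imageI[of "k v" "carrier M" \<rho>] R.rgr.D_carrier[OF v0] by simp
    qed
    show "bij_betw k (carrier (Fr R 1 (\<lambda>_. n))) (carrier ?L)"
      unfolding bij_betw_def
    proof
      show "inj_on k (carrier (Fr R 1 (\<lambda>_. n)))"
      proof (rule inj_onI, rule ext)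
        fix v w j assume vw: "v \<in> carrier (Fr R 1 (\<lambda>_. n))" "w \<in> carrier (Fr R 1 (\<lambda>_. n))" "k v = k w"
        have "\<eta> (k v) = \<eta> (k w)" using vw(3) by simp
        then have "v 0 = w 0" unfolding k_def using \<eta>sm vw(1,2) by simp
        then show "v j = w j" using vw(1,2) by (cases "j = 0") simp_all
      qed
      show "k ` carrier (Fr R 1 (\<lambda>_. n)) = carrier ?L"
      proof
        show "carrier ?L \<subseteq> k ` carrier (Fr R 1 (\<lambda>_. n))"
        proof
          fix y assume "y \<in> carrier ?L"
          then obtain x where x: "x \<in> carrier M" "y = \<rho> x" by auto
          have "y = k (\<lambda>j. if j = 0 then \<eta> x else \<zero>\<^bsub>R\<^esub>)" unfolding x(2) k_def \<rho>_def by simp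
          moreover have "(\<lambda>j. if j = 0 then \<eta> x else \<zero>\<^bsub>R\<^esub>) \<in> carrier (Fr R 1 (\<lambda>_. n))" using \<eta>c[OF x(1)] by simp
          ultimately show "y \<in> k ` carrier (Fr R 1 (\<lambda>_. n))" by (rule image_eqI)
        qed
        show "k ` carrier (Fr R 1 (\<lambda>_. n)) \<subseteq> carrier ?L"
          by (rule image_subsetI) (rule kL)
      qed
    qed
  qed (use m0c in \<open>simp_all add: k_def M.lsmult_l_distr M.lsmult_assoc\<close>)
  then have freeL: "graded_free R ?L" by (rule graded_free_iso[OF R.graded_free_Fr[OF R.nontrivial] L])
  have "m0 = \<rho> m0" unfolding \<rho>_def m0(2) using m0c by (simp add: M.lsmult_one)
  then have "m0 \<in> carrier ?L" using m0c by simp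
  moreover have "m0 \<noteq> \<zero>\<^bsub>M\<^esub>"
    using gmod_hom_zero[OF M glm_gshift[OF R.glm_reg_module] \<eta>] m0(2) R.nontrivial by auto
  ultimately have nz: "carrier ?L \<noteq> {\<zero>\<^bsub>?L\<^esub>}" by auto
  have d\<rho>: "\<rho> (x \<ominus>\<^bsub>M\<^esub> \<rho> x) = \<zero>\<^bsub>M\<^esub>" if x: "x \<in> carrier M" for x
    using gmod_hom_eq_diff[OF M M \<rho> x \<rho>c[OF x]] \<rho>\<rho>[OF x] \<rho>c[OF x] by (simp add: a_minus_def M.M.r_neg)
  have split: "x \<ominus>\<^bsub>M\<^esub> \<rho> x \<oplus>\<^bsub>M\<^esub> \<rho> x = x" if x: "x \<in> carrier M" for x
    using x \<rho>c[OF x] by (simp add: a_minus_def M.M.a_assoc M.M.l_neg)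
  have "(\<lambda>x. x \<ominus>\<^bsub>M\<^esub> \<rho> x) \<in> gmod_hom R M ?N"
    by (rule gmod_hom_gsub_cod[OF gmod_hom_diff[OF M gmod_hom_id \<rho>]])
      (use d\<rho> \<rho>c M.mgr.D_carrier in \<open>simp_all add: hker_def\<close>)
  moreover have "\<rho> \<in> gmod_hom R M ?L"
    by (rule gmod_hom_gsub_cod[OF \<rho>]) (use M.mgr.D_carrier in simp_all)
  ultimately have \<Psi>: "(\<lambda>x. (x \<ominus>\<^bsub>M\<^esub> \<rho> x, \<rho> x)) \<in> gmod_hom R M (gsum ?N ?L)" by (rule gsum_pair_hom)
  have "bij_betw (\<lambda>x. (x \<ominus>\<^bsub>M\<^esub> \<rho> x, \<rho> x)) (carrier M) (carrier (gsum ?N ?L))"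
    unfolding bij_betw_def
  proof
    show "inj_on (\<lambda>x. (x \<ominus>\<^bsub>M\<^esub> \<rho> x, \<rho> x)) (carrier M)"
    proof (rule inj_onI)
      fix x y assume xy: "x \<in> carrier M" "y \<in> carrier M" "(x \<ominus>\<^bsub>M\<^esub> \<rho> x, \<rho> x) = (y \<ominus>\<^bsub>M\<^esub> \<rho> y, \<rho> y)"
      have eq: "x \<ominus>\<^bsub>M\<^esub> \<rho> x = y \<ominus>\<^bsub>M\<^esub> \<rho> y" "\<rho> x = \<rho> y" using xy(3)[unfolded prod.inject] by blast+
      have "x = x \<ominus>\<^bsub>M\<^esub> \<rho> x \<oplus>\<^bsub>M\<^esub> \<rho> x" using split[OF xy(1)] by simp
      also have "\<dots> = y \<ominus>\<^bsub>M\<^esub> \<rho> y \<oplus>\<^bsub>M\<^esub> \<rho> y" unfolding eq(1) unfolding eq(2) ..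
      finally show "x = y" using split[OF xy(2)] by simp
    qed
    show "(\<lambda>x. (x \<ominus>\<^bsub>M\<^esub> \<rho> x, \<rho> x)) ` carrier M = carrier (gsum ?N ?L)"
    proof
      show "(\<lambda>x. (x \<ominus>\<^bsub>M\<^esub> \<rho> x, \<rho> x)) ` carrier M \<subseteq> carrier (gsum ?N ?L)"
        using gmod_homD(1)[OF \<Psi>] by (rule image_subsetI)
      show "carrier (gsum ?N ?L) \<subseteq> (\<lambda>x. (x \<ominus>\<^bsub>M\<^esub> \<rho> x, \<rho> x)) ` carrier M"
      proof
        fix z assume "z \<in> carrier (gsum ?N ?L)"
        then obtain a x where ax: "z = (a, \<rho> x)" "a \<in> carrier M" "\<rho> a = \<zero>\<^bsub>M\<^esub>" "x \<in> carrier M"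
          by (auto simp: hker_def)
        let ?x = "a \<oplus>\<^bsub>M\<^esub> \<rho> x"
        have xc: "?x \<in> carrier M" using ax \<rho>c by simp
        have r: "\<rho> ?x = \<rho> x" using gmod_homD(2)[OF \<rho> ax(2) \<rho>c[OF ax(4)]] ax(3) \<rho>\<rho>[OF ax(4)] \<rho>c[OF ax(4)] by simp
        have "?x \<ominus>\<^bsub>M\<^esub> \<rho> x = a" using ax(2) \<rho>c[OF ax(4)] by (simp add: a_minus_def M.M.a_assoc M.M.r_neg)
        then have "z = (?x \<ominus>\<^bsub>M\<^esub> \<rho> ?x, \<rho> ?x)" unfolding r ax(1) by simp
        then show "z \<in> (\<lambda>x. (x \<ominus>\<^bsub>M\<^esub> \<rho> x, \<rho> x)) ` carrier M" using xc by (rule image_eqI)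
      qed
    qed
  qed
  then have "(\<lambda>x. (x \<ominus>\<^bsub>M\<^esub> \<rho> x, \<rho> x)) \<in> gmod_iso R M (gsum ?N ?L)" using \<Psi> by (simp add: gmod_iso_def)
  then show ?thesis unfolding has_free_summand_def using N freeL nz by blast
qed

context minimal_resolution
begin

lemma proj_dim_one_presentation:
  assumes pd: "proj_dim A (restr M) = 1" and nf: "\<not> has_free_summand B M"
  shows "\<exists>r \<delta> H g. good_presentation r \<delta> H g"
proof -
  obtain r \<delta> q D where "mf_tower A f e \<sigma> r \<delta> QA (cdiff Q) q D" using tower_exists by (elim exE)
  then interpret T: mf_tower A f e \<sigma> r \<delta> QA "cdiff Q" q D .
  define g where "g x = aug (q 0 x)" for x
  note RM = glm_restr[OF M(1)]
  have aug: "aug \<in> gmod_hom A (QA 0) (restr M)" using resD(4) by (simp add: gmod_hom_restr)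
  have g: "g \<in> gmod_hom A (T.G 0) (restr M)" unfolding g_def by (rule gmod_hom_comp[OF T.q_hom aug])
  have qs: "q 0 ` carrier (T.G 0) = carrier (cobj Q 0)" using T.q_surj[of 0] by (simp del: Fr_simps)
  have surj: "g ` carrier (T.G 0) = carrier (restr M)"
    unfolding g_def using qs resD(5) by (simp add: image_image[symmetric] del: Fr_simps)
  have ker: "g x = \<zero>\<^bsub>restr M\<^esub> \<longleftrightarrow> x \<in> T.K 0" if x: "x \<in> carrier (T.G 0)" for x
  proof -
    have "q 0 x \<in> carrier (cobj Q 0)" using x qs by blast
    then show ?thesis using resD(6) x unfolding g_def T.K_def by (simp del: Fr_simps)
  qed
  have "(INF n\<in>{n. pd_le A (restr M) n}. enat n) < enat 2" using pd unfolding proj_dim_def by (simp add: one_enat_def)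
  then obtain n where n: "pd_le A (restr M) n" "n < 2" by (auto simp: INF_less_iff)
  obtain P :: "('a, ('a + 'm) list) gcomplex" where P: "projective_resolution A (restr M) P"
    "\<And>i. i > n \<Longrightarrow> carrier (cobj P i) = {\<zero>\<^bsub>cobj P i\<^esub>}" using n(1) unfolding pd_le_def by blast
  \<comment> \<open>Since the resolution P stops at place 1, the cover of \<open>K 0\<close> splits
    already.\<close>
  have "\<exists>s\<in>gmod_hom A (T.KM 0) (T.T 0). \<forall>x\<in>carrier (T.KM 0). T.gT 0 (s x) = x"
    by (rule T.pd_split[OF RM g surj ker P(1)]) (use P(2) n(2) in simp_all)
  then obtain s where s: "s \<in> gmod_hom A (T.KM 0) (T.T 0)" "\<And>x. x \<in> carrier (T.KM 0) \<Longrightarrow> T.gT 0 (s x) = x"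
    by (elim bexE) simp
  have free: "graded_free A (T.KM 0)" by (rule T.KM_free[OF s])
  obtain Y where "graded_left_module A (T.KM 0)" "graded_basis A (T.KM 0) Y" using free by (auto simp: graded_free_def)
  then have Y: "free_basis A (T.KM 0) Y" by (rule free_basisI)
  interpret HP: pos_graded_module A "T.KM 0" by (rule pgm[OF T.glm_KM])
  interpret G: graded_left_module A "T.G 0" by (rule T.glm_G)
  note coord = f_coordinate[OF T.glm_G Y T.f_smult_K]
  have gB: "graded_ring B" by (rule glm_ring[OF M(1)])
  have irr: "\<sigma> (coef A (T.KM 0) Y (f \<odot>\<^bsub>T.G 0\<^esub> x) y) \<in> irrelevant_ideal A" if y: "y \<in> Y" and x: "x \<in> mpart (T.G 0) n" for x y n
  proof (rule ccontr)
    define \<xi> where "\<xi> z = \<sigma> (coef A (T.KM 0) Y (f \<odot>\<^bsub>T.G 0\<^esub> z) y)" for z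
    assume "\<sigma> (coef A (T.KM 0) Y (f \<odot>\<^bsub>T.G 0\<^esub> x) y) \<notin> irrelevant_ideal A"
    then have nirr: "\<xi> x \<notin> irrelevant_ideal A" unfolding \<xi>_def .
    define m where "m = e - bdeg (T.KM 0) y"
    have \<xi>: "\<xi> \<in> gmod_hom A (T.G 0) (gshift m (reg_module A))"
      unfolding \<xi>_def m_def by (rule coord(1)[OF _ y])
    have xc: "x \<in> carrier (T.G 0)" by (rule G.mgr.D_carrier[OF x])
    have \<xi>c: "\<xi> z \<in> carrier A" if "z \<in> carrier (T.G 0)" for z using gmod_homD(1)[OF \<xi> that] by simp
    have \<xi>x: "\<xi> x \<in> rpart A (n + m)" using gmod_homD(4)[OF \<xi> x] by simp
    \<comment> \<open>A homogeneous element outside \<open>A_+\<close> must have degree 0.\<close>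
    have nm: "n + m = 0"
      using \<xi>x nirr irr_homog[of "\<xi> x" "n + m"] rpart_prod_neg[of "\<xi> x" "n + m"] irr_zero
      by (metis linorder_neqE_linordered_idom)
    have c0: "\<xi> x \<in> rpart A 0" using \<xi>x nm by simp
    have "\<xi> x \<noteq> \<zero>" using nirr irr_zero by metis
    then obtain c' where c': "c' \<in> carrier A" "c' \<otimes> \<xi> x = \<one>" using degree_0_field[OF c0] by blast
    \<comment> \<open>The degree 0 part of the inverse is still a left inverse, and scaling by it
      keeps x homogeneous of degree n.\<close>
    define u where "u = rgr.cp c' 0"
    have u: "u \<in> rpart A 0" unfolding u_def by (rule rgr.cp_D[OF c'(1)])
    have uc: "u \<otimes> \<xi> x = \<one>"
      using cp_mult_0[OF c'(1) \<xi>c[OF xc]] rgr.cp_homog[OF c0, of 0] rgr.cp_homog[OF rpart_one, of 0] c'(2) by (simp add: u_def)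
    have \<xi>K: "p (\<xi> z) = \<zero>\<^bsub>B\<^esub>" if z: "z \<in> T.K 0" for z
    proof -
      have "\<exists>c\<in>carrier A. \<xi> z = f \<otimes> c" unfolding \<xi>_def by (rule coord(2)[OF _ z])
      then have "\<xi> z \<in> fA" unfolding fA_def by blast
      then show ?thesis using p_eq_0_iff[OF \<xi>c[OF T.K_carrier[OF z]]] by simp
    qed
    let ?BR = "gshift m (restr (reg_module B))"
    have gBR: "graded_left_module A ?BR" by (rule glm_gshift[OF glm_restr[OF graded_ring.glm_reg_module[OF gB]]])
    \<comment> \<open>\<xi> sends \<open>K 0\<close>, the kernel of g, into fA. Its reduction modulo
      f therefore factors through g and becomes a map from M to a shift of B.\<close>
    have "\<exists>\<eta>\<in>gmod_hom A (restr M) ?BR. \<forall>z\<in>carrier (T.G 0). \<eta> (g z) = p (\<xi> z)"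
      by (rule factor_through_surjection[OF T.glm_G RM gBR g surj gmod_hom_comp[OF \<xi> gmod_hom_gshift[OF p_hom[OF gB]]]])
        (use ker \<xi>K in simp)
    then obtain \<eta> where \<eta>: "\<eta> \<in> gmod_hom A (restr M) ?BR" "\<And>z. z \<in> carrier (T.G 0) \<Longrightarrow> \<eta> (g z) = p (\<xi> z)"
      by (elim bexE) (simp del: Fr_simps)
    have "m = - n" using nm by simp
    then have \<eta>B: "\<eta> \<in> gmod_hom B M (gshift (- n) (reg_module B))"
      using \<eta>(1) by (simp add: gmod_hom_restr flip: restr_gshift)
    let ?z = "u \<odot>\<^bsub>T.G 0\<^esub> x"
    have z: "?z \<in> mpart (T.G 0) n" using G.mpart_smult[OF u x] by simp
    have "\<xi> ?z = \<one>" using gmod_homD(3)[OF \<xi> rgr.D_carrier[OF u] xc] uc by (simp del: Fr_simps)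
    then have \<eta>1: "\<eta> (g ?z) = \<one>\<^bsub>B\<^esub>" using \<eta>(2)[OF G.mgr.D_carrier[OF z]] by simp
    have "g ?z \<in> mpart M n" using gmod_homD(4)[OF g z] by simp
    then have "has_free_summand B M" using \<eta>1 by (rule free_summandI[OF pos_graded_ring_B[OF gB] M(1) \<eta>B])
    then show False using nf by simp
  qed
  \<comment> \<open>The coordinates were controlled on homogeneous elements only; additivity does
    the rest.\<close>
  have f_min: "f \<odot>\<^bsub>T.G 0\<^esub> x \<in> irr_span A (T.KM 0)" if "x \<in> carrier (T.G 0)" for x
    using that
  proof (induction x rule: G.mgr.homog_induct)
    case zero
    then show ?case unfolding G.lsmult_r_null[OF fc] using HP.irr_span_zero by simp
  next
    case (homog n x)
    show ?case by (rule coord(3)[OF _ G.mgr.D_carrier[OF homog] irr[OF _ homog]])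
  next
    case (add x z)
    then show ?case unfolding G.lsmult_r_distr[OF fc add(1,2)] using HP.irr_span_add[OF add(3,4)] by (simp del: Fr_simps)
  qed
  have "good_syzygy (r 0) (\<delta> 0) (T.K 0)"
    unfolding good_syzygy_def by (intro conjI ballI T.K_graded free T.K_irr f_min)
  then have "good_presentation (r 0) (\<delta> 0) (T.K 0) g"
    unfolding good_presentation_def using g surj ker by (simp del: Fr_simps)
  then show ?thesis by blast
qed

end

section \<open>Assembly of the four statements\<close>

context minimal_resolution
begin

lemma presentation_period:
  assumes "good_presentation r \<delta> H g" and s: "\<And>a. a \<in> carrier A \<Longrightarrow> (\<sigma> ^^ s) a = a"
  shows "shift_periodic B Q (2 * s)"
  using Omega_iso_periodic[of r \<delta> H 0 s] good_presentation_Omega[OF assms(1)] assms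
  by (simp add: good_presentation_def ctrunc_0)

lemma periodic_iff_presentation:
  assumes "gl_dim A \<le> enat m" and s: "\<And>a. a \<in> carrier A \<Longrightarrow> (\<sigma> ^^ s) a = a" "0 < s"
  shows "periodic B Q \<longleftrightarrow> (\<exists>r \<delta> H g. good_presentation r \<delta> H g)"
proof
  assume "periodic B Q"
  then obtain k where "shift_periodic B Q k" "0 < k" unfolding periodic_def periodic_of_period_def by blast
  then show "\<exists>r \<delta> H g. good_presentation r \<delta> H g" by (rule periodic_good_presentation[OF assms(1)])
next
  assume "\<exists>r \<delta> H g. good_presentation r \<delta> H g"
  then obtain r \<delta> H g where "good_presentation r \<delta> H g" by (elim exE)
  then have "shift_periodic B Q (2 * s)" by (rule presentation_period[OF _ s(1)])
  from periodic_least[OF this] show "periodic B Q" using s(2) unfolding periodic_def by auto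
qed

end

lemma mf_settingI:
  assumes AS: "AS_regular K A d" and "left_noetherian A" "0 < e" "f \<in> rpart A e" "regular_element A f"
    and n: "normalizing_automorphism K A f \<sigma>"
  shows "mf_setting A f e \<sigma>"
proof -
  have c: "connected_graded_algebra K A" using AS by (simp add: AS_regular_def)
  interpret connected_graded_algebra K A by (rule c)
  have sf: "subfield K A" by unfold_locales
  have "pos_graded_ring A"
    by unfold_locales (use rpart_neg subfieldE(6)[OF sf] in auto)
  moreover have "\<exists>c'\<in>carrier A. c' \<otimes>\<^bsub>A\<^esub> c = \<one>\<^bsub>A\<^esub>" if "c \<in> rpart A 0" "c \<noteq> \<zero>\<^bsub>A\<^esub>" for c
  proof -
    have c: "c \<in> K - {\<zero>\<^bsub>A\<^esub>}" using that connected by simp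
    show ?thesis using subfield_m_inv[OF sf c] subfieldE(3)[OF sf] by blast
  qed
  ultimately show ?thesis
    using assms(2-5) n
    by (simp add: mf_setting_def mf_setting_axioms_def normalizing_automorphism_def graded_algebra_automorphism_def)
qed

theorem theorem4p7:
  fixes K :: "'a set" and A :: "'a gring" and d :: nat
    and f :: 'a and e :: int and \<sigma> :: "'a \<Rightarrow> 'a"
    and B :: "'a set gring"
    and M :: "('a set, 'm) gmodule" and Q :: "('a set, 'q) gcomplex"
  assumes "AS_regular K A d" and "left_noetherian A"
    and "0 < e" and "f \<in> rpart A e" and "normal_element A f" and "regular_element A f"
    and "normalizing_automorphism K A f \<sigma>"
    and "B = quot_ring A f"
    and "graded_left_module B M" and "fin_gen B M"
    and "minimal_free_resolution B M Q"
  shows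
    "(\<exists>X :: ('a, nat \<Rightarrow> 'a) factorization. reduced_mf A \<sigma> e f X \<and>
        chain_isomorphic B (ctrunc (d + 1) Q) (Omega A \<sigma> e f X)) \<and>
     (finite_aut_order A \<sigma> \<longrightarrow>
        (\<exists>p. periodic_of_period B (ctrunc (d + 1) Q) p \<and> p \<le> 2 * aut_order A \<sigma>) \<and>
        (carrier M \<noteq> {\<zero>\<^bsub>M\<^esub>} \<longrightarrow>
           (periodic B Q \<longleftrightarrow>
              proj_dim A (restrict_scalars (quot_map A f) M) = 1 \<and> \<not> has_free_summand B M)) \<and>
        (\<forall>p. periodic_of_period B Q p \<longrightarrow> p \<le> 2 * aut_order A \<sigma>) \<and>
        (\<forall>(M' :: ('a set, 'm) gmodule) (Q' :: ('a set, 'q) gcomplex).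
           graded_left_module B M' \<and> fin_gen B M' \<and> minimal_free_resolution B M' Q' \<and>
           periodic B Q' \<longrightarrow>
           (\<exists>X :: ('a, nat \<Rightarrow> 'a) factorization. reduced_mf A \<sigma> e f X \<and>
              chain_isomorphic B Q' (Omega A \<sigma> e f X))))"
proof -
  interpret mf_setting A f e \<sigma>
    by (rule mf_settingI[OF assms(1,2,3,4,6,7)])
  have gd: "gl_dim A \<le> enat d" using assms(1) by (simp add: AS_regular_def)
  have B: "B = quot_ring A f" by (rule assms(8))
  interpret Q: minimal_resolution A f e \<sigma> M Q
    by (intro minimal_resolution.intro mf_setting_axioms minimal_resolution_axioms.intro) (use assms(9-11) B in simp_all)
  have one: "\<exists>X :: ('a, nat \<Rightarrow> 'a) factorization. reduced_mf A \<sigma> e f X \<and>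
      chain_isomorphic B (ctrunc (d + 1) Q) (Omega A \<sigma> e f X)"
    using Q.truncation_Omega[OF gd] syzygy_mf_reduced unfolding B Suc_eq_plus1 by blast
  show ?thesis
  proof (rule conjI[OF one], rule impI)
    assume fin: "finite_aut_order A \<sigma>"
    define s where "s = aut_order A \<sigma>"
    have "0 < s \<and> (\<forall>a\<in>carrier A. (\<sigma> ^^ s) a = a)"
      unfolding s_def aut_order_def using fin unfolding finite_aut_order_def by (rule LeastI_ex)
    then have s: "\<And>a. a \<in> carrier A \<Longrightarrow> (\<sigma> ^^ s) a = a" and s0: "0 < s" "0 < 2 * s" by auto
    obtain r \<delta> H where "good_syzygy r \<delta> H" "chain_isomorphic B (ctrunc (Suc d) Q) (Omega A \<sigma> e f (syzygy_mf r \<delta> H))"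
      using Q.truncation_Omega[OF gd] unfolding B by (elim exE conjE)
    then have "shift_periodic B (ctrunc (Suc d) Q) (2 * s)" unfolding B by (rule Q.Omega_iso_periodic[OF _ _ s])
    from periodic_least[OF this s0(2)]
    have two: "\<exists>p. periodic_of_period B (ctrunc (d + 1) Q) p \<and> p \<le> 2 * aut_order A \<sigma>"
      unfolding s_def Suc_eq_plus1 .
    have per: "periodic B Q \<longleftrightarrow> (\<exists>r \<delta> H g. Q.good_presentation r \<delta> H g)"
      unfolding B by (rule Q.periodic_iff_presentation[OF gd s s0(1)])
    \<comment> \<open>For M = 0 the minimal resolution is zero, hence periodic, whereas
      \<open>proj_dim\<close> is 0. The equivalence is therefore about nonzero M.\<close>
    have three: "periodic B Q \<longleftrightarrow> proj_dim A (restrict_scalars (quot_map A f) M) = 1 \<and> \<not> has_free_summand B M"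
      if nz: "carrier M \<noteq> {\<zero>\<^bsub>M\<^esub>}"
      unfolding per unfolding B
      using Q.presentation_proj_dim[OF _ nz] Q.presentation_no_free_summand Q.proj_dim_one_presentation by blast
    \<comment> \<open>A period is the least positive shift, so it suffices to exhibit the shift 2 s;
      a good presentation of M provides it.\<close>
    have bound: "p \<le> 2 * aut_order A \<sigma>" if p: "periodic_of_period B Q p" for p
    proof -
      have "periodic B Q" using p unfolding periodic_def by blast
      then obtain r \<delta> H g where "Q.good_presentation r \<delta> H g"
        unfolding per by (elim exE)
      then have "shift_periodic B Q (2 * s)" unfolding B by (rule Q.presentation_period[OF _ s])
      then show ?thesis using periodic_of_period_le[OF p _ s0(2)] unfolding s_def by blast
    qed
    have four: "\<exists>X :: ('a, nat \<Rightarrow> 'a) factorization. reduced_mf A \<sigma> e f X \<and> chain_isomorphic B Q' (Omega A \<sigma> e f X)"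
      if M': "graded_left_module B M'" "fin_gen B M'" "minimal_free_resolution B M' Q'" "periodic B Q'"
      for M' :: "('a set, 'm) gmodule" and Q' :: "('a set, 'q) gcomplex"
    proof -
      interpret Q': minimal_resolution A f e \<sigma> M' Q'
        by (intro minimal_resolution.intro mf_setting_axioms minimal_resolution_axioms.intro) (use M' B in simp_all)
      have "periodic B Q' \<longleftrightarrow> (\<exists>r \<delta> H g. Q'.good_presentation r \<delta> H g)"
        unfolding B by (rule Q'.periodic_iff_presentation[OF gd s s0(1)])
      then obtain r \<delta> H g where pres: "Q'.good_presentation r \<delta> H g" using M'(4) by (elim iffE) blast
      then have "good_syzygy r \<delta> H" unfolding Q'.good_presentation_def by (rule conjunct1)
      then show ?thesis using syzygy_mf_reduced Q'.good_presentation_Omega[OF pres] unfolding B by blast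
    qed
    show "(\<exists>p. periodic_of_period B (ctrunc (d + 1) Q) p \<and> p \<le> 2 * aut_order A \<sigma>) \<and>
        (carrier M \<noteq> {\<zero>\<^bsub>M\<^esub>} \<longrightarrow>
           (periodic B Q \<longleftrightarrow>
              proj_dim A (restrict_scalars (quot_map A f) M) = 1 \<and> \<not> has_free_summand B M)) \<and>
        (\<forall>p. periodic_of_period B Q p \<longrightarrow> p \<le> 2 * aut_order A \<sigma>) \<and>
        (\<forall>(M' :: ('a set, 'm) gmodule) (Q' :: ('a set, 'q) gcomplex).
           graded_left_module B M' \<and> fin_gen B M' \<and> minimal_free_resolution B M' Q' \<and>
           periodic B Q' \<longrightarrow>
           (\<exists>X :: ('a, nat \<Rightarrow> 'a) factorization. reduced_mf A \<sigma> e f X \<and>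
              chain_isomorphic B Q' (Omega A \<sigma> e f X)))"
      using two three bound four by blast
  qed
qed

end
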